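(* Let $n\ge 1$ and $V=\mathbb{T}^n\times\mathbb{T}^n$. Let $\mathcal{V}$ and $\mathcal{T}$ be the groups of real-analytic vertical and horizontal shear maps of $V$, respectively. Then the group $\langle \mathcal{V},\mathcal{T}\rangle$ generated by $\mathcal{V}$ and $\mathcal{T}$ is dense in $\mathrm{Ham}^\omega(V)$ (for the $C^\omega$-topology). In other words, every real-analytic Hamiltonian diffeomorphism of $V$ can be $C^\omega$-approximated by a composition $S_M\circ\cdots\circ S_1$ where $S_j\in\mathcal{T}\cup\mathcal{V}$ for $j=1,\dots,M$.
   Context: $\mathbb{T}^n=\mathbb{R}^n/\mathbb{Z}^n$, and $V=\mathbb{T}^n\times\mathbb{T}^n$ has coordinates $(q,p)=(q_1,\dots,q_n,p_1,\dots,p_n)$ and symplectic form $\omega=\sum_i dp_i\wedge dq_i$. Hamiltonian maps: for a function $H$ on $V$, $X_H=(\partial_p H,-\partial_q H)$. For a continuous family $(H_t)_{t\ge 0}$ of functions, the time-dependent Hamiltonian system is $(\dot q,\dot p)=(\partial_p H_t,-\partial_q H_t)$, and $\phi_H^{s,t}$ ($0\le s\le t$) denotes the map sending the initial condition at time $s$ to the value of the solution at time $t$. $\mathrm{Ham}^\omega(V)$ is the group of diffeomorphisms of the form $\phi_H^{0,1}$ where $H=(H_t)_t$ consists of real-analytic functions depending on $t$ continuously in $C^\omega(V,\mathbb{R})$; its elements are the real-analytic Hamiltonian diffeomorphisms of $V$. Shears: $\mathcal{T}$ is the group of horizontal shears $(q,p)\mapsto(q+\nabla\tau(p),p)$ with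 $\tau\in C^\omega(\mathbb{T}^n,\mathbb{R})$; $\mathcal{V}$ is the group of vertical shears $(q,p)\mapsto(q,p-\nabla v(q))$ with $v\in C^\omega(\mathbb{T}^n,\mathbb{R})$. $C^\omega$-topology: a complex neighborhood of $V=\mathbb{R}^{2n}/\mathbb{Z}^{2n}$ is an open neighborhood of $V$ in $\mathbb{C}^{2n}/\mathbb{Z}^{2n}$. $C^\omega(V,\mathbb{R})$ carries the inductive limit topology, over complex neighborhoods $V_\rho$ of $V$, of the sup-norm ($C^0$) topologies on spaces of holomorphic functions on $V_\rho$. A sequence $\phi_j$ converges to $\phi$ iff there is a complex neighborhood $V_\rho$ of $V$ to which $\phi$ and all $\phi_j$ with $j$ large extend holomorphically, with $\sup_{V_\rho}\|\phi_j-\phi\|\to 0$. $\mathrm{Ham}^\omega(V)$, formed by analytic mappings, carries the analogous inductive limit topology. "$C^\omega$-approximated" means that every $C^\omega$-neighborhood of the map contains such a composition. *)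

theory Defs
  imports "HOL-Analysis.Analysis" "HOL-Algebra.Generated_Groups" "HOL-Algebra.Bij"
begin

section \<open>The real torus and its complexification\<close>

definition integer_lattice :: "('a::ring_1 ^ 'k) set" where
  "integer_lattice = {x. \<forall>i. x $ i \<in> \<int>}"

lemma integer_lattice_0 [simp]: "0 \<in> integer_lattice"
  by (simp add: integer_lattice_def)

lemma integer_lattice_add: "x \<in> integer_lattice \<Longrightarrow> y \<in> integer_lattice \<Longrightarrow> x + y \<in> integer_lattice"
  by (simp add: integer_lattice_def)

lemma integer_lattice_uminus: "x \<in> integer_lattice \<Longrightarrow> - x \<in> integer_lattice"
  by (simp add: integer_lattice_def)

lemma integer_lattice_diff: "x \<in> integer_lattice \<Longrightarrow> y \<in> integer_lattice \<Longrightarrow> x - y \<in> integer_lattice"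
  by (simp add: integer_lattice_def)

definition lattice_rel :: "'a::ring_1 ^ 'k \<Rightarrow> 'a ^ 'k \<Rightarrow> bool" where
  "lattice_rel x y \<longleftrightarrow> x - y \<in> integer_lattice"

lemma lattice_rel_diff:
  assumes "lattice_rel x x'" "lattice_rel y y'"
  shows "lattice_rel (x - y) (x' - y')"
proof -
  have "(x - y) - (x' - y') = (x - x') - (y - y')" by (simp add: algebra_simps)
  then show ?thesis using assms integer_lattice_diff unfolding lattice_rel_def by metis
qed

lemma equivp_lattice_rel: "equivp (lattice_rel :: 'a::ring_1 ^ 'k \<Rightarrow> _)" (is "equivp ?R")
proof (rule equivpI)
  show "reflp ?R"
    by (simp add: reflp_def lattice_rel_def)
  show "symp ?R"
  proof (rule sympI)
    fix x y :: "'a ^ 'k" assume "lattice_rel x y"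
    then show "lattice_rel y x"
      using integer_lattice_uminus[of "x - y"] by (simp add: lattice_rel_def)
  qed
  show "transp ?R"
  proof (rule transpI)
    fix x y z :: "'a ^ 'k" assume "lattice_rel x y" "lattice_rel y z"
    then show "lattice_rel x z"
      using integer_lattice_add[of "x - y" "y - z"] by (simp add: lattice_rel_def)
  qed
qed

text \<open>
  \<open>(real, 'k) torus\<close> is $\mathbb{R}^k/\mathbb{Z}^k$ and \<open>(complex, 'k) torus\<close> is
  $\mathbb{C}^k/\mathbb{Z}^k$ (quotient by integer translations only, so not compact).
\<close>

quotient_type (overloaded) ('a, 'k) torus = "('a::ring_1, 'k::finite) vec" / lattice_rel
  morphisms rep_torus to_torus
  by (rule equivp_lattice_rel)

instantiation torus :: (ring_1, finite) ab_group_add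
begin

lift_definition zero_torus :: "('a, 'b) torus" is "0" .

lift_definition plus_torus :: "('a, 'b) torus \<Rightarrow> ('a, 'b) torus \<Rightarrow> ('a, 'b) torus" is "(+)"
  by (simp add: lattice_rel_def add_diff_add integer_lattice_add)

lift_definition uminus_torus :: "('a, 'b) torus \<Rightarrow> ('a, 'b) torus" is "uminus"
  unfolding lattice_rel_def by (simp only: minus_diff_minus integer_lattice_uminus)

lift_definition minus_torus :: "('a, 'b) torus \<Rightarrow> ('a, 'b) torus \<Rightarrow> ('a, 'b) torus" is "(-)"
  by (rule lattice_rel_diff)

instance
  by standard (transfer, simp add: lattice_rel_def algebra_simps)+

end

lemma closed_integer_lattice: "closed (integer_lattice :: ('a::real_normed_algebra_1 ^ 'k) set)"
  unfolding integer_lattice_def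
  by (intro closed_Collect_all closed_vimage[OF closed_Ints, unfolded vimage_def] continuous_intros)

lemma infdist_lattice_add:
  fixes u v :: "'a::real_normed_algebra_1 ^ 'k"
  shows "infdist (u + v) integer_lattice \<le> infdist u integer_lattice + infdist v integer_lattice"
proof -
  let ?L = "integer_lattice :: ('a ^ 'k) set"
  have ne: "?L \<noteq> {}" using integer_lattice_0 by blast
  have *: "infdist (u + v) ?L \<le> dist u a + dist v b" if "a \<in> ?L" "b \<in> ?L" for a b
    using infdist_le2[OF integer_lattice_add[OF that]] dist_triangle_add by blast
  have "infdist (u + v) ?L - dist u a \<le> infdist v ?L" if "a \<in> ?L" for a
    unfolding infdist_notempty[OF ne, of v] using *[OF that]
    by (intro cINF_greatest[OF ne]) (simp add: algebra_simps)
  then have "infdist (u + v) ?L - infdist v ?L \<le> infdist u ?L"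
    unfolding infdist_notempty[OF ne, of u]
    by (intro cINF_greatest[OF ne]) (simp add: algebra_simps)
  then show ?thesis by simp
qed

lemma infdist_lattice_uminus:
  fixes u :: "'a::real_normed_algebra_1 ^ 'k"
  shows "infdist (- u) integer_lattice = infdist u integer_lattice"
proof -
  have *: "infdist (- x) integer_lattice \<le> infdist x integer_lattice" for x :: "'a ^ 'k"
  proof -
    have ne: "(integer_lattice :: ('a ^ 'k) set) \<noteq> {}" using integer_lattice_0 by blast
    show ?thesis
      unfolding infdist_notempty[OF ne, of x]
    proof (rule cINF_greatest[OF ne])
      fix a :: "'a ^ 'k" assume "a \<in> integer_lattice"
      then show "infdist (- x) integer_lattice \<le> dist x a"
        using infdist_le[OF integer_lattice_uminus, of a "- x"] by (simp add: dist_minus)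
    qed
  qed
  from *[of u] *[of "- u"] show ?thesis by simp
qed

lemma infdist_lattice_cong:
  fixes u v :: "'a::real_normed_algebra_1 ^ 'k"
  assumes "lattice_rel u v"
  shows "infdist u integer_lattice = infdist v integer_lattice"
proof -
  have *: "infdist x integer_lattice \<le> infdist y integer_lattice" if "lattice_rel x y" for x y :: "'a ^ 'k"
    using infdist_lattice_add[of "x - y" y] that by (simp add: lattice_rel_def)
  show ?thesis
    using *[OF assms] *[OF equivp_symp[OF equivp_lattice_rel assms]] by (rule order.antisym)
qed

text \<open>The quotient metric; the norm on \<open>'a ^ 'k\<close> is the Euclidean (Hermitian) one.\<close>

instantiation torus :: (real_normed_algebra_1, finite) metric_space
begin

lift_definition dist_torus :: "('a, 'b) torus \<Rightarrow> ('a, 'b) torus \<Rightarrow> real"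
  is "\<lambda>x y. infdist (x - y) integer_lattice"
proof -
  fix x x' y y' :: "'a ^ 'b"
  assume "lattice_rel x x'" "lattice_rel y y'"
  then have "lattice_rel (x - y) (x' - y')"
    by (rule lattice_rel_diff)
  then show "infdist (x - y) integer_lattice = infdist (x' - y') integer_lattice"
    by (rule infdist_lattice_cong)
qed

definition uniformity_torus :: "(('a, 'b) torus \<times> ('a, 'b) torus) filter" where
  "uniformity_torus = (INF e\<in>{0 <..}. principal {(x, y). dist x y < e})"

definition open_torus :: "('a, 'b) torus set \<Rightarrow> bool" where
  "open_torus U \<longleftrightarrow> (\<forall>x\<in>U. \<forall>\<^sub>F (x', y) in uniformity. x' = x \<longrightarrow> y \<in> U)"

instance
proof
  show "(uniformity :: (('a, 'b) torus \<times> ('a, 'b) torus) filter)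
      = (INF e\<in>{0 <..}. principal {(x, y). dist x y < e})"
    by (rule uniformity_torus_def)
  show "open U \<longleftrightarrow> (\<forall>x\<in>U. \<forall>\<^sub>F (x', y) in uniformity. x' = x \<longrightarrow> y \<in> U)"
    for U :: "('a, 'b) torus set"
    by (rule open_torus_def)
  show "dist x y = 0 \<longleftrightarrow> x = y" for x y :: "('a, 'b) torus"
  proof transfer
    fix x y :: "'a ^ 'b"
    have "(integer_lattice :: ('a ^ 'b) set) \<noteq> {}" using integer_lattice_0 by blast
    then show "infdist (x - y) integer_lattice = 0 \<longleftrightarrow> lattice_rel x y"
      using in_closed_iff_infdist_zero[OF closed_integer_lattice] by (auto simp: lattice_rel_def)
  qed
  show "dist x y \<le> dist x z + dist y z" for x y z :: "('a, 'b) torus"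
  proof transfer
    fix x y z :: "'a ^ 'b"
    show "infdist (x - y) integer_lattice
        \<le> infdist (x - z) integer_lattice + infdist (y - z) integer_lattice"
      using infdist_lattice_add[of "x - z" "z - y"] infdist_lattice_uminus[of "y - z"] by simp
  qed
qed

end

lift_definition torus_complexify :: "(real, 'k::finite) torus \<Rightarrow> (complex, 'k) torus"
  is "\<lambda>x. \<chi> i. complex_of_real (x $ i)"
  unfolding lattice_rel_def integer_lattice_def
  by (auto simp flip: of_real_diff elim!: Ints_cases)


section \<open>Holomorphic and real-analytic functions and maps\<close>

definition complex_nbhd :: "(complex, 'k::finite) torus set \<Rightarrow> bool" where
  "complex_nbhd W \<longleftrightarrow> open W \<and> range torus_complexify \<subseteq> W"

text \<open>Holomorphy in several variables: the Frechet derivative exists and is complex-linear.\<close>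

definition holo_on :: "(complex ^ 'k \<Rightarrow> complex) \<Rightarrow> (complex ^ 'k) set \<Rightarrow> bool" where
  "holo_on f U \<longleftrightarrow>
     (\<forall>z\<in>U. \<exists>D. (f has_derivative D) (at z) \<and> (\<forall>c v. D (c *s v) = c * D v))"

text \<open>
  Holomorphy on an open subset \<open>W\<close> of $\mathbb{C}^k/\mathbb{Z}^k$ with values in $\mathbb{C}$
  and in $\mathbb{C}^l/\mathbb{Z}^l$. A holomorphic torus-valued map need not lift globally
  to $\mathbb{C}^l$, hence the local lifts.
\<close>

definition torus_holo_fun ::
  "(complex, 'k::finite) torus set \<Rightarrow> ((complex, 'k) torus \<Rightarrow> complex) \<Rightarrow> bool" where
  "torus_holo_fun W F \<longleftrightarrow> holo_on (\<lambda>z. F (to_torus z)) (to_torus -` W)"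

definition torus_holo_map ::
  "(complex, 'k::finite) torus set \<Rightarrow> ((complex, 'k) torus \<Rightarrow> (complex, 'l::finite) torus) \<Rightarrow> bool" where
  "torus_holo_map W F \<longleftrightarrow>
     (\<forall>z \<in> to_torus -` W. \<exists>U g. open U \<and> z \<in> U \<and> U \<subseteq> to_torus -` W \<and>
        (\<forall>j. holo_on (\<lambda>w. g w $ j) U) \<and> (\<forall>w\<in>U. F (to_torus w) = to_torus (g w)))"

definition analytic_fun :: "((real, 'k::finite) torus \<Rightarrow> real) \<Rightarrow> bool" where
  "analytic_fun f \<longleftrightarrow>
     (\<exists>W F. complex_nbhd W \<and> torus_holo_fun W F \<and>
        (\<forall>x. F (torus_complexify x) = complex_of_real (f x)))"


section \<open>The inductive limit topology\<close>

text \<open>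
  Let \<open>A\<close> be a set of functions on $\mathbb{T}^k$ whose values are embedded by \<open>e\<close> into a
  metric space, and let \<open>hol W\<close> be the holomorphic functions on \<open>W\<close> with values in that space.
  The elements of \<open>A\<close> which extend to \<open>W\<close> are topologized by the uniform distance of their
  extensions on \<open>W\<close>, and \<open>A\<close> carries the final topology with respect to all complex
  neighborhoods \<open>W\<close>.
\<close>

definition inductive_limit_topology ::
  "((complex, 'k::finite) torus set \<Rightarrow> ((complex, 'k) torus \<Rightarrow> 'c::metric_space) \<Rightarrow> bool) \<Rightarrow>
   ('b \<Rightarrow> 'c) \<Rightarrow> ((real, 'k) torus \<Rightarrow> 'b) set \<Rightarrow> ((real, 'k) torus \<Rightarrow> 'b) topology" where
  "inductive_limit_topology hol e A = topology (\<lambda>U. U \<subseteq> A \<and>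
     (\<forall>W F f. complex_nbhd W \<and> hol W F \<and> f \<in> U \<and> (\<forall>x. F (torus_complexify x) = e (f x)) \<longrightarrow>
        (\<exists>\<epsilon>>0. \<forall>G g. hol W G \<and> g \<in> A \<and> (\<forall>x. G (torus_complexify x) = e (g x)) \<and>
           (\<forall>z\<in>W. dist (G z) (F z) < \<epsilon>) \<longrightarrow> g \<in> U)))"

lemma openin_inductive_limit_topology:
  "openin (inductive_limit_topology hol e A) U \<longleftrightarrow> U \<subseteq> A \<and>
     (\<forall>W F f. complex_nbhd W \<and> hol W F \<and> f \<in> U \<and> (\<forall>x. F (torus_complexify x) = e (f x)) \<longrightarrow>
        (\<exists>\<epsilon>>0. \<forall>G g. hol W G \<and> g \<in> A \<and> (\<forall>x. G (torus_complexify x) = e (g x)) \<and>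
           (\<forall>z\<in>W. dist (G z) (F z) < \<epsilon>) \<longrightarrow> g \<in> U))"
  (is "_ \<longleftrightarrow> ?P U")
proof -
  have "istopology ?P"
    unfolding istopology_def
  proof (intro conjI allI impI)
    fix S T assume S: "?P S" and T: "?P T"
    show "S \<inter> T \<subseteq> A" using S by blast
    fix W F f
    assume h: "complex_nbhd W \<and> hol W F \<and> f \<in> S \<inter> T \<and> (\<forall>x. F (torus_complexify x) = e (f x))"
    obtain d1 where d1: "d1 > 0" "\<And>G g. hol W G \<and> g \<in> A \<and> (\<forall>x. G (torus_complexify x) = e (g x)) \<and>
           (\<forall>z\<in>W. dist (G z) (F z) < d1) \<Longrightarrow> g \<in> S"
      using S h by blast
    obtain d2 where d2: "d2 > 0" "\<And>G g. hol W G \<and> g \<in> A \<and> (\<forall>x. G (torus_complexify x) = e (g x)) \<and>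
           (\<forall>z\<in>W. dist (G z) (F z) < d2) \<Longrightarrow> g \<in> T"
      using T h by blast
    show "\<exists>\<epsilon>>0. \<forall>G g. hol W G \<and> g \<in> A \<and> (\<forall>x. G (torus_complexify x) = e (g x)) \<and>
           (\<forall>z\<in>W. dist (G z) (F z) < \<epsilon>) \<longrightarrow> g \<in> S \<inter> T"
    proof (intro exI[of _ "min d1 d2"] conjI allI impI)
      show "min d1 d2 > 0" using d1(1) d2(1) by simp
      fix G g
      assume "hol W G \<and> g \<in> A \<and> (\<forall>x. G (torus_complexify x) = e (g x)) \<and>
        (\<forall>z\<in>W. dist (G z) (F z) < min d1 d2)"
      then show "g \<in> S \<inter> T" using d1(2)[of G g] d2(2)[of G g] by simp
    qed
  next
    fix K assume K: "\<forall>S\<in>K. ?P S"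
    show "\<Union>K \<subseteq> A" using K by blast
    fix W F f
    assume h: "complex_nbhd W \<and> hol W F \<and> f \<in> \<Union>K \<and> (\<forall>x. F (torus_complexify x) = e (f x))"
    then have "f \<in> \<Union>K" by (elim conjE)
    then obtain S where S: "S \<in> K" "f \<in> S" by (elim UnionE)
    have "\<exists>\<epsilon>>0. \<forall>G g. hol W G \<and> g \<in> A \<and> (\<forall>x. G (torus_complexify x) = e (g x)) \<and>
           (\<forall>z\<in>W. dist (G z) (F z) < \<epsilon>) \<longrightarrow> g \<in> S"
      using K[rule_format, OF S(1), THEN conjunct2, rule_format, of W F f] h S(2) by simp
    moreover have "S \<subseteq> \<Union>K" using S(1) by (rule Union_upper)
    ultimately show "\<exists>\<epsilon>>0. \<forall>G g. hol W G \<and> g \<in> A \<and> (\<forall>x. G (torus_complexify x) = e (g x)) \<and>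
           (\<forall>z\<in>W. dist (G z) (F z) < \<epsilon>) \<longrightarrow> g \<in> \<Union>K"
      by (meson subsetD)
  qed
  then show ?thesis
    unfolding inductive_limit_topology_def by (simp only: topology_inverse')
qed

lemma topspace_inductive_limit_topology [simp]:
  "topspace (inductive_limit_topology hol e A) = A"
proof
  show "topspace (inductive_limit_topology hol e A) \<subseteq> A"
    using openin_topspace[of "inductive_limit_topology hol e A"]
    unfolding openin_inductive_limit_topology by blast
  have "openin (inductive_limit_topology hol e A) A"
    unfolding openin_inductive_limit_topology by (auto intro: zero_less_one)
  then show "A \<subseteq> topspace (inductive_limit_topology hol e A)"
    by (rule openin_subset)
qed

definition analytic_fun_topology :: "((real, 'k::finite) torus \<Rightarrow> real) topology" where
  "analytic_fun_topology = inductive_limit_topology torus_holo_fun complex_of_real {f. analytic_fun f}"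


section \<open>Phase space, Hamiltonian maps and shears\<close>

text \<open>
  $V = \mathbb{T}^n \times \mathbb{T}^n = \mathbb{R}^{2n}/\mathbb{Z}^{2n}$, with coordinate
  \<open>Inl i\<close> being $q_i$ and \<open>Inr i\<close> being $p_i$. The product structure is given by the maps
  \<open>q_part\<close>, \<open>p_part\<close> and \<open>phase_pt\<close>.
\<close>

type_synonym 'n phase_space = "(real, 'n + 'n) torus"

lift_definition q_part :: "'n::finite phase_space \<Rightarrow> (real, 'n) torus" is "\<lambda>x. \<chi> i. x $ Inl i"
  by (simp add: lattice_rel_def integer_lattice_def)

lift_definition p_part :: "'n::finite phase_space \<Rightarrow> (real, 'n) torus" is "\<lambda>x. \<chi> i. x $ Inr i"
  by (simp add: lattice_rel_def integer_lattice_def)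

lift_definition phase_pt :: "(real, 'n::finite) torus \<Rightarrow> (real, 'n) torus \<Rightarrow> 'n phase_space"
  is "\<lambda>q p. \<chi> k. case k of Inl i \<Rightarrow> q $ i | Inr i \<Rightarrow> p $ i"
  by (auto simp: lattice_rel_def integer_lattice_def split: sum.split)

lemma q_part_phase_pt [simp]: "q_part (phase_pt q p) = q"
  by transfer (simp add: lattice_rel_def integer_lattice_def)

lemma p_part_phase_pt [simp]: "p_part (phase_pt q p) = p"
  by transfer (simp add: lattice_rel_def integer_lattice_def)

lemma phase_pt_parts [simp]: "phase_pt (q_part z) (p_part z) = z"
  by transfer (auto simp: lattice_rel_def integer_lattice_def split: sum.split)

definition torus_partial :: "'k::finite \<Rightarrow> ((real, 'k) torus \<Rightarrow> real) \<Rightarrow> (real, 'k) torus \<Rightarrow> real" where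
  "torus_partial i f x = deriv (\<lambda>h. f (x + to_torus (axis i h))) 0"

definition torus_grad :: "((real, 'k::finite) torus \<Rightarrow> real) \<Rightarrow> (real, 'k) torus \<Rightarrow> real ^ 'k" where
  "torus_grad f x = (\<chi> i. torus_partial i f x)"

definition ham_vf :: "('n::finite phase_space \<Rightarrow> real) \<Rightarrow> 'n phase_space \<Rightarrow> real ^ ('n + 'n)" where
  "ham_vf H z = (\<chi> k. case k of Inl i \<Rightarrow> torus_partial (Inr i) H z
                              | Inr i \<Rightarrow> - torus_partial (Inl i) H z)"

text \<open>Solutions on \<open>{s..t}\<close> of the Hamiltonian system on $V$ are given through their lifts
  to $\mathbb{R}^{2n}$.\<close>

definition ham_solution ::
  "(real \<Rightarrow> 'n::finite phase_space \<Rightarrow> real) \<Rightarrow> real \<Rightarrow> real \<Rightarrow> (real \<Rightarrow> real ^ ('n + 'n)) \<Rightarrow> bool" where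
  "ham_solution H s t x \<longleftrightarrow>
     (\<forall>r\<in>{s..t}. (x has_vector_derivative ham_vf (H r) (to_torus (x r))) (at r within {s..t}))"

definition ham_flow ::
  "(real \<Rightarrow> 'n::finite phase_space \<Rightarrow> real) \<Rightarrow> real \<Rightarrow> real \<Rightarrow> 'n phase_space \<Rightarrow> 'n phase_space" where
  "ham_flow H s t z =
     (THE z'. \<exists>x. ham_solution H s t x \<and> to_torus (x s) = z \<and> to_torus (x t) = z')"

definition analytic_Ham :: "('n::finite phase_space \<Rightarrow> 'n phase_space) set" where
  "analytic_Ham =
     {ham_flow H 0 1 | H. continuous_map (top_of_set {0..}) analytic_fun_topology H}"

definition analytic_Ham_topology :: "('n::finite phase_space \<Rightarrow> 'n phase_space) topology" where
  "analytic_Ham_topology = inductive_limit_topology torus_holo_map torus_complexify analytic_Ham"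

definition horizontal_shears :: "('n::finite phase_space \<Rightarrow> 'n phase_space) set" where
  "horizontal_shears =
     {\<lambda>z. phase_pt (q_part z + to_torus (torus_grad \<tau> (p_part z))) (p_part z) | \<tau>. analytic_fun \<tau>}"

definition vertical_shears :: "('n::finite phase_space \<Rightarrow> 'n phase_space) set" where
  "vertical_shears =
     {\<lambda>z. phase_pt (q_part z) (p_part z - to_torus (torus_grad v (q_part z))) | v. analytic_fun v}"

definition shear_group :: "('n::finite phase_space \<Rightarrow> 'n phase_space) set" where
  "shear_group = generate (BijGroup UNIV) (vertical_shears \<union> horizontal_shears)"

end

(*
  A Hamiltonian which is a cosine of p alone or of q alone has a shear as its flow, and conjugating
  a p-shear by q-shears shows that the Hamiltonians cos (2 pi l.p + g(q)) also have exact flows in the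
  shear group, g being any trigonometric polynomial whose frequencies b satisfy l.b /= 0. A mixed
  second difference in g yields products cos (2 pi l.p + theta) g1(q) g2(q), and these span all
  trigonometric polynomials; by composing short-time flows, sums are handled as well.

  A continuous path t -> H_t of analytic functions extends to one common complex strip: otherwise
  some sequence H_(t_j), t_j -> t, would be closed together with all its subsets. Trigonometric
  interpolation approximates H_t on a smaller strip by a trigonometric polynomial whose coefficients
  are linear in finitely many values of H_t at real points. Hence H_t varies continuously in the
  sup norm on the strip, and each H_t is approximated by Hamiltonians as above. A one-step method
  whose steps are compositions of shears then converges to the flow uniformly on a strip; the limit
  is holomorphic by Cauchy's estimates and extends the Hamiltonian diffeomorphism.
*)

theory Submission
  imports Defs "HOL-Complex_Analysis.Cauchy_Integral_Formula"
begin

section \<open>Strips around the real torus\<close>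

text \<open>Two obstacles shape the argument. The first is resonance. Conjugation by a q-shear of
  frequency b moves the phase of cos (2 pi l.p) at a rate proportional to l.b, so q-frequencies with
  l.b = 0 are out of direct reach. Every q-frequency is however a sum b1 + b2 with l.b1 and l.b2
  both nonzero. This is why products with two q-factors, and hence a mixed second difference, are
  the right target. The second is loss of analyticity width. Each Cauchy estimate costs a part of
  the strip, which would be fatal if it were paid at every time step. The shears are therefore
  lifted to entire maps of the complex cover, derivatives are estimated only for the Hamiltonians
  and a fixed number of times, and approximate orbits are compared with exact ones, which stay near
  real orbits by Gronwall's inequality. What a step has to satisfy is then an o(h) consistency on a
  fixed strip, a condition that survives real multiples, sums and uniform limits of
  Hamiltonians.\<close>

definition strip :: "real \<Rightarrow> (complex ^ 'k) set" where
  "strip r = {z. \<forall>i. \<bar>Im (z $ i)\<bar> < r}"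

definition cvec :: "real ^ 'k \<Rightarrow> complex ^ 'k" where
  "cvec x = (\<chi> i. complex_of_real (x $ i))"

lemma cvec_nth [simp]: "cvec x $ i = complex_of_real (x $ i)"
  by (simp add: cvec_def)

lemma cvec_add: "cvec (x + y) = cvec x + cvec y"
  by (simp add: vec_eq_iff)

lemma cvec_diff: "cvec (x - y) = cvec x - cvec y"
  by (simp add: vec_eq_iff)

lemma norm_cvec [simp]: "norm (cvec x) = norm (x :: real ^ 'k::finite)"
  by (simp add: norm_vec_def L2_set_def)

lemma bounded_linear_cvec: "bounded_linear (cvec :: real ^ 'k::finite \<Rightarrow> _)"
  by (rule bounded_linear_intro[where K = 1]) (simp_all add: cvec_add, simp add: vec_eq_iff scaleR_conv_of_real[where 'a = complex])

lemma cvec_in_strip [simp]: "r > 0 \<Longrightarrow> cvec x \<in> strip r"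
  by (simp add: strip_def)

lemma strip_mono: "r \<le> s \<Longrightarrow> strip r \<subseteq> strip s"
  unfolding strip_def by (auto intro: order.strict_trans2)

lemma strip_mono': "z \<in> strip r \<Longrightarrow> r \<le> s \<Longrightarrow> z \<in> strip s"
  using strip_mono by blast

lemma open_strip: "open (strip r :: (complex ^ 'k::finite) set)"
proof -
  have "strip r = (\<Inter>i. {z :: complex ^ 'k. \<bar>Im (z $ i)\<bar> < r})" by (auto simp: strip_def)
  then show ?thesis
    by (auto intro!: open_INT open_Collect_less continuous_intros)
qed

text \<open>Convexity makes the mean value inequality and the theorem on limits of derivatives
  applicable on a whole strip.\<close>

lemma convex_strip: "convex (strip r)"
proof (rule convexI)
  fix z w :: "complex ^ 'k" and u v :: real
  assume *: "z \<in> strip r" "w \<in> strip r" "0 \<le> u" "0 \<le> v" "u + v = 1"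
  show "u *\<^sub>R z + v *\<^sub>R w \<in> strip r"
    unfolding strip_def
  proof (intro CollectI allI)
    fix i
    have "convex {-r<..<r}" by simp
    moreover have "Im (z $ i) \<in> {-r<..<r}" "Im (w $ i) \<in> {-r<..<r}"
      using * by (auto simp: strip_def abs_less_iff minus_less_iff)
    ultimately have "u *\<^sub>R Im (z $ i) + v *\<^sub>R Im (w $ i) \<in> {-r<..<r}"
      using *(3-5) by (rule convexD)
    then show "\<bar>Im ((u *\<^sub>R z + v *\<^sub>R w) $ i)\<bar> < r" by (auto simp: abs_less_iff)
  qed
qed

lemma strip_add:
  assumes "z \<in> strip r" "\<And>i. \<bar>Im (v $ i)\<bar> \<le> s"
  shows "z + v \<in> strip (r + s)"
  unfolding strip_def
proof (intro CollectI allI)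
  fix i
  have "\<bar>Im (z $ i)\<bar> < r" using assms(1) by (simp add: strip_def)
  then show "\<bar>Im ((z + v) $ i)\<bar> < r + s" using assms(2)[of i] by simp
qed

lemma strip_add_norm: "z \<in> strip r \<Longrightarrow> norm (v :: complex ^ 'k::finite) \<le> s \<Longrightarrow> z + v \<in> strip (r + s)"
proof (rule strip_add)
  fix i assume "norm v \<le> s"
  then show "\<bar>Im (v $ i)\<bar> \<le> s"
    using abs_Im_le_cmod[of "v $ i"] Finite_Cartesian_Product.norm_nth_le[of v i] by linarith
qed

lemma strip_near:
  "z \<in> strip r \<Longrightarrow> norm (w - z) \<le> s \<Longrightarrow> r + s \<le> t \<Longrightarrow> (w :: complex ^ 'k::finite) \<in> strip t"
  using strip_add_norm[of z r "w - z" s] strip_mono by force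

section \<open>Lattice translations and the quotient map\<close>

lemma integer_lattice_complexE:
  assumes "(m :: complex ^ 'k) \<in> integer_lattice"
  obtains n where "m = cvec n" "n \<in> integer_lattice"
proof -
  have "\<forall>i. \<exists>k. m $ i = of_int k"
    using assms by (auto simp: integer_lattice_def elim!: Ints_cases)
  then obtain k where k: "\<And>i. m $ i = of_int (k i)" by metis
  show ?thesis
    by (rule that[of "\<chi> i. of_int (k i)"]) (auto simp: vec_eq_iff integer_lattice_def k)
qed

lemma cvec_in_integer_lattice [simp]: "cvec n \<in> integer_lattice \<longleftrightarrow> n \<in> integer_lattice"
proof -
  have "complex_of_real x \<in> \<int> \<longleftrightarrow> x \<in> \<int>" for x
    by (metis Ints_cases Ints_of_int of_real_of_int_eq of_real_eq_iff)
  then show ?thesis by (simp add: integer_lattice_def)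
qed

text \<open>Lattice vectors are real even in the complex space, so translations leave imaginary
  parts alone; this is why strips descend to the torus.\<close>

lemma strip_lattice: "m \<in> integer_lattice \<Longrightarrow> z + m \<in> strip r \<longleftrightarrow> z \<in> strip r"
  by (auto elim!: integer_lattice_complexE simp: strip_def)

lemma to_torus_eq_iff: "to_torus x = to_torus y \<longleftrightarrow> x - y \<in> integer_lattice"
  using torus.abs_eq_iff[of x y] by (simp add: lattice_rel_def)

lemma to_torus_rep_torus [simp]: "to_torus (rep_torus x) = x"
  by (rule Quotient_abs_rep[OF Quotient_torus])

lemma rep_torus_to_torusE:
  obtains m where "m \<in> integer_lattice" "rep_torus (to_torus x) = x + m"
proof
  show "rep_torus (to_torus x) - x \<in> integer_lattice"
    using to_torus_eq_iff[of "rep_torus (to_torus x)" x] by simp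
  show "rep_torus (to_torus x) = x + (rep_torus (to_torus x) - x)" by simp
qed

lemma to_torus_add: "to_torus (x + y) = to_torus x + to_torus y"
  by (simp add: plus_torus.abs_eq)

lemma to_torus_diff: "to_torus (x - y) = to_torus x - to_torus y"
  by (simp add: minus_torus.abs_eq)

lemma to_torus_minus: "to_torus (- y) = - to_torus y"
  by (simp add: uminus_torus.abs_eq)

lemma torus_complexify_to_torus [simp]: "torus_complexify (to_torus x) = to_torus (cvec x)"
  by (simp add: torus_complexify.abs_eq cvec_def)

lemma dist_to_torus_le: "dist (to_torus x) (to_torus y) \<le> norm (x - y)"
  using infdist_le[of 0 integer_lattice "x - y"] by (simp add: dist_torus.abs_eq)

text \<open>The quotient distance is an infimum over the lattice; the strict inequality allows a
  translate to be picked without showing that the infimum is attained.\<close>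

lemma dist_to_torusE:
  assumes "dist (to_torus x) (to_torus y) < e"
  obtains m where "m \<in> integer_lattice" "norm (x - y - m) < e"
proof -
  have ne: "integer_lattice \<noteq> {}" using integer_lattice_0 by blast
  have "(INF a\<in>integer_lattice. dist (x - y) a) < e"
    using assms by (simp add: dist_torus.abs_eq infdist_notempty[OF ne])
  then obtain a where "a \<in> integer_lattice" "dist (x - y) a < e"
    using cInf_lessD[of "dist (x - y) ` integer_lattice" e] ne by auto
  then show ?thesis using that by (simp add: dist_norm)
qed

lemma continuous_on_to_torus: "continuous_on S to_torus"
  by (rule continuous_on_subset[of UNIV])
    (auto simp: continuous_on_iff dist_norm intro!: exI elim!: order.strict_trans1[OF dist_to_torus_le])

lemma open_vimage_to_torus: "open W \<Longrightarrow> open (to_torus -` W)"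
  by (simp add: continuous_on_to_torus open_vimage)

lemma open_image_to_torus:
  assumes "open U"
  shows "open (to_torus ` U)"
  unfolding open_dist
proof (intro ballI)
  fix x assume "x \<in> to_torus ` U"
  then obtain u where u: "u \<in> U" "x = to_torus u" by blast
  then obtain e where e: "e > 0" "\<And>y. dist y u < e \<Longrightarrow> y \<in> U"
    using assms unfolding open_dist by metis
  have "y \<in> to_torus ` U" if d: "dist y x < e" for y
  proof -
    obtain w where w: "y = to_torus w" using to_torus_rep_torus by metis
    obtain m where m: "m \<in> integer_lattice" "norm (w - u - m) < e"
      using dist_to_torusE[OF d[unfolded w u(2)]] by metis
    have "w - m \<in> U" using m(2) by (intro e(2)) (simp add: dist_norm algebra_simps)
    moreover have "to_torus (w - m) = y"
      using m(1) integer_lattice_uminus[of m] unfolding w to_torus_eq_iff by simp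
    ultimately show ?thesis by blast
  qed
  then show "\<exists>e>0. \<forall>y. dist y x < e \<longrightarrow> y \<in> to_torus ` U" using e(1) by blast
qed

lemma to_torus_in_strip_image: "to_torus z \<in> to_torus ` strip r \<longleftrightarrow> z \<in> strip r"
proof
  assume "to_torus z \<in> to_torus ` strip r"
  then obtain w where "w \<in> strip r" "z - w \<in> integer_lattice"
    by (auto simp: to_torus_eq_iff)
  then show "z \<in> strip r" using strip_lattice[of "z - w" w r] by simp
qed simp

lemma complex_nbhd_strip:
  assumes "r > 0"
  shows "complex_nbhd (to_torus ` (strip r :: (complex ^ 'k::finite) set))"
  unfolding complex_nbhd_def
proof
  show "open (to_torus ` (strip r :: (complex ^ 'k) set))" by (intro open_image_to_torus open_strip)
  show "range torus_complexify \<subseteq> to_torus ` (strip r :: (complex ^ 'k) set)"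
  proof
    fix y :: "(complex, 'k) torus" assume "y \<in> range torus_complexify"
    then obtain x :: "(real, 'k) torus" where x: "y = torus_complexify x" by blast
    have "y = to_torus (cvec (rep_torus x))"
      unfolding x torus_complexify_to_torus[symmetric] to_torus_rep_torus ..
    then show "y \<in> to_torus ` strip r" using assms by simp
  qed
qed

lemma norm_cart_le_sum: "norm (v :: 'a::real_normed_vector ^ 'k::finite) \<le> (\<Sum>i\<in>UNIV. norm (v $ i))"
  unfolding norm_vec_def by (rule L2_set_le_sum) simp

lemma norm_cart_le_card:
  assumes "\<And>i. norm (v $ i) \<le> B"
  shows "norm (v :: 'a::real_normed_vector ^ 'k::finite) \<le> real CARD('k) * B"
proof -
  have "(\<Sum>i\<in>UNIV. norm (v $ i)) \<le> real CARD('k) * B"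
    using sum_mono[of UNIV "\<lambda>i. norm (v $ i)" "\<lambda>_. B"] assms by simp
  then show ?thesis using norm_cart_le_sum[of v] by linarith
qed

definition cRe :: "complex ^ 'k \<Rightarrow> real ^ 'k" where "cRe z = (\<chi> i. Re (z $ i))"

lemma norm_diff_cRe_strip:
  assumes "(z :: complex ^ 'k::finite) \<in> strip r"
  shows "norm (z - cvec (cRe z)) \<le> real CARD('k) * r"
proof (rule norm_cart_le_card)
  fix i
  have "z $ i - complex_of_real (Re (z $ i)) = \<i> * complex_of_real (Im (z $ i))"
    by (simp add: complex_eq_iff)
  then have "norm ((z - cvec (cRe z)) $ i) = \<bar>Im (z $ i)\<bar>" by (simp add: cRe_def norm_mult)
  then show "norm ((z - cvec (cRe z)) $ i) \<le> r" using assms by (auto simp: strip_def less_imp_le)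
qed

text \<open>The real torus is compact, so a neighbourhood of it has a uniform width. Strips are thus
  cofinal among the complex neighbourhoods, and every question about the inductive limit can be
  asked on them.\<close>

lemma complex_nbhd_contains_strip:
  assumes "complex_nbhd (W :: (complex, 'k::finite) torus set)"
  obtains r where "r > 0" "\<And>z. z \<in> strip r \<Longrightarrow> to_torus z \<in> W"
proof -
  let ?K = "cvec ` (cbox 0 1 :: (real ^ 'k) set)"
  have "compact ?K"
    by (intro compact_continuous_image compact_cbox linear_continuous_on bounded_linear_cvec)
  moreover have "open (to_torus -` W :: (complex ^ 'k) set)"
    using assms by (intro open_vimage_to_torus) (simp add: complex_nbhd_def)
  moreover have inW: "to_torus (cvec x) \<in> W" for x
    using assms unfolding complex_nbhd_def torus_complexify_to_torus[symmetric] by blast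
  then have "?K \<subseteq> to_torus -` W" by auto
  ultimately obtain e where e: "e > 0" "(\<Union>x\<in>?K. ball x e) \<subseteq> to_torus -` W"
    by (rule compact_subset_open_imp_ball_epsilon_subset)
  \<comment> \<open>A point of \<open>strip r\<close> is within \<open>CARD('k) * r\<close> of its
    real part, here e / 2, hence strictly inside the ball of radius e.\<close>
  define r where "r = e / (2 * real CARD('k))"
  have c0: "real CARD('k) > 0" by simp
  then have r: "r > 0" "real CARD('k) * r < e" using e(1) by (auto simp: r_def field_simps)
  show ?thesis
  proof
    show "r > 0" by (rule r)
    fix z :: "complex ^ 'k" assume z: "z \<in> strip r"
    \<comment> \<open>Translating by the integer parts moves the real part into the unit cube, where
      compactness was used.\<close>
    define n :: "real ^ 'k" where "n = (\<chi> i. of_int \<lfloor>Re (z $ i)\<rfloor>)"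
    define w where "w = z - cvec n"
    have n: "n \<in> integer_lattice" by (simp add: n_def integer_lattice_def)
    have "z = w + cvec n" by (simp add: w_def)
    then have ws: "w \<in> strip r" using z n strip_lattice[of "cvec n" w r] by simp
    have "cRe w \<in> cbox 0 1"
    proof -
      have "0 \<le> Re (z $ i) - of_int \<lfloor>Re (z $ i)\<rfloor>" "Re (z $ i) - of_int \<lfloor>Re (z $ i)\<rfloor> \<le> 1" for i
        using floor_correct[of "Re (z $ i)"] by linarith+
      then show ?thesis by (simp add: cRe_def w_def n_def mem_box_cart)
    qed
    moreover have "norm (w - cvec (cRe w)) < e" using norm_diff_cRe_strip[OF ws] r by linarith
    then have "w \<in> ball (cvec (cRe w)) e" by (simp add: dist_norm norm_minus_commute)
    ultimately have "w \<in> (\<Union>x\<in>?K. ball x e)" by blast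
    then have "to_torus w \<in> W" using e(2) by blast
    moreover have "to_torus w = to_torus z"
      using n integer_lattice_uminus[of "cvec n"] by (simp add: to_torus_eq_iff w_def)
    ultimately show "to_torus z \<in> W" by simp
  qed
qed


section \<open>Cauchy estimates\<close>

text \<open>A derivative in one complex variable, so that the one-variable Cauchy inequality applies
  to it directly.\<close>

definition cpart :: "'k \<Rightarrow> (complex ^ 'k \<Rightarrow> complex) \<Rightarrow> complex ^ 'k::finite \<Rightarrow> complex" where
  "cpart k F z = deriv (\<lambda>\<zeta>. F (z + axis k \<zeta>)) 0"

section \<open>Calculus of holomorphic functions of several variables\<close>

lemma holo_on_subset: "holo_on F U \<Longrightarrow> V \<subseteq> U \<Longrightarrow> holo_on F V"
  by (auto simp: holo_on_def)

lemma holo_onE: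
  assumes "holo_on F U" "z \<in> U"
  obtains D where "(F has_derivative D) (at z)" "\<forall>c v. D (c *s v) = c * D v"
  using assms unfolding holo_on_def by blast

lemma holo_onI:
  assumes "\<And>z. z \<in> U \<Longrightarrow> (F has_derivative D z) (at z)" "\<And>z c v. z \<in> U \<Longrightarrow> D z (c *s v) = c * D z v"
  shows "holo_on F U"
  unfolding holo_on_def using assms by (intro ballI exI conjI allI)

lemma holo_on_add:
  assumes "holo_on F U" "holo_on G U"
  shows "holo_on (\<lambda>z. F z + G z) U"
  unfolding holo_on_def
proof
  fix z assume z: "z \<in> U"
  obtain D where D: "(F has_derivative D) (at z)" "\<forall>c v. D (c *s v) = c * D v"
    using assms(1) z by (rule holo_onE)
  obtain E where E: "(G has_derivative E) (at z)" "\<forall>c v. E (c *s v) = c * E v"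
    using assms(2) z by (rule holo_onE)
  have "((\<lambda>z. F z + G z) has_derivative (\<lambda>v. D v + E v)) (at z)"
    using D(1) E(1) by (rule has_derivative_add)
  moreover have "\<forall>c v. D (c *s v) + E (c *s v) = c * (D v + E v)"
    using D(2) E(2) by (simp add: distrib_left)
  ultimately show "\<exists>D. ((\<lambda>z. F z + G z) has_derivative D) (at z) \<and> (\<forall>c v. D (c *s v) = c * D v)"
    by (intro exI[of _ "\<lambda>v. D v + E v"] conjI)
qed

lemma holo_on_comp:
  assumes "holo_on F U" "\<And>z. z \<in> U \<Longrightarrow> \<exists>d. (g has_field_derivative d) (at (F z))"
  shows "holo_on (\<lambda>z. g (F z)) U"
  unfolding holo_on_def
proof
  fix z assume z: "z \<in> U"
  obtain D where D: "(F has_derivative D) (at z)" "\<forall>c v. D (c *s v) = c * D v"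
    using assms(1) z by (rule holo_onE)
  obtain d where "(g has_field_derivative d) (at (F z))" using assms(2) z by blast
  then have "((\<lambda>z. g (F z)) has_derivative (\<lambda>v. d * D v)) (at z)"
    using D(1) by (auto simp: has_field_derivative_def intro: has_derivative_compose)
  then show "\<exists>D. ((\<lambda>z. g (F z)) has_derivative D) (at z) \<and> (\<forall>c v. D (c *s v) = c * D v)"
    using D(2) by (intro exI[of _ "\<lambda>v. d * D v"]) (auto simp: algebra_simps)
qed

lemma holo_on_const: "holo_on (\<lambda>z. c) U"
  unfolding holo_on_def by (auto intro!: exI[of _ "\<lambda>_. 0"])

lemma holo_on_nth: "holo_on (\<lambda>z. z $ i) U"
  unfolding holo_on_def
  by (auto intro!: exI[of _ "\<lambda>v. v $ i"] bounded_linear_imp_has_derivative bounded_linear_vec_nth)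

lemma holo_on_cmult: "holo_on F U \<Longrightarrow> holo_on (\<lambda>z. c * F z) U"
  by (rule holo_on_comp) (auto intro!: derivative_eq_intros)

lemma holo_on_diff: "holo_on F U \<Longrightarrow> holo_on G U \<Longrightarrow> holo_on (\<lambda>z. F z - G z) U"
  using holo_on_add[of F U "\<lambda>z. -1 * G z"] holo_on_cmult[of G U "-1"] by simp

lemma holo_on_mult: "holo_on F U \<Longrightarrow> holo_on G U \<Longrightarrow> holo_on (\<lambda>z. F z * G z) U"
proof -
  assume "holo_on F U" "holo_on G U"
  \<comment> \<open>Polarisation: a product is a combination of squares of a sum and a difference,
    so the composition rule with a function of one variable suffices.\<close>
  then have "holo_on (\<lambda>z. 1/4 * ((\<lambda>x. x^2) (F z + G z) - (\<lambda>x. x^2) (F z - G z))) U"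
    by (intro holo_on_cmult holo_on_diff[of "\<lambda>z. (F z + G z)^2"] holo_on_comp[of _ _ "\<lambda>x. x^2"] holo_on_add)
      (auto intro!: derivative_eq_intros holo_on_diff)
  then show ?thesis by (simp add: power2_eq_square algebra_simps)
qed

lemma holo_on_sum: "(\<And>i. i \<in> I \<Longrightarrow> holo_on (F i) U) \<Longrightarrow> holo_on (\<lambda>z. \<Sum>i\<in>I. F i z) U"
  by (induction I rule: infinite_finite_induct) (auto intro: holo_on_add holo_on_const)

lemma holo_on_imp_continuous_on: "holo_on F U \<Longrightarrow> continuous_on U F"
  by (rule continuous_at_imp_continuous_on) (blast elim: holo_onE intro: has_derivative_continuous)

text \<open>Complex linearity of the Frechet derivative is what makes the restriction to a complex
  line complex differentiable; all Cauchy estimates are made on such lines.\<close>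

lemma holo_slice:
  assumes "(F has_derivative D) (at (z + \<zeta> *s (v :: complex ^ 'k::finite)))" "\<forall>c v. D (c *s v) = c * D v"
  shows "((\<lambda>\<zeta>. F (z + \<zeta> *s v)) has_field_derivative D v) (at \<zeta>)"
proof -
  have bl: "bounded_linear (\<lambda>\<zeta>::complex. \<zeta> *s v)"
  proof (rule bounded_linear_intro)
    fix x y :: complex and c :: real
    show "(x + y) *s v = x *s v + y *s v" by (rule vector_sadd_rdistrib)
    show "(c *\<^sub>R x) *s v = c *\<^sub>R (x *s v)" by (simp add: vec_eq_iff)
    have "norm (x *s v) = norm x * norm v"
      by (simp add: norm_vec_def L2_set_right_distrib norm_mult)
    then show "norm (x *s v) \<le> norm x * norm v" by simp
  qed
  have "((\<lambda>\<zeta>. z + \<zeta> *s v) has_derivative (\<lambda>\<zeta>. \<zeta> *s v)) (at \<zeta>)"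
    using bounded_linear_imp_has_derivative[OF bl] by (auto intro!: derivative_eq_intros)
  from has_derivative_compose[OF this, of F D] assms
  have "((\<lambda>\<zeta>. F (z + \<zeta> *s v)) has_derivative (\<lambda>\<zeta>. D (\<zeta> *s v))) (at \<zeta>)" by simp
  moreover have "(\<lambda>\<zeta>. D (\<zeta> *s v)) = (\<lambda>\<zeta>. D v * \<zeta>)" using assms(2) by auto
  ultimately show ?thesis by (simp add: has_field_derivative_def)
qed

lemma holo_slice_differentiable:
  assumes "holo_on F U" "z + \<zeta> *s (v :: complex ^ 'k::finite) \<in> U"
  shows "\<exists>D. ((\<lambda>\<zeta>. F (z + \<zeta> *s v)) has_field_derivative D) (at \<zeta>)"
proof -
  obtain D where "(F has_derivative D) (at (z + \<zeta> *s v))" "\<forall>c v. D (c *s v) = c * D v"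
    using assms by (rule holo_onE)
  then show ?thesis by (blast intro: holo_slice)
qed

lemma norm_axis: "norm (axis k a :: 'a::real_normed_vector ^ 'k::finite) = norm a"
proof -
  have "(\<Sum>i\<in>UNIV. (norm ((axis k a :: 'a ^ 'k) $ i))\<^sup>2) = (\<Sum>i\<in>UNIV. if i = k then (norm a)\<^sup>2 else 0)"
    by (intro sum.cong) (auto simp: axis_def)
  then show ?thesis by (simp add: norm_vec_def L2_set_def)
qed

lemma axis_conv_smult: "axis k \<zeta> = \<zeta> *s (axis k 1 :: complex ^ 'k::finite)"
  by (simp add: vec_eq_iff axis_def)

lemma axis_slice: "(\<lambda>\<zeta>. F (z + axis k \<zeta>)) = (\<lambda>\<zeta>. F (z + \<zeta> *s (axis k 1 :: complex ^ 'k::finite)))"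
  by (rule ext, subst axis_conv_smult) simp

lemma cpart_eq:
  assumes "(F has_derivative D) (at z)" "\<forall>c v. D (c *s v) = c * D v"
  shows "cpart k F z = D (axis k 1)"
  unfolding cpart_def axis_slice
  by (rule DERIV_imp_deriv, rule holo_slice) (use assms in auto)

lemma cpart_DERIV:
  assumes "holo_on F U" "z \<in> U"
  shows "((\<lambda>\<zeta>. F (z + axis k \<zeta>)) has_field_derivative cpart k F z) (at 0)"
proof -
  obtain D where D: "(F has_derivative D) (at z)" "\<forall>c v. D (c *s v) = c * D v"
    using assms by (rule holo_onE)
  show ?thesis unfolding axis_slice cpart_eq[OF D]
    by (rule holo_slice) (use D in auto)
qed

lemma norm_smult_nth_le: "norm ((\<zeta> *s (v :: complex ^ 'k::finite)) $ i) \<le> norm \<zeta> * norm v"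
  by (simp add: norm_mult mult_left_mono Finite_Cartesian_Product.norm_nth_le)

text \<open>The vector v enters only as a scale: the radius \<open>s / norm v\<close> is the largest
  one for which the displacement \<open>\<zeta> *s v\<close> has norm at most s.\<close>

lemma Cauchy_slice:
  fixes f :: "complex \<Rightarrow> complex"
  assumes s: "0 < s" and v: "v \<noteq> 0"
    and holo: "\<And>\<zeta>. norm \<zeta> * norm v \<le> s \<Longrightarrow> \<exists>D. (f has_field_derivative D) (at \<zeta>)"
    and bd: "\<And>\<zeta>. norm \<zeta> * norm v \<le> s \<Longrightarrow> norm (f \<zeta>) \<le> B"
  shows "norm (deriv f 0) \<le> B / s * norm (v :: complex ^ 'k::finite)"
proof -
  let ?R = "s / norm v"
  have R: "?R > 0" using s v by simp
  have iff: "norm \<zeta> \<le> ?R \<longleftrightarrow> norm \<zeta> * norm v \<le> s" for \<zeta> :: complex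
    using v by (simp add: field_simps)
  have "norm ((deriv ^^ 1) f 0) \<le> fact 1 * B / ?R ^ 1"
  proof (rule Cauchy_inequality)
    show "0 < ?R" by (rule R)
    have *: "f field_differentiable at \<zeta>" if "\<zeta> \<in> cball 0 ?R" for \<zeta>
    proof -
      have "norm \<zeta> \<le> ?R" using that by simp
      then show ?thesis unfolding field_differentiable_def iff by (rule holo)
    qed
    have "f field_differentiable at \<zeta> within ball 0 ?R" if "\<zeta> \<in> ball 0 ?R" for \<zeta>
      using *[OF subsetD[OF ball_subset_cball that]] by (rule field_differentiable_at_within)
    then show "f holomorphic_on ball 0 ?R" unfolding holomorphic_on_def by blast
    show "continuous_on (cball 0 ?R) f"
      by (intro continuous_at_imp_continuous_on ballI field_differentiable_imp_continuous_at *)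
    show "norm (f x) \<le> B" if "norm (0 - x) = ?R" for x
    proof -
      have "norm x \<le> ?R" using that by simp
      then show ?thesis unfolding iff by (rule bd)
    qed
  qed
  then show ?thesis by simp
qed

text \<open>From a point of \<open>strip (r - s)\<close> every displacement of norm at most s stays
  in \<open>strip r\<close>, so the estimate holds in all directions with the same s.\<close>

lemma Cauchy_derivative:
  assumes holo: "holo_on F (strip r)" and bd: "\<And>z. z \<in> strip r \<Longrightarrow> norm (F z) \<le> M"
    and s: "0 < s" and z: "z \<in> strip (r - s)"
    and D: "(F has_derivative D) (at z)" "\<forall>c v. D (c *s v) = c * D v"
  shows "norm (D v) \<le> M / s * norm (v :: complex ^ 'k::finite)"
proof (cases "v = 0")
  case True
  then show ?thesis using D(2)[rule_format, of 0 0] by simp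
next
  case False
  have in': "z + \<zeta> *s v \<in> strip r" if "norm \<zeta> * norm v \<le> s" for \<zeta>
  proof -
    have "z + \<zeta> *s v \<in> strip ((r - s) + s)"
      using that by (intro strip_add z) (meson abs_Im_le_cmod norm_smult_nth_le order_trans)
    then show ?thesis by simp
  qed
  have "((\<lambda>\<zeta>. F (z + \<zeta> *s v)) has_field_derivative D v) (at 0)"
    by (rule holo_slice) (use D in auto)
  then have "deriv (\<lambda>\<zeta>. F (z + \<zeta> *s v)) 0 = D v" by (rule DERIV_imp_deriv)
  moreover have "norm (deriv (\<lambda>\<zeta>. F (z + \<zeta> *s v)) 0) \<le> M / s * norm v"
  proof (rule Cauchy_slice[OF s False])
    fix \<zeta> :: complex assume le: "norm \<zeta> * norm v \<le> s"
    show "norm (F (z + \<zeta> *s v)) \<le> M" by (rule bd[OF in'[OF le]])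
    show "\<exists>D. ((\<lambda>\<zeta>. F (z + \<zeta> *s v)) has_field_derivative D) (at \<zeta>)"
      by (rule holo_slice_differentiable[OF holo in'[OF le]])
  qed
  ultimately show ?thesis by simp
qed

text \<open>Cauchy's bound on the derivative, integrated along segments of the convex smaller
  strip.\<close>

lemma holo_strip_lipschitz:
  assumes holo: "holo_on F (strip r)" and bd: "\<And>z. z \<in> strip r \<Longrightarrow> norm (F z) \<le> M"
    and s: "0 < s" and z: "z \<in> strip (r - s)" "w \<in> strip (r - s)"
  shows "norm (F z - F w) \<le> M / s * norm (z - w :: complex ^ 'k::finite)"
proof -
  have "\<forall>z\<in>strip (r - s). \<exists>D. (F has_derivative D) (at z) \<and> (\<forall>c v. D (c *s v) = c * D v)"
    using holo_on_subset[OF holo, of "strip (r - s)"] strip_mono[of "r - s" r] s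
    by (simp add: holo_on_def)
  from bchoice[OF this] obtain F' where "\<forall>z\<in>strip (r - s). (F has_derivative F' z) (at z) \<and>
    (\<forall>c v. F' z (c *s v) = c * F' z v)" by blast
  then have F': "\<And>z. z \<in> strip (r - s) \<Longrightarrow> (F has_derivative F' z) (at z)"
    "\<And>z. z \<in> strip (r - s) \<Longrightarrow> \<forall>c v. F' z (c *s v) = c * F' z v" by blast+
  show ?thesis
  proof (rule differentiable_bound[OF convex_strip _ _ z, of F F'])
    show "(F has_derivative F' x) (at x within strip (r - s))" if "x \<in> strip (r - s)" for x
      using F'(1)[OF that] by (rule has_derivative_at_withinI)
    show "onorm (F' x) \<le> M / s" if "x \<in> strip (r - s)" for x
      by (rule onorm_le) (intro Cauchy_derivative[OF holo bd s that] F' that)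
  qed
qed

lemma cpart_bound:
  assumes holo: "holo_on F (strip r)" and bd: "\<And>z. z \<in> strip r \<Longrightarrow> norm (F z) \<le> M"
    and s: "0 < s" and z: "z \<in> strip (r - s)"
  shows "norm (cpart k F z) \<le> M / s"
proof -
  have "z \<in> strip r" using z s strip_mono[of "r - s" r] by auto
  then obtain D where D: "(F has_derivative D) (at z)" "\<forall>c v. D (c *s v) = c * D v"
    using holo holo_onE by blast
  show ?thesis using Cauchy_derivative[OF holo bd s z D, of "axis k 1"] cpart_eq[OF D] by simp
qed

text \<open>Cauchy's estimate for the difference quotient gives the Lipschitz bound for the first
  derivatives without any reference to second derivatives.\<close>

lemma cpart_lipschitz:
  assumes holo: "holo_on F (strip r)" and bd: "\<And>z. z \<in> strip r \<Longrightarrow> norm (F z) \<le> M"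
    and s: "0 < s" and z: "z \<in> strip (r - 2 * s)" "w \<in> strip (r - 2 * s)"
  shows "norm (cpart k F z - cpart k F w) \<le> M / s\<^sup>2 * norm (z - w)"
proof -
  let ?f = "\<lambda>\<zeta>. F (z + axis k \<zeta>) - F (w + axis k \<zeta>)"
  have in': "u + axis k \<zeta> \<in> strip (r - s)" if "norm \<zeta> * norm (axis k 1 :: complex ^ 'a) \<le> s" "u \<in> strip (r - 2 * s)" for \<zeta> u
  proof -
    have "norm (axis k \<zeta> :: complex ^ 'a) \<le> s"
      using that norm_smult_nth_le[of \<zeta> "axis k 1 :: complex ^ 'a"] by (simp add: norm_axis)
    then have "u + axis k \<zeta> \<in> strip ((r - 2 * s) + s)"
      using that by (intro strip_add_norm) auto
    then show ?thesis by (simp add: algebra_simps)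
  qed
  have sub: "strip (r - s) \<subseteq> strip r" "strip (r - 2 * s) \<subseteq> strip r" using s by (auto intro!: strip_mono)
  have "(?f has_field_derivative (cpart k F z - cpart k F w)) (at 0)"
    using z sub by (intro derivative_intros cpart_DERIV[OF holo]) auto
  then have "deriv ?f 0 = cpart k F z - cpart k F w" by (rule DERIV_imp_deriv)
  moreover have "norm (deriv ?f 0) \<le> (M / s * norm (z - w)) / s * norm (axis k 1 :: complex ^ 'a)"
  proof (rule Cauchy_slice[OF s])
    show "axis k 1 \<noteq> (0 :: complex ^ 'a)" using norm_axis[of k "1::complex"] by auto
    fix \<zeta> :: complex assume le: "norm \<zeta> * norm (axis k 1 :: complex ^ 'a) \<le> s"
    show "norm (?f \<zeta>) \<le> M / s * norm (z - w)"
      using holo_strip_lipschitz[OF holo bd s in'[OF le z(1)] in'[OF le z(2)]] by simp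
    have "\<exists>D. ((\<lambda>\<zeta>. F (u + axis k \<zeta>)) has_field_derivative D) (at \<zeta>)" if "u \<in> strip (r - 2 * s)" for u
    proof -
      have "u + axis k \<zeta> \<in> strip r" using in'[OF le that] sub by auto
      then show ?thesis unfolding axis_slice
        by (intro holo_slice_differentiable[OF holo]) (subst (asm) axis_conv_smult, simp)
    qed
    then obtain D E where "((\<lambda>\<zeta>. F (z + axis k \<zeta>)) has_field_derivative D) (at \<zeta>)"
      "((\<lambda>\<zeta>. F (w + axis k \<zeta>)) has_field_derivative E) (at \<zeta>)"
      using z by blast
    then show "\<exists>D. (?f has_field_derivative D) (at \<zeta>)"
      by (intro exI[of _ "D - E"] DERIV_diff)
  qed
  ultimately show ?thesis by (simp add: power2_eq_square)
qed

section \<open>Holomorphic extensions to strips\<close>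

text \<open>Works on the cover with a total function F. Periodicity is demanded off the strip as
  well, which makes \<open>F (rep_torus x)\<close> independent of the representative without any
  side condition; extensions coming from the torus satisfy it automatically.\<close>

definition strip_ext :: "real \<Rightarrow> (complex ^ 'k \<Rightarrow> complex) \<Rightarrow> ((real, 'k::finite) torus \<Rightarrow> real) \<Rightarrow> bool" where
  "strip_ext r F f \<longleftrightarrow> holo_on F (strip r) \<and> (\<forall>z m. m \<in> integer_lattice \<longrightarrow> F (z + m) = F z) \<and>
     (\<forall>x. F (cvec x) = complex_of_real (f (to_torus x)))"

lemma strip_extD:
  assumes "strip_ext r F f"
  shows "holo_on F (strip r)" "m \<in> integer_lattice \<Longrightarrow> F (z + m) = F z"
    "F (cvec x) = complex_of_real (f (to_torus x))"
  using assms by (auto simp: strip_ext_def)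

lemma strip_ext_mono: "strip_ext r F f \<Longrightarrow> s \<le> r \<Longrightarrow> strip_ext s F f"
  unfolding strip_ext_def using holo_on_subset strip_mono by blast

lemma strip_ext_of_torus:
  assumes "torus_holo_fun W G" "\<And>x. G (torus_complexify x) = complex_of_real (f x)"
    "\<And>z. z \<in> strip r \<Longrightarrow> to_torus z \<in> W"
  shows "strip_ext r (\<lambda>z. G (to_torus z)) f"
  unfolding strip_ext_def
proof (intro conjI allI impI)
  show "holo_on (\<lambda>z. G (to_torus z)) (strip r)"
    using assms(1,3) unfolding torus_holo_fun_def by (blast intro: holo_on_subset)
  show "G (to_torus (z + m)) = G (to_torus z)" if "m \<in> integer_lattice" for z m
  proof -
    have "to_torus (z + m) = to_torus z" using that by (simp add: to_torus_eq_iff)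
    then show ?thesis by simp
  qed
  show "G (to_torus (cvec x)) = complex_of_real (f (to_torus x))" for x
    using assms(2)[of "to_torus x"] by simp
qed

lemma strip_ext_rep_torus:
  assumes "strip_ext r F f"
  shows "F (rep_torus (to_torus z)) = F z"
  using rep_torus_to_torusE[of z] strip_extD(2)[OF assms] by metis

lemma torus_of_strip_ext:
  assumes "strip_ext r F f"
  shows "torus_holo_fun (to_torus ` strip r) (\<lambda>x. F (rep_torus x))"
    "F (rep_torus (torus_complexify x)) = complex_of_real (f x)"
proof -
  have "to_torus -` (to_torus ` strip r) = (strip r :: (complex ^ 'a) set)"
    using to_torus_in_strip_image by blast
  then show "torus_holo_fun (to_torus ` strip r) (\<lambda>x. F (rep_torus x))"
    unfolding torus_holo_fun_def strip_ext_rep_torus[OF assms] using strip_extD(1)[OF assms] by simp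
  have "torus_complexify (to_torus (rep_torus x)) = to_torus (cvec (rep_torus x))"
    by (rule torus_complexify_to_torus)
  then show "F (rep_torus (torus_complexify x)) = complex_of_real (f x)"
    using strip_extD(3)[OF assms, of "rep_torus x"] strip_ext_rep_torus[OF assms] by simp
qed

lemma analytic_fun_strip_ext: "strip_ext r F f \<Longrightarrow> r > 0 \<Longrightarrow> analytic_fun f"
  unfolding analytic_fun_def using complex_nbhd_strip torus_of_strip_ext by blast

text \<open>The closed period cell of the smaller strip is compact and still inside the larger one.
  On the original strip an extension may be unbounded, hence the loss of width.\<close>

lemma strip_ext_bounded:
  assumes ext: "strip_ext r F f" and "0 < s" "s < r"
  obtains M where "\<And>z. z \<in> strip s \<Longrightarrow> norm (F z) \<le> M"
proof -
  let ?K = "{z :: complex ^ 'a. \<forall>i. 0 \<le> Re (z $ i) \<and> Re (z $ i) \<le> 1 \<and> \<bar>Im (z $ i)\<bar> \<le> s}"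
  have "bounded ?K"
    unfolding bounded_iff
  proof (intro exI ballI)
    fix z assume z: "z \<in> ?K"
    show "norm z \<le> real CARD('a) * (1 + s)"
    proof (rule norm_cart_le_card)
      fix i
      have "norm (z $ i) \<le> \<bar>Re (z $ i)\<bar> + \<bar>Im (z $ i)\<bar>" by (rule cmod_le)
      moreover have "\<bar>Re (z $ i)\<bar> \<le> 1" "\<bar>Im (z $ i)\<bar> \<le> s" using z by auto
      ultimately show "norm (z $ i) \<le> 1 + s" by linarith
    qed
  qed
  moreover have "closed ?K"
    by (intro closed_Collect_all closed_Collect_conj closed_Collect_le continuous_intros)
  ultimately have "compact ?K" by (simp add: compact_eq_bounded_closed)
  moreover have sub: "?K \<subseteq> strip r" using \<open>s < r\<close> by (auto simp: strip_def intro: order.strict_trans1)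
  then have "continuous_on ?K F"
    using holo_on_imp_continuous_on[OF strip_extD(1)[OF ext]] continuous_on_subset by blast
  ultimately have "compact (F ` ?K)" by (rule compact_continuous_image[rotated])
  then have "bounded (F ` ?K)" by (rule compact_imp_bounded)
  then obtain M where "\<forall>y\<in>F ` ?K. norm y \<le> M" unfolding bounded_iff by (elim exE)
  then have M: "\<And>z. z \<in> ?K \<Longrightarrow> norm (F z) \<le> M" by blast
  show ?thesis
  proof (rule that)
    fix z :: "complex ^ 'a" assume z: "z \<in> strip s"
    define n :: "real ^ 'a" where "n = (\<chi> i. of_int \<lfloor>Re (z $ i)\<rfloor>)"
    have n: "n \<in> integer_lattice" by (simp add: n_def integer_lattice_def)
    have "0 \<le> Re (z $ i) - of_int \<lfloor>Re (z $ i)\<rfloor>" "Re (z $ i) - of_int \<lfloor>Re (z $ i)\<rfloor> \<le> 1" for i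
      using floor_correct[of "Re (z $ i)"] by linarith+
    then have "z - cvec n \<in> ?K" using z by (auto simp: n_def strip_def less_imp_le)
    moreover have "F z = F (z - cvec n)"
      using strip_extD(2)[OF ext, of "cvec n" "z - cvec n"] n by simp
    ultimately show "norm (F z) \<le> M" using M by simp
  qed
qed

lemma analytic_funE:
  assumes "analytic_fun f"
  obtains r F M where "r > 0" "strip_ext r F f" "\<And>z. z \<in> strip r \<Longrightarrow> norm (F z) \<le> M"
proof -
  obtain W G where WG: "complex_nbhd W" "torus_holo_fun W G"
      "\<And>x. G (torus_complexify x) = complex_of_real (f x)"
    using assms unfolding analytic_fun_def by blast
  obtain r where r: "r > 0" "\<And>z. z \<in> strip r \<Longrightarrow> to_torus z \<in> W"
    using complex_nbhd_contains_strip[OF WG(1)] by metis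
  have ext: "strip_ext r (\<lambda>z. G (to_torus z)) f" by (rule strip_ext_of_torus[OF WG(2,3) r(2)])
  obtain M where M: "\<And>z. z \<in> strip (r / 2) \<Longrightarrow> norm (G (to_torus z)) \<le> M"
    using strip_ext_bounded[OF ext, of "r / 2"] r(1) by auto
  have "strip_ext (r / 2) (\<lambda>z. G (to_torus z)) f"
    using r(1) by (intro strip_ext_mono[OF ext]) simp
  then show ?thesis using M r(1) by (intro that[of "r / 2"]) simp_all
qed

section \<open>Regularity of the inductive limit\<close>

text \<open>A single index controls both the width of the strip and the bound, so these sets form an
  increasing sequence that exhausts the analytic functions.\<close>

definition ext_ball :: "nat \<Rightarrow> ((real, 'k::finite) torus \<Rightarrow> real) set" where
  "ext_ball n = {f. \<exists>F. strip_ext (1 / Suc n) F f \<and> (\<forall>z\<in>strip (1 / Suc n). norm (F z) \<le> n)}"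

lemma ext_ball_I:
  fixes F :: "complex ^ 'k::finite \<Rightarrow> complex" and M :: real
  assumes "strip_ext r F f" "\<And>z. z \<in> strip r \<Longrightarrow> norm (F z) \<le> M" "1 / Suc n \<le> r" "M \<le> n"
  shows "f \<in> ext_ball n"
  unfolding ext_ball_def
proof (intro CollectI exI conjI ballI)
  show "strip_ext (1 / Suc n) F f" using assms(1,3) by (rule strip_ext_mono)
  fix z :: "complex ^ 'k" assume "z \<in> strip (1 / Suc n)"
  then have "z \<in> strip r" using assms(3) by (rule strip_mono')
  then show "norm (F z) \<le> n" using assms(2)[of z] assms(4) by linarith
qed

lemma ext_ball_mono: "m \<le> n \<Longrightarrow> ext_ball m \<subseteq> ext_ball n"
proof
  fix f :: "(real, 'a::finite) torus \<Rightarrow> real" assume "m \<le> n" "f \<in> ext_ball m"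
  then obtain F where "strip_ext (1 / Suc m) F f" "\<And>z. z \<in> strip (1 / Suc m) \<Longrightarrow> norm (F z) \<le> m"
    unfolding ext_ball_def by blast
  then show "f \<in> ext_ball n"
    using \<open>m \<le> n\<close> by (intro ext_ball_I[of "1 / Suc m" F f m]) (auto simp: frac_le)
qed

lemma ext_ball_threshold:
  fixes M :: real
  assumes "r > 0"
  obtains n :: nat where "1 / Suc n \<le> r" "M \<le> n"
proof -
  obtain n1 :: nat where n1: "1 / r < n1" using reals_Archimedean2 by blast
  obtain n2 :: nat where n2: "M < n2" using reals_Archimedean2 by blast
  have "1 / r \<le> real (Suc (max n1 n2))" using n1 by auto
  then have "1 / real (Suc (max n1 n2)) \<le> r" using assms
    by (simp add: field_simps del: of_nat_Suc)
  moreover have "M \<le> real (max n1 n2)" using n2 by simp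
  ultimately show ?thesis by (rule that)
qed

lemma analytic_fun_ext_ball: "analytic_fun f \<Longrightarrow> \<exists>n. f \<in> ext_ball n"
proof -
  assume "analytic_fun f"
  then obtain r F M where F: "r > 0" "strip_ext r F f" "\<And>z. z \<in> strip r \<Longrightarrow> norm (F z) \<le> M"
    by (rule analytic_funE) blast
  obtain n :: nat where "1 / Suc n \<le> r" "M \<le> n" using F(1) by (rule ext_ball_threshold)
  then show ?thesis using ext_ball_I[OF F(2,3)] by blast
qed

text \<open>Functions uniformly close to f on a given complex neighbourhood all lie in one
  \<open>ext_ball n\<close>. Only finitely many elements of C have to be avoided there, and each
  differs from f at some real point, where every extension can be tested.\<close>

lemma openin_Diff_ext_ball_finite:
  assumes fin: "\<And>n. finite (C \<inter> ext_ball n)"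
  shows "openin analytic_fun_topology ({f. analytic_fun f} - C)"
  unfolding analytic_fun_topology_def openin_inductive_limit_topology
proof (intro conjI allI impI)
  fix W F and f :: "(real, 'a) torus \<Rightarrow> real"
  assume *: "complex_nbhd W \<and> torus_holo_fun W F \<and> f \<in> {f. analytic_fun f} - C \<and>
    (\<forall>x. F (torus_complexify x) = complex_of_real (f x))"
  then obtain r where r: "r > 0" "\<And>z. z \<in> strip r \<Longrightarrow> to_torus z \<in> W"
    using complex_nbhd_contains_strip by blast
  have ext: "strip_ext r (\<lambda>z. F (to_torus z)) f" by (rule strip_ext_of_torus) (use * r(2) in auto)
  obtain M where M: "\<And>z. z \<in> strip (r / 2) \<Longrightarrow> norm (F (to_torus z)) \<le> M"
    using strip_ext_bounded[OF ext, of "r / 2"] r(1) by auto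
  \<comment> \<open>The \<open>+ 1\<close> leaves room for the neighbours of f, whose extensions are
    within \<open>e \<le> 1\<close> of that of f.\<close>
  obtain n where n: "1 / Suc n \<le> r / 2" "M + 1 \<le> real n"
    using ext_ball_threshold[of "r / 2" "M + 1"] r(1) by auto
  have "\<forall>g\<in>C \<inter> ext_ball n. \<exists>x. g x \<noteq> f x"
  proof
    fix g assume "g \<in> C \<inter> ext_ball n"
    then have "g \<noteq> f" using * by blast
    then show "\<exists>x. g x \<noteq> f x" by (simp add: fun_eq_iff)
  qed
  then obtain p where p: "\<And>g. g \<in> C \<inter> ext_ball n \<Longrightarrow> g (p g) \<noteq> f (p g)" by metis
  \<comment> \<open>Inserting 1 gives \<open>e \<le> 1\<close> and keeps the minimum meaningful when
    no element of C has to be avoided.\<close>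
  define e where "e = Min (insert 1 ((\<lambda>g. \<bar>g (p g) - f (p g)\<bar>) ` (C \<inter> ext_ball n)))"
  have e0: "e > 0" unfolding e_def using fin p by (subst Min_gr_iff) auto
  have e1: "e \<le> 1" unfolding e_def using fin by (intro Min_le) auto
  have eg: "e \<le> \<bar>g (p g) - f (p g)\<bar>" if "g \<in> C \<inter> ext_ball n" for g
    unfolding e_def using fin that by (intro Min_le) auto
  show "\<exists>\<epsilon>>0. \<forall>G g. torus_holo_fun W G \<and> g \<in> {f. analytic_fun f} \<and>
      (\<forall>x. G (torus_complexify x) = complex_of_real (g x)) \<and> (\<forall>z\<in>W. dist (G z) (F z) < \<epsilon>) \<longrightarrow>
      g \<in> {f. analytic_fun f} - C"
  proof (intro exI[of _ e] conjI allI impI e0)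
    fix G g
    assume g: "torus_holo_fun W G \<and> g \<in> {f. analytic_fun f} \<and>
      (\<forall>x. G (torus_complexify x) = complex_of_real (g x)) \<and> (\<forall>z\<in>W. dist (G z) (F z) < e)"
    have "g \<notin> C"
    proof
      assume "g \<in> C"
      have gext: "strip_ext r (\<lambda>z. G (to_torus z)) g" by (rule strip_ext_of_torus) (use g r(2) in auto)
      have gext2: "strip_ext (r / 2) (\<lambda>z. G (to_torus z)) g"
        using r(1) by (intro strip_ext_mono[OF gext]) simp
      have gM: "norm (G (to_torus z)) \<le> M + 1" if "z \<in> strip (r / 2)" for z
      proof -
        have "z \<in> strip r" using that by (rule strip_mono') (use r(1) in simp)
        then have "dist (G (to_torus z)) (F (to_torus z)) < e" using g r(2) by blast
        then have "norm (G (to_torus z) - F (to_torus z)) < 1" using e1 by (simp add: dist_norm)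
        then show ?thesis using M[OF that] norm_triangle_ineq2[of "G (to_torus z)" "F (to_torus z)"]
          by linarith
      qed
      have gn: "g \<in> C \<inter> ext_ball n"
        using \<open>g \<in> C\<close> ext_ball_I[OF gext2 gM n] by blast
      have "torus_complexify (p g) \<in> W" using * unfolding complex_nbhd_def by blast
      then have "dist (G (torus_complexify (p g))) (F (torus_complexify (p g))) < e" using g by blast
      then have "\<bar>g (p g) - f (p g)\<bar> < e" using g * by (simp add: dist_of_real dist_real_def)
      then show False using eg[OF gn] by simp
    qed
    then show "g \<in> {f. analytic_fun f} - C" using g by blast
  qed
qed blast

lemma analytic_path_uniform_strip:
  assumes H: "continuous_map (top_of_set {0..}) analytic_fun_topology H"
  obtains n where "\<And>t. t \<in> {0..1::real} \<Longrightarrow> H t \<in> ext_ball n"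
proof (rule ccontr)
  assume "\<not> thesis"
  then have "\<forall>n. \<exists>t\<in>{0..1}. H t \<notin> ext_ball n" using that by blast
  then obtain t where t: "\<And>n. t n \<in> {0..1}" "\<And>n. H (t n) \<notin> ext_ball n" by metis
  obtain l \<sigma> where l: "l \<in> {0..1}" "strict_mono \<sigma>" "(t \<circ> \<sigma>) \<longlonglongrightarrow> l"
    using compact_Icc[of 0 "1::real"] t(1) unfolding compact_def by blast
  have an: "analytic_fun (H s)" if "s \<ge> 0" for s
    using continuous_map_image_subset_topspace[OF H] that
    unfolding analytic_fun_topology_def by auto
  then obtain m where m: "H l \<in> ext_ball m" using analytic_fun_ext_ball l(1) by fastforce
  \<comment> \<open>Starting the tail at m excludes \<open>H l\<close>: it lies in
    \<open>ext_ball m\<close>, hence in all later balls, while \<open>H (t n)\<close> avoids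
    \<open>ext_ball n\<close>. All subsequent information about continuity is then read off from the
    single open set \<open>- C\<close>.\<close>
  define C where "C = H ` t ` {m..}"
  have "finite (C \<inter> ext_ball k)" for k
  proof (rule finite_subset)
    show "C \<inter> ext_ball k \<subseteq> H ` t ` {..k}"
    proof
      fix g assume "g \<in> C \<inter> ext_ball k"
      then obtain n where n: "g = H (t n)" "g \<in> ext_ball k" unfolding C_def by blast
      have "n \<le> k"
        using t(2)[of n] n ext_ball_mono[of k n] by (meson in_mono nle_le)
      then show "g \<in> H ` t ` {..k}" using n by blast
    qed
  qed simp
  then have op: "openin analytic_fun_topology ({f. analytic_fun f} - C)"
    by (rule openin_Diff_ext_ball_finite)
  have "H l \<notin> C"
  proof
    assume "H l \<in> C"
    then obtain n where "n \<ge> m" "H l = H (t n)" unfolding C_def by auto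
    then show False using t(2)[of n] m ext_ball_mono[of m n] by auto
  qed
  then have "l \<in> {s \<in> topspace (top_of_set {0..}). H s \<in> {f. analytic_fun f} - C}"
    using an l(1) by auto
  moreover have "openin (top_of_set {0..}) {s \<in> topspace (top_of_set {0..}). H s \<in> {f. analytic_fun f} - C}"
    using H op by (rule openin_continuous_map_preimage)
  ultimately have "\<exists>e>0. \<forall>s\<in>{0..}. dist s l < e \<longrightarrow>
      s \<in> {s \<in> topspace (top_of_set {0..}). H s \<in> {f. analytic_fun f} - C}"
    unfolding openin_euclidean_subtopology_iff by (elim conjE) (drule (1) bspec)
  then obtain e where e: "e > 0"
      "\<And>s. s \<in> {0..} \<Longrightarrow> dist s l < e \<Longrightarrow> H s \<in> {f. analytic_fun f} - C"
    by blast
  have "\<forall>\<^sub>F n in sequentially. dist ((t \<circ> \<sigma>) n) l < e" using l(3) e(1) by (rule tendstoD)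
  then have "\<forall>\<^sub>F n in sequentially. dist ((t \<circ> \<sigma>) n) l < e \<and> n \<ge> m"
    using eventually_ge_at_top[of m] by (rule eventually_conj)
  then obtain n where n: "dist (t (\<sigma> n)) l < e" "n \<ge> m"
    unfolding eventually_sequentially by auto
  have "\<sigma> n \<ge> m" using n(2) seq_suble[OF l(2), of n] by linarith
  then have "H (t (\<sigma> n)) \<in> C" unfolding C_def by blast
  moreover have "t (\<sigma> n) \<in> {0..}" using t(1)[of "\<sigma> n"] by simp
  ultimately show False using e(2) n(1) by blast
qed

text \<open>A real point belongs to every complex neighbourhood, so closeness of extensions forces
  closeness of values there. Together with the common strip, continuity of these values is all that
  is later used of the dependence on t.\<close>

lemma analytic_path_eval_continuous:
  assumes H: "continuous_map (top_of_set {0..}) analytic_fun_topology H"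
  shows "continuous_on {0..} (\<lambda>t. H t x)"
proof -
  have ev: "continuous_map analytic_fun_topology euclideanreal (\<lambda>f. f x)"
    unfolding continuous_map_def
  proof (intro conjI allI impI)
    fix U :: "real set" assume "openin euclidean U"
    then have U: "open U" by simp
    show "openin analytic_fun_topology {f \<in> topspace analytic_fun_topology. f x \<in> U}"
      unfolding analytic_fun_topology_def openin_inductive_limit_topology topspace_inductive_limit_topology
    proof (intro conjI allI impI)
      fix W F f
      assume *: "complex_nbhd W \<and> torus_holo_fun W F \<and> f \<in> {f \<in> {f. analytic_fun f}. f x \<in> U} \<and>
        (\<forall>x. F (torus_complexify x) = complex_of_real (f x))"
      then obtain e where e: "e > 0" "\<And>y. dist y (f x) < e \<Longrightarrow> y \<in> U"
        using U unfolding open_dist by blast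
      show "\<exists>\<epsilon>>0. \<forall>G g. torus_holo_fun W G \<and> g \<in> {f. analytic_fun f} \<and>
          (\<forall>x. G (torus_complexify x) = complex_of_real (g x)) \<and> (\<forall>z\<in>W. dist (G z) (F z) < \<epsilon>) \<longrightarrow>
          g \<in> {f \<in> {f. analytic_fun f}. f x \<in> U}"
      proof (intro exI[of _ e] conjI allI impI e(1))
        fix G g
        assume g: "torus_holo_fun W G \<and> g \<in> {f. analytic_fun f} \<and>
          (\<forall>x. G (torus_complexify x) = complex_of_real (g x)) \<and> (\<forall>z\<in>W. dist (G z) (F z) < e)"
        have "torus_complexify x \<in> W" using * unfolding complex_nbhd_def by blast
        then have "dist (G (torus_complexify x)) (F (torus_complexify x)) < e" using g by blast
        then have "dist (g x) (f x) < e" using g * by (simp add: dist_of_real)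
        then show "g \<in> {f \<in> {f. analytic_fun f}. f x \<in> U}" using e(2) g by blast
      qed
    qed blast
  qed simp
  have "continuous_map (top_of_set {0..}) euclideanreal ((\<lambda>f. f x) \<circ> H)"
    using H ev by (rule continuous_map_compose)
  then show ?thesis by (simp add: o_def continuous_map_iff_continuous)
qed

section \<open>Hamiltonian vector fields\<close>

definition cham :: "(complex ^ ('n + 'n) \<Rightarrow> complex) \<Rightarrow> complex ^ ('n::finite + 'n) \<Rightarrow> complex ^ ('n + 'n)" where
  "cham F z = (\<chi> k. case k of Inl i \<Rightarrow> cpart (Inr i) F z | Inr i \<Rightarrow> - cpart (Inl i) F z)"

lemma norm_cham_diff_le:
  fixes z w :: "complex ^ ('n::finite + 'n)"
  assumes "\<And>k. norm (cpart k F z - cpart k G w) \<le> B"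
  shows "norm (cham F z - cham G w) \<le> real CARD('n + 'n) * B"
proof (rule norm_cart_le_card)
  fix k :: "'n + 'n"
  show "norm ((cham F z - cham G w) $ k) \<le> B"
  proof (cases k)
    case (Inl i)
    then show ?thesis using assms[of "Inr i"] by (simp add: cham_def)
  next
    case (Inr i)
    then show ?thesis using assms[of "Inl i"] by (simp add: cham_def norm_minus_commute)
  qed
qed

lemma cpart_const [simp]: "cpart k (\<lambda>_. c) z = 0"
  by (simp add: cpart_def)

lemma cham_zero [simp]: "cham (\<lambda>_. c) z = 0"
  by (simp add: cham_def vec_eq_iff split: sum.split)

lemma cpart_diff:
  "holo_on F U \<Longrightarrow> holo_on G U \<Longrightarrow> z \<in> U \<Longrightarrow> cpart k (\<lambda>z. F z - G z) z = cpart k F z - cpart k G z"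
  unfolding cpart_def[of _ "\<lambda>z. F z - G z"]
  by (intro DERIV_imp_deriv DERIV_diff) (auto intro: cpart_DERIV)

lemma cpart_add:
  "holo_on F U \<Longrightarrow> holo_on G U \<Longrightarrow> z \<in> U \<Longrightarrow> cpart k (\<lambda>z. F z + G z) z = cpart k F z + cpart k G z"
  unfolding cpart_def[of _ "\<lambda>z. F z + G z"]
  by (intro DERIV_imp_deriv DERIV_add) (auto intro: cpart_DERIV)

lemma cpart_cmult:
  "holo_on F U \<Longrightarrow> z \<in> U \<Longrightarrow> cpart k (\<lambda>z. c * F z) z = c * cpart k F z"
  unfolding cpart_def[of _ "\<lambda>z. c * F z"]
  by (intro DERIV_imp_deriv DERIV_cmult) (auto intro: cpart_DERIV)

lemma cham_add:
  "holo_on F U \<Longrightarrow> holo_on G U \<Longrightarrow> z \<in> U \<Longrightarrow> cham (\<lambda>z. F z + G z) z = cham F z + cham G z"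
  by (auto simp: cham_def vec_eq_iff cpart_add[of F U G] split: sum.split)

lemma cham_cmult: "holo_on F U \<Longrightarrow> z \<in> U \<Longrightarrow> cham (\<lambda>z. c * F z) z = c *s cham F z"
  by (auto simp: cham_def vec_eq_iff cpart_cmult[of F U] split: sum.split)

text \<open>Uniform closeness of Hamiltonians passes to their vector fields at the price of a width
  s; every approximation below is therefore made at the level of Hamiltonians.\<close>

lemma cham_diff_bound:
  fixes z :: "complex ^ ('n::finite + 'n)"
  assumes holo: "holo_on F (strip r)" "holo_on G (strip r)"
    and bd: "\<And>z. z \<in> strip r \<Longrightarrow> norm (F z - G z) \<le> M"
    and s: "0 < s" and z: "z \<in> strip (r - s)"
  shows "norm (cham F z - cham G z) \<le> real CARD('n + 'n) * (M / s)"
proof (rule norm_cham_diff_le)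
  fix k
  have "z \<in> strip r" using z by (rule strip_mono') (use s in simp)
  then have "cpart k F z - cpart k G z = cpart k (\<lambda>z. F z - G z) z"
    using holo by (simp add: cpart_diff[of F "strip r" G])
  then show "norm (cpart k F z - cpart k G z) \<le> M / s"
    using cpart_bound[OF holo_on_diff[OF holo] bd s z, of k] by simp
qed

lemma cham_bound:
  fixes z :: "complex ^ ('n::finite + 'n)"
  assumes "holo_on F (strip r)" "\<And>z. z \<in> strip r \<Longrightarrow> norm (F z) \<le> M" "0 < s" "z \<in> strip (r - s)"
  shows "norm (cham F z) \<le> real CARD('n + 'n) * (M / s)"
  using cham_diff_bound[of F r "\<lambda>_. 0" M s z] assms by (simp add: holo_on_const)

lemma cham_lipschitz:
  fixes z w :: "complex ^ ('n::finite + 'n)"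
  assumes "holo_on F (strip r)" "\<And>z. z \<in> strip r \<Longrightarrow> norm (F z) \<le> M" "0 < s"
    "z \<in> strip (r - 2 * s)" "w \<in> strip (r - 2 * s)"
  shows "norm (cham F z - cham F w) \<le> real CARD('n + 'n) * (M / s\<^sup>2) * norm (z - w)"
proof -
  have "norm (cham F z - cham F w) \<le> real CARD('n + 'n) * (M / s\<^sup>2 * norm (z - w))"
    by (rule norm_cham_diff_le) (rule cpart_lipschitz[OF assms])
  then show ?thesis by (simp add: mult.assoc)
qed

lemma torus_partial_eq_cpart:
  assumes ext: "strip_ext r F f" and r: "r > 0"
  shows "complex_of_real (torus_partial k f (to_torus x)) = cpart k F (cvec x)"
    and "((\<lambda>h. f (to_torus x + to_torus (axis k h))) has_real_derivative
          torus_partial k f (to_torus x)) (at 0)"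
proof -
  have cv: "cvec x + axis k (complex_of_real h) = cvec (x + axis k h)" for h
    by (simp add: vec_eq_iff axis_def)
  have eq: "F (cvec x + axis k (complex_of_real h)) = complex_of_real (f (to_torus x + to_torus (axis k h)))" for h
    unfolding cv strip_extD(3)[OF ext] to_torus_add ..
  have "((\<lambda>\<zeta>. F (cvec x + axis k \<zeta>)) has_field_derivative cpart k F (cvec x)) (at (complex_of_real 0))"
    using cpart_DERIV[OF strip_extD(1)[OF ext]] r by simp
  then have d: "((\<lambda>h. complex_of_real (f (to_torus x + to_torus (axis k h)))) has_vector_derivative
      cpart k F (cvec x)) (at 0)"
    unfolding eq[symmetric] by (rule has_vector_derivative_real_field)
  have re: "((\<lambda>h. f (to_torus x + to_torus (axis k h))) has_real_derivative Re (cpart k F (cvec x))) (at 0)"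
    using bounded_linear.has_vector_derivative[OF bounded_linear_Re d]
    by (simp add: has_real_derivative_iff_has_vector_derivative)
  have "((\<lambda>h. 0) has_real_derivative Im (cpart k F (cvec x))) (at (0::real))"
    using bounded_linear.has_vector_derivative[OF bounded_linear_Im d]
    by (simp add: has_real_derivative_iff_has_vector_derivative)
  \<comment> \<open>The function is real on real points, so the imaginary part of the extension is
    constant along the real direction.\<close>
  then have im: "Im (cpart k F (cvec x)) = 0" using DERIV_const DERIV_unique by blast
  have tp: "torus_partial k f (to_torus x) = Re (cpart k F (cvec x))"
    unfolding torus_partial_def by (rule DERIV_imp_deriv[OF re])
  show "complex_of_real (torus_partial k f (to_torus x)) = cpart k F (cvec x)"
    using im tp by (simp add: complex_eq_iff)
  show "((\<lambda>h. f (to_torus x + to_torus (axis k h))) has_real_derivative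
          torus_partial k f (to_torus x)) (at 0)" using re tp by simp
qed

lemma cvec_ham_vf:
  assumes "strip_ext r F f" "r > 0"
  shows "cvec (ham_vf f (to_torus x)) = cham F (cvec x)"
  by (auto simp: vec_eq_iff ham_vf_def cham_def torus_partial_eq_cpart(1)[OF assms] split: sum.split)

section \<open>Trigonometric interpolation in one variable\<close>

definition cexp :: "complex \<Rightarrow> complex" where
  "cexp u = exp (2 * of_real pi * \<i> * u)"

lemma cexp_add: "cexp (u + v) = cexp u * cexp v"
  by (simp add: cexp_def distrib_left exp_add)

lemma cexp_0 [simp]: "cexp 0 = 1"
  by (simp add: cexp_def)

lemma cexp_nonzero [simp]: "cexp u \<noteq> 0"
  by (simp add: cexp_def)

lemma cexp_minus: "cexp (- u) = inverse (cexp u)"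
  by (simp add: cexp_def exp_minus)

lemma cexp_of_int [simp]: "cexp (of_int n) = 1"
  unfolding cexp_def exp_eq_1 by (auto intro!: exI[of _ n])

lemma cexp_eq_1_iff: "cexp u = 1 \<longleftrightarrow> u \<in> \<int>"
proof
  assume "cexp u = 1"
  then obtain n :: int where "Im u = 0" "2 * pi * Re u = of_int (2 * n) * pi"
    unfolding cexp_def exp_eq_1 by auto
  then have "u = of_int n" by (simp add: complex_eq_iff)
  then show "u \<in> \<int>" by simp
qed (auto elim!: Ints_cases)

lemma cexp_power: "cexp u ^ n = cexp (of_nat n * u)"
  by (simp add: cexp_def exp_of_nat_mult[symmetric] algebra_simps)

lemma norm_cexp: "norm (cexp u) = exp (- 2 * pi * Im u)"
  by (simp add: cexp_def norm_exp_eq_Re)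

lemma norm_cexp_le: "y \<le> Im u \<Longrightarrow> norm (cexp u) \<le> exp (- 2 * pi * y)"
  unfolding norm_cexp by simp

lemma DERIV_cexp_scaled:
  "((\<lambda>w. cexp (c * w + d)) has_field_derivative 2 * of_real pi * \<i> * c * cexp (c * w + d)) (at w within S)"
  unfolding cexp_def by (auto intro!: derivative_eq_intros)

lemma horizontal_has_vector_derivative:
  fixes c :: complex
  assumes "(G has_field_derivative D) (at (of_real t + c))"
  shows "((\<lambda>t. G (of_real t + c)) has_vector_derivative D) (at t within S)"
proof -
  have "((\<lambda>t. of_real t + c :: complex) has_vector_derivative 1) (at t within S)"
    by (auto intro!: derivative_eq_intros)
  from field_vector_diff_chain_within[OF this, of G D] assms
  show ?thesis by (simp add: o_def has_field_derivative_at_within)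
qed

lemma integral_cexp_period:
  assumes "n \<noteq> 0"
  shows "((\<lambda>t. cexp (of_int n * (of_real t + c))) has_integral 0) {0..1}"
proof -
  let ?a = "2 * of_real pi * \<i> * of_int n :: complex"
  have a: "?a \<noteq> 0" using assms by simp
  let ?G = "\<lambda>w. cexp (of_int n * w + 0) / ?a"
  have D: "(?G has_field_derivative cexp (of_int n * w + 0)) (at w)" for w
    using DERIV_cdivide[OF DERIV_cexp_scaled[of "of_int n" 0 w UNIV], of ?a] a by simp
  have "((\<lambda>t. cexp (of_int n * (of_real t + c) + 0)) has_integral
      ?G (of_real 1 + c) - ?G (of_real 0 + c)) {0..1}"
  proof (rule fundamental_theorem_of_calculus)
    fix t :: real
    show "((\<lambda>t. ?G (of_real t + c)) has_vector_derivative cexp (of_int n * (of_real t + c) + 0))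
      (at t within {0..1})"
      by (rule horizontal_has_vector_derivative) (rule D)
  qed simp
  moreover have "?G (of_real 1 + c) = ?G (of_real 0 + c)"
    by (simp add: distrib_left cexp_add)
  ultimately show ?thesis by (simp only: add_0_right diff_self)
qed

text \<open>Remainder of a geometric series truncated after degree r, multiplied by a bounded
  factor.\<close>

lemma geometric_remainder_norm:
  fixes \<xi> :: complex
  assumes "norm \<xi> \<le> \<kappa>" "\<kappa> < 1" "norm a \<le> A"
  shows "norm (a * \<xi> ^ Suc r / (1 - \<xi>)) \<le> A * (\<kappa> ^ Suc r / (1 - \<kappa>))"
proof -
  have "1 - \<kappa> \<le> norm (1 - \<xi>)"
    using norm_triangle_ineq2[of 1 \<xi>] assms(1) by simp
  moreover have "norm \<xi> ^ Suc r \<le> \<kappa> ^ Suc r" using assms(1) by (intro power_mono) auto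
  moreover have "0 \<le> \<kappa>" "0 \<le> A" using assms norm_ge_zero order_trans by metis+
  ultimately have "norm a * (norm \<xi> ^ Suc r / norm (1 - \<xi>)) \<le> A * (\<kappa> ^ Suc r / (1 - \<kappa>))"
    using assms(2,3) by (intro mult_mono frac_le) auto
  then show ?thesis by (simp only: norm_divide norm_mult norm_power times_divide_eq_right)
qed

text \<open>The quotient \<open>(f w - f z) / (cexp (w - z) - 1)\<close> is holomorphic and periodic, so its
  integrals over the two horizontal sides of the period rectangle agree; expanding the
  denominator as a geometric series on each side gives the truncated Laurent expansion of \<open>f\<close>.\<close>

lemma periodic_quotient_integrals:
  assumes holo: "f holomorphic_on {w. \<bar>Im w\<bar> < \<rho>}" and per: "\<And>w. f (w + 1) = f w"
    and \<sigma>: "0 < \<sigma>" "\<sigma> < \<rho>" and z: "0 < Re z" "Re z < 1" "\<bar>Im z\<bar> < \<sigma>"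
  obtains I where
    "\<And>y. \<bar>y\<bar> = \<sigma> \<Longrightarrow> ((\<lambda>t. (f (of_real t + \<i> * of_real y) - f z) /
       (cexp (of_real t + \<i> * of_real y - z) - 1)) has_integral I) {0..1}"
proof -
  \<comment> \<open>The window of half-width 1 around Re z contains the period rectangle, because 0
    < Re z < 1, but neither z + 1 nor z - 1; so z is the only zero of the denominator in it.\<close>
  let ?S = "{w. \<bar>Im w\<bar> < \<rho> \<and> \<bar>Re w - Re z\<bar> < 1}"
  have S_eq: "?S = {w. Im w < \<rho>} \<inter> {w. Im w > -\<rho>} \<inter> {w. Re w < Re z + 1} \<inter> {w. Re w > Re z - 1}"
    by auto
  have S: "open ?S" "convex ?S"
    unfolding S_eq
    by (intro open_Int open_halfspace_Im_lt open_halfspace_Im_gt open_halfspace_Re_lt open_halfspace_Re_gt)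
      (intro convex_Int convex_halfspace_Im_lt convex_halfspace_Im_gt convex_halfspace_Re_lt convex_halfspace_Re_gt)
  let ?e = "\<lambda>w. cexp (1 * w + (- z))"
  \<comment> \<open>Numerator and denominator are both divided by w - z and completed at z by their
    derivatives. This removes the common zero, and the derivative of the exponential at z is
    nonzero.\<close>
  let ?h = "\<lambda>w. if w = z then deriv f z else (f w - f z) / (w - z)"
  let ?E = "\<lambda>w. if w = z then deriv ?e z else (?e w - ?e z) / (w - z)"
  define g where "g = (\<lambda>w. ?h w / ?E w)"
  have hS: "?h holomorphic_on ?S"
    by (rule pole_lemma_open[OF _ S(1)]) (rule holomorphic_on_subset[OF holo], auto)
  have eh: "?e holomorphic_on ?S"
    unfolding holomorphic_on_def field_differentiable_def using DERIV_cexp_scaled by blast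
  have ES: "?E holomorphic_on ?S" by (rule pole_lemma_open[OF eh S(1)])
  have e1: "?e w \<noteq> 1" if "w \<in> ?S" "w \<noteq> z" for w
  proof
    assume "?e w = 1"
    then obtain n where n: "w - z = of_int n" by (auto simp: cexp_eq_1_iff elim!: Ints_cases)
    have "\<bar>Re (w - z)\<bar> < 1" using that(1) by simp
    then have "n = 0" unfolding n by simp
    then show False using n that(2) by simp
  qed
  have "deriv ?e z = 2 * of_real pi * \<i> * 1 * ?e z" by (rule DERIV_imp_deriv[OF DERIV_cexp_scaled])
  then have dz: "deriv ?e z = 2 * of_real pi * \<i>" by simp
  have E0: "?E w \<noteq> 0" if "w \<in> ?S" for w
  proof (cases "w = z")
    case True
    then show ?thesis unfolding dz by simp
  next
    case False
    then show ?thesis using e1[OF that False] by simp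
  qed
  have gh: "g holomorphic_on ?S" unfolding g_def by (rule holomorphic_on_divide[OF hS ES E0])
  have "\<exists>G. \<forall>x\<in>?S. (G has_field_derivative g x) (at x within ?S)"
    by (rule holomorphic_convex_primitive'[OF S(2,1) gh]) blast
  then obtain G where G0: "\<forall>x\<in>?S. (G has_field_derivative g x) (at x within ?S)" ..
  have G: "(G has_field_derivative g x) (at x)" if "x \<in> ?S" for x
    using G0[rule_format, OF that] at_within_open[OF that S(1)] by simp
  have g_eq: "g w = (f w - f z) / (cexp (w - z) - 1)" if "w \<noteq> z" for w
    using that by (simp add: g_def)
  have inS: "of_real t + \<i> * of_real y \<in> ?S" if "\<bar>y\<bar> \<le> \<sigma>" "t \<in> {0..1}" for t y
    using that \<sigma> z by auto
  let ?J = "\<lambda>y. G (1 + \<i> * of_real y) - G (0 + \<i> * of_real y)"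
  have J: "((\<lambda>t. g (of_real t + \<i> * of_real y)) has_integral ?J y) {0..1}" if "\<bar>y\<bar> \<le> \<sigma>" for y
  proof -
    have "((\<lambda>t. g (of_real t + \<i> * of_real y)) has_integral
        G (of_real 1 + \<i> * of_real y) - G (of_real 0 + \<i> * of_real y)) {0..1}"
      by (rule fundamental_theorem_of_calculus)
        (simp, intro horizontal_has_vector_derivative G inS that)
    then show ?thesis by simp
  qed
  \<comment> \<open>The derivative in y of the integral over a horizontal side is i times the
    difference of g at its two end points, which vanishes by periodicity.\<close>
  have "?J y = ?J (-\<sigma>)" if "y \<in> {-\<sigma>..\<sigma>}" for y
  proof (rule has_derivative_zero_unique[of "{-\<sigma>..\<sigma>}" ?J])
    show "convex {-\<sigma>..\<sigma>}" by simp
    show "y \<in> {-\<sigma>..\<sigma>}" by (rule that)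
    show "- \<sigma> \<in> {-\<sigma>..\<sigma>}" using \<sigma> by simp
    fix y assume y: "y \<in> {-\<sigma>..\<sigma>}"
    have v: "((\<lambda>y. c + \<i> * of_real y) has_vector_derivative \<i>) (at y within {-\<sigma>..\<sigma>})" for c
      by (auto intro!: derivative_eq_intros)
    have GG: "((\<lambda>y. G (c + \<i> * of_real y)) has_vector_derivative \<i> * g (c + \<i> * of_real y)) (at y within {-\<sigma>..\<sigma>})"
      if "c + \<i> * of_real y \<in> ?S" for c
      using field_vector_diff_chain_within[OF v[of c] has_field_derivative_at_within[OF G[OF that]]]
      by (simp add: o_def)
    have "1 + \<i> * of_real y \<in> ?S" "0 + \<i> * of_real y \<in> ?S" using inS[of y 1] inS[of y 0] y by auto
    then have d: "(?J has_vector_derivative (\<i> * g (1 + \<i> * of_real y) - \<i> * g (0 + \<i> * of_real y))) (at y within {-\<sigma>..\<sigma>})"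
      by (intro has_vector_derivative_diff GG)
    have nz: "1 + \<i> * of_real y \<noteq> z" "0 + \<i> * of_real y \<noteq> z" using z by (auto simp: complex_eq_iff)
    have "cexp (1 + \<i> * of_real y - z) = cexp (\<i> * of_real y - z)"
      using cexp_add[of "of_int 1" "\<i> * of_real y - z"] cexp_of_int[of 1] by (simp add: algebra_simps)
    moreover have "f (1 + \<i> * of_real y) = f (\<i> * of_real y)" using per[of "\<i> * of_real y"] by (simp add: add.commute)
    ultimately have "g (1 + \<i> * of_real y) = g (0 + \<i> * of_real y)"
      unfolding g_eq[OF nz(1)] g_eq[OF nz(2)] by simp
    then show "(?J has_derivative (\<lambda>h. 0)) (at y within {-\<sigma>..\<sigma>})"
      using d by (simp add: has_vector_derivative_def)
  qed
  note Jc = this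
  have "?J y = ?J (-\<sigma>)" if "\<bar>y\<bar> = \<sigma>" for y
    by (rule Jc) (use that in \<open>auto simp: abs_if split: if_splits\<close>)
  then have *: "((\<lambda>t. g (of_real t + \<i> * of_real y)) has_integral ?J (-\<sigma>)) {0..1}" if "\<bar>y\<bar> = \<sigma>" for y
    using J[of y] that by auto
  show ?thesis
  proof (rule that[of "?J (-\<sigma>)"])
    fix y assume y: "\<bar>y\<bar> = \<sigma>"
    then have nz: "of_real t + \<i> * of_real y \<noteq> z" for t using z(3) by (auto simp: complex_eq_iff)
    show "((\<lambda>t. (f (of_real t + \<i> * of_real y) - f z) /
       (cexp (of_real t + \<i> * of_real y - z) - 1)) has_integral ?J (-\<sigma>)) {0..1}"
      using *[OF y] unfolding g_eq[OF nz] .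
  qed
qed

text \<open>On the lower side 1 / (cexp (w - z) - 1) expands into positive powers of cexp (z - w),
  on the upper side into nonnegative powers of cexp (w - z) with a minus sign. The contribution of f
  z integrates to 0 except for the constant term on the upper side, which yields f z itself. The
  factor 4 is 2 for the two sides times 2 from \<open>norm (f w - f z) \<le> 2 * M\<close>.\<close>

lemma laurent_truncation_aux:
  assumes holo: "f holomorphic_on {w. \<bar>Im w\<bar> < \<rho>}" and per: "\<And>w. f (w + 1) = f w"
    and bd: "\<And>w. \<bar>Im w\<bar> < \<rho> \<Longrightarrow> norm (f w) \<le> M"
    and \<sigma>: "0 < \<sigma>" "\<sigma> < \<rho>"
  obtains A B where "\<And>z. 0 < Re z \<Longrightarrow> Re z < 1 \<Longrightarrow> \<bar>Im z\<bar> < \<sigma> \<Longrightarrow>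
    norm (f z - ((\<Sum>m=1..r. B m * cexp (of_int (int m) * z)) + (\<Sum>m\<le>r. A m * cexp (of_int (- int m) * z))))
      \<le> 4 * M * (exp (- 2 * pi * (\<sigma> - \<bar>Im z\<bar>)) ^ Suc r / (1 - exp (- 2 * pi * (\<sigma> - \<bar>Im z\<bar>))))"
proof -
  let ?b = "\<lambda>t. complex_of_real t + \<i> * of_real (-\<sigma>)"
  let ?t = "\<lambda>t. complex_of_real t + \<i> * of_real \<sigma>"
  define B where "B m = integral {0..1} (\<lambda>t. f (?b t) * cexp (of_int (- int m) * ?b t))" for m
  define A where "A m = integral {0..1} (\<lambda>t. f (?t t) * cexp (of_int (int m) * ?t t))" for m
  have cf: "continuous_on {0..1} (\<lambda>t. f (complex_of_real t + \<i> * of_real y))" if "\<bar>y\<bar> = \<sigma>" for y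
    by (rule continuous_on_compose2[OF holomorphic_on_imp_continuous_on[OF holo]])
      (use that \<sigma> in \<open>auto intro!: continuous_intros\<close>)
  have ce: "continuous_on {0..1} (\<lambda>t. cexp (c * (complex_of_real t + d)))" for c d
    unfolding cexp_def by (intro continuous_intros)
  have Bi: "((\<lambda>t. f (?b t) * cexp (of_int (- int m) * ?b t)) has_integral B m) {0..1}" for m
    unfolding B_def by (intro integrable_integral integrable_continuous_interval continuous_on_mult cf ce)
      (use \<sigma> in simp)
  have Ai: "((\<lambda>t. f (?t t) * cexp (of_int (int m) * ?t t)) has_integral A m) {0..1}" for m
    unfolding A_def by (intro integrable_integral integrable_continuous_interval continuous_on_mult cf ce)
      (use \<sigma> in simp)
  show ?thesis
  proof (rule that[of B A])
    fix z :: complex assume z: "0 < Re z" "Re z < 1" "\<bar>Im z\<bar> < \<sigma>"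
    let ?\<kappa> = "exp (- 2 * pi * (\<sigma> - \<bar>Im z\<bar>))"
    let ?R = "2 * M * (?\<kappa> ^ Suc r / (1 - ?\<kappa>))"
    have k1: "?\<kappa> < 1" using z(3) by simp
    have "norm (f 0) \<le> M" using \<sigma> by (intro bd) simp
    then have M0: "0 \<le> M" by (rule order_trans[OF norm_ge_zero])
    have fz: "norm (f z) \<le> M" using z \<sigma> by (intro bd) auto
    have fd: "norm (f w - f z) \<le> 2 * M" if "\<bar>Im w\<bar> = \<sigma>" for w
      using norm_triangle_ineq4[of "f w" "f z"] fz bd[of w] that \<sigma> by simp
    obtain I where I: "\<And>y. \<bar>y\<bar> = \<sigma> \<Longrightarrow> ((\<lambda>t. (f (of_real t + \<i> * of_real y) - f z) /
       (cexp (of_real t + \<i> * of_real y - z) - 1)) has_integral I) {0..1}"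
      using periodic_quotient_integrals[OF holo per \<sigma> z] by blast
    have R0: "0 \<le> ?R" using M0 k1 by simp
    let ?PB = "\<Sum>m=1..r. B m * cexp (of_int (int m) * z)"
    let ?PA = "\<Sum>m\<le>r. A m * cexp (of_int (- int m) * z)"
    \<comment> \<open>The summands with factor 0 are the period integrals of the terms containing f
      z; they are kept unsimplified so that they match the integrand term by term.\<close>
    have "norm (I - (?PB - (\<Sum>m=1..r. 0 * (f z * cexp (of_int (int m) * z))))) \<le> ?R * measure lborel (cbox 0 (1::real))"
    proof (rule has_integral_bound[OF R0])
      show "((\<lambda>t. (f (?b t) - f z) / (cexp (?b t - z) - 1) -
          ((\<Sum>m=1..r. f (?b t) * cexp (of_int (- int m) * ?b t) * cexp (of_int (int m) * z)) -
          (\<Sum>m=1..r. cexp (of_int (- int m) * ?b t) * (f z * cexp (of_int (int m) * z))))) has_integral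
          (I - (?PB - (\<Sum>m=1..r. 0 * (f z * cexp (of_int (int m) * z)))))) (cbox 0 1)"
        unfolding cbox_interval
        by (intro has_integral_diff has_integral_sum finite_atLeastAtMost has_integral_mult_left Bi
             integral_cexp_period I) (use \<sigma> in auto)
      fix t :: real
      define \<xi> where "\<xi> = cexp (z - ?b t)"
      have n\<xi>: "norm \<xi> \<le> ?\<kappa>" unfolding \<xi>_def by (rule norm_cexp_le) simp
      then have "\<xi> \<noteq> 1" using k1 by auto
      have pw: "cexp (of_int (- int m) * ?b t) * cexp (of_int (int m) * z) = \<xi> ^ m" for m
        unfolding \<xi>_def cexp_power cexp_add[symmetric] by (simp add: algebra_simps)
      have inv: "cexp (?b t - z) = inverse \<xi>"
        unfolding \<xi>_def cexp_minus[symmetric] by simp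
      have "\<xi> \<noteq> 0" by (simp add: \<xi>_def)
      have gs: "(\<Sum>m=1..r. \<xi> ^ m) = (1 - \<xi> ^ Suc r) / (1 - \<xi>) - 1"
      proof -
        have "(\<Sum>m\<le>r. \<xi> ^ m) = (\<Sum>m=1..r. \<xi> ^ m) + 1"
          by (simp add: atMost_atLeast0 sum.atLeast_Suc_atMost)
        then show ?thesis using \<open>\<xi> \<noteq> 1\<close> by (simp add: sum_gp0)
      qed
      have "(f (?b t) - f z) / (cexp (?b t - z) - 1) -
          ((\<Sum>m=1..r. f (?b t) * cexp (of_int (- int m) * ?b t) * cexp (of_int (int m) * z)) -
          (\<Sum>m=1..r. cexp (of_int (- int m) * ?b t) * (f z * cexp (of_int (int m) * z))))
        = (f (?b t) - f z) * (1 / (inverse \<xi> - 1) - (\<Sum>m=1..r. \<xi> ^ m))"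
        unfolding inv by (simp add: pw[symmetric] sum_distrib_left sum_distrib_right sum_subtractf algebra_simps diff_divide_distrib)
      also have "1 / (inverse \<xi> - 1) - (\<Sum>m=1..r. \<xi> ^ m) = \<xi> ^ Suc r / (1 - \<xi>)"
      proof -
        have u: "1 - \<xi> \<noteq> 0" using \<open>\<xi> \<noteq> 1\<close> by simp
        have "1 / (inverse \<xi> - 1) = \<xi> / (1 - \<xi>)" using \<open>\<xi> \<noteq> 0\<close> u by (simp add: field_simps)
        moreover have "x / (1 - \<xi>) - (y / (1 - \<xi>) - 1) = (x - y + (1 - \<xi>)) / (1 - \<xi>)" for x y
          using u by (simp add: diff_divide_distrib add_divide_distrib)
        ultimately show ?thesis unfolding gs by simp
      qed
      also have "(f (?b t) - f z) * (\<xi> ^ Suc r / (1 - \<xi>)) = (f (?b t) - f z) * \<xi> ^ Suc r / (1 - \<xi>)" by simp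
      finally show "norm ((f (?b t) - f z) / (cexp (?b t - z) - 1) -
          ((\<Sum>m=1..r. f (?b t) * cexp (of_int (- int m) * ?b t) * cexp (of_int (int m) * z)) -
          (\<Sum>m=1..r. cexp (of_int (- int m) * ?b t) * (f z * cexp (of_int (int m) * z))))) \<le> ?R"
        using geometric_remainder_norm[OF n\<xi> k1 fd[of "?b t"], of r] \<sigma> by simp
    qed
    then have b: "norm (I - ?PB) \<le> ?R" by simp
    have "norm (I - (f z + (\<Sum>m=1..r. 0 * (f z * cexp (of_int (- int m) * z))) - ?PA)) \<le> ?R * measure lborel (cbox 0 (1::real))"
    proof (rule has_integral_bound[OF R0])
      have fz': "((\<lambda>t. f z) has_integral f z) {0..1::real}"
        using has_integral_const_real[of "f z" 0 1] by simp
      show "((\<lambda>t. (f (?t t) - f z) / (cexp (?t t - z) - 1) -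
          (f z + (\<Sum>m=1..r. cexp (of_int (int m) * ?t t) * (f z * cexp (of_int (- int m) * z))) -
          (\<Sum>m\<le>r. f (?t t) * cexp (of_int (int m) * ?t t) * cexp (of_int (- int m) * z)))) has_integral
          (I - (f z + (\<Sum>m=1..r. 0 * (f z * cexp (of_int (- int m) * z))) - ?PA))) (cbox 0 1)"
        unfolding cbox_interval
        by (intro has_integral_diff has_integral_add fz' has_integral_sum finite_atLeastAtMost finite_atMost
             has_integral_mult_left Ai integral_cexp_period I) (use \<sigma> in auto)
      fix t :: real
      define \<xi> where "\<xi> = cexp (?t t - z)"
      have n\<xi>: "norm \<xi> \<le> ?\<kappa>" unfolding \<xi>_def by (rule norm_cexp_le) simp
      then have "\<xi> \<noteq> 1" using k1 by auto
      have pw: "cexp (of_int (int m) * ?t t) * cexp (of_int (- int m) * z) = \<xi> ^ m" for m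
        unfolding \<xi>_def cexp_power cexp_add[symmetric] by (simp add: algebra_simps)
      have gs: "(\<Sum>m\<le>r. \<xi> ^ m) = (1 - \<xi> ^ Suc r) / (1 - \<xi>)"
        using \<open>\<xi> \<noteq> 1\<close> by (simp add: sum_gp0)
      have s1: "1 + (\<Sum>m=1..r. \<xi> ^ m) = (\<Sum>m\<le>r. \<xi> ^ m)"
        by (simp add: atMost_atLeast0 sum.atLeast_Suc_atMost)
      have "(f (?t t) - f z) / (\<xi> - 1) -
          (f z + (\<Sum>m=1..r. cexp (of_int (int m) * ?t t) * (f z * cexp (of_int (- int m) * z))) -
          (\<Sum>m\<le>r. f (?t t) * cexp (of_int (int m) * ?t t) * cexp (of_int (- int m) * z)))
        = (f (?t t) - f z) / (\<xi> - 1) - (f z * (1 + (\<Sum>m=1..r. \<xi> ^ m)) - f (?t t) * (\<Sum>m\<le>r. \<xi> ^ m))"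
        by (simp add: pw[symmetric] sum_distrib_left algebra_simps)
      also have "\<dots> = (f (?t t) - f z) * (1 / (\<xi> - 1) + (\<Sum>m\<le>r. \<xi> ^ m))"
        unfolding s1 by (simp add: algebra_simps diff_divide_distrib)
      also have "1 / (\<xi> - 1) + (\<Sum>m\<le>r. \<xi> ^ m) = - (\<xi> ^ Suc r / (1 - \<xi>))"
      proof -
        have "1 / (\<xi> - 1) = - (1 / (1 - \<xi>))" by (metis minus_diff_eq minus_divide_right)
        then show ?thesis unfolding gs by (simp add: diff_divide_distrib)
      qed
      finally show "norm ((f (?t t) - f z) / (cexp (?t t - z) - 1) -
          (f z + (\<Sum>m=1..r. cexp (of_int (int m) * ?t t) * (f z * cexp (of_int (- int m) * z))) -
          (\<Sum>m\<le>r. f (?t t) * cexp (of_int (int m) * ?t t) * cexp (of_int (- int m) * z)))) \<le> ?R"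
        using geometric_remainder_norm[OF n\<xi> k1 fd[of "?t t"], of r] \<sigma> by (simp add: \<xi>_def[symmetric])
    qed
    then have t: "norm (I - (f z - ?PA)) \<le> ?R" by simp
    \<comment> \<open>The common value I of the two side integrals is eliminated.\<close>
    have "f z - (?PB + ?PA) = (I - ?PB) - (I - (f z - ?PA))" by simp
    then have "norm (f z - (?PB + ?PA)) \<le> norm (I - ?PB) + norm (I - (f z - ?PA))"
      using norm_triangle_ineq4[of "I - ?PB" "I - (f z - ?PA)"] by (simp only:)
    then have "norm (f z - (?PB + ?PA)) \<le> ?R + ?R"
      using b t by linarith
    then show "norm (f z - (?PB + ?PA)) \<le> 4 * M * (?\<kappa> ^ Suc r / (1 - ?\<kappa>))"
      by (simp only: mult_2[symmetric] mult.assoc[symmetric])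
  qed
qed

text \<open>The remaining points are those with integral real part, excluded before because there
  the singularity lies on a vertical side. Both sides of the estimate are invariant under integer
  translation and the bound depends on Im z alone, so a limit from the right settles them.\<close>

lemma laurent_truncation:
  assumes holo: "f holomorphic_on {w. \<bar>Im w\<bar> < \<rho>}" and per: "\<And>w. f (w + 1) = f w"
    and bd: "\<And>w. \<bar>Im w\<bar> < \<rho> \<Longrightarrow> norm (f w) \<le> M"
    and \<sigma>: "0 < \<sigma>" "\<sigma> < \<rho>"
  obtains A B where "\<And>z. \<bar>Im z\<bar> < \<sigma> \<Longrightarrow>
    norm (f z - ((\<Sum>m=1..r. B m * cexp (of_int (int m) * z)) + (\<Sum>m\<le>r. A m * cexp (of_int (- int m) * z))))
      \<le> 4 * M * (exp (- 2 * pi * (\<sigma> - \<bar>Im z\<bar>)) ^ Suc r / (1 - exp (- 2 * pi * (\<sigma> - \<bar>Im z\<bar>))))"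
proof -
  obtain A B where AB: "\<And>z. 0 < Re z \<Longrightarrow> Re z < 1 \<Longrightarrow> \<bar>Im z\<bar> < \<sigma> \<Longrightarrow>
    norm (f z - ((\<Sum>m=1..r. B m * cexp (of_int (int m) * z)) + (\<Sum>m\<le>r. A m * cexp (of_int (- int m) * z))))
      \<le> 4 * M * (exp (- 2 * pi * (\<sigma> - \<bar>Im z\<bar>)) ^ Suc r / (1 - exp (- 2 * pi * (\<sigma> - \<bar>Im z\<bar>))))"
    using laurent_truncation_aux[OF assms, of r] by blast
  define P where "P z = (\<Sum>m=1..r. B m * cexp (of_int (int m) * z)) + (\<Sum>m\<le>r. A m * cexp (of_int (- int m) * z))" for z
  define N where "N z = norm (f z - P z)" for z
  have fint: "f (w + of_int n) = f w" for w and n :: int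
  proof -
    have nat': "f (w + of_nat k) = f w" for w and k :: nat
    proof (induction k)
      case (Suc k)
      have "f (w + of_nat (Suc k)) = f ((w + of_nat k) + 1)" by (simp add: add_ac)
      then show ?case using per Suc by simp
    qed simp
    show ?thesis
    proof (cases "n \<ge> 0")
      case True
      then show ?thesis using nat'[of w "nat n"] by (simp add: of_nat_nat)
    next
      case False
      then have "(w + of_int n) + of_nat (nat (- n)) = w" by (simp add: of_nat_nat)
      then show ?thesis using nat'[of "w + of_int n" "nat (- n)"] by (simp only:)
    qed
  qed
  have eint: "cexp (of_int m * (w + of_int n)) = cexp (of_int m * w)" for m n w
    using cexp_of_int[of "m * n"] by (simp add: distrib_left cexp_add)
  have Nint: "N (w + of_int n) = N w" for w n
    unfolding N_def P_def fint eint ..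
  have Ncont: "continuous_on {w. \<bar>Im w\<bar> < \<rho>} N"
    unfolding N_def P_def cexp_def
    by (intro continuous_intros holomorphic_on_imp_continuous_on[OF holo])
  show ?thesis
  proof (rule that[of B A])
    fix z assume z: "\<bar>Im z\<bar> < \<sigma>"
    let ?b = "4 * M * (exp (- 2 * pi * (\<sigma> - \<bar>Im z\<bar>)) ^ Suc r / (1 - exp (- 2 * pi * (\<sigma> - \<bar>Im z\<bar>))))"
    let ?n = "\<lfloor>Re z\<rfloor>"
    have "\<forall>\<^sub>F \<delta> in at_right 0. \<delta> \<in> {0<..<1 - frac (Re z)}"
      using frac_lt_1[of "Re z"] by (intro eventually_at_right_real) simp
    then have "\<forall>\<^sub>F \<delta> in at_right 0. N (z + of_real \<delta>) \<le> ?b"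
    proof eventually_elim
      case (elim \<delta>)
      have "N (z + of_real \<delta>) = N (z + of_real \<delta> + of_int (- ?n))" by (rule Nint[symmetric])
      also have "\<dots> \<le> ?b"
      proof -
        let ?w = "z + of_real \<delta> + of_int (- ?n)"
        have "of_int ?n \<le> Re z" by simp
        then have "0 < Re ?w" using elim by (simp del: of_int_floor_le)
        moreover have "Re ?w < 1" "Im ?w = Im z" using elim by (auto simp: frac_def)
        ultimately have "0 < Re ?w" "Re ?w < 1" "Im ?w = Im z" by blast+
        then show ?thesis using AB[of ?w] z unfolding N_def P_def by simp
      qed
      finally show ?case .
    qed
    moreover have "((\<lambda>\<delta>. N (z + of_real \<delta>)) \<longlongrightarrow> N (z + of_real 0)) (at_right 0)"
    proof -
      have "open {w. \<bar>Im w\<bar> < \<rho>}" by (intro open_Collect_less continuous_intros)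
      then have "isCont N z"
        using Ncont z \<sigma> continuous_on_eq_continuous_at[of "{w. \<bar>Im w\<bar> < \<rho>}" N] by auto
      then show ?thesis
        by (intro isCont_tendsto_compose[of _ N] tendsto_intros) simp
    qed
    ultimately have "N (z + of_real 0) \<le> ?b"
      by (intro tendsto_upperbound) auto
    then show "norm (f z - ((\<Sum>m=1..r. B m * cexp (of_int (int m) * z)) + (\<Sum>m\<le>r. A m * cexp (of_int (- int m) * z)))) \<le> ?b"
      unfolding N_def P_def by simp
  qed
qed

section \<open>Interpolation at equidistant nodes\<close>

definition dirichlet :: "nat \<Rightarrow> complex \<Rightarrow> complex" where
  "dirichlet r u = (\<Sum>m\<in>{-int r..int r}. cexp (of_int m * u)) / of_nat (2 * r + 1)"

text \<open>Trigonometric interpolation of degree r: the Dirichlet kernel divided by the number 2r +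
  1 of nodes is 1 at 0 and 0 at the other nodes j / (2r + 1).\<close>

definition interp :: "nat \<Rightarrow> (complex \<Rightarrow> complex) \<Rightarrow> complex \<Rightarrow> complex" where
  "interp r f z = (\<Sum>j<2 * r + 1. f (of_real (real j / real (2 * r + 1))) *
     dirichlet r (z - of_real (real j / real (2 * r + 1))))"

lemma roots_of_unity_sum:
  assumes "\<bar>l\<bar> < int N"
  shows "(\<Sum>j<N. cexp (of_int l * of_real (real j / real N))) = (if l = 0 then of_nat N else 0)"
proof (cases "l = 0")
  case False
  define x where "x = cexp (of_int l / of_nat N)"
  have N: "N > 0" using assms by (cases N) auto
  have jl: "of_int l * complex_of_real (real j / real N) = of_nat j * (of_int l / of_nat N)" for j by simp
  have pw: "cexp (of_int l * of_real (real j / real N)) = x ^ j" for j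
    unfolding x_def cexp_power jl ..
  have "x \<noteq> 1"
  proof
    assume "x = 1"
    then obtain k where "of_int l / complex_of_nat N = of_int k"
      unfolding x_def cexp_eq_1_iff by (auto elim: Ints_cases)
    then have "complex_of_int l = of_int (k * int N)" using N by (simp add: field_simps)
    then have "l = k * int N" by (simp only: of_int_eq_iff)
    then have "k \<noteq> 0" "\<bar>k\<bar> * int N < int N" using False assms by (auto simp: abs_mult)
    then show False using N by (simp add: mult_less_cancel_right)
  qed
  moreover have "x ^ N = 1"
    unfolding x_def cexp_power using N by simp
  ultimately show ?thesis unfolding pw using False geometric_sum[of x N] by simp
qed simp

text \<open>Differences of two frequencies of modulus at most r have modulus at most 2r, less than
  the number of nodes, so there is no aliasing and the roots of unity sum to 0.\<close>

lemma interp_cexp: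
  assumes "\<bar>k\<bar> \<le> int r"
  shows "interp r (\<lambda>z. c * cexp (of_int k * z)) z = c * cexp (of_int k * z)"
proof -
  let ?N = "2 * r + 1"
  let ?x = "\<lambda>j. complex_of_real (real j / real ?N)"
  have "interp r (\<lambda>z. c * cexp (of_int k * z)) z =
      (\<Sum>j<?N. \<Sum>m\<in>{-int r..int r}. c * cexp (of_int m * z) / of_nat ?N * cexp (of_int (k - m) * ?x j))"
    unfolding interp_def dirichlet_def sum_divide_distrib sum_distrib_left
  proof (intro sum.cong refl)
    fix j m
    have "of_int k * x + of_int m * (z - x) = of_int m * z + of_int (k - m) * x" for x
      by (simp add: algebra_simps)
    note eq = this
    have "cexp (of_int k * ?x j) * cexp (of_int m * (z - ?x j)) = cexp (of_int m * z) * cexp (of_int (k - m) * ?x j)"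
      unfolding cexp_add[symmetric] eq ..
    then show "c * cexp (of_int k * ?x j) * (cexp (of_int m * (z - ?x j)) / of_nat ?N) =
        c * cexp (of_int m * z) / of_nat ?N * cexp (of_int (k - m) * ?x j)"
      by (simp add: mult.assoc)
  qed
  also have "\<dots> = (\<Sum>m\<in>{-int r..int r}. c * cexp (of_int m * z) / of_nat ?N * (\<Sum>j<?N. cexp (of_int (k - m) * ?x j)))"
    unfolding sum_distrib_left by (rule sum.swap)
  also have "\<dots> = (\<Sum>m\<in>{-int r..int r}. if m = k then c * cexp (of_int k * z) else 0)"
  proof (intro sum.cong refl)
    fix m assume "m \<in> {-int r..int r}"
    then have "\<bar>k - m\<bar> < int ?N" using assms by auto
    then have "(\<Sum>j<?N. cexp (of_int (k - m) * ?x j)) = (if k - m = 0 then of_nat ?N else 0)"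
      by (rule roots_of_unity_sum)
    then show "c * cexp (of_int m * z) / of_nat ?N * (\<Sum>j<?N. cexp (of_int (k - m) * ?x j)) =
        (if m = k then c * cexp (of_int k * z) else 0)" by (simp del: of_nat_Suc of_nat_add)
  qed
  also have "\<dots> = c * cexp (of_int k * z)" using assms by (simp add: abs_le_iff minus_le_iff)
  finally show ?thesis .
qed

lemma interp_add: "interp r (\<lambda>z. f z + g z) z = interp r f z + interp r g z"
  by (simp add: interp_def distrib_right sum.distrib)

lemma interp_sum: "finite A \<Longrightarrow> interp r (\<lambda>z. \<Sum>i\<in>A. f i z) z = (\<Sum>i\<in>A. interp r (f i) z)"
  unfolding interp_def sum_distrib_right by (rule sum.swap)

lemma norm_dirichlet_le: "norm (dirichlet r u) \<le> exp (2 * pi * \<bar>Im u\<bar>) ^ r"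
proof -
  have "norm (\<Sum>m\<in>{-int r..int r}. cexp (of_int m * u)) \<le> (\<Sum>m\<in>{-int r..int r}. exp (2 * pi * \<bar>Im u\<bar>) ^ r)"
  proof (rule order_trans[OF norm_sum sum_mono])
    fix m assume "m \<in> {-int r..int r}"
    then have "\<bar>real_of_int m\<bar> \<le> real r" by auto
    then have "\<bar>real_of_int m\<bar> * \<bar>Im u\<bar> \<le> real r * \<bar>Im u\<bar>" by (rule mult_right_mono) simp
    then have "- (real r * \<bar>Im u\<bar>) \<le> Im (of_int m * u)" by (simp add: abs_mult[symmetric])
    then have "norm (cexp (of_int m * u)) \<le> exp (- 2 * pi * - (real r * \<bar>Im u\<bar>))" by (rule norm_cexp_le)
    also have "- 2 * pi * - (real r * \<bar>Im u\<bar>) = real r * (2 * pi * \<bar>Im u\<bar>)" by simp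
    finally show "norm (cexp (of_int m * u)) \<le> exp (2 * pi * \<bar>Im u\<bar>) ^ r" by (simp only: exp_of_nat_mult)
  qed
  also have "\<dots> = real (2 * r + 1) * exp (2 * pi * \<bar>Im u\<bar>) ^ r" by simp
  finally have "norm (\<Sum>m\<in>{-int r..int r}. cexp (of_int m * u)) / real (2 * r + 1) \<le> exp (2 * pi * \<bar>Im u\<bar>) ^ r"
    by (simp add: field_simps del: of_nat_Suc of_nat_add)
  then show ?thesis unfolding dirichlet_def norm_divide norm_of_nat .
qed

text \<open>Interpolation reproduces the truncated Laurent polynomial, so only its remainder counts.
  At the real nodes the remainder is of order exp (-2 pi \<sigma>) ^ r, and the kernel at height
  \<rho>' grows like exp (2 pi \<rho>') ^ r; the product is \<open>\<kappa> ^ r\<close>. The factor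
  2r + 2 is one for the remainder at z and 2r + 1 for the nodes.\<close>

lemma interp_error:
  assumes holo: "f holomorphic_on {w. \<bar>Im w\<bar> < \<rho>}" and per: "\<And>w. f (w + 1) = f w"
    and bd: "\<And>w. \<bar>Im w\<bar> < \<rho> \<Longrightarrow> norm (f w) \<le> M"
    and \<sigma>: "0 < \<rho>'" "\<rho>' < \<sigma>" "\<sigma> < \<rho>" and z: "\<bar>Im z\<bar> \<le> \<rho>'"
  defines "\<kappa> \<equiv> exp (- 2 * pi * (\<sigma> - \<rho>'))"
  shows "norm (f z - interp r f z) \<le> M * (4 * (real (2 * r + 2) * \<kappa> ^ r) / (1 - \<kappa>))"
proof -
  let ?N = "2 * r + 1"
  have s0: "0 < \<sigma>" using \<sigma> by linarith
  obtain A B where AB: "\<And>z. \<bar>Im z\<bar> < \<sigma> \<Longrightarrow>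
    norm (f z - ((\<Sum>m=1..r. B m * cexp (of_int (int m) * z)) + (\<Sum>m\<le>r. A m * cexp (of_int (- int m) * z))))
      \<le> 4 * M * (exp (- 2 * pi * (\<sigma> - \<bar>Im z\<bar>)) ^ Suc r / (1 - exp (- 2 * pi * (\<sigma> - \<bar>Im z\<bar>))))"
    using laurent_truncation[OF holo per bd s0 \<sigma>(3), of r] by blast
  define P where "P = (\<lambda>z. (\<Sum>m=1..r. B m * cexp (of_int (int m) * z)) + (\<Sum>m\<le>r. A m * cexp (of_int (- int m) * z)))"
  define \<kappa>0 where "\<kappa>0 = exp (- 2 * pi * \<sigma>)"
  have "norm (f 0) \<le> M" using \<sigma> by (intro bd) simp
  then have M0: "0 \<le> M" by (rule order_trans[OF norm_ge_zero])
  have \<kappa>: "0 < \<kappa>" "\<kappa> < 1" using \<sigma> by (simp_all add: \<kappa>_def)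
  have \<kappa>0: "0 < \<kappa>0" "\<kappa>0 \<le> \<kappa>" using \<sigma> by (simp_all add: \<kappa>0_def \<kappa>_def)
  have interpP: "interp r P z = P z"
    unfolding P_def interp_add interp_sum[OF finite_atLeastAtMost] interp_sum[OF finite_atMost]
    by (intro arg_cong2[where f = "(+)"] sum.cong refl interp_cexp) auto
  have Rz: "norm (f z - P z) \<le> 4 * M * (\<kappa> ^ r / (1 - \<kappa>))"
  proof -
    have le: "exp (- 2 * pi * (\<sigma> - \<bar>Im z\<bar>)) \<le> \<kappa>" using z by (simp add: \<kappa>_def)
    have "exp (- 2 * pi * (\<sigma> - \<bar>Im z\<bar>)) ^ Suc r \<le> \<kappa> ^ Suc r" by (rule power_mono[OF le]) simp
    also have "\<dots> \<le> \<kappa> ^ r" using \<kappa> by (intro power_decreasing) auto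
    finally have "exp (- 2 * pi * (\<sigma> - \<bar>Im z\<bar>)) ^ Suc r / (1 - exp (- 2 * pi * (\<sigma> - \<bar>Im z\<bar>))) \<le> \<kappa> ^ r / (1 - \<kappa>)"
      using le \<kappa> by (intro frac_le) auto
    then have "4 * M * (exp (- 2 * pi * (\<sigma> - \<bar>Im z\<bar>)) ^ Suc r / (1 - exp (- 2 * pi * (\<sigma> - \<bar>Im z\<bar>)))) \<le> 4 * M * (\<kappa> ^ r / (1 - \<kappa>))"
      using M0 by (intro mult_left_mono) auto
    then show ?thesis using AB[of z] z \<sigma> unfolding P_def by linarith
  qed
  have Rx: "norm (f (of_real x) - P (of_real x)) \<le> 4 * M * (\<kappa>0 ^ r / (1 - \<kappa>))" for x
  proof -
    have "\<kappa>0 ^ Suc r \<le> \<kappa>0 ^ r" using \<kappa>0 \<kappa> by (intro power_decreasing) auto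
    then have "\<kappa>0 ^ Suc r / (1 - \<kappa>0) \<le> \<kappa>0 ^ r / (1 - \<kappa>)"
      using \<kappa>0 \<kappa> by (intro frac_le) auto
    then have "4 * M * (\<kappa>0 ^ Suc r / (1 - \<kappa>0)) \<le> 4 * M * (\<kappa>0 ^ r / (1 - \<kappa>))"
      using M0 by (intro mult_left_mono) auto
    then show ?thesis using AB[of "of_real x"] \<sigma> unfolding P_def \<kappa>0_def by simp
  qed
  have "interp r f z = interp r (\<lambda>z. (f z - P z) + P z) z" by simp
  also have "\<dots> = interp r (\<lambda>z. f z - P z) z + P z" unfolding interp_add interpP ..
  finally have eq: "f z - interp r f z = (f z - P z) - interp r (\<lambda>z. f z - P z) z" by simp
  have "norm (interp r (\<lambda>z. f z - P z) z) \<le> (\<Sum>j<?N. 4 * M * (\<kappa>0 ^ r / (1 - \<kappa>)) * exp (2 * pi * \<rho>') ^ r)"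
    unfolding interp_def
  proof (rule order_trans[OF norm_sum sum_mono])
    fix j
    let ?x = "real j / real ?N"
    have "norm (dirichlet r (z - of_real ?x)) \<le> exp (2 * pi * \<bar>Im (z - of_real ?x)\<bar>) ^ r" by (rule norm_dirichlet_le)
    also have "\<dots> \<le> exp (2 * pi * \<rho>') ^ r" using z by (intro power_mono) auto
    finally show "norm ((f (of_real ?x) - P (of_real ?x)) * dirichlet r (z - of_real ?x)) \<le>
        4 * M * (\<kappa>0 ^ r / (1 - \<kappa>)) * exp (2 * pi * \<rho>') ^ r"
      unfolding norm_mult using Rx[of ?x] M0 \<kappa> \<kappa>0 by (intro mult_mono) auto
  qed
  also have "\<dots> = real ?N * (4 * M * (\<kappa>0 ^ r * exp (2 * pi * \<rho>') ^ r / (1 - \<kappa>)))" by simp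
  also have "\<kappa>0 ^ r * exp (2 * pi * \<rho>') ^ r = \<kappa> ^ r"
    unfolding power_mult_distrib[symmetric] \<kappa>0_def \<kappa>_def exp_add[symmetric] by (simp add: algebra_simps)
  finally have Ri: "norm (interp r (\<lambda>z. f z - P z) z) \<le> real ?N * (4 * M * (\<kappa> ^ r / (1 - \<kappa>)))" .
  have "norm (f z - interp r f z) \<le> norm (f z - P z) + norm (interp r (\<lambda>z. f z - P z) z)"
    unfolding eq by (rule norm_triangle_ineq4)
  also have "\<dots> \<le> 4 * M * (\<kappa> ^ r / (1 - \<kappa>)) + real ?N * (4 * M * (\<kappa> ^ r / (1 - \<kappa>)))"
    using Rz Ri by (rule add_mono)
  also have "\<dots> = M * (4 * (real (2 * r + 2) * \<kappa> ^ r) / (1 - \<kappa>))"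
  proof -
    have "u + real ?N * u = real (2 * r + 2) * u" for u by (simp add: algebra_simps)
    then have "4 * M * (\<kappa> ^ r / (1 - \<kappa>)) + real ?N * (4 * M * (\<kappa> ^ r / (1 - \<kappa>))) =
      real (2 * r + 2) * (4 * M * (\<kappa> ^ r / (1 - \<kappa>)))" .
    then show ?thesis by (simp only: times_divide_eq_right mult_ac)
  qed
  finally show ?thesis .
qed

text \<open>The degree r is chosen before f, and the error is proportional to M. This uniformity is
  what later serves all times t at once.\<close>

lemma interp_uniform:
  assumes "0 < \<rho>'" "\<rho>' < \<rho>" "0 < \<eta>"
  obtains r where "\<And>f M z. f holomorphic_on {w. \<bar>Im w\<bar> < \<rho>} \<Longrightarrow> (\<And>w. f (w + 1) = f w) \<Longrightarrow>
    (\<And>w. \<bar>Im w\<bar> < \<rho> \<Longrightarrow> norm (f w) \<le> M) \<Longrightarrow> \<bar>Im z\<bar> \<le> \<rho>' \<Longrightarrow> norm (f z - interp r f z) \<le> M * \<eta>"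
proof -
  define \<sigma> where "\<sigma> = (\<rho>' + \<rho>) / 2"
  have \<sigma>: "\<rho>' < \<sigma>" "\<sigma> < \<rho>" using assms by (auto simp: \<sigma>_def)
  define \<kappa> where "\<kappa> = exp (- 2 * pi * (\<sigma> - \<rho>'))"
  have \<kappa>: "0 < \<kappa>" "\<kappa> < 1" using \<sigma> by (simp_all add: \<kappa>_def)
  \<comment> \<open>The 8 is 4 times the 2 of 2r + 2; the term r * \<kappa> ^ r still tends to
    0.\<close>
  have "(\<lambda>n. 8 / (1 - \<kappa>) * (real n * \<kappa> ^ n) + 8 / (1 - \<kappa>) * \<kappa> ^ n) \<longlonglongrightarrow> 8 / (1 - \<kappa>) * 0 + 8 / (1 - \<kappa>) * 0"
    using \<kappa> by (intro tendsto_intros powser_times_n_limit_0 LIMSEQ_realpow_zero) auto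
  then have "\<forall>\<^sub>F n in sequentially. 8 / (1 - \<kappa>) * (real n * \<kappa> ^ n) + 8 / (1 - \<kappa>) * \<kappa> ^ n < \<eta>"
    by (rule order_tendstoD) (use assms in simp)
  then obtain r where "8 / (1 - \<kappa>) * (real r * \<kappa> ^ r) + 8 / (1 - \<kappa>) * \<kappa> ^ r < \<eta>"
    unfolding eventually_sequentially by blast
  moreover have "4 * (real (2 * r + 2) * \<kappa> ^ r) / (1 - \<kappa>) = 8 / (1 - \<kappa>) * (real r * \<kappa> ^ r) + 8 / (1 - \<kappa>) * \<kappa> ^ r"
    by (simp add: algebra_simps add_divide_distrib)
  ultimately have r: "4 * (real (2 * r + 2) * \<kappa> ^ r) / (1 - \<kappa>) \<le> \<eta>" by linarith
  show ?thesis
  proof (rule that[of r])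
    fix f M z
    assume f: "f holomorphic_on {w. \<bar>Im w\<bar> < \<rho>}" "\<And>w. f (w + 1) = f w"
      "\<And>w. \<bar>Im w\<bar> < \<rho> \<Longrightarrow> norm (f w) \<le> M" "\<bar>Im z\<bar> \<le> \<rho>'"
    have "norm (f 0) \<le> M" using assms by (intro f) simp
    then have M0: "0 \<le> M" by (rule order_trans[OF norm_ge_zero])
    have "norm (f z - interp r f z) \<le> M * (4 * (real (2 * r + 2) * \<kappa> ^ r) / (1 - \<kappa>))"
      unfolding \<kappa>_def by (rule interp_error[OF f(1-3) assms(1) \<sigma> f(4)])
    also have "\<dots> \<le> M * \<eta>" using r M0 by (rule mult_left_mono)
    finally show "norm (f z - interp r f z) \<le> M * \<eta>" .
  qed
qed

section \<open>Real trigonometric polynomials\<close>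

definition phase :: "('k \<Rightarrow> int) \<Rightarrow> complex ^ 'k::finite \<Rightarrow> complex" where
  "phase a z = (\<Sum>i\<in>UNIV. of_int (a i) * z $ i)"

definition ctrig :: "('k \<Rightarrow> int) \<Rightarrow> real \<Rightarrow> complex ^ 'k::finite \<Rightarrow> complex" where
  "ctrig a \<theta> z = cos (of_real (2 * pi) * phase a z + of_real \<theta>)"

text \<open>Real coefficients and real phases keep these functions real on real points, so that they
  can be Hamiltonians; the free phase \<theta> includes the sines.\<close>

inductive trigpoly :: "(complex ^ 'k::finite \<Rightarrow> complex) \<Rightarrow> bool" where
  trigpoly_ctrig: "trigpoly (ctrig a \<theta>)"
| trigpoly_add: "trigpoly F \<Longrightarrow> trigpoly G \<Longrightarrow> trigpoly (\<lambda>z. F z + G z)"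
| trigpoly_scale: "trigpoly F \<Longrightarrow> trigpoly (\<lambda>z. of_real c * F z)"

lemma phase_add_right: "phase a (z + w) = phase a z + phase a w"
  by (simp add: phase_def distrib_left sum.distrib)

lemma phase_smult: "phase a (c *s z) = c * phase a z"
  by (simp add: phase_def sum_distrib_left mult_ac)

lemma phase_add_left: "phase (\<lambda>i. a i + b i) z = phase a z + phase b z"
  by (simp add: phase_def distrib_right sum.distrib)

lemma phase_diff_left: "phase (\<lambda>i. a i - b i) z = phase a z - phase b z"
  by (simp add: phase_def left_diff_distrib sum_subtractf)

lemma phase_cvec: "phase a (cvec x) = of_real (\<Sum>i\<in>UNIV. of_int (a i) * x $ i)"
  by (simp add: phase_def)

lemma phase_lattice:
  assumes "m \<in> integer_lattice"
  obtains n where "phase a m = of_int n"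
proof -
  have "phase a m \<in> \<int>"
    unfolding phase_def using assms by (intro Ints_sum Ints_mult) (auto simp: integer_lattice_def)
  then show ?thesis using that by (auto elim: Ints_cases)
qed

lemma phase_axis: "phase a (axis k c) = of_int (a k) * c"
proof -
  have "phase a (axis k c) = (\<Sum>i\<in>UNIV. if i = k then of_int (a k) * c else 0)"
    unfolding phase_def by (intro sum.cong) (auto simp: axis_def)
  then show ?thesis by simp
qed

lemma cos_shift_int: "cos (of_real (2 * pi) * (w + of_int n) + c) = cos (of_real (2 * pi) * w + (c :: complex))"
proof -
  have "of_real (2 * pi) * (w + of_int n) + c = (of_real (2 * pi) * w + c) + of_real (2 * pi * of_int n)"
    by (simp add: algebra_simps)
  then show ?thesis by (simp only: cos_add cos_of_real sin_of_real) (simp add: cos_int_2pin sin_int_2pin)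
qed

lemma ctrig_periodic: "m \<in> integer_lattice \<Longrightarrow> ctrig a \<theta> (z + m) = ctrig a \<theta> z"
  by (metis phase_lattice cos_shift_int ctrig_def phase_add_right)

lemma ctrig_cvec: "ctrig a \<theta> (cvec x) = of_real (cos (2 * pi * (\<Sum>i\<in>UNIV. of_int (a i) * x $ i) + \<theta>))"
  unfolding ctrig_def phase_cvec by (simp add: cos_of_real[symmetric])

lemma holo_on_phase: "holo_on (phase a) U"
  unfolding phase_def by (intro holo_on_sum holo_on_cmult holo_on_nth)

lemma holo_on_ctrig: "holo_on (ctrig a \<theta>) U"
  unfolding ctrig_def
  by (rule holo_on_comp[OF holo_on_phase, where g = "\<lambda>u. cos (of_real (2 * pi) * u + of_real \<theta>)"])
    (auto intro!: derivative_eq_intros)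

lemma norm_cos_le_exp_Im: "norm (cos w) \<le> exp \<bar>Im w\<bar>"
proof -
  have "norm (exp (\<i> * w) + exp (- (\<i> * w))) \<le> exp \<bar>Im w\<bar> + exp \<bar>Im w\<bar>"
    by (rule order_trans[OF norm_triangle_ineq add_mono]) (simp_all add: norm_exp_eq_Re)
  then show ?thesis by (simp add: cos_exp_eq norm_divide)
qed

lemma Im_phase_le:
  assumes "z \<in> strip r"
  shows "\<bar>Im (phase a z)\<bar> \<le> (\<Sum>i\<in>UNIV. \<bar>of_int (a i)\<bar>) * r"
proof -
  have "\<bar>Im (phase a z)\<bar> \<le> (\<Sum>i\<in>UNIV. \<bar>of_int (a i) * Im (z $ i)\<bar>)"
    unfolding phase_def by (simp add: sum_abs)
  also have "\<dots> \<le> (\<Sum>i\<in>UNIV. \<bar>of_int (a i)\<bar> * r)"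
  proof (rule sum_mono)
    fix i
    have "\<bar>Im (z $ i)\<bar> \<le> r" using assms by (auto simp: strip_def less_imp_le)
    then show "\<bar>of_int (a i) * Im (z $ i)\<bar> \<le> \<bar>of_int (a i)\<bar> * r"
      unfolding abs_mult by (rule mult_left_mono) simp
  qed
  finally show ?thesis by (simp add: sum_distrib_right)
qed

lemma ctrig_bounded:
  fixes a :: "'k::finite \<Rightarrow> int"
  shows "\<exists>B. \<forall>z\<in>strip r. norm (ctrig a \<theta> z) \<le> B"
proof (intro exI ballI)
  fix z :: "complex ^ 'k" assume "z \<in> strip r"
  then have "2 * pi * \<bar>Im (phase a z)\<bar> \<le> 2 * pi * ((\<Sum>i\<in>UNIV. \<bar>of_int (a i)\<bar>) * r)"
    using Im_phase_le by (intro mult_left_mono) auto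
  moreover have "norm (ctrig a \<theta> z) \<le> exp \<bar>Im (of_real (2 * pi) * phase a z + of_real \<theta>)\<bar>"
    unfolding ctrig_def by (rule norm_cos_le_exp_Im)
  ultimately show "norm (ctrig a \<theta> z) \<le> exp (2 * pi * ((\<Sum>i\<in>UNIV. \<bar>of_int (a i)\<bar>) * r))"
    by (simp add: abs_mult) (rule order_trans, assumption, simp)
qed

lemma trigpoly_bounded: "trigpoly F \<Longrightarrow> \<exists>B\<ge>0. \<forall>z\<in>strip r. norm (F z) \<le> B"
proof (induction rule: trigpoly.induct)
  case (trigpoly_ctrig a \<theta>)
  obtain B where B: "\<forall>z\<in>strip r. norm (ctrig a \<theta> z) \<le> B" using ctrig_bounded by blast
  then have "\<forall>z\<in>strip r. norm (ctrig a \<theta> z) \<le> max 0 B" by auto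
  then show ?case by (intro exI[of _ "max 0 B"]) simp
next
  case (trigpoly_add F G)
  then obtain B C where "0 \<le> B" "\<forall>z\<in>strip r. norm (F z) \<le> B" "0 \<le> C" "\<forall>z\<in>strip r. norm (G z) \<le> C" by blast
  then show ?case
    by (intro exI[of _ "B + C"]) (auto intro!: norm_triangle_le add_mono)
next
  case (trigpoly_scale F c)
  then obtain B where "0 \<le> B" "\<forall>z\<in>strip r. norm (F z) \<le> B" by blast
  then show ?case
    by (intro exI[of _ "\<bar>c\<bar> * B"]) (auto simp: norm_mult intro!: mult_left_mono)
qed

lemma ctrig_0: "ctrig (\<lambda>_. 0) 0 = (\<lambda>z. 1)"
  by (simp add: ctrig_def phase_def fun_eq_iff)

lemma trigpoly_one: "trigpoly (\<lambda>z. 1)"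
  using trigpoly_ctrig[of "\<lambda>_. 0" 0] by (simp add: ctrig_0)

lemma trigpoly_sum: "(\<And>i. i \<in> A \<Longrightarrow> trigpoly (F i)) \<Longrightarrow> trigpoly (\<lambda>z. \<Sum>i\<in>A. F i z)"
proof (induction A rule: infinite_finite_induct)
  case (insert x A)
  then show ?case by (simp add: trigpoly_add)
qed (use trigpoly_scale[OF trigpoly_one, of 0] in auto)

lemma trigpoly_mult_ctrig: "trigpoly F \<Longrightarrow> trigpoly (\<lambda>z. F z * ctrig b \<phi> z)"
proof (induction rule: trigpoly.induct)
  case (trigpoly_ctrig a \<theta>)
  have "ctrig a \<theta> z * ctrig b \<phi> z = of_real (1/2) * (ctrig (\<lambda>i. a i - b i) (\<theta> - \<phi>) z + ctrig (\<lambda>i. a i + b i) (\<theta> + \<phi>) z)" for z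
    unfolding ctrig_def cos_times_cos phase_add_left phase_diff_left by (simp add: algebra_simps)
  then show ?case
    by (simp only:) (intro trigpoly.intros)
next
  case (trigpoly_add F G)
  then show ?case by (simp add: distrib_right trigpoly.trigpoly_add)
next
  case (trigpoly_scale F c)
  then show ?case by (simp add: mult.assoc trigpoly.trigpoly_scale)
qed

text \<open>Pairing m with -m in the symmetric range turns the kernel into a real combination of
  cosines, the form that \<open>trigpoly\<close> admits.\<close>

lemma dirichlet_cos:
  "dirichlet r u = (\<Sum>m\<in>{-int r..int r}. of_real (1 / real (2 * r + 1)) * cos (of_real (2 * pi) * (of_int m * u)))"
proof -
  have "(\<Sum>m\<in>{-int r..int r}. cexp (of_int m * u)) = (\<Sum>m\<in>{-int r..int r}. cexp (of_int (- m) * u))"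
    by (rule sum.reindex_bij_witness[where i = uminus and j = uminus]) auto
  then have "2 * (\<Sum>m\<in>{-int r..int r}. cexp (of_int m * u)) =
      (\<Sum>m\<in>{-int r..int r}. cexp (of_int m * u) + cexp (of_int (- m) * u))"
    by (simp only: mult_2 sum.distrib)
  also have "\<dots> = (\<Sum>m\<in>{-int r..int r}. 2 * cos (of_real (2 * pi) * (of_int m * u)))"
    by (intro sum.cong refl) (simp add: cos_exp_eq cexp_def algebra_simps)
  finally have "(\<Sum>m\<in>{-int r..int r}. cexp (of_int m * u)) = (\<Sum>m\<in>{-int r..int r}. cos (of_real (2 * pi) * (of_int m * u)))"
    by (simp add: sum_distrib_left[symmetric])
  then show ?thesis
    unfolding dirichlet_def by (simp add: sum_distrib_left sum_divide_distrib)
qed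

lemma trigpoly_mult_dirichlet:
  assumes "trigpoly F"
  shows "trigpoly (\<lambda>z. F z * dirichlet r (z $ i - of_real x))"
proof -
  have "of_real (2 * pi) * (of_int m * (z $ i - of_real x)) =
      of_real (2 * pi) * phase (\<lambda>k. if k = i then m else 0) z + complex_of_real (- 2 * pi * of_int m * x)" for m z
  proof -
    have "phase (\<lambda>k. if k = i then m else 0) z = (\<Sum>k\<in>UNIV. if k = i then of_int m * z $ i else 0)"
      unfolding phase_def by (intro sum.cong) auto
    then show ?thesis by (simp add: algebra_simps)
  qed
  then have "F z * dirichlet r (z $ i - of_real x) =
      (\<Sum>m\<in>{-int r..int r}. of_real (1 / real (2 * r + 1)) *
        (F z * ctrig (\<lambda>k. if k = i then m else 0) (- 2 * pi * of_int m * x) z))" for z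
    unfolding dirichlet_cos ctrig_def sum_distrib_left by (intro sum.cong refl) (simp only: mult_ac)
  then show ?thesis
    by (simp only:) (intro trigpoly_sum trigpoly_scale trigpoly_mult_ctrig assms)
qed

section \<open>Approximation from finitely many real samples\<close>

text \<open>A partially sampled point: the coordinates in I have already been replaced by real
  nodes, the others are still those of z.\<close>

definition upd :: "'k set \<Rightarrow> complex ^ 'k \<Rightarrow> real ^ 'k \<Rightarrow> complex ^ 'k" where
  "upd I z x = (\<chi> i. if i \<in> I then of_real (x $ i) else z $ i)"

lemma norm_sum_list_le: "norm (sum_list (xs :: 'a::real_normed_vector list)) \<le> sum_list (map norm xs)"
  by (induction xs) (auto intro: norm_triangle_le)

lemma sum_list_concat_map:
  "(\<Sum>x\<leftarrow>concat (map h L). g x :: 'a::comm_monoid_add) = (\<Sum>p\<leftarrow>L. \<Sum>x\<leftarrow>h p. g x)"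
  by (induction L) simp_all

text \<open>Tensor-product interpolation by induction on the set of sampled coordinates. A new
  coordinate is interpolated inside every term found so far, and its error is multiplied by the
  weights of these terms; since the weights are fixed beforehand, the new degree can compensate for
  them. The list depends on \<eta> and the strips, not on F.\<close>

lemma sampling_aux:
  fixes I :: "'k::finite set"
  assumes \<rho>: "0 < \<rho>'" "\<rho>' < \<rho>" and "finite I"
  shows "\<eta> > 0 \<Longrightarrow> \<exists>L. (\<forall>p\<in>set L. trigpoly (snd p)) \<and> (\<forall>F M z. holo_on F (strip \<rho>) \<longrightarrow>
    (\<forall>z m. m \<in> integer_lattice \<longrightarrow> F (z + m) = F z) \<longrightarrow> (\<forall>z\<in>strip \<rho>. norm (F z) \<le> M) \<longrightarrow> z \<in> strip \<rho>' \<longrightarrow>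
    norm (F z - (\<Sum>p\<leftarrow>L. F (upd I z (fst p)) * snd p z)) \<le> M * \<eta>)"
  using \<open>finite I\<close>
proof (induction I arbitrary: \<eta> rule: finite_induct)
  case empty
  have upd: "upd {} z x = z" for z :: "complex ^ 'k" and x by (simp add: upd_def vec_eq_iff)
  have "norm (F z - F z) \<le> M * \<eta>" if "\<forall>z\<in>strip \<rho>. norm (F z) \<le> M" "z \<in> strip \<rho>'"
    for F :: "complex ^ 'k \<Rightarrow> complex" and M z
  proof -
    have "z \<in> strip \<rho>" using that(2) by (rule strip_mono') (use \<rho> in simp)
    then have "0 \<le> M" using that(1) norm_ge_zero order_trans by blast
    then show ?thesis using empty by simp
  qed
  \<comment> \<open>With no coordinate sampled the point 0 is a placeholder, and the weight 1
    returns F z itself.\<close>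
  then show ?case by (intro exI[of _ "[(0, \<lambda>z. 1)]"]) (simp add: upd trigpoly_one)
next
  case (insert i I)
  have half: "\<eta> / 2 > 0" using insert.prems by simp
  obtain L where L0: "\<forall>p\<in>set L. trigpoly (snd p)"
    "\<forall>F M z. holo_on F (strip \<rho>) \<longrightarrow> (\<forall>z m. m \<in> integer_lattice \<longrightarrow> F (z + m) = F z) \<longrightarrow>
       (\<forall>z\<in>strip \<rho>. norm (F z) \<le> M) \<longrightarrow> z \<in> strip \<rho>' \<longrightarrow>
       norm (F z - (\<Sum>p\<leftarrow>L. F (upd I z (fst p)) * snd p z)) \<le> M * (\<eta> / 2)"
    using insert.IH[OF half] by (elim exE conjE)
  note L = L0(1)[rule_format] L0(2)[THEN spec, THEN spec, THEN spec, THEN mp, THEN mp, THEN mp, THEN mp]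
  have "\<forall>p\<in>set L. \<exists>B\<ge>0. \<forall>z\<in>strip \<rho>'. norm (snd p z) \<le> B"
    using L(1) trigpoly_bounded by blast
  from bchoice[OF this] obtain B where
    B: "\<And>p. p \<in> set L \<Longrightarrow> 0 \<le> B p" "\<And>p z. p \<in> set L \<Longrightarrow> z \<in> strip \<rho>' \<Longrightarrow> norm (snd p z) \<le> B p" by blast
  define C where "C = (\<Sum>p\<leftarrow>L. B p)"
  have C0: "0 \<le> C" unfolding C_def by (rule sum_list_nonneg) (use B(1) in auto)
  \<comment> \<open>C bounds the total weight of the old terms on the smaller strip; the
    \<open>+ 1\<close> prevents division by 0.\<close>
  define \<eta>' where "\<eta>' = \<eta> / (2 * (C + 1))"
  have \<eta>': "\<eta>' > 0" "C * \<eta>' \<le> \<eta> / 2" using C0 insert.prems by (auto simp: \<eta>'_def field_simps)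
  obtain r where r: "\<And>f M z. f holomorphic_on {w. \<bar>Im w\<bar> < \<rho>} \<Longrightarrow> (\<And>w. f (w + 1) = f w) \<Longrightarrow>
    (\<And>w. \<bar>Im w\<bar> < \<rho> \<Longrightarrow> norm (f w) \<le> M) \<Longrightarrow> \<bar>Im z\<bar> \<le> \<rho>' \<Longrightarrow> norm (f z - interp r f z) \<le> M * \<eta>'"
    using interp_uniform[OF \<rho> \<eta>'(1)] by blast
  let ?N = "2 * r + 1"
  let ?x = "\<lambda>j. real j / real ?N"
  \<comment> \<open>Refines one sample by putting its i-th coordinate at the j-th node and
    multiplying its weight by the corresponding kernel.\<close>
  define new where "new p j = ((\<chi> k. if k = i then ?x j else fst p $ k) :: real ^ 'k,
     \<lambda>z. snd p z * dirichlet r (z $ i - of_real (?x j)))" for p :: "(real ^ 'k) \<times> (complex ^ 'k \<Rightarrow> complex)" and j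
  define L' where "L' = concat (map (\<lambda>p. map (new p) [0..<?N]) L)"
  have "trigpoly (snd p)" if "p \<in> set L'" for p
  proof -
    have "\<exists>q\<in>set L. \<exists>j. p = new q j"
      using that unfolding L'_def by (auto simp del: upt_Suc)
    then obtain q j where q: "q \<in> set L" "p = new q j" by blast
    show ?thesis unfolding q(2) new_def snd_conv by (intro trigpoly_mult_dirichlet L(1) q(1))
  qed
  moreover have "norm (F z - (\<Sum>p\<leftarrow>L'. F (upd (insert i I) z (fst p)) * snd p z)) \<le> M * \<eta>"
    if F: "holo_on F (strip \<rho>)" "\<forall>z m. m \<in> integer_lattice \<longrightarrow> F (z + m) = F z"
      "\<forall>z\<in>strip \<rho>. norm (F z) \<le> M" and z: "z \<in> strip \<rho>'" for F M z
  proof -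
    have "z \<in> strip \<rho>" using z by (rule strip_mono') (use \<rho> in simp)
    then have M0: "0 \<le> M" using F(3) norm_ge_zero order_trans by blast
    \<comment> \<open>The i-th coordinate is set to 0, so that adding \<open>axis i \<zeta>\<close>
      inserts \<zeta> there and leaves a function of one variable.\<close>
    define w0 where "w0 p = (\<chi> k. if k = i then 0 else upd I z (fst p) $ k)" for p :: "(real ^ 'k) \<times> (complex ^ 'k \<Rightarrow> complex)"
    define f where "f p \<zeta> = F (w0 p + axis i \<zeta>)" for p \<zeta>
    have fz: "f p (z $ i) = F (upd I z (fst p))" for p
    proof -
      have "w0 p + axis i (z $ i) = upd I z (fst p)"
        using insert.hyps by (simp add: vec_eq_iff w0_def axis_def upd_def)
      then show ?thesis by (simp add: f_def)
    qed
    have fx: "F (upd (insert i I) z (fst (new p j))) = f p (of_real (?x j))" for p j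
    proof -
      have "w0 p + axis i (of_real (?x j)) = upd (insert i I) z (fst (new p j))"
        by (simp add: vec_eq_iff w0_def axis_def upd_def new_def)
      then show ?thesis by (simp add: f_def)
    qed
    have w0s: "w0 p + axis i \<zeta> \<in> strip \<rho>" if "\<bar>Im \<zeta>\<bar> < \<rho>" for p \<zeta>
      using that \<open>z \<in> strip \<rho>\<close> \<rho> by (auto simp: strip_def w0_def axis_def upd_def)
    have err: "norm (f p (z $ i) - interp r (f p) (z $ i)) \<le> M * \<eta>'" for p
    proof (rule r)
      have "\<exists>D. (f p has_field_derivative D) (at \<zeta>)" if "\<bar>Im \<zeta>\<bar> < \<rho>" for \<zeta>
        unfolding f_def axis_slice
        by (rule holo_slice_differentiable[OF F(1)]) (use w0s[OF that] axis_conv_smult[of i \<zeta>] in simp)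
      then show "f p holomorphic_on {w. \<bar>Im w\<bar> < \<rho>}"
        unfolding holomorphic_on_def field_differentiable_def
        by (auto intro: has_field_derivative_at_within)
      show "f p (w + 1) = f p w" for w
      proof -
        have eq: "w0 p + axis i (w + 1) = (w0 p + axis i w) + axis i 1"
          by (simp add: vec_eq_iff axis_def)
        have "(axis i 1 :: complex ^ 'k) \<in> integer_lattice"
          by (simp add: integer_lattice_def axis_def)
        then have "F ((w0 p + axis i w) + axis i 1) = F (w0 p + axis i w)" using F(2) by blast
        then show ?thesis unfolding f_def eq .
      qed
      show "norm (f p w) \<le> M" if "\<bar>Im w\<bar> < \<rho>" for w
        using w0s[OF that] F(3) by (simp add: f_def)
      show "\<bar>Im (z $ i)\<bar> \<le> \<rho>'" using z by (auto simp: strip_def less_imp_le)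
    qed
    have "(\<Sum>p\<leftarrow>L'. F (upd (insert i I) z (fst p)) * snd p z) =
        (\<Sum>p\<leftarrow>L. \<Sum>j\<leftarrow>[0..<?N]. F (upd (insert i I) z (fst (new p j))) * snd (new p j) z)"
      unfolding L'_def by (simp add: sum_list_concat_map o_def del: upt_Suc)
    also have "\<dots> = (\<Sum>p\<leftarrow>L. interp r (f p) (z $ i) * snd p z)"
    proof -
      have "(\<Sum>j\<leftarrow>[0..<?N]. F (upd (insert i I) z (fst (new p j))) * snd (new p j) z) =
          interp r (f p) (z $ i) * snd p z" for p
      proof -
        have "(\<Sum>j\<leftarrow>[0..<?N]. F (upd (insert i I) z (fst (new p j))) * snd (new p j) z) =
            (\<Sum>j<?N. F (upd (insert i I) z (fst (new p j))) * snd (new p j) z)"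
          by (simp only: interv_sum_list_conv_sum_set_nat set_upt atLeast0LessThan)
        also have "\<dots> = (\<Sum>j<?N. f p (of_real (?x j)) * dirichlet r (z $ i - of_real (?x j)) * snd p z)"
          unfolding fx by (intro sum.cong refl) (simp add: new_def)
        also have "\<dots> = interp r (f p) (z $ i) * snd p z"
          unfolding interp_def sum_distrib_right ..
        finally show ?thesis .
      qed
      then show ?thesis by simp
    qed
    finally have S2: "(\<Sum>p\<leftarrow>L'. F (upd (insert i I) z (fst p)) * snd p z) = (\<Sum>p\<leftarrow>L. interp r (f p) (z $ i) * snd p z)" .
    have "(\<Sum>p\<leftarrow>L. F (upd I z (fst p)) * snd p z) - (\<Sum>p\<leftarrow>L. interp r (f p) (z $ i) * snd p z) =
        (\<Sum>p\<leftarrow>L. (f p (z $ i) - interp r (f p) (z $ i)) * snd p z)"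
      unfolding fz by (simp add: sum_list_subtractf left_diff_distrib)
    also have "norm \<dots> \<le> (\<Sum>p\<leftarrow>L. norm ((f p (z $ i) - interp r (f p) (z $ i)) * snd p z))"
      using norm_sum_list_le[of "map (\<lambda>p. (f p (z $ i) - interp r (f p) (z $ i)) * snd p z) L"] by (simp add: o_def)
    also have "\<dots> \<le> (\<Sum>p\<leftarrow>L. M * \<eta>' * B p)"
      using B(2)[OF _ z] M0 \<eta>' err by (intro sum_list_mono) (auto simp: norm_mult intro!: mult_mono)
    also have "\<dots> = M * (C * \<eta>')" by (simp add: C_def sum_list_const_mult mult_ac)
    also have "\<dots> \<le> M * (\<eta> / 2)" using \<eta>'(2) M0 by (rule mult_left_mono)
    finally have "norm ((\<Sum>p\<leftarrow>L. F (upd I z (fst p)) * snd p z) - (\<Sum>p\<leftarrow>L'. F (upd (insert i I) z (fst p)) * snd p z)) \<le> M * (\<eta> / 2)"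
      unfolding S2 .
    with L(2)[OF F z] have "norm ((F z - (\<Sum>p\<leftarrow>L. F (upd I z (fst p)) * snd p z)) +
       ((\<Sum>p\<leftarrow>L. F (upd I z (fst p)) * snd p z) - (\<Sum>p\<leftarrow>L'. F (upd (insert i I) z (fst p)) * snd p z)))
       \<le> M * (\<eta> / 2) + M * (\<eta> / 2)"
      by (intro norm_triangle_le add_mono)
    then show ?thesis by (simp add: field_simps)
  qed
  ultimately show ?case by blast
qed

text \<open>With all coordinates sampled only values at real points remain. The list is fixed before
  f, so continuity in t of an analytic path reduces to that of finitely many real functions.\<close>

lemma sampling:
  assumes "0 < \<rho>'" "\<rho>' < \<rho>" "\<eta> > 0"
  obtains L :: "((real ^ 'k::finite) \<times> (complex ^ 'k \<Rightarrow> complex)) list" where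
    "\<And>p. p \<in> set L \<Longrightarrow> trigpoly (snd p)"
    "\<And>F f M z. strip_ext \<rho> F f \<Longrightarrow> (\<And>z. z \<in> strip \<rho> \<Longrightarrow> norm (F z) \<le> M) \<Longrightarrow> z \<in> strip \<rho>' \<Longrightarrow>
       norm (F z - (\<Sum>p\<leftarrow>L. of_real (f (to_torus (fst p))) * snd p z)) \<le> M * \<eta>"
proof -
  have upd: "upd UNIV z x = cvec x" for z :: "complex ^ 'k" and x by (simp add: upd_def vec_eq_iff)
  obtain L :: "((real ^ 'k) \<times> (complex ^ 'k \<Rightarrow> complex)) list" where L: "\<forall>p\<in>set L. trigpoly (snd p)"
    "\<forall>F M z. holo_on F (strip \<rho>) \<longrightarrow>
    (\<forall>z m. m \<in> integer_lattice \<longrightarrow> F (z + m) = F z) \<longrightarrow> (\<forall>z\<in>strip \<rho>. norm (F z) \<le> M) \<longrightarrow> z \<in> strip \<rho>' \<longrightarrow>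
    norm (F z - (\<Sum>p\<leftarrow>L. F (upd UNIV z (fst p)) * snd p z)) \<le> M * \<eta>"
    using sampling_aux[OF assms(1,2) finite assms(3), of "UNIV :: 'k set"] by (elim exE conjE)
  show ?thesis
  proof (rule that[of L])
    show "trigpoly (snd p)" if "p \<in> set L" for p using L(1) that by blast
    fix F :: "complex ^ 'k \<Rightarrow> complex" and f M and z :: "complex ^ 'k"
    assume *: "strip_ext \<rho> F f" "\<And>z. z \<in> strip \<rho> \<Longrightarrow> norm (F z) \<le> M" "z \<in> strip \<rho>'"
    have "norm (F z - (\<Sum>p\<leftarrow>L. F (upd UNIV z (fst p)) * snd p z)) \<le> M * \<eta>"
      using L(2)[rule_format, of F M z] strip_extD[OF *(1)] *(2,3) by blast
    then show "norm (F z - (\<Sum>p\<leftarrow>L. of_real (f (to_torus (fst p))) * snd p z)) \<le> M * \<eta>"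
      unfolding upd strip_extD(3)[OF *(1)] .
  qed
qed

section \<open>Lifts of compositions of trigonometric shears\<close>

text \<open>The symplectic gradient of the linear form \<open>phase a\<close>, with the signs of
  X_H: the direction in which any Hamiltonian depending on \<open>phase a\<close> alone moves
  points.\<close>

definition symp :: "('n + 'n \<Rightarrow> int) \<Rightarrow> complex ^ ('n::finite + 'n)" where
  "symp a = (\<chi> k. case k of Inl i \<Rightarrow> of_int (a (Inr i)) | Inr i \<Rightarrow> - of_int (a (Inl i)))"

text \<open>The standard symplectic form on frequencies, i.e. the bracket of two linear phases; for
  b in q alone and a in p alone it is the product l.b of the overview.\<close>

definition pairing :: "('n::finite + 'n \<Rightarrow> int) \<Rightarrow> ('n + 'n \<Rightarrow> int) \<Rightarrow> int" where
  "pairing a b = (\<Sum>i\<in>UNIV. a (Inl i) * b (Inr i) - a (Inr i) * b (Inl i))"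

definition q_only :: "('n + 'n \<Rightarrow> int) \<Rightarrow> bool" where "q_only a \<longleftrightarrow> (\<forall>i. a (Inr i) = 0)"
definition p_only :: "('n + 'n \<Rightarrow> int) \<Rightarrow> bool" where "p_only a \<longleftrightarrow> (\<forall>i. a (Inl i) = 0)"

text \<open>The cosine is here the velocity, not the Hamiltonian, which is an antiderivative of it
  along a. Since \<open>pairing a a = 0\<close>, the velocity is constant along the motion and the
  map is an exact flow.\<close>

definition tshear :: "('n + 'n \<Rightarrow> int) \<Rightarrow> real \<Rightarrow> real \<Rightarrow> complex ^ ('n::finite + 'n) \<Rightarrow> complex ^ ('n + 'n)" where
  "tshear a c \<theta> z = z + (of_real c * ctrig a \<theta> z) *s symp a"

text \<open>Entire maps of the complex cover: compositions of any length are defined on all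
  strips.\<close>

inductive shear_lift :: "(complex ^ ('n::finite + 'n) \<Rightarrow> complex ^ ('n + 'n)) \<Rightarrow> bool" where
  shear_lift_id: "shear_lift (\<lambda>z. z)"
| shear_lift_step: "shear_lift \<Psi> \<Longrightarrow> q_only a \<or> p_only a \<Longrightarrow> shear_lift (\<lambda>z. tshear a c \<theta> (\<Psi> z))"

lemma shear_lift_comp: "shear_lift \<Phi> \<Longrightarrow> shear_lift \<Psi> \<Longrightarrow> shear_lift (\<lambda>z. \<Phi> (\<Psi> z))"
  by (induction \<Phi> rule: shear_lift.induct) (auto intro: shear_lift.intros)

lemma shear_lift_tshear: "q_only a \<or> p_only a \<Longrightarrow> shear_lift (tshear a c \<theta>)"
  using shear_lift_step[OF shear_lift_id, of a c \<theta>] by simp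

lemma sum_UNIV_sum:
  "(\<Sum>k\<in>UNIV. f k) = (\<Sum>i\<in>UNIV. f (Inl i)) + (\<Sum>i\<in>UNIV. f (Inr i))"
  for f :: "'n::finite + 'n \<Rightarrow> 'a::comm_monoid_add"
  unfolding UNIV_Plus_UNIV[symmetric] by (subst sum.Plus) (simp_all add: o_def)

lemma phase_symp: "phase b (symp a) = of_int (pairing b a)"
  by (simp add: phase_def sum_UNIV_sum symp_def pairing_def sum_subtractf sum_negf)

lemma pairing_antisym: "pairing a b = - pairing b a"
  by (simp add: pairing_def sum_negf[symmetric] algebra_simps)

lemma pairing_q_only: "q_only a \<Longrightarrow> q_only b \<Longrightarrow> pairing a b = 0"
  by (simp add: pairing_def q_only_def)

lemma ctrig_add: "ctrig b \<phi> (z + v) = cos (of_real (2 * pi) * phase b z + of_real \<phi> + of_real (2 * pi) * phase b v)"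
  unfolding ctrig_def phase_add_right by (simp add: algebra_simps)

lemma ctrig_add_invariant: "phase b v = 0 \<Longrightarrow> ctrig b \<phi> (z + v) = ctrig b \<phi> z"
  by (simp add: ctrig_def phase_add_right)

lemma phase_sum_smult: "phase b (\<Sum>j\<in>J. c j *s v j) = (\<Sum>j\<in>J. c j * phase b (v j))"
  by (induction J rule: infinite_finite_induct)
    (simp_all add: phase_add_right phase_smult, simp_all add: phase_def)

text \<open>Shears that depend on q alone do not change q, so they commute and their displacements
  add up.\<close>

lemma shear_lift_sum:
  assumes "finite J" "\<And>j. j \<in> J \<Longrightarrow> q_only (b j)"
  shows "shear_lift (\<lambda>z. z + (\<Sum>j\<in>J. (of_real (c j) * ctrig (b j) (\<phi> j) z) *s symp (b j)))"
  using assms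
proof (induction J rule: finite_induct)
  case empty
  then show ?case by (simp add: shear_lift_id)
next
  case (insert i J)
  let ?u = "\<lambda>z. \<Sum>j\<in>J. (of_real (c j) * ctrig (b j) (\<phi> j) z) *s symp (b j)"
  have inv: "ctrig (b i) (\<phi> i) (z + ?u z) = ctrig (b i) (\<phi> i) z" for z
    by (rule ctrig_add_invariant)
      (use insert.prems in \<open>simp add: phase_sum_smult phase_symp pairing_q_only\<close>)
  have "shear_lift (\<lambda>z. tshear (b i) (c i) (\<phi> i) (z + ?u z))"
    using insert by (intro shear_lift_step) auto
  then show ?case
    using insert.hyps by (simp add: tshear_def inv add_ac)
qed

section \<open>Hamiltonians whose flow is approximated by shears\<close>

text \<open>Consistency of first order: one composition of shears per step, with error o(h)
  uniformly on each strip. Both signs of h are required, because otherwise negative multiples of a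
  field would be lost.\<close>

definition flowable :: "(complex ^ ('n::finite + 'n) \<Rightarrow> complex ^ ('n + 'n)) \<Rightarrow> bool" where
  "flowable X \<longleftrightarrow> (\<forall>\<rho> \<delta>. \<rho> > 0 \<longrightarrow> \<delta> > 0 \<longrightarrow> (\<exists>h0>0. \<forall>h. \<bar>h\<bar> \<le> h0 \<longrightarrow>
     (\<exists>\<Psi>. shear_lift \<Psi> \<and> (\<forall>w\<in>strip \<rho>. norm (\<Psi> w - w - h *\<^sub>R X w) \<le> \<delta> * \<bar>h\<bar>))))"

definition tame :: "(complex ^ 'k::finite \<Rightarrow> complex) \<Rightarrow> bool" where
  "tame K \<longleftrightarrow> holo_on K UNIV \<and> (\<forall>\<rho>. \<exists>B. \<forall>z\<in>strip \<rho>. norm (K z) \<le> B)"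

definition shear_ham :: "(complex ^ ('n::finite + 'n) \<Rightarrow> complex) \<Rightarrow> bool" where
  "shear_ham K \<longleftrightarrow> tame K \<and> flowable (cham K)"

lemma flowableD:
  assumes "flowable X" "\<rho> > 0" "\<delta> > 0"
  obtains h0 where "h0 > 0" "\<And>h. \<bar>h\<bar> \<le> h0 \<Longrightarrow>
    \<exists>\<Psi>. shear_lift \<Psi> \<and> (\<forall>w\<in>strip \<rho>. norm (\<Psi> w - w - h *\<^sub>R X w) \<le> \<delta> * \<bar>h\<bar>)"
  using assms unfolding flowable_def by blast

lemma tameD: "tame K \<Longrightarrow> holo_on K U" "tame K \<Longrightarrow> \<exists>B. \<forall>z\<in>strip \<rho>. norm (K z) \<le> B"
  unfolding tame_def using holo_on_subset by auto

lemma tame_add: assumes "tame F" "tame G" shows "tame (\<lambda>z. F z + G z)"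
  unfolding tame_def
proof (intro conjI allI)
  show "holo_on (\<lambda>z. F z + G z) UNIV" using assms by (intro holo_on_add tameD)
  fix \<rho>
  obtain B where "\<forall>z\<in>strip \<rho>. norm (F z) \<le> B" using assms tameD(2) by blast
  moreover obtain C where "\<forall>z\<in>strip \<rho>. norm (G z) \<le> C" using assms tameD(2) by blast
  ultimately show "\<exists>B. \<forall>z\<in>strip \<rho>. norm (F z + G z) \<le> B"
    by (intro exI[of _ "B + C"]) (auto intro!: norm_triangle_le add_mono)
qed

lemma tame_mult: assumes "tame F" "tame G" shows "tame (\<lambda>z. F z * G z)"
  unfolding tame_def
proof (intro conjI allI)
  show "holo_on (\<lambda>z. F z * G z) UNIV" using assms by (intro holo_on_mult tameD)
  fix \<rho>
  obtain B where B: "\<forall>z\<in>strip \<rho>. norm (F z) \<le> B" using assms tameD(2) by blast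
  obtain C where C: "\<forall>z\<in>strip \<rho>. norm (G z) \<le> C" using assms tameD(2) by blast
  have "norm (F z * G z) \<le> B * C" if "z \<in> strip \<rho>" for z
  proof -
    have "norm (F z) \<le> B" "norm (G z) \<le> C" using B C that by auto
    moreover have "0 \<le> B" using calculation norm_ge_zero order_trans by blast
    ultimately show ?thesis unfolding norm_mult by (intro mult_mono) auto
  qed
  then show "\<exists>B. \<forall>z\<in>strip \<rho>. norm (F z * G z) \<le> B" by blast
qed

lemma tame_const: "tame (\<lambda>_. c)"
  unfolding tame_def by (auto intro: holo_on_const)

lemma tame_ctrig: "tame (ctrig a \<theta>)"
  unfolding tame_def using holo_on_ctrig ctrig_bounded by blast

lemma tame_sum: "(\<And>i. i \<in> A \<Longrightarrow> tame (F i)) \<Longrightarrow> tame (\<lambda>z. \<Sum>i\<in>A. F i z)"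
  by (induction A rule: infinite_finite_induct) (auto intro: tame_add tame_const)

lemma cham_tame:
  fixes K :: "complex ^ ('n::finite + 'n) \<Rightarrow> complex"
  assumes "tame K"
  obtains B where "0 \<le> B" "\<And>z. z \<in> strip \<rho> \<Longrightarrow> norm (cham K z) \<le> B"
    "\<And>z w. z \<in> strip \<rho> \<Longrightarrow> w \<in> strip \<rho> \<Longrightarrow> norm (cham K z - cham K w) \<le> B * norm (z - w)"
proof -
  \<comment> \<open>The margin 2 pays for the Lipschitz bound, which loses twice the Cauchy width s
    = 1; the bound on the field itself uses s = 2.\<close>
  obtain C where C: "\<And>z. z \<in> strip (\<rho> + 2) \<Longrightarrow> norm (K z) \<le> C" using tameD(2)[OF assms] by blast
  define B where "B = real CARD('n + 'n) * \<bar>C\<bar>"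
  have C': "norm (K z) \<le> \<bar>C\<bar>" if "z \<in> strip (\<rho> + 2)" for z using C[OF that] by simp
  show ?thesis
  proof (rule that[of B])
    show "0 \<le> B" by (simp add: B_def)
    show "norm (cham K z) \<le> B" if "z \<in> strip \<rho>" for z
    proof -
      have "norm (cham K z) \<le> real CARD('n + 'n) * (\<bar>C\<bar> / 2)"
        using cham_bound[OF tameD(1)[OF assms] C', where s = 2 and z = z] that by simp
      also have "\<dots> \<le> B" unfolding B_def by (intro mult_left_mono) auto
      finally show ?thesis .
    qed
    show "norm (cham K z - cham K w) \<le> B * norm (z - w)" if "z \<in> strip \<rho>" "w \<in> strip \<rho>" for z w
      using cham_lipschitz[OF tameD(1)[OF assms] C', where s = 1 and z = z and w = w] that by (simp add: B_def)
  qed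
qed

lemma scaleR_smult: "h *\<^sub>R (of_real c *s v) = (h * c) *\<^sub>R (v :: complex ^ 'k)"
  by (simp add: vec_eq_iff scaleR_conv_of_real[where 'a = complex])

lemma scaleR_smult': "h *\<^sub>R (v :: complex ^ 'k) = of_real h *s v"
  by (simp add: vec_eq_iff scaleR_conv_of_real[where 'a = complex])

section \<open>Stability of consistency under multiples, sums and limits\<close>

lemma flowable_scale:
  assumes "flowable X"
  shows "flowable (\<lambda>z. of_real c *s X z)"
  unfolding flowable_def
proof (intro allI impI)
  fix \<rho> \<delta> :: real assume "\<rho> > 0" "\<delta> > 0"
  \<comment> \<open>Using \<open>\<bar>c\<bar> + 1\<close> in place of \<open>\<bar>c\<bar>\<close>
    covers c = 0.\<close>
  have c: "\<bar>c\<bar> + 1 > 0" by simp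
  then obtain h0 where h0: "h0 > 0" "\<And>h. \<bar>h\<bar> \<le> h0 \<Longrightarrow>
    \<exists>\<Psi>. shear_lift \<Psi> \<and> (\<forall>w\<in>strip \<rho>. norm (\<Psi> w - w - h *\<^sub>R X w) \<le> \<delta> / (\<bar>c\<bar> + 1) * \<bar>h\<bar>)"
    using flowableD[OF assms \<open>\<rho> > 0\<close>, of "\<delta> / (\<bar>c\<bar> + 1)"] \<open>\<delta> > 0\<close> by (metis divide_pos_pos)
  show "\<exists>h0>0. \<forall>h. \<bar>h\<bar> \<le> h0 \<longrightarrow> (\<exists>\<Psi>. shear_lift \<Psi> \<and>
      (\<forall>w\<in>strip \<rho>. norm (\<Psi> w - w - h *\<^sub>R (of_real c *s X w)) \<le> \<delta> * \<bar>h\<bar>))"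
  proof (intro exI[of _ "h0 / (\<bar>c\<bar> + 1)"] conjI allI impI)
    show "h0 / (\<bar>c\<bar> + 1) > 0" using h0(1) c by simp
    fix h assume "\<bar>h\<bar> \<le> h0 / (\<bar>c\<bar> + 1)"
    then have "\<bar>h\<bar> * (\<bar>c\<bar> + 1) \<le> h0" using c by (simp add: field_simps)
    then have "\<bar>h * c\<bar> \<le> h0" by (simp add: abs_mult algebra_simps)
    then obtain \<Psi> where \<Psi>: "shear_lift \<Psi>"
      "\<And>w. w \<in> strip \<rho> \<Longrightarrow> norm (\<Psi> w - w - (h * c) *\<^sub>R X w) \<le> \<delta> / (\<bar>c\<bar> + 1) * \<bar>h * c\<bar>"
      using h0(2) by blast
    have "\<delta> / (\<bar>c\<bar> + 1) * \<bar>h * c\<bar> = \<delta> * \<bar>h\<bar> * (\<bar>c\<bar> / (\<bar>c\<bar> + 1))" by (simp add: abs_mult)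
    also have "\<dots> \<le> \<delta> * \<bar>h\<bar> * 1" using \<open>\<delta> > 0\<close> by (intro mult_left_mono) auto
    finally have "\<delta> / (\<bar>c\<bar> + 1) * \<bar>h * c\<bar> \<le> \<delta> * \<bar>h\<bar>" by simp
    then show "\<exists>\<Psi>. shear_lift \<Psi> \<and> (\<forall>w\<in>strip \<rho>. norm (\<Psi> w - w - h *\<^sub>R (of_real c *s X w)) \<le> \<delta> * \<bar>h\<bar>)"
      unfolding scaleR_smult using \<Psi> by (intro exI[of _ \<Psi>]) (auto intro: order_trans)
  qed
qed

text \<open>Lie-Trotter splitting. Besides the two consistency errors, the composition evaluates X
  at the displaced point; by the Lipschitz bound this changes the step only by a term of order h
  squared. Each of the three errors gets \<delta> / 3.\<close>

lemma flowable_add: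
  assumes X: "flowable X" and Y: "flowable Y"
    and lip: "\<And>\<rho>. \<exists>L\<ge>0. \<forall>z\<in>strip \<rho>. \<forall>w\<in>strip \<rho>. norm (X z - X w) \<le> L * norm (z - w)"
    and bd: "\<And>\<rho>. \<exists>B\<ge>0. \<forall>z\<in>strip \<rho>. norm (Y z) \<le> B"
  shows "flowable (\<lambda>z. X z + Y z)"
  unfolding flowable_def
proof (intro allI impI)
  fix \<rho> \<delta> :: real assume \<rho>: "\<rho> > 0" and \<delta>: "\<delta> > 0"
  obtain L where L: "L \<ge> 0" "\<And>z w. z \<in> strip (\<rho> + 1) \<Longrightarrow> w \<in> strip (\<rho> + 1) \<Longrightarrow> norm (X z - X w) \<le> L * norm (z - w)"
    using lip by blast
  obtain B where B: "B \<ge> 0" "\<And>z. z \<in> strip \<rho> \<Longrightarrow> norm (Y z) \<le> B" using bd by blast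
  have \<rho>1: "\<rho> + 1 > 0" and \<delta>3: "\<delta> / 3 > 0" using \<rho> \<delta> by auto
  obtain hX where hX: "hX > 0" "\<And>h. \<bar>h\<bar> \<le> hX \<Longrightarrow>
    \<exists>\<Psi>. shear_lift \<Psi> \<and> (\<forall>w\<in>strip (\<rho> + 1). norm (\<Psi> w - w - h *\<^sub>R X w) \<le> \<delta> / 3 * \<bar>h\<bar>)"
    using flowableD[OF X \<rho>1 \<delta>3] by metis
  obtain hY where hY: "hY > 0" "\<And>h. \<bar>h\<bar> \<le> hY \<Longrightarrow>
    \<exists>\<Psi>. shear_lift \<Psi> \<and> (\<forall>w\<in>strip \<rho>. norm (\<Psi> w - w - h *\<^sub>R Y w) \<le> \<delta> / 3 * \<bar>h\<bar>)"
    using flowableD[OF Y \<rho> \<delta>3] by metis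
  \<comment> \<open>Bound on the displacement per unit of time under the approximate flow of Y:
    speed plus consistency error.\<close>
  define D where "D = B + \<delta>"
  have D: "D > 0" using B \<delta> by (simp add: D_def)
  \<comment> \<open>The bound 1 / D keeps the intermediate point in the strip of width \<rho> + 1;
    the last one makes the second-order term at most \<delta> / 3 times h.\<close>
  define h0 where "h0 = min (min hX hY) (min (1 / D) (\<delta> / (3 * (L + 1) * D)))"
  have h0: "h0 > 0" using hX(1) hY(1) D \<delta> L(1) by (simp add: h0_def)
  show "\<exists>h0>0. \<forall>h. \<bar>h\<bar> \<le> h0 \<longrightarrow> (\<exists>\<Psi>. shear_lift \<Psi> \<and>
      (\<forall>w\<in>strip \<rho>. norm (\<Psi> w - w - h *\<^sub>R (X w + Y w)) \<le> \<delta> * \<bar>h\<bar>))"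
  proof (intro exI[of _ h0] conjI allI impI h0)
    fix h assume h: "\<bar>h\<bar> \<le> h0"
    then have hh: "\<bar>h\<bar> \<le> hX" "\<bar>h\<bar> \<le> hY" "\<bar>h\<bar> \<le> 1 / D" "\<bar>h\<bar> \<le> \<delta> / (3 * (L + 1) * D)"
      by (auto simp: h0_def)
    have h1: "\<bar>h\<bar> * D \<le> 1" using hh(3) D by (simp add: field_simps)
    have "\<bar>h\<bar> * (3 * (L + 1) * D) \<le> \<delta>"
      using hh(4) by (subst (asm) pos_le_divide_eq) (use D L(1) in auto)
    then have "L * (\<bar>h\<bar> * D) + \<bar>h\<bar> * D \<le> \<delta> / 3" by (simp add: algebra_simps)
    moreover have "0 \<le> \<bar>h\<bar> * D" using D by simp
    ultimately have h2: "L * (\<bar>h\<bar> * D) \<le> \<delta> / 3" by linarith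
    obtain \<Phi> where \<Phi>0: "shear_lift \<Phi>" "\<forall>w\<in>strip (\<rho> + 1). norm (\<Phi> w - w - h *\<^sub>R X w) \<le> \<delta> / 3 * \<bar>h\<bar>"
      using hX(2)[OF hh(1)] by (elim exE conjE)
    note \<Phi> = \<Phi>0(1) bspec[OF \<Phi>0(2)]
    obtain \<Psi> where \<Psi>0: "shear_lift \<Psi>" "\<forall>w\<in>strip \<rho>. norm (\<Psi> w - w - h *\<^sub>R Y w) \<le> \<delta> / 3 * \<bar>h\<bar>"
      using hY(2)[OF hh(2)] by (elim exE conjE)
    note \<Psi> = \<Psi>0(1) bspec[OF \<Psi>0(2)]
    show "\<exists>\<Psi>. shear_lift \<Psi> \<and> (\<forall>w\<in>strip \<rho>. norm (\<Psi> w - w - h *\<^sub>R (X w + Y w)) \<le> \<delta> * \<bar>h\<bar>)"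
    proof (rule exI[of _ "\<lambda>z. \<Phi> (\<Psi> z)"], rule conjI, rule shear_lift_comp[OF \<Phi>(1) \<Psi>(1)], rule ballI)
      fix w :: "complex ^ ('a + 'a)" assume w: "w \<in> strip \<rho>"
      have "\<Psi> w - w = (\<Psi> w - w - h *\<^sub>R Y w) + h *\<^sub>R Y w" by simp
      then have "norm (\<Psi> w - w) \<le> norm (\<Psi> w - w - h *\<^sub>R Y w) + norm (h *\<^sub>R Y w)"
        using norm_triangle_ineq[of "\<Psi> w - w - h *\<^sub>R Y w" "h *\<^sub>R Y w"] by (simp only:)
      also have "\<dots> \<le> \<delta> / 3 * \<bar>h\<bar> + \<bar>h\<bar> * B"
        using \<Psi>(2)[OF w] B(2)[OF w] by (intro add_mono) (auto intro: mult_left_mono)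
      also have "\<dots> \<le> \<bar>h\<bar> * D" using \<delta> by (simp add: D_def algebra_simps)
      finally have near: "norm (\<Psi> w - w) \<le> \<bar>h\<bar> * D" .
      have w1: "\<Psi> w \<in> strip (\<rho> + 1)" by (rule strip_near[OF w near]) (use h1 in simp)
      have w2: "w \<in> strip (\<rho> + 1)" using w by (rule strip_mono') simp
      have "norm (h *\<^sub>R (X (\<Psi> w) - X w)) \<le> \<bar>h\<bar> * (L * (\<bar>h\<bar> * D))"
        using L(2)[OF w1 w2] mult_left_mono[OF near L(1)] by (auto intro!: mult_left_mono)
      also have "\<dots> \<le> \<bar>h\<bar> * (\<delta> / 3)" using h2 by (intro mult_left_mono) auto
      finally have l: "norm (h *\<^sub>R (X (\<Psi> w) - X w)) \<le> \<delta> / 3 * \<bar>h\<bar>" by (simp add: mult.commute)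
      have "\<Phi> (\<Psi> w) - w - h *\<^sub>R (X w + Y w) = (\<Phi> (\<Psi> w) - \<Psi> w - h *\<^sub>R X (\<Psi> w)) +
          ((\<Psi> w - w - h *\<^sub>R Y w) + h *\<^sub>R (X (\<Psi> w) - X w))" by (simp add: algebra_simps)
      also have "norm \<dots> \<le> \<delta> / 3 * \<bar>h\<bar> + (\<delta> / 3 * \<bar>h\<bar> + \<delta> / 3 * \<bar>h\<bar>)"
        by (intro norm_triangle_le add_mono \<Phi>(2)[OF w1] \<Psi>(2)[OF w] l)
      finally show "norm (\<Phi> (\<Psi> w) - w - h *\<^sub>R (X w + Y w)) \<le> \<delta> * \<bar>h\<bar>" by simp
    qed
  qed
qed

lemma shear_ham_add:
  assumes "shear_ham F" "shear_ham G"
  shows "shear_ham (\<lambda>z. F z + G z)"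
proof -
  have t: "tame F" "tame G" using assms by (auto simp: shear_ham_def)
  have "flowable (\<lambda>z. cham F z + cham G z)"
  proof (rule flowable_add)
    show "flowable (cham F)" "flowable (cham G)" using assms by (auto simp: shear_ham_def)
    show "\<exists>L\<ge>0. \<forall>z\<in>strip \<rho>. \<forall>w\<in>strip \<rho>. norm (cham F z - cham F w) \<le> L * norm (z - w)" for \<rho>
      by (rule cham_tame[OF t(1), of \<rho>]) blast
    show "\<exists>B\<ge>0. \<forall>z\<in>strip \<rho>. norm (cham G z) \<le> B" for \<rho>
      by (rule cham_tame[OF t(2), of \<rho>]) blast
  qed
  moreover have "cham (\<lambda>z. F z + G z) = (\<lambda>z. cham F z + cham G z)"
    using cham_add[OF tameD(1)[OF t(1), of UNIV] tameD(1)[OF t(2), of UNIV]] by auto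
  ultimately show ?thesis using tame_add[OF t] by (simp add: shear_ham_def)
qed

lemma shear_ham_scale:
  assumes "shear_ham F"
  shows "shear_ham (\<lambda>z. of_real c * F z)"
proof -
  have t: "tame F" using assms by (simp add: shear_ham_def)
  have "cham (\<lambda>z. of_real c * F z) = (\<lambda>z. of_real c *s cham F z)"
    using cham_cmult[OF tameD(1)[OF t, of UNIV]] by auto
  then show ?thesis using flowable_scale[of "cham F" c] assms tame_mult[OF tame_const t]
    by (simp add: shear_ham_def)
qed

text \<open>The tolerance \<delta> is given first, so K' may be fixed according to it and only then
  the step size of K' be used; no uniformity over the approximants is asked for. Cauchy's estimate
  costs the width 1.\<close>

lemma shear_ham_limit:
  fixes K :: "complex ^ ('n::finite + 'n) \<Rightarrow> complex"
  assumes t: "tame K"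
    and lim: "\<And>\<rho> \<delta>. \<rho> > 0 \<Longrightarrow> \<delta> > 0 \<Longrightarrow> \<exists>K'. shear_ham K' \<and> (\<forall>z\<in>strip \<rho>. norm (K z - K' z) \<le> \<delta>)"
  shows "shear_ham K"
  unfolding shear_ham_def flowable_def
proof (intro conjI t allI impI)
  fix \<rho> \<delta> :: real assume \<rho>: "\<rho> > 0" and \<delta>: "\<delta> > 0"
  let ?c = "real CARD('n + 'n)"
  have c: "?c > 0" by (simp only: of_nat_0_less_iff zero_less_card_finite)
  obtain K' where K': "shear_ham K'" "\<And>z. z \<in> strip (\<rho> + 1) \<Longrightarrow> norm (K z - K' z) \<le> \<delta> / (2 * ?c)"
    using lim[of "\<rho> + 1" "\<delta> / (2 * ?c)"] \<rho> \<delta> c by (metis add_pos_pos divide_pos_pos mult_pos_pos zero_less_numeral zero_less_one)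
  have t': "tame K'" and f': "flowable (cham K')" using K' by (auto simp: shear_ham_def)
  have close: "norm (cham K' w - cham K w) \<le> \<delta> / 2" if "w \<in> strip \<rho>" for w
    using cham_diff_bound[OF tameD(1)[OF t] tameD(1)[OF t'] K'(2), where s = 1 and z = w] that c
    by (simp add: norm_minus_commute field_simps)
  obtain h0 where h0: "h0 > 0" "\<And>h. \<bar>h\<bar> \<le> h0 \<Longrightarrow>
    \<exists>\<Psi>. shear_lift \<Psi> \<and> (\<forall>w\<in>strip \<rho>. norm (\<Psi> w - w - h *\<^sub>R cham K' w) \<le> \<delta> / 2 * \<bar>h\<bar>)"
    using flowableD[OF f' \<rho>, of "\<delta> / 2"] \<delta> by (metis half_gt_zero)
  show "\<exists>h0>0. \<forall>h. \<bar>h\<bar> \<le> h0 \<longrightarrow> (\<exists>\<Psi>. shear_lift \<Psi> \<and>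
      (\<forall>w\<in>strip \<rho>. norm (\<Psi> w - w - h *\<^sub>R cham K w) \<le> \<delta> * \<bar>h\<bar>))"
  proof (intro exI[of _ h0] conjI allI impI h0(1))
    fix h assume "\<bar>h\<bar> \<le> h0"
    then obtain \<Psi> where \<Psi>: "shear_lift \<Psi>" "\<And>w. w \<in> strip \<rho> \<Longrightarrow> norm (\<Psi> w - w - h *\<^sub>R cham K' w) \<le> \<delta> / 2 * \<bar>h\<bar>"
      using h0(2) by blast
    have "norm (\<Psi> w - w - h *\<^sub>R cham K w) \<le> \<delta> * \<bar>h\<bar>" if w: "w \<in> strip \<rho>" for w
    proof -
      have "\<Psi> w - w - h *\<^sub>R cham K w = (\<Psi> w - w - h *\<^sub>R cham K' w) + h *\<^sub>R (cham K' w - cham K w)"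
        by (simp add: algebra_simps)
      also have "norm \<dots> \<le> \<delta> / 2 * \<bar>h\<bar> + \<bar>h\<bar> * (\<delta> / 2)"
        unfolding norm_scaleR[symmetric]
        by (intro norm_triangle_le add_mono \<Psi>(2) w) (simp only: norm_scaleR, rule mult_left_mono[OF close[OF w]], simp)
      finally show ?thesis by simp
    qed
    then show "\<exists>\<Psi>. shear_lift \<Psi> \<and> (\<forall>w\<in>strip \<rho>. norm (\<Psi> w - w - h *\<^sub>R cham K w) \<le> \<delta> * \<bar>h\<bar>)"
      using \<Psi>(1) by blast
  qed
qed

section \<open>From shear Hamiltonians to all plane waves\<close>

lemma cos_minus_half_pi: "cos (w - of_real (pi / 2)) = sin (w :: complex)"
  by (simp add: cos_diff flip: cos_of_real sin_of_real)

text \<open>Sines are written as cosines with shifted phase, so derivatives stay within the family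
  and share its bounds.\<close>

lemma ctrig_minus_half_pi: "ctrig a (\<theta> - pi / 2) z = sin (of_real (2 * pi) * phase a z + of_real \<theta>)"
proof -
  have "of_real (2 * pi) * phase a z + complex_of_real (\<theta> - pi / 2) =
      (of_real (2 * pi) * phase a z + of_real \<theta>) - of_real (pi / 2)" by simp
  then show ?thesis unfolding ctrig_def by (simp only: cos_minus_half_pi)
qed

lemma cpart_ctrig: "cpart k (ctrig a \<theta>) z = - (of_real (2 * pi) * ctrig a (\<theta> - pi / 2) z) * of_int (a k)"
  unfolding cpart_def ctrig_minus_half_pi unfolding ctrig_def phase_add_right phase_axis
  by (rule DERIV_imp_deriv) (auto intro!: derivative_eq_intros)

lemma smult_symp_nth: "(c *s symp a) $ k = c * (case k of Inl i \<Rightarrow> of_int (a (Inr i)) | Inr i \<Rightarrow> - of_int (a (Inl i)))"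
  by (simp add: symp_def)

lemma cham_ctrig: "cham (ctrig a \<theta>) z = (- (of_real (2 * pi) * ctrig a (\<theta> - pi / 2) z)) *s symp a"
  unfolding vec_eq_iff smult_symp_nth
  by (auto simp: cham_def cpart_ctrig split: sum.split)

text \<open>The velocity is constant along orbits, so the shear is the Euler step itself and the
  consistency error is 0.\<close>

lemma shear_ham_ctrig_block:
  assumes "q_only a \<or> p_only a"
  shows "shear_ham (ctrig a \<theta>)"
  unfolding shear_ham_def flowable_def
proof (intro conjI tame_ctrig allI impI exI[of _ 1])
  fix \<rho> \<delta> h :: real assume "\<rho> > 0" "\<delta> > 0"
  have "tshear a (h * - (2 * pi)) (\<theta> - pi / 2) w - w - h *\<^sub>R cham (ctrig a \<theta>) w = 0" for w
    unfolding cham_ctrig tshear_def by (simp add: vec_eq_iff scaleR_conv_of_real[where 'a = complex])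
  then show "\<exists>\<Psi>. shear_lift \<Psi> \<and> (\<forall>w\<in>strip \<rho>. norm (\<Psi> w - w - h *\<^sub>R cham (ctrig a \<theta>) w) \<le> \<delta> * \<bar>h\<bar>)"
    using shear_lift_tshear[OF assms, of "h * - (2 * pi)" "\<theta> - pi / 2"] \<open>\<delta> > 0\<close>
    by (intro exI[of _ "tshear a (h * - (2 * pi)) (\<theta> - pi / 2)"]) simp
qed simp

text \<open>This is differentiability of cos and sin at 0; a little-o is enough for consistency, so
  no Taylor coefficients appear.\<close>

lemma small_trig:
  fixes \<eta> :: real
  assumes "\<eta> > 0"
  obtains d where "d > 0" "\<And>u :: complex. norm u \<le> d \<Longrightarrow> norm (1 - cos u) \<le> \<eta> * norm u"
    "\<And>u :: complex. norm u \<le> d \<Longrightarrow> norm (sin u - u) \<le> \<eta> * norm u"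
proof -
  have c: "(cos has_derivative (\<lambda>h. 0)) (at (0 :: complex))"
    using DERIV_cos[of "0 :: complex"] by (simp add: has_field_derivative_def lambda_zero)
  have s: "(sin has_derivative (\<lambda>h. h)) (at (0 :: complex))"
    by (rule has_derivative_eq_rhs[OF DERIV_sin[unfolded has_field_derivative_def]]) auto
  obtain d1 where d1: "d1 > 0" "\<And>u :: complex. norm u < d1 \<Longrightarrow> norm (cos u - 1) \<le> \<eta> * norm u"
    using c assms unfolding has_derivative_at_alt by auto
  obtain d2 where d2: "d2 > 0" "\<And>u :: complex. norm u < d2 \<Longrightarrow> norm (sin u - u) \<le> \<eta> * norm u"
    using s assms unfolding has_derivative_at_alt by auto
  show ?thesis
  proof (rule that[of "min d1 d2 / 2"])
    show "min d1 d2 / 2 > 0" using d1(1) d2(1) by simp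
    fix u :: complex assume u: "norm u \<le> min d1 d2 / 2"
    then have "norm u < d1" "norm u < d2" using d1(1) d2(1) by linarith+
    then show "norm (1 - cos u) \<le> \<eta> * norm u" "norm (sin u - u) \<le> \<eta> * norm u"
      using d1(2)[of u] d2(2)[of u] by (simp_all add: norm_minus_commute)
  qed
qed

lemma cos_first_order:
  fixes u B :: complex
  assumes "norm (1 - cos u) \<le> \<eta> * norm u" "norm (sin u - u) \<le> \<eta> * norm u" "norm (cos B) \<le> C" "norm (sin B) \<le> C"
  shows "norm (cos B - cos (B + u) - u * sin B) \<le> 2 * C * \<eta> * norm u"
proof -
  have "cos B - cos (B + u) - u * sin B = cos B * (1 - cos u) + sin B * (sin u - u)"
    by (simp add: cos_add algebra_simps)
  also have "norm \<dots> \<le> norm (cos B) * norm (1 - cos u) + norm (sin B) * norm (sin u - u)"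
    by (rule order_trans[OF norm_triangle_ineq]) (simp add: norm_mult)
  also have "\<dots> \<le> C * (\<eta> * norm u) + C * (\<eta> * norm u)"
  proof -
    have "0 \<le> C" using assms(3) norm_ge_zero order_trans by blast
    then show ?thesis using assms by (intro add_mono mult_mono) auto
  qed
  finally show ?thesis by simp
qed

definition cos_sum :: "('k \<Rightarrow> int) \<Rightarrow> real \<Rightarrow> nat set \<Rightarrow> (nat \<Rightarrow> 'k \<Rightarrow> int) \<Rightarrow> (nat \<Rightarrow> real) \<Rightarrow> (nat \<Rightarrow> real) \<Rightarrow>
    complex ^ 'k::finite \<Rightarrow> complex" where
  "cos_sum a \<theta> J b \<phi> \<epsilon> z = cos (of_real (2 * pi) * phase a z + of_real \<theta> +
     (\<Sum>j\<in>J. of_real (\<epsilon> j) * ctrig (b j) (\<phi> j) z))"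

lemma cos_sum_arg_bounded:
  fixes a :: "'k::finite \<Rightarrow> int"
  obtains B where "\<And>z. z \<in> strip \<rho> \<Longrightarrow> \<bar>Im (of_real (2 * pi) * phase a z + of_real \<theta> +
     (\<Sum>j\<in>J. of_real (\<epsilon> j) * ctrig (b j) (\<phi> j) z))\<bar> \<le> B"
proof -
  have "tame (\<lambda>z. \<Sum>j\<in>J. of_real (\<epsilon> j) * ctrig (b j) (\<phi> j) z)"
    by (intro tame_sum tame_mult tame_const tame_ctrig)
  then obtain C where C: "\<And>z. z \<in> strip \<rho> \<Longrightarrow> norm (\<Sum>j\<in>J. of_real (\<epsilon> j) * ctrig (b j) (\<phi> j) z) \<le> C"
    using tameD(2) by blast
  show ?thesis
  proof (rule that)
    fix z :: "complex ^ 'k" assume z: "z \<in> strip \<rho>"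
    have "\<bar>Im (\<Sum>j\<in>J. of_real (\<epsilon> j) * ctrig (b j) (\<phi> j) z)\<bar> \<le> C"
      using C[OF z] abs_Im_le_cmod order_trans by blast
    moreover have "\<bar>2 * pi * Im (phase a z)\<bar> \<le> 2 * pi * ((\<Sum>i\<in>UNIV. \<bar>of_int (a i)\<bar>) * \<rho>)"
      using mult_left_mono[OF Im_phase_le[OF z, of a], of "2 * pi"] by (simp add: abs_mult)
    moreover have "Im (of_real (2 * pi) * phase a z + of_real \<theta> + (\<Sum>j\<in>J. of_real (\<epsilon> j) * ctrig (b j) (\<phi> j) z)) =
        2 * pi * Im (phase a z) + Im (\<Sum>j\<in>J. of_real (\<epsilon> j) * ctrig (b j) (\<phi> j) z)"
      by simp
    ultimately show "\<bar>Im (of_real (2 * pi) * phase a z + of_real \<theta> + (\<Sum>j\<in>J. of_real (\<epsilon> j) * ctrig (b j) (\<phi> j) z))\<bar>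
        \<le> 2 * pi * ((\<Sum>i\<in>UNIV. \<bar>of_int (a i)\<bar>) * \<rho>) + C"
      using abs_triangle_ineq[of "2 * pi * Im (phase a z)" "Im (\<Sum>j\<in>J. of_real (\<epsilon> j) * ctrig (b j) (\<phi> j) z)"]
      by linarith
  qed
qed

lemma holo_on_cos_sum_arg:
  "holo_on (\<lambda>z. of_real (2 * pi) * phase a z + of_real \<theta> + (\<Sum>j\<in>J. of_real (\<epsilon> j) * ctrig (b j) (\<phi> j) z)) U"
  by (intro holo_on_add holo_on_cmult holo_on_phase holo_on_const holo_on_sum holo_on_ctrig)

lemma tame_cos_sum: "tame (cos_sum a \<theta> J b \<phi> \<epsilon>)"
  unfolding tame_def
proof (intro conjI allI)
  show "holo_on (cos_sum a \<theta> J b \<phi> \<epsilon>) UNIV"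
    unfolding cos_sum_def
    by (rule holo_on_comp[OF holo_on_cos_sum_arg]) (auto intro!: derivative_eq_intros)
  fix \<rho>
  obtain B where B: "\<And>z. z \<in> strip \<rho> \<Longrightarrow> \<bar>Im (of_real (2 * pi) * phase a z + of_real \<theta> +
     (\<Sum>j\<in>J. of_real (\<epsilon> j) * ctrig (b j) (\<phi> j) z))\<bar> \<le> B"
    using cos_sum_arg_bounded[of \<rho> a \<theta> \<epsilon> b \<phi> J] by blast
  have "norm (cos_sum a \<theta> J b \<phi> \<epsilon> z) \<le> exp B" if "z \<in> strip \<rho>" for z
    unfolding cos_sum_def by (rule order_trans[OF norm_cos_le_exp_Im]) (use B[OF that] in simp)
  then show "\<exists>B. \<forall>z\<in>strip \<rho>. norm (cos_sum a \<theta> J b \<phi> \<epsilon> z) \<le> B" by blast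
qed

lemma cos_sum_minus_half_pi:
  "cos_sum a (\<theta> - pi / 2) J b \<phi> \<epsilon> z = sin (of_real (2 * pi) * phase a z + of_real \<theta> +
     (\<Sum>j\<in>J. of_real (\<epsilon> j) * ctrig (b j) (\<phi> j) z))"
proof -
  have "of_real (2 * pi) * phase a z + complex_of_real (\<theta> - pi / 2) + S =
      (of_real (2 * pi) * phase a z + of_real \<theta> + S) - of_real (pi / 2)" for S by simp
  then show ?thesis unfolding cos_sum_def by (simp only: cos_minus_half_pi)
qed

lemma cpart_cos_sum:
  "cpart k (cos_sum a \<theta> J b \<phi> \<epsilon>) z = - cos_sum a (\<theta> - pi / 2) J b \<phi> \<epsilon> z *
    (of_real (2 * pi) * of_int (a k) + (\<Sum>j\<in>J. of_real (\<epsilon> j) * cpart k (ctrig (b j) (\<phi> j)) z))"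
proof -
  have arg: "((\<lambda>\<zeta>. of_real (2 * pi) * phase a (z + axis k \<zeta>) + of_real \<theta> +
      (\<Sum>j\<in>J. of_real (\<epsilon> j) * ctrig (b j) (\<phi> j) (z + axis k \<zeta>))) has_field_derivative
      (of_real (2 * pi) * of_int (a k) + (\<Sum>j\<in>J. of_real (\<epsilon> j) * cpart k (ctrig (b j) (\<phi> j)) z))) (at 0)"
  proof -
    have 1: "((\<lambda>\<zeta>. of_real (2 * pi) * phase a (z + axis k \<zeta>) + of_real \<theta>) has_field_derivative of_real (2 * pi) * of_int (a k)) (at 0)"
      unfolding phase_add_right phase_axis by (auto intro!: derivative_eq_intros)
    have "((\<lambda>\<zeta>. ctrig (b j) (\<phi> j) (z + axis k \<zeta>)) has_field_derivative cpart k (ctrig (b j) (\<phi> j)) z) (at 0)" for j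
      by (rule cpart_DERIV[OF holo_on_ctrig[of _ _ UNIV]]) simp
    then show ?thesis by (intro DERIV_add[OF 1] DERIV_sum DERIV_cmult)
  qed
  have z0: "z + axis k 0 = z" by (simp add: vec_eq_iff axis_def)
  have "((\<lambda>\<zeta>. cos_sum a \<theta> J b \<phi> \<epsilon> (z + axis k \<zeta>)) has_field_derivative
      - cos_sum a (\<theta> - pi / 2) J b \<phi> \<epsilon> z *
      (of_real (2 * pi) * of_int (a k) + (\<Sum>j\<in>J. of_real (\<epsilon> j) * cpart k (ctrig (b j) (\<phi> j)) z))) (at 0)"
    unfolding cos_sum_minus_half_pi using DERIV_chain2[OF DERIV_cos arg] unfolding z0 cos_sum_def .
  then show ?thesis unfolding cpart_def by (rule DERIV_imp_deriv)
qed

lemma cham_cos_sum: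
  "cham (cos_sum a \<theta> J b \<phi> \<epsilon>) z = (- cos_sum a (\<theta> - pi / 2) J b \<phi> \<epsilon> z) *s
    (of_real (2 * pi) *s symp a + (\<Sum>j\<in>J. of_real (\<epsilon> j) *s cham (ctrig (b j) (\<phi> j)) z))"
  by (simp add: vec_eq_iff cham_def cpart_cos_sum symp_def sum_negf algebra_simps split: sum.split)

text \<open>The \<open>p\<close>-shear with Hamiltonian \<open>cos (2\<pi> a\<cdot>p + \<theta>)\<close> is conjugated by a \<open>q\<close>-shear chosen
  such that it adds \<open>\<Sum>j. \<epsilon> j cos (2\<pi> b j\<cdot>q + \<phi> j)\<close> to the argument of the cosine.\<close>

lemma shear_ham_cos_sum:
  fixes a :: "'n::finite + 'n \<Rightarrow> int"
  assumes J: "finite J" and a: "p_only a" and b: "\<And>j. j \<in> J \<Longrightarrow> q_only (b j)"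
    and nz: "\<And>j. j \<in> J \<Longrightarrow> pairing (b j) a \<noteq> 0"
  shows "shear_ham (cos_sum a \<theta> J b \<phi> \<epsilon>)"
  unfolding shear_ham_def flowable_def
proof (intro conjI tame_cos_sum allI impI)
  fix \<rho> \<delta> :: real assume \<rho>: "\<rho> > 0" and \<delta>: "\<delta> > 0"
  define \<sigma> where "\<sigma> j = real_of_int (pairing (b j) a)" for j
  \<comment> \<open>With this amplitude the translation by u adds exactly
    \<open>\<Sum>j\<in>J. \<epsilon> j * ctrig (b j) (\<phi> j)\<close> to the argument of the
    cosine; the division by \<open>\<sigma> j\<close> is where nonresonance enters, and the sign
    comes from the antisymmetry of the pairing.\<close>
  define d where "d j = - \<epsilon> j / (2 * pi * \<sigma> j)" for j
  define s where "s = cos_sum a (\<theta> - pi / 2) J b \<phi> \<epsilon>"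
  define u where "u z = (\<Sum>j\<in>J. (of_real (d j) * ctrig (b j) (\<phi> j) z) *s symp (b j))" for z
  define u' where "u' z = (\<Sum>j\<in>J. (of_real (- d j) * ctrig (b j) (\<phi> j) z) *s symp (b j))" for z
  have \<sigma>: "\<sigma> j \<noteq> 0" if "j \<in> J" for j using nz[OF that] by (simp add: \<sigma>_def)
  have uinv: "ctrig (b j) (\<phi> j) (z + u z) = ctrig (b j) (\<phi> j) z" if "j \<in> J" for j z
    unfolding u_def
    by (rule ctrig_add_invariant) (use that b in \<open>simp add: phase_sum_smult phase_symp pairing_q_only\<close>)
  have pu: "of_real (2 * pi) * phase a (u z) = (\<Sum>j\<in>J. of_real (\<epsilon> j) * ctrig (b j) (\<phi> j) z)" for z
    unfolding u_def phase_sum_smult sum_distrib_left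
  proof (intro sum.cong refl)
    fix j assume j: "j \<in> J"
    have "phase a (symp (b j)) = - of_real (\<sigma> j)"
      unfolding phase_symp pairing_antisym[of a] \<sigma>_def by simp
    then show "of_real (2 * pi) * (of_real (d j) * ctrig (b j) (\<phi> j) z * phase a (symp (b j))) =
        of_real (\<epsilon> j) * ctrig (b j) (\<phi> j) z"
      using \<sigma>[OF j] by (simp add: d_def)
  qed
  have s_eq: "ctrig a (\<theta> - pi / 2) (z + u z) = s z" for z
    unfolding s_def cos_sum_minus_half_pi ctrig_minus_half_pi phase_add_right distrib_left pu
    by (simp add: add_ac)
  obtain S0 where S0: "\<And>z. z \<in> strip \<rho> \<Longrightarrow> norm (s z) \<le> S0"
    using tameD(2)[OF tame_cos_sum[of a "\<theta> - pi / 2" J b \<phi> \<epsilon>], of \<rho>] unfolding s_def by blast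
  define S where "S = max S0 0"
  have S: "S \<ge> 0" "\<And>z. z \<in> strip \<rho> \<Longrightarrow> norm (s z) \<le> S"
    unfolding S_def using S0 by (auto simp: le_max_iff_disj)
  have "\<forall>j. \<exists>C. \<forall>z\<in>strip \<rho>. norm (ctrig (b j) (\<phi> j) z) \<le> C \<and> norm (ctrig (b j) (\<phi> j - pi / 2) z) \<le> C"
  proof
    fix j
    obtain C1 C2 where "\<forall>z\<in>strip \<rho>. norm (ctrig (b j) (\<phi> j) z) \<le> C1" "\<forall>z\<in>strip \<rho>. norm (ctrig (b j) (\<phi> j - pi / 2) z) \<le> C2"
      using ctrig_bounded by meson
    then show "\<exists>C. \<forall>z\<in>strip \<rho>. norm (ctrig (b j) (\<phi> j) z) \<le> C \<and> norm (ctrig (b j) (\<phi> j - pi / 2) z) \<le> C"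
      by (intro exI[of _ "max C1 C2"]) (auto simp: le_max_iff_disj)
  qed
  then obtain C where C: "\<And>j z. z \<in> strip \<rho> \<Longrightarrow> norm (ctrig (b j) (\<phi> j) z) \<le> C j"
    "\<And>j z. z \<in> strip \<rho> \<Longrightarrow> norm (ctrig (b j) (\<phi> j - pi / 2) z) \<le> C j" by metis
  have C0: "C j \<ge> 0" for j
  proof -
    have "(0 :: complex ^ ('n + 'n)) \<in> strip \<rho>" using \<rho> by (simp add: strip_def)
    then show ?thesis using C(1) norm_ge_zero order_trans by blast
  qed
  let ?k = "\<lambda>j. 4 * pi\<^sup>2 * S * \<bar>\<sigma> j\<bar>"
  \<comment> \<open>Collects the constants of all summands, so that the total error becomes
    \<open>A * \<eta> * \<bar>h\<bar>\<close>.\<close>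
  define A where "A = (\<Sum>j\<in>J. \<bar>d j\<bar> * (2 * C j * ?k j) * norm (symp (b j)))"
  have A0: "A \<ge> 0" unfolding A_def using C0 S(1) by (intro sum_nonneg mult_nonneg_nonneg) auto
  define \<eta> where "\<eta> = \<delta> / (A + 1)"
  have \<eta>: "\<eta> > 0" "A * \<eta> \<le> \<delta>" using A0 \<delta> by (auto simp: \<eta>_def field_simps)
  obtain e where e: "e > 0" "\<And>u :: complex. norm u \<le> e \<Longrightarrow> norm (1 - cos u) \<le> \<eta> * norm u"
    "\<And>u :: complex. norm u \<le> e \<Longrightarrow> norm (sin u - u) \<le> \<eta> * norm u"
    by (rule small_trig[OF \<eta>(1)]) blast
  \<comment> \<open>Dominates every \<open>?k j\<close>, so that
    \<open>\<bar>h\<bar> \<le> e / \<kappa>\<close> keeps all phase changes within e; the added 1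
    keeps it positive for empty J.\<close>
  define \<kappa> where "\<kappa> = (\<Sum>j\<in>J. ?k j) + 1"
  have k: "0 \<le> ?k j" for j using S(1) by simp
  then have \<kappa>: "\<kappa> > 0" "\<And>j. j \<in> J \<Longrightarrow> ?k j \<le> \<kappa>"
    unfolding \<kappa>_def using J
    by (auto intro!: add_nonneg_pos sum_nonneg order_trans[OF member_le_sum[of _ J ?k]])
  show "\<exists>h0>0. \<forall>h. \<bar>h\<bar> \<le> h0 \<longrightarrow> (\<exists>\<Psi>. shear_lift \<Psi> \<and>
      (\<forall>w\<in>strip \<rho>. norm (\<Psi> w - w - h *\<^sub>R cham (cos_sum a \<theta> J b \<phi> \<epsilon>) w) \<le> \<delta> * \<bar>h\<bar>))"
  proof (intro exI[of _ "e / \<kappa>"] conjI allI impI)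
    show "e / \<kappa> > 0" using e(1) \<kappa>(1) by simp
    fix h assume h: "\<bar>h\<bar> \<le> e / \<kappa>"
    \<comment> \<open>The q-shear, the p-shear for time h, and the inverse q-shear, whose
      displacement u' has the opposite amplitudes.\<close>
    define \<Psi> where "\<Psi> z = (\<lambda>y. y + u' y) (tshear a (- (2 * pi) * h) (\<theta> - pi / 2) (z + u z))" for z
    have lift: "shear_lift \<Psi>"
      unfolding \<Psi>_def u_def u'_def using a
      by (intro shear_lift_comp[OF shear_lift_sum] shear_lift_step shear_lift_sum J b disjI2) auto
    have "norm (\<Psi> w - w - h *\<^sub>R cham (cos_sum a \<theta> J b \<phi> \<epsilon>) w) \<le> \<delta> * \<bar>h\<bar>" if w: "w \<in> strip \<rho>" for w
    proof -
      \<comment> \<open>\<open>t\<close> is the displacement along \<open>symp a\<close> made by the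
        p-shear, and \<open>v j\<close> the resulting change of the phase of the j-th
        q-cosine.\<close>
      define t where "t = of_real (- (2 * pi) * h) * s w"
      define v where "v j = of_real (2 * pi) * t * of_real (\<sigma> j)" for j
      have nv: "norm (v j) \<le> ?k j * \<bar>h\<bar>" for j
      proof -
        have "norm (v j) = 4 * pi\<^sup>2 * norm (s w) * \<bar>\<sigma> j\<bar> * \<bar>h\<bar>"
          by (simp add: v_def t_def norm_mult power2_eq_square)
        also have "\<dots> \<le> ?k j * \<bar>h\<bar>" using S(2)[OF w] by (intro mult_right_mono mult_left_mono) auto
        finally show ?thesis .
      qed
      have nve: "norm (v j) \<le> e" if "j \<in> J" for j
      proof -
        have "?k j * \<bar>h\<bar> \<le> \<kappa> * (e / \<kappa>)" using \<kappa>(2)[OF that] h \<kappa>(1) by (intro mult_mono) auto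
        also have "\<dots> = e" using \<kappa>(1) by simp
        finally show ?thesis using nv[of j] by linarith
      qed
      have mid: "tshear a (- (2 * pi) * h) (\<theta> - pi / 2) (w + u w) = (w + u w) + t *s symp a"
        unfolding tshear_def s_eq t_def ..
      have \<Psi>w: "\<Psi> w = w + u w + t *s symp a + u' ((w + u w) + t *s symp a)"
        unfolding \<Psi>_def mid by (simp add: add_ac)
      have arg: "ctrig (b j) (\<phi> j) ((w + u w) + t *s symp a) =
          cos (of_real (2 * pi) * phase (b j) w + of_real (\<phi> j) + v j)" if "j \<in> J" for j
      proof -
        have "phase (b j) (u w) = 0"
          unfolding u_def using that b by (simp add: phase_sum_smult phase_symp pairing_q_only)
        then show ?thesis
          unfolding ctrig_add phase_add_right phase_smult phase_symp v_def \<sigma>_def by (simp add: mult_ac)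
      qed
      have c_eq: "h *\<^sub>R cham (cos_sum a \<theta> J b \<phi> \<epsilon>) w = t *s symp a +
          (\<Sum>j\<in>J. (of_real (d j) * v j * ctrig (b j) (\<phi> j - pi / 2) w) *s symp (b j))"
      proof -
        have "h *\<^sub>R cham (cos_sum a \<theta> J b \<phi> \<epsilon>) w = t *s symp a +
            (\<Sum>j\<in>J. (of_real h * (- s w) * of_real (\<epsilon> j) * - (of_real (2 * pi) * ctrig (b j) (\<phi> j - pi / 2) w)) *s symp (b j))"
          unfolding cham_cos_sum s_def[symmetric] cham_ctrig scaleR_smult' t_def
          by (simp add: vec_eq_iff sum_distrib_left sum_negf algebra_simps)
        also have "(\<Sum>j\<in>J. (of_real h * (- s w) * of_real (\<epsilon> j) * - (of_real (2 * pi) * ctrig (b j) (\<phi> j - pi / 2) w)) *s symp (b j))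
            = (\<Sum>j\<in>J. (of_real (d j) * v j * ctrig (b j) (\<phi> j - pi / 2) w) *s symp (b j))"
        proof (intro sum.cong refl arg_cong2[where f = "(*s)"])
          fix j assume "j \<in> J"
          then show "of_real h * (- s w) * of_real (\<epsilon> j) * - (of_real (2 * pi) * ctrig (b j) (\<phi> j - pi / 2) w) =
              of_real (d j) * v j * ctrig (b j) (\<phi> j - pi / 2) w"
            using \<sigma> by (simp add: d_def v_def t_def)
        qed
        finally show ?thesis .
      qed
      let ?B = "\<lambda>j. of_real (2 * pi) * phase (b j) w + of_real (\<phi> j)"
      \<comment> \<open>The two q-shears would cancel if q did not move in between. What remains of
        the difference to the Euler step is the Taylor remainder of each q-cosine for the phase
        change \<open>v j\<close>.\<close>
      have err_eq: "\<Psi> w - w - h *\<^sub>R cham (cos_sum a \<theta> J b \<phi> \<epsilon>) w =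
          (\<Sum>j\<in>J. (of_real (d j) * (cos (?B j) - cos (?B j + v j) - v j * sin (?B j))) *s symp (b j))"
      proof -
        have "u' ((w + u w) + t *s symp a) = (\<Sum>j\<in>J. (of_real (- d j) * cos (?B j + v j)) *s symp (b j))"
          unfolding u'_def by (intro sum.cong refl) (simp add: arg)
        moreover have "u w = (\<Sum>j\<in>J. (of_real (d j) * cos (?B j)) *s symp (b j))"
          unfolding u_def ctrig_def ..
        ultimately have "\<Psi> w - w - h *\<^sub>R cham (cos_sum a \<theta> J b \<phi> \<epsilon>) w =
          (\<Sum>j\<in>J. (of_real (d j) * cos (?B j)) *s symp (b j)) + (\<Sum>j\<in>J. (of_real (- d j) * cos (?B j + v j)) *s symp (b j))
          - (\<Sum>j\<in>J. (of_real (d j) * v j * sin (?B j)) *s symp (b j))"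
          unfolding \<Psi>w c_eq ctrig_minus_half_pi by (simp add: algebra_simps)
        also have "\<dots> = (\<Sum>j\<in>J. (of_real (d j) * (cos (?B j) - cos (?B j + v j) - v j * sin (?B j))) *s symp (b j))"
          unfolding sum.distrib[symmetric] sum_subtractf[symmetric]
          by (intro sum.cong refl) (simp add: vec_eq_iff algebra_simps)
        finally show ?thesis .
      qed
      have err: "norm (\<Sum>j\<in>J. (of_real (d j) * (cos (?B j) - cos (?B j + v j) - v j * sin (?B j))) *s symp (b j))
          \<le> (\<Sum>j\<in>J. \<bar>d j\<bar> * (2 * C j * ?k j) * norm (symp (b j)) * (\<eta> * \<bar>h\<bar>))"
      proof (rule order_trans[OF norm_sum sum_mono])
        fix j assume j: "j \<in> J"
        have "norm (cos (?B j) - cos (?B j + v j) - v j * sin (?B j)) \<le> 2 * C j * \<eta> * norm (v j)"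
          using C(1)[OF w, of j] C(2)[OF w, of j] unfolding ctrig_minus_half_pi unfolding ctrig_def
          by (intro cos_first_order e nve j)
        also have "\<dots> \<le> 2 * C j * \<eta> * (?k j * \<bar>h\<bar>)" using C0[of j] \<eta>(1) by (intro mult_left_mono nv) auto
        finally have 1: "norm (cos (?B j) - cos (?B j + v j) - v j * sin (?B j)) \<le> 2 * C j * \<eta> * (?k j * \<bar>h\<bar>)" .
        have nsm: "norm (c *s (y :: complex ^ ('n + 'n))) = norm c * norm y" for c y
          by (simp add: norm_vec_def L2_set_right_distrib norm_mult)
        have "norm ((of_real (d j) * (cos (?B j) - cos (?B j + v j) - v j * sin (?B j))) *s symp (b j)) =
            \<bar>d j\<bar> * norm (cos (?B j) - cos (?B j + v j) - v j * sin (?B j)) * norm (symp (b j))"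
          unfolding nsm by (simp add: norm_mult)
        also have "\<dots> \<le> \<bar>d j\<bar> * (2 * C j * \<eta> * (?k j * \<bar>h\<bar>)) * norm (symp (b j))"
          by (intro mult_right_mono mult_left_mono 1) auto
        also have "\<dots> = \<bar>d j\<bar> * (2 * C j * ?k j) * norm (symp (b j)) * (\<eta> * \<bar>h\<bar>)" by (simp only: mult_ac)
        finally show "norm ((of_real (d j) * (cos (?B j) - cos (?B j + v j) - v j * sin (?B j))) *s symp (b j)) \<le>
            \<bar>d j\<bar> * (2 * C j * ?k j) * norm (symp (b j)) * (\<eta> * \<bar>h\<bar>)" .
      qed
      have "(\<Sum>j\<in>J. \<bar>d j\<bar> * (2 * C j * ?k j) * norm (symp (b j)) * (\<eta> * \<bar>h\<bar>)) = (A * \<eta>) * \<bar>h\<bar>"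
        unfolding A_def mult.assoc[of _ \<eta>] by (rule sum_distrib_right[symmetric])
      also have "\<dots> \<le> \<delta> * \<bar>h\<bar>" using \<eta>(2) by (rule mult_right_mono) simp
      finally show ?thesis unfolding err_eq by (rule order_trans[OF err])
    qed
    then show "\<exists>\<Psi>. shear_lift \<Psi> \<and>
      (\<forall>w\<in>strip \<rho>. norm (\<Psi> w - w - h *\<^sub>R cham (cos_sum a \<theta> J b \<phi> \<epsilon>) w) \<le> \<delta> * \<bar>h\<bar>)"
      using lift by blast
  qed
qed

text \<open>The addition theorems factor the mixed difference into terms that are each a product of
  a quantity small in x and one small in y. The bound is therefore relative to
  \<open>norm x * norm y\<close> and survives the division by e squared later. The constant is (1 +
  2 + 1) + (2 + 2).\<close>

lemma cos_mixed_difference: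
  fixes A x y :: complex
  assumes "norm (1 - cos x) \<le> \<eta> * norm x" "norm (sin x - x) \<le> \<eta> * norm x"
    "norm (1 - cos y) \<le> \<eta> * norm y" "norm (sin y - y) \<le> \<eta> * norm y"
    "0 \<le> \<eta>" "\<eta> \<le> 1" "norm (cos A) \<le> C" "norm (sin A) \<le> C"
  shows "norm (cos (A + (x + y)) - cos (A + x) - cos (A + y) + cos A + x * y * cos A) \<le> 8 * C * \<eta> * (norm x * norm y)"
proof -
  have C: "0 \<le> C" using assms(7) norm_ge_zero order_trans by blast
  have sx: "norm (sin x) \<le> 2 * norm x"
  proof -
    have "norm (sin x) \<le> norm (sin x - x) + norm x" using norm_triangle_ineq[of "sin x - x" x] by simp
    also have "\<dots> \<le> 1 * norm x + norm x"
      using assms(2) mult_right_mono[OF assms(6), of "norm x"] by simp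
    finally show ?thesis by simp
  qed
  have sy: "norm (sin y) \<le> 2 * norm y"
  proof -
    have "norm (sin y) \<le> norm (sin y - y) + norm y" using norm_triangle_ineq[of "sin y - y" y] by simp
    also have "\<dots> \<le> 1 * norm y + norm y"
      using assms(4) mult_right_mono[OF assms(6), of "norm y"] by simp
    finally show ?thesis by simp
  qed
  let ?p = "\<eta> * (norm x * norm y)"
  have b1: "norm ((1 - cos x) * (1 - cos y)) \<le> ?p"
  proof -
    have "norm ((1 - cos x) * (1 - cos y)) \<le> (\<eta> * norm x) * (1 * norm y)"
      unfolding norm_mult using assms(1,3,5) mult_right_mono[OF assms(6), of "norm y"]
      by (intro mult_mono) auto
    then show ?thesis by (simp add: mult.assoc)
  qed
  have b2: "norm ((sin x - x) * sin y) \<le> 2 * ?p"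
    using mult_mono[OF assms(2) sy] assms(5) by (simp add: norm_mult mult_ac)
  have b3: "norm (x * (sin y - y)) \<le> ?p"
    using mult_left_mono[OF assms(4), of "norm x"] by (simp add: norm_mult mult_ac)
  have b4: "norm (sin x * (1 - cos y)) \<le> 2 * ?p"
    using mult_mono[OF sx assms(3)] assms(5) by (simp add: norm_mult mult_ac)
  have b5: "norm ((1 - cos x) * sin y) \<le> 2 * ?p"
    using mult_mono[OF assms(1) sy] assms(5) by (simp add: norm_mult mult_ac)
  have "cos (A + (x + y)) - cos (A + x) - cos (A + y) + cos A + x * y * cos A =
      cos A * (((1 - cos x) * (1 - cos y) - (sin x - x) * sin y) - x * (sin y - y))
      + sin A * (sin x * (1 - cos y) + (1 - cos x) * sin y)"
    by (simp add: cos_add sin_add algebra_simps)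
  also have "norm \<dots> \<le> norm (cos A) * (norm ((1 - cos x) * (1 - cos y)) + norm ((sin x - x) * sin y) + norm (x * (sin y - y)))
      + norm (sin A) * (norm (sin x * (1 - cos y)) + norm ((1 - cos x) * sin y))"
  proof -
    have "norm (p - q - r) \<le> norm p + norm q + norm r" for p q r :: complex
      using norm_triangle_ineq4[of "p - q" r] norm_triangle_ineq4[of p q] by linarith
    then show ?thesis
      by (intro order_trans[OF norm_triangle_ineq] add_mono)
        (simp_all only: norm_mult[of "cos A"] norm_mult[of "sin A"] mult_left_mono norm_ge_zero norm_triangle_ineq)
  qed
  also have "\<dots> \<le> C * (?p + 2 * ?p + ?p) + C * (2 * ?p + 2 * ?p)"
    using b1 b2 b3 b4 b5 assms(7,8) C by (intro add_mono mult_mono) auto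
  also have "\<dots> = 8 * C * \<eta> * (norm x * norm y)" by (simp add: algebra_simps)
  finally show ?thesis .
qed

text \<open>The product is, up to sign, the mixed derivative at 0 of \<open>cos_sum\<close> with
  respect to its two amplitudes. The difference quotient is a real combination of four shear
  Hamiltonians, two of its amplitudes pairs having a zero entry, and it converges uniformly on every
  strip.\<close>

lemma shear_ham_product:
  fixes a :: "'n::finite + 'n \<Rightarrow> int"
  assumes a: "p_only a" and b: "q_only b1" "q_only b2"
    and nz: "pairing b1 a \<noteq> 0" "pairing b2 a \<noteq> 0"
  shows "shear_ham (\<lambda>z. ctrig a \<theta> z * ctrig b1 \<phi>1 z * ctrig b2 \<phi>2 z)"
proof -
  define G where "G e1 e2 = cos_sum a \<theta> {0, 1} (\<lambda>j. if j = 0 then b1 else b2)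
    (\<lambda>j. if j = 0 then \<phi>1 else \<phi>2) (\<lambda>j. if j = 0 then e1 else e2)" for e1 e2
  have G: "shear_ham (G e1 e2)" for e1 e2
    unfolding G_def by (rule shear_ham_cos_sum) (use assms in auto)
  have G_eq: "G e1 e2 z = cos (of_real (2 * pi) * phase a z + of_real \<theta> +
      (of_real e1 * ctrig b1 \<phi>1 z + of_real e2 * ctrig b2 \<phi>2 z))" for e1 e2 z
    by (simp add: G_def cos_sum_def)
  have "shear_ham (\<lambda>z. of_real (-1) * (ctrig a \<theta> z * ctrig b1 \<phi>1 z * ctrig b2 \<phi>2 z))"
  proof (rule shear_ham_limit)
    show "tame (\<lambda>z. of_real (-1) * (ctrig a \<theta> z * ctrig b1 \<phi>1 z * ctrig b2 \<phi>2 z))"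
      by (intro tame_mult tame_const tame_ctrig)
    fix \<rho> \<delta> :: real assume \<delta>: "\<delta> > 0"
    obtain C1 where C1: "\<And>z. z \<in> strip \<rho> \<Longrightarrow> norm (ctrig a \<theta> z) \<le> C1" using ctrig_bounded by blast
    obtain C2 where C2: "\<And>z. z \<in> strip \<rho> \<Longrightarrow> norm (ctrig a (\<theta> - pi / 2) z) \<le> C2" using ctrig_bounded by blast
    obtain D1 where D1: "\<And>z. z \<in> strip \<rho> \<Longrightarrow> norm (ctrig b1 \<phi>1 z) \<le> D1" using ctrig_bounded by blast
    obtain D2 where D2: "\<And>z. z \<in> strip \<rho> \<Longrightarrow> norm (ctrig b2 \<phi>2 z) \<le> D2" using ctrig_bounded by blast
    define C where "C = \<bar>C1\<bar> + \<bar>C2\<bar>"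
    define D where "D = \<bar>D1\<bar> + \<bar>D2\<bar> + 1"
    have C: "C \<ge> 0" "norm (ctrig a \<theta> z) \<le> C" "norm (ctrig a (\<theta> - pi / 2) z) \<le> C" if "z \<in> strip \<rho>" for z
      using C1[OF that] C2[OF that] by (auto simp: C_def)
    have D: "D > 0" by (simp add: D_def)
    have D': "norm (ctrig b1 \<phi>1 z) \<le> D" "norm (ctrig b2 \<phi>2 z) \<le> D" if "z \<in> strip \<rho>" for z
      using D1[OF that] D2[OF that] by (auto simp: D_def)
    define \<eta> where "\<eta> = min 1 (\<delta> / (8 * (C + 1) * D\<^sup>2))"
    have C0: "C \<ge> 0" by (simp add: C_def)
    then have \<eta>: "\<eta> > 0" "\<eta> \<le> 1" using \<delta> D by (auto simp: \<eta>_def)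
    have \<eta>2: "8 * C * \<eta> * D\<^sup>2 \<le> \<delta>"
    proof -
      have "8 * C * \<eta> * D\<^sup>2 \<le> \<eta> * (8 * (C + 1) * D\<^sup>2)" using \<eta>(1) D by (simp add: algebra_simps)
      also have "\<dots> \<le> \<delta> / (8 * (C + 1) * D\<^sup>2) * (8 * (C + 1) * D\<^sup>2)"
        using C0 D by (intro mult_right_mono) (auto simp: \<eta>_def)
      also have "\<dots> = \<delta>" using C0 D by simp
      finally show ?thesis .
    qed
    obtain d where d: "d > 0" "\<And>u :: complex. norm u \<le> d \<Longrightarrow> norm (1 - cos u) \<le> \<eta> * norm u"
      "\<And>u :: complex. norm u \<le> d \<Longrightarrow> norm (sin u - u) \<le> \<eta> * norm u"
      by (rule small_trig[OF \<eta>(1)]) blast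
    \<comment> \<open>Makes both amplitudes times their q-cosines at most d on the strip, where the
      expansions of cos and sin hold.\<close>
    define e where "e = d / D"
    have e: "e > 0" using d(1) D by (simp add: e_def)
    define K' where "K' = (\<lambda>z. of_real (1 / e\<^sup>2) * (((G e e z + of_real (-1) * G e 0 z) + of_real (-1) * G 0 e z) + G 0 0 z))"
    have "shear_ham K'"
      unfolding K'_def by (intro shear_ham_scale shear_ham_add G)
    moreover have "norm (of_real (-1) * (ctrig a \<theta> z * ctrig b1 \<phi>1 z * ctrig b2 \<phi>2 z) - K' z) \<le> \<delta>"
      if z: "z \<in> strip \<rho>" for z
    proof -
      let ?A = "of_real (2 * pi) * phase a z + complex_of_real \<theta>"
      let ?x = "of_real e * ctrig b1 \<phi>1 z" and ?y = "of_real e * ctrig b2 \<phi>2 z"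
      have xd: "norm ?x \<le> d" "norm ?y \<le> d"
      proof -
        have "norm (of_real e * w) \<le> d" if "norm w \<le> D" for w :: complex
        proof -
          have "norm (of_real e * w) \<le> e * D" using that e by (simp add: norm_mult)
          then show ?thesis using D by (simp add: e_def)
        qed
        then show "norm ?x \<le> d" "norm ?y \<le> d" using D'[OF z] by blast+
      qed
      have "norm (cos (?A + (?x + ?y)) - cos (?A + ?x) - cos (?A + ?y) + cos ?A + ?x * ?y * cos ?A) \<le> 8 * C * \<eta> * (norm ?x * norm ?y)"
        using C(2,3)[OF z] unfolding ctrig_minus_half_pi unfolding ctrig_def[of a]
        by (intro cos_mixed_difference d xd \<eta> less_imp_le[OF \<eta>(1)])
      also have "\<dots> \<le> 8 * C * \<eta> * ((e * D) * (e * D))"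
        using D'[OF z] e C0 \<eta>(1) D by (intro mult_left_mono mult_mono) (auto simp: norm_mult)
      also have "\<dots> = e\<^sup>2 * (8 * C * \<eta> * D\<^sup>2)" by (simp add: power2_eq_square)
      also have "\<dots> \<le> e\<^sup>2 * \<delta>" using \<eta>2 by (rule mult_left_mono) simp
      finally have "norm (cos (?A + (?x + ?y)) - cos (?A + ?x) - cos (?A + ?y) + cos ?A + ?x * ?y * cos ?A) \<le> e\<^sup>2 * \<delta>" .
      then have Q: "norm (of_real (1 / e\<^sup>2) :: complex) * norm (cos (?A + (?x + ?y)) - cos (?A + ?x) - cos (?A + ?y) + cos ?A + ?x * ?y * cos ?A) \<le> (1 / e\<^sup>2) * (e\<^sup>2 * \<delta>)"
        by (intro mult_mono) (auto simp: norm_divide norm_power)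
      have eq: "of_real (-1) * (ctrig a \<theta> z * ctrig b1 \<phi>1 z * ctrig b2 \<phi>2 z) - K' z =
          - (of_real (1 / e\<^sup>2) * (cos (?A + (?x + ?y)) - cos (?A + ?x) - cos (?A + ?y) + cos ?A + ?x * ?y * cos ?A))"
      proof -
        have "of_real (1 / e\<^sup>2) * (?x * ?y * cos ?A) = ctrig a \<theta> z * ctrig b1 \<phi>1 z * ctrig b2 \<phi>2 z"
          using e by (simp add: power2_eq_square ctrig_def[of a])
        then show ?thesis unfolding K'_def G_eq by (simp add: algebra_simps)
      qed
      show ?thesis
        unfolding eq norm_minus_cancel norm_mult by (rule order_trans[OF Q]) (use e in simp)
    qed
    ultimately show "\<exists>K'. shear_ham K' \<and> (\<forall>z\<in>strip \<rho>. norm (of_real (-1) * (ctrig a \<theta> z * ctrig b1 \<phi>1 z * ctrig b2 \<phi>2 z) - K' z) \<le> \<delta>)"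
      by blast
  qed
  \<comment> \<open>Removes the minus sign produced by differentiating the cosine twice.\<close>
  from shear_ham_scale[OF this, of "-1"] show ?thesis by simp
qed

text \<open>The addition theorem for three angles, with sines in the shifted-cosine notation; it
  turns products back into a single plane wave.\<close>

lemma ctrig_triple:
  "ctrig (\<lambda>i. a i + (b1 i + b2 i)) \<theta> z =
     ((ctrig a \<theta> z * ctrig b1 0 z * ctrig b2 0 z + of_real (-1) * (ctrig a \<theta> z * ctrig b1 (0 - pi / 2) z * ctrig b2 (0 - pi / 2) z))
     + of_real (-1) * (ctrig a (\<theta> - pi / 2) z * ctrig b1 (0 - pi / 2) z * ctrig b2 0 z))
     + of_real (-1) * (ctrig a (\<theta> - pi / 2) z * ctrig b1 0 z * ctrig b2 (0 - pi / 2) z)"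
proof -
  have "of_real (2 * pi) * (phase a z + (phase b1 z + phase b2 z)) + of_real \<theta> =
      (of_real (2 * pi) * phase a z + of_real \<theta>) + (of_real (2 * pi) * phase b1 z + of_real (2 * pi) * phase b2 z)"
    by (simp add: algebra_simps)
  then show ?thesis
    unfolding ctrig_minus_half_pi unfolding ctrig_def phase_add_left
    by (simp only: cos_add sin_add) (simp add: algebra_simps)
qed

text \<open>A wave in q alone is itself a shear Hamiltonian. Otherwise the p-part a is nonzero, and
  the q-part, possibly resonant with a or even 0, is split into two nonresonant frequencies.\<close>

lemma shear_ham_ctrig:
  fixes c :: "'n::finite + 'n \<Rightarrow> int"
  shows "shear_ham (ctrig c \<theta>)"
proof (cases "q_only c")
  case True
  then show ?thesis by (rule shear_ham_ctrig_block[OF disjI1])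
next
  case False
  then obtain i where i: "c (Inr i) \<noteq> 0" by (auto simp: q_only_def)
  define a where "a = (\<lambda>k. case k of Inl (_ :: 'n) \<Rightarrow> 0 | Inr i \<Rightarrow> c (Inr i))"
  define q where "q = (\<lambda>k. case k of Inl i \<Rightarrow> c (Inl i) | Inr (_ :: 'n) \<Rightarrow> 0)"
  \<comment> \<open>\<open>b1\<close> is s times a unit frequency in a coordinate where a does not
    vanish. The choice s = 1 fails only if it makes \<open>b2\<close> resonant, and then s = 2
    leaves \<open>pairing b2 a = - a (Inr i)\<close>.\<close>
  define s :: int where "s = (if pairing q a = a (Inr i) then 2 else 1)"
  define b1 :: "'n + 'n \<Rightarrow> int" where "b1 = (\<lambda>k. if k = Inl i then s else 0)"
  define b2 where "b2 = (\<lambda>k. q k - b1 k)"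
  have a: "p_only a" by (simp add: p_only_def a_def)
  have b: "q_only b1" "q_only b2" by (simp_all add: q_only_def b1_def b2_def q_def)
  have "pairing b1 a = (\<Sum>j\<in>UNIV. if j = i then s * a (Inr i) else 0)"
    unfolding pairing_def by (intro sum.cong) (auto simp: b1_def)
  then have p1: "pairing b1 a = s * a (Inr i)" by simp
  have p2: "pairing b2 a = pairing q a - pairing b1 a"
    unfolding pairing_def b2_def sum_subtractf[symmetric] by (simp add: algebra_simps)
  have ai: "a (Inr i) \<noteq> 0" using i by (simp add: a_def)
  have nz: "pairing b1 a \<noteq> 0" "pairing b2 a \<noteq> 0"
    unfolding p2 p1 using ai by (auto simp: s_def)
  have "c = (\<lambda>k. a k + (b1 k + b2 k))"
    by (auto simp: a_def b2_def q_def fun_eq_iff split: sum.split)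
  then have "ctrig c \<theta> = ctrig (\<lambda>k. a k + (b1 k + b2 k)) \<theta>" by (rule arg_cong)
  moreover have "shear_ham (ctrig (\<lambda>k. a k + (b1 k + b2 k)) \<theta>)"
    unfolding ctrig_triple[abs_def]
    by (intro shear_ham_add shear_ham_scale shear_ham_product a b nz)
  ultimately show ?thesis by simp
qed

lemma shear_ham_trigpoly: "trigpoly K \<Longrightarrow> shear_ham K"
  by (induction rule: trigpoly.induct) (auto intro: shear_ham_ctrig shear_ham_add shear_ham_scale)

lemma shear_ham_sum_list:
  "(\<And>p. p \<in> set L \<Longrightarrow> shear_ham (snd p)) \<Longrightarrow> shear_ham (\<lambda>z. \<Sum>p\<leftarrow>L. of_real (c p) * snd p z)"
proof (induction L)
  case Nil
  then show ?case using shear_ham_scale[OF shear_ham_ctrig, of 0] by simp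
next
  case (Cons p L)
  then show ?case by (simp add: shear_ham_add shear_ham_scale)
qed

section \<open>Ordinary differential equations on the unit interval\<close>

lemma continuous_on_lipschitz_comp:
  fixes f :: "real \<Rightarrow> 'a::real_normed_vector \<Rightarrow> 'b::real_normed_vector"
  assumes lip: "\<And>t x y. t \<in> S \<Longrightarrow> norm (f t x - f t y) \<le> L * norm (x - y)"
    and cont: "\<And>x. continuous_on S (\<lambda>t. f t x)" and x: "continuous_on S x"
  shows "continuous_on S (\<lambda>t. f t (x t))"
  unfolding continuous_on_def
proof
  fix s assume s: "s \<in> S"
  have "((\<lambda>t. L * norm (x t - x s) + norm (f t (x s) - f s (x s))) \<longlongrightarrow> L * norm (x s - x s) + norm (f s (x s) - f s (x s))) (at s within S)"
    using x cont[of "x s"] s unfolding continuous_on_def by (intro tendsto_intros) auto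
  then have lim: "((\<lambda>t. L * norm (x t - x s) + norm (f t (x s) - f s (x s))) \<longlongrightarrow> 0) (at s within S)" by simp
  have "norm (f t (x t) - f s (x s)) \<le> L * norm (x t - x s) + norm (f t (x s) - f s (x s))" if "t \<in> S" for t
    using norm_triangle_ineq[of "f t (x t) - f t (x s)" "f t (x s) - f s (x s)"] lip[OF that, of "x t" "x s"] by simp
  then have "\<forall>\<^sub>F t in at s within S. norm (f t (x t) - f s (x s)) \<le> L * norm (x t - x s) + norm (f t (x s) - f s (x s))"
    by (simp add: eventually_at_filter)
  then have "((\<lambda>t. f t (x t) - f s (x s)) \<longlongrightarrow> 0) (at s within S)"
    by (rule Lim_null_comparison) (rule lim)
  then show "((\<lambda>t. f t (x t)) \<longlongrightarrow> f s (x s)) (at s within S)" by (simp add: LIM_zero_iff)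
qed

text \<open>Banach's fixed point theorem for the Picard operator; multiplying the solutions by
  \<open>exp (- K t)\<close> with \<open>K > 2 L\<close> makes it a contraction on the whole interval at once.\<close>

lemma picard_lindeloef:
  fixes f :: "real \<Rightarrow> 'a::banach \<Rightarrow> 'a"
  assumes lip: "\<And>t x y. t \<in> {0..1} \<Longrightarrow> norm (f t x - f t y) \<le> L * norm (x - y)" and L: "L \<ge> 0"
    and cont: "\<And>x. continuous_on {0..1} (\<lambda>t. f t x)"
  obtains x where "x 0 = x0" "\<And>t. t \<in> {0..1} \<Longrightarrow> (x has_vector_derivative f t (x t)) (at t within {0..1})"
proof -
  define K where "K = 2 * L + 1"
  have K: "K > 0" "L / K \<le> 1 / 2" using L by (auto simp: K_def field_simps)
  \<comment> \<open>Clamping time to the unit interval turns continuous functions on it into bounded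
    continuous functions on the line, a complete metric space.\<close>
  define c :: "real \<Rightarrow> real" where "c t = max 0 (min 1 t)" for t
  have c: "c t \<in> {0..1}" "t \<in> {0..1} \<Longrightarrow> c t = t" for t by (auto simp: c_def)
  \<comment> \<open>The unknown u is the weighted deviation exp (-K s) (x s - x0) of the solution x
    from its initial value.\<close>
  define y where "y u s = x0 + exp (K * s) *\<^sub>R apply_bcontfun u s" for u :: "real \<Rightarrow>\<^sub>C 'a" and s
  define Q where "Q u t = exp (- (K * t)) *\<^sub>R integral {0..t} (\<lambda>s. f s (y u s))" for u t
  have fc: "continuous_on {0..1} (\<lambda>s. f s (y u s))" for u
    by (rule continuous_on_lipschitz_comp[OF lip cont]) (auto simp: y_def intro!: continuous_intros)
  have fi: "(\<lambda>s. f s (y u s)) integrable_on {0..t}" if "t \<in> {0..1}" for u t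
    by (rule integrable_continuous_interval, rule continuous_on_subset[OF fc]) (use that in auto)
  have Qc: "continuous_on {0..1} (Q u)" for u
    unfolding Q_def by (intro continuous_intros indefinite_integral_continuous_1 fi) auto
  have "(\<lambda>t. Q u (c t)) \<in> bcontfun" for u
  proof -
    have "continuous_on UNIV c" unfolding c_def by (intro continuous_intros)
    then have "continuous_on UNIV (\<lambda>t. Q u (c t))"
      by (rule continuous_on_compose2[OF Qc]) (use c in auto)
    moreover have "bounded (range (\<lambda>t. Q u (c t)))"
    proof (rule bounded_subset)
      show "bounded (Q u ` {0..1})" by (intro compact_imp_bounded compact_continuous_image Qc) simp
      show "range (\<lambda>t. Q u (c t)) \<subseteq> Q u ` {0..1}" using c(1) by blast
    qed
    ultimately show ?thesis by (simp add: bcontfun_def)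
  qed
  then have P: "apply_bcontfun (Bcontfun (\<lambda>t. Q u (c t))) t = Q u (c t)" for u t
    by (simp add: Bcontfun_inverse)
  have contr: "norm (Q u t - Q v t) \<le> 1 / 2 * dist u v" if t: "t \<in> {0..1}" for u v t
  proof -
    let ?D = "dist u v"
    have "integral {0..t} (\<lambda>s. f s (y u s)) - integral {0..t} (\<lambda>s. f s (y v s)) =
        integral {0..t} (\<lambda>s. f s (y u s) - f s (y v s))"
      by (rule integral_diff[symmetric]) (intro fi t)+
    also have "norm \<dots> \<le> integral {0..t} (\<lambda>s. L * ?D * exp (K * s))"
    proof (rule integral_norm_bound_integral)
      show "(\<lambda>s. f s (y u s) - f s (y v s)) integrable_on {0..t}" by (intro integrable_diff fi t)
      show "(\<lambda>s. L * ?D * exp (K * s)) integrable_on {0..t}"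
        by (intro integrable_continuous_interval continuous_intros)
      fix s assume s: "s \<in> {0..t}"
      have "norm (y u s - y v s) = exp (K * s) * dist (apply_bcontfun u s) (apply_bcontfun v s)"
        by (simp add: y_def dist_norm scaleR_diff_right[symmetric])
      also have "\<dots> \<le> exp (K * s) * ?D" by (intro mult_left_mono dist_bounded) simp
      finally have "L * norm (y u s - y v s) \<le> L * (exp (K * s) * ?D)" using L by (rule mult_left_mono)
      then show "norm (f s (y u s) - f s (y v s)) \<le> L * ?D * exp (K * s)"
        using lip[of s "y u s" "y v s"] s t by (simp add: mult_ac)
    qed
    also have "integral {0..t} (\<lambda>s. L * ?D * exp (K * s)) = L * ?D * ((exp (K * t) - 1) / K)"
    proof -
      have "((\<lambda>s. exp (K * s)) has_integral exp (K * t) / K - exp (K * 0) / K) {0..t}"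
        using K(1) t by (intro fundamental_theorem_of_calculus)
          (auto simp: has_real_derivative_iff_has_vector_derivative[symmetric] intro!: derivative_eq_intros)
      then have "integral {0..t} (\<lambda>s. exp (K * s)) = (exp (K * t) - 1) / K"
        by (simp add: integral_unique diff_divide_distrib)
      then show ?thesis by simp
    qed
    finally have "norm (integral {0..t} (\<lambda>s. f s (y u s)) - integral {0..t} (\<lambda>s. f s (y v s))) \<le> L * ?D * ((exp (K * t) - 1) / K)" .
    then have "exp (- (K * t)) * norm (integral {0..t} (\<lambda>s. f s (y u s)) - integral {0..t} (\<lambda>s. f s (y v s)))
       \<le> exp (- (K * t)) * (L * ?D * ((exp (K * t) - 1) / K))" by (rule mult_left_mono) simp
    also have "\<dots> = (L / K) * ?D * (1 - exp (- (K * t)))" by (simp add: exp_minus field_simps)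
    also have "\<dots> \<le> (1 / 2) * ?D * 1" using K L t by (intro mult_mono) auto
    finally show ?thesis by (simp add: Q_def scaleR_diff_right[symmetric])
  qed
  have "\<exists>!u. Bcontfun (\<lambda>t. Q u (c t)) = u"
  proof (rule banach_fix_type)
    show "\<forall>u v. dist (Bcontfun (\<lambda>t. Q u (c t))) (Bcontfun (\<lambda>t. Q v (c t))) \<le> 1 / 2 * dist u v"
    proof (intro allI dist_bound)
      fix u v t
      show "dist (apply_bcontfun (Bcontfun (\<lambda>t. Q u (c t))) t) (apply_bcontfun (Bcontfun (\<lambda>t. Q v (c t))) t) \<le> 1 / 2 * dist u v"
        unfolding P dist_norm[of "Q u (c t)"] by (rule contr[OF c(1)])
    qed
  qed auto
  then obtain u where "Bcontfun (\<lambda>t. Q u (c t)) = u" by blast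
  then have u: "apply_bcontfun u t = Q u t" if "t \<in> {0..1}" for t using P[of u t] c(2)[OF that] by simp
  have yu: "y u t = x0 + integral {0..t} (\<lambda>s. f s (y u s))" if "t \<in> {0..1}" for t
    unfolding y_def[of u t] u[OF that] Q_def by (simp add: exp_minus)
  show ?thesis
  proof (rule that[of "\<lambda>t. x0 + integral {0..t} (\<lambda>s. f s (y u s))"])
    fix t :: real assume t: "t \<in> {0..1}"
    have "((\<lambda>t. x0 + integral {0..t} (\<lambda>s. f s (y u s))) has_vector_derivative 0 + f t (y u t)) (at t within {0..1})"
      by (intro has_vector_derivative_add has_vector_derivative_const integral_has_vector_derivative fc t)
    then show "((\<lambda>t. x0 + integral {0..t} (\<lambda>s. f s (y u s))) has_vector_derivative
        f t (x0 + integral {0..t} (\<lambda>s. f s (y u s)))) (at t within {0..1})"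
      using yu[OF t] by simp
  qed simp
qed

text \<open>The squared distance, damped by exp (-2 L t), is nonincreasing. Using the square avoids
  differentiating the norm at 0.\<close>

lemma gronwall_difference:
  fixes x y :: "real \<Rightarrow> 'a::real_inner"
  assumes x: "\<And>t. t \<in> {0..1} \<Longrightarrow> (x has_vector_derivative x' t) (at t within {0..1})"
    and y: "\<And>t. t \<in> {0..1} \<Longrightarrow> (y has_vector_derivative y' t) (at t within {0..1})"
    and lip: "\<And>t. t \<in> {0..1} \<Longrightarrow> norm (x' t - y' t) \<le> L * norm (x t - y t)"
    and t: "t \<in> {0..1}"
  shows "norm (x t - y t) \<le> exp (L * t) * norm (x 0 - y 0)"
proof -
  define d where "d s = x s - y s" for s
  define d' where "d' s = x' s - y' s" for s
  define w where "w s = exp (- (2 * L * s)) * (d s \<bullet> d s)" for s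
  have d: "(d has_vector_derivative d' s) (at s within {0..1})" if "s \<in> {0..1}" for s
    unfolding d_def d'_def by (intro has_vector_derivative_diff x y that)
  have dc: "continuous_on {0..1} d"
    unfolding continuous_on_eq_continuous_within using has_vector_derivative_continuous[OF d] by blast
  have "w t \<le> w 0"
  proof (rule DERIV_nonpos_imp_decreasing_open[of 0 t w])
    show "0 \<le> t" using t by simp
    show "continuous_on {0..t} w"
      unfolding w_def by (rule continuous_on_subset[of "{0..1}"]) (use t in \<open>auto intro!: continuous_intros dc\<close>)
    fix s assume s: "0 < s" "s < t"
    then have s01: "s \<in> {0..1}" "s \<in> interior {0..1}" using t by (auto simp: interior_atLeastAtMost_real)
    then have ds: "(d has_vector_derivative d' s) (at s)" using d[OF s01(1)] at_within_interior[OF s01(2)] by simp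
    have ip: "((\<lambda>s. d s \<bullet> d s) has_vector_derivative 2 * (d s \<bullet> d' s)) (at s)"
      using has_derivative_inner[OF ds[unfolded has_vector_derivative_def] ds[unfolded has_vector_derivative_def]]
      unfolding has_vector_derivative_def by (rule has_derivative_eq_rhs) (auto simp: inner_commute)
    then have "((\<lambda>s. d s \<bullet> d s) has_real_derivative 2 * (d s \<bullet> d' s)) (at s)"
      by (simp add: has_real_derivative_iff_has_vector_derivative)
    then have "(w has_real_derivative exp (- (2 * L * s)) * (2 * (d s \<bullet> d' s) - 2 * L * (d s \<bullet> d s))) (at s)"
      unfolding w_def by (auto intro!: derivative_eq_intros simp: algebra_simps)
    moreover have "d s \<bullet> d' s \<le> L * (d s \<bullet> d s)"
    proof -
      have "d s \<bullet> d' s \<le> norm (d s) * norm (d' s)" by (rule norm_cauchy_schwarz)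
      also have "\<dots> \<le> norm (d s) * (L * norm (d s))"
        using lip[OF s01(1)] by (intro mult_left_mono) (auto simp: d_def d'_def)
      also have "\<dots> = L * (d s \<bullet> d s)" by (simp add: power2_norm_eq_inner[symmetric] power2_eq_square)
      finally show ?thesis .
    qed
    then have "exp (- (2 * L * s)) * (2 * (d s \<bullet> d' s) - 2 * L * (d s \<bullet> d s)) \<le> 0"
      by (intro mult_nonneg_nonpos) auto
    ultimately show "\<exists>z. (w has_real_derivative z) (at s) \<and> z \<le> 0" by blast
  qed
  then have "exp (- (2 * L * t)) * (norm (d t))\<^sup>2 \<le> (norm (d 0))\<^sup>2"
    by (simp add: w_def power2_norm_eq_inner)
  then have "exp (2 * L * t) * (exp (- (2 * L * t)) * (norm (d t))\<^sup>2) \<le> exp (2 * L * t) * (norm (d 0))\<^sup>2"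
    by (rule mult_left_mono) simp
  moreover have "exp (2 * L * t) * (exp (- (2 * L * t)) * (norm (d t))\<^sup>2) = (norm (d t))\<^sup>2"
    by (simp add: mult.assoc[symmetric] exp_add[symmetric])
  moreover have "exp (2 * L * t) * (norm (d 0))\<^sup>2 = (exp (L * t) * norm (d 0))\<^sup>2"
    by (simp add: power_mult_distrib power2_eq_square exp_add[symmetric])
  ultimately have "(norm (d t))\<^sup>2 \<le> (exp (L * t) * norm (d 0))\<^sup>2" by simp
  then show ?thesis unfolding d_def by (rule power2_le_imp_le) simp
qed

text \<open>Serves with v = 0 to bound how far an orbit travels, and with v the initial velocity to
  bound the defect of an Euler step.\<close>

lemma vector_derivative_increment:
  fixes x :: "real \<Rightarrow> 'a::real_normed_vector"
  assumes x: "\<And>t. t \<in> {0..1} \<Longrightarrow> (x has_vector_derivative x' t) (at t within {0..1})"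
    and st: "s \<in> {0..1}" "t \<in> {0..1}" "s \<le> t"
    and bd: "\<And>r. r \<in> {s..t} \<Longrightarrow> norm (x' r - v) \<le> B"
  shows "norm (x t - x s - (t - s) *\<^sub>R v) \<le> B * (t - s)"
proof -
  let ?g = "\<lambda>r. x r - (r - s) *\<^sub>R v"
  have "norm (?g t - ?g s) \<le> B * norm (t - s)"
  proof (rule differentiable_bound[of "{s..t}" ?g "\<lambda>r h. h *\<^sub>R (x' r - v)"])
    fix r assume r: "r \<in> {s..t}"
    then have "(x has_vector_derivative x' r) (at r within {s..t})"
      using st by (intro has_vector_derivative_within_subset[OF x]) auto
    then have "(?g has_vector_derivative x' r - 1 *\<^sub>R v) (at r within {s..t})"
      by (intro has_vector_derivative_diff) (auto intro!: derivative_eq_intros)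
    then show "(?g has_derivative (\<lambda>h. h *\<^sub>R (x' r - v))) (at r within {s..t})"
      by (simp add: has_vector_derivative_def)
    show "onorm (\<lambda>h. h *\<^sub>R (x' r - v)) \<le> B"
      by (rule onorm_le) (use bd[OF r] in \<open>simp add: mult.commute[of B] mult_left_mono\<close>)
  qed (use st in auto)
  then show ?thesis using st by (simp add: algebra_simps)
qed

text \<open>Consistency (\<open>step\<close>) plus Lipschitz stability give convergence of one-step methods; the
  approximate orbits stay within distance \<open>R\<close> of the exact ones, where \<open>step\<close> applies.\<close>

lemma one_step_method_converges:
  fixes f :: "real \<Rightarrow> 'a::real_normed_vector \<Rightarrow> 'a" and P :: "('a \<Rightarrow> 'a) \<Rightarrow> bool"
  assumes P_id: "P (\<lambda>z. z)" and P_comp: "\<And>\<Phi> \<Psi>. P \<Phi> \<Longrightarrow> P \<Psi> \<Longrightarrow> P (\<lambda>z. \<Phi> (\<Psi> z))"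
    and lip: "\<And>t x y. t \<in> {0..1} \<Longrightarrow> norm (f t x - f t y) \<le> L * norm (x - y)" and L: "L \<ge> 0"
    and bd: "\<And>t x. t \<in> {0..1} \<Longrightarrow> norm (f t x) \<le> M"
    and uc: "\<And>\<eta>. \<eta> > 0 \<Longrightarrow> \<exists>r>0. \<forall>s\<in>{0..1}. \<forall>t\<in>{0..1}. \<bar>s - t\<bar> < r \<longrightarrow> (\<forall>x. norm (f s x - f t x) \<le> \<eta>)"
    and step: "\<And>\<delta>. \<delta> > 0 \<Longrightarrow> \<exists>h0>0. \<forall>t\<in>{0..1}. \<forall>h. 0 < h \<longrightarrow> h \<le> h0 \<longrightarrow>
       (\<exists>\<Psi>. P \<Psi> \<and> (\<forall>w\<in>V. norm (\<Psi> w - w - h *\<^sub>R f t w) \<le> \<delta> * h))"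
    and sol: "\<And>z t. z \<in> Z \<Longrightarrow> t \<in> {0..1} \<Longrightarrow> ((\<lambda>t. x t z) has_vector_derivative f t (x t z)) (at t within {0..1})"
    and init: "\<And>z. z \<in> Z \<Longrightarrow> x 0 z = z"
    and R: "R > 0" "\<And>z t w. z \<in> Z \<Longrightarrow> t \<in> {0..1} \<Longrightarrow> norm (w - x t z) \<le> R \<Longrightarrow> w \<in> V"
    and \<epsilon>: "\<epsilon> > 0"
  shows "\<exists>\<Psi>. P \<Psi> \<and> (\<forall>z\<in>Z. norm (\<Psi> z - x 1 z) \<le> \<epsilon>)"
proof -
  \<comment> \<open>The global error will be \<open>\<eta> * exp L\<close>; making it at most R as
    well keeps the approximate orbit where \<open>step\<close> applies.\<close>
  define \<eta> where "\<eta> = min \<epsilon> R / exp L"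
  have \<eta>: "\<eta> > 0" "\<eta> * exp L \<le> \<epsilon>" "\<eta> * exp L \<le> R" using \<epsilon> R(1) by (auto simp: \<eta>_def)
  obtain h0 where h0: "h0 > 0" "\<And>t h. t \<in> {0..1} \<Longrightarrow> 0 < h \<Longrightarrow> h \<le> h0 \<Longrightarrow>
      \<exists>\<Psi>. P \<Psi> \<and> (\<forall>w\<in>V. norm (\<Psi> w - w - h *\<^sub>R f t w) \<le> \<eta> / 2 * h)"
    using step[of "\<eta> / 2"] \<eta>(1) by auto
  obtain r where r: "r > 0" "\<And>s t x. s \<in> {0..1} \<Longrightarrow> t \<in> {0..1} \<Longrightarrow> \<bar>s - t\<bar> < r \<Longrightarrow> norm (f s x - f t x) \<le> \<eta> / 4"
    using uc[of "\<eta> / 4"] \<eta>(1) by auto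
  have "norm (f 0 0) \<le> M" by (rule bd) simp
  then have M: "M \<ge> 0" by (rule order_trans[OF norm_ge_zero])
  \<comment> \<open>Besides consistency and continuity in time, the last bound gives
    \<open>L * (M * h) \<le> \<eta> / 4\<close>: during one step an orbit moves at most
    \<open>M * h\<close>, so its velocity changes little.\<close>
  define b where "b = min (min h0 r) (\<eta> / (4 * (L * M + 1)))"
  have LM: "L * M + 1 > 0" using L M by (simp add: add_nonneg_pos)
  then have b: "b > 0" using h0(1) r(1) \<eta>(1) by (simp add: b_def)
  obtain N0 :: nat where N0: "1 / b < N0" using reals_Archimedean2 by blast
  define N where "N = Suc N0"
  define h where "h = 1 / real N"
  have N: "real N > 0" by (simp add: N_def)
  have h: "h > 0" using N by (simp add: h_def)
  have "1 / b < real N" using N0 by (simp add: N_def)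
  then have hb: "h < b" using b N by (simp add: h_def field_simps)
  then have hh: "h \<le> h0" "h < r" "h \<le> \<eta> / (4 * (L * M + 1))" by (auto simp: b_def)
  have "h * (4 * (L * M + 1)) \<le> \<eta>"
    using hh(3) by (subst (asm) pos_le_divide_eq) (use LM in auto)
  then have hLM: "L * (M * h) \<le> \<eta> / 4" using h by (simp add: algebra_simps)
  have Nh: "real N * h = 1" using N by (simp add: h_def)
  have grid: "real i * h \<in> {0..1}" if "i \<le> N" for i
  proof -
    have "real i * h \<le> real N * h" using that h by (intro mult_right_mono) auto
    then show ?thesis using Nh h by simp
  qed
  \<comment> \<open>Discrete Gronwall: i local errors of at most \<open>\<eta> * h\<close> each,
    half from consistency and half from the Euler defect, amplified by at most the exponential of L
    times the elapsed time.\<close>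
  have "\<exists>\<Phi>. P \<Phi> \<and> (\<forall>z\<in>Z. norm (\<Phi> z - x (real i * h) z) \<le> real i * h * \<eta> * exp (L * (real i * h)))"
    if "i \<le> N" for i
    using that
  proof (induction i)
    case 0
    show ?case by (intro exI[of _ "\<lambda>z. z"] conjI P_id ballI) (simp add: init)
  next
    case (Suc i)
    then obtain \<Phi> where \<Phi>: "P \<Phi>" "\<And>z. z \<in> Z \<Longrightarrow> norm (\<Phi> z - x (real i * h) z) \<le> real i * h * \<eta> * exp (L * (real i * h))"
      by auto
    let ?t = "real i * h" and ?t' = "real (Suc i) * h"
    have t: "?t \<in> {0..1}" "?t' \<in> {0..1}" using grid[of i] grid[of "Suc i"] Suc.prems by auto
    have tt': "?t' - ?t = h" by (simp add: algebra_simps)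
    obtain \<Psi> where \<Psi>: "P \<Psi>" "\<And>w. w \<in> V \<Longrightarrow> norm (\<Psi> w - w - h *\<^sub>R f ?t w) \<le> \<eta> / 2 * h"
      using h0(2)[OF t(1) h hh(1)] by blast
    have "norm (\<Psi> (\<Phi> z) - x ?t' z) \<le> ?t' * \<eta> * exp (L * ?t')" if z: "z \<in> Z" for z
    proof -
      let ?w = "\<Phi> z" and ?y = "x ?t z"
      let ?e = "?t * \<eta> * exp (L * ?t)"
      have e: "norm (?w - ?y) \<le> ?e" by (rule \<Phi>(2)[OF z])
      have "L * ?t \<le> L * 1" using t(1) L by (intro mult_left_mono) auto
      then have "?e \<le> 1 * \<eta> * exp (L * 1)" using t(1) \<eta>(1) h by (intro mult_mono) auto
      then have wV: "?w \<in> V" using e \<eta>(3) by (intro R(2)[OF z t(1)]) simp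
      have "norm (x ?t' z - x ?t z - (?t' - ?t) *\<^sub>R f ?t ?y) \<le> \<eta> / 2 * (?t' - ?t)"
      proof (rule vector_derivative_increment[OF sol[OF z] t])
        show "?t \<le> ?t'" using h by (simp add: algebra_simps)
        fix s assume s: "s \<in> {?t..?t'}"
        then have s01: "s \<in> {0..1}" using t by auto
        have sh: "s - ?t \<le> h" using s tt' by auto
        have "norm (x s z - x ?t z - (s - ?t) *\<^sub>R 0) \<le> M * (s - ?t)"
          by (rule vector_derivative_increment[OF sol[OF z] t(1) s01]) (use s t s01 bd in auto)
        also have "\<dots> \<le> M * h" using sh M by (rule mult_left_mono)
        finally have "L * norm (x s z - x ?t z) \<le> \<eta> / 4"
          using mult_left_mono[of "norm (x s z - x ?t z)" "M * h" L] L hLM by simp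
        then have "norm (f s (x s z) - f s ?y) \<le> \<eta> / 4" using lip[OF s01, of "x s z" ?y] by linarith
        moreover have "norm (f s ?y - f ?t ?y) \<le> \<eta> / 4"
          using s sh hh(2) by (intro r(2) s01 t) auto
        ultimately show "norm (f s (x s z) - f ?t ?y) \<le> \<eta> / 2"
          using norm_triangle_ineq[of "f s (x s z) - f s ?y" "f s ?y - f ?t ?y"] by simp
      qed
      then have inc: "norm (x ?t' z - ?y - h *\<^sub>R f ?t ?y) \<le> \<eta> / 2 * h" unfolding tt' .
      have "norm (h *\<^sub>R (f ?t ?w - f ?t ?y)) \<le> h * (L * norm (?w - ?y))"
        using lip[OF t(1), of ?w ?y] h by (simp add: mult_left_mono)
      also have "\<dots> \<le> h * (L * ?e)" using e L h by (intro mult_left_mono) auto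
      finally have l: "norm (h *\<^sub>R (f ?t ?w - f ?t ?y)) \<le> h * (L * ?e)" .
      have split: "\<Psi> ?w - x ?t' z = (\<Psi> ?w - ?w - h *\<^sub>R f ?t ?w) + ((?w - ?y) + (h *\<^sub>R (f ?t ?w - f ?t ?y) +
          - (x ?t' z - ?y - h *\<^sub>R f ?t ?y)))" by (simp add: algebra_simps)
      have "norm (\<Psi> ?w - x ?t' z) \<le> \<eta> / 2 * h + (?e + (h * (L * ?e) + \<eta> / 2 * h))"
        unfolding split by (intro norm_triangle_le add_mono \<Psi>(2) wV e l) (simp only: norm_minus_cancel inc)
      also have "\<dots> = ?e * (1 + L * h) + \<eta> * h" by (simp add: algebra_simps)
      also have "\<dots> \<le> ?e * exp (L * h) + \<eta> * h * exp (L * ?t')"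
      proof (rule add_mono)
        show "?e * (1 + L * h) \<le> ?e * exp (L * h)"
          using \<eta>(1) h by (intro mult_left_mono exp_ge_add_one_self) auto
        have "1 \<le> exp (L * ?t')" using L t(2) by simp
        then show "\<eta> * h \<le> \<eta> * h * exp (L * ?t')" using \<eta>(1) h by simp
      qed
      also have "?e * exp (L * h) = ?t * \<eta> * exp (L * ?t')"
        by (simp add: exp_add[symmetric] algebra_simps)
      also have "?t * \<eta> * exp (L * ?t') + \<eta> * h * exp (L * ?t') = ?t' * \<eta> * exp (L * ?t')"
        by (simp add: algebra_simps)
      finally show ?thesis .
    qed
    then show ?case using P_comp[OF \<Psi>(1) \<Phi>(1)] by (intro exI[of _ "\<lambda>z. \<Psi> (\<Phi> z)"] conjI) auto
  qed
  from this[of N] obtain \<Phi> where \<Phi>: "P \<Phi>" "\<And>z. z \<in> Z \<Longrightarrow> norm (\<Phi> z - x 1 z) \<le> \<eta> * exp L"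
    by (auto simp: Nh)
  show ?thesis using \<Phi> \<eta>(2) by (intro exI[of _ \<Phi>]) (auto intro: order_trans)
qed

section \<open>Approximation of the flow of a time-dependent Hamiltonian\<close>

text \<open>Summarises what the numerical scheme needs, all on one strip independent of t.
  Holomorphic functions and topologies on function spaces do not appear in its conclusions any
  more.\<close>

lemma ham_path_fields:
  fixes H :: "real \<Rightarrow> 'n::finite phase_space \<Rightarrow> real"
  assumes H: "continuous_map (top_of_set {0..}) analytic_fun_topology H"
  obtains \<rho> F L M where "\<rho> > 0" "L \<ge> 0"
    "\<And>t x. t \<in> {0..1} \<Longrightarrow> cvec (ham_vf (H t) (to_torus x)) = cham (F t) (cvec x)"
    "\<And>t z w. t \<in> {0..1} \<Longrightarrow> z \<in> strip \<rho> \<Longrightarrow> w \<in> strip \<rho> \<Longrightarrow> norm (cham (F t) z - cham (F t) w) \<le> L * norm (z - w)"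
    "\<And>t z. t \<in> {0..1} \<Longrightarrow> z \<in> strip \<rho> \<Longrightarrow> norm (cham (F t) z) \<le> M"
    "\<And>\<eta>. \<eta> > 0 \<Longrightarrow> \<exists>r>0. \<forall>s\<in>{0..1}. \<forall>t\<in>{0..1}. \<bar>s - t\<bar> < r \<longrightarrow>
       (\<forall>z\<in>strip \<rho>. norm (cham (F s) z - cham (F t) z) \<le> \<eta>)"
    "\<And>\<delta> t. \<delta> > 0 \<Longrightarrow> t \<in> {0..1} \<Longrightarrow> \<exists>h0>0. \<forall>h. \<bar>h\<bar> \<le> h0 \<longrightarrow>
       (\<exists>\<Psi>. shear_lift \<Psi> \<and> (\<forall>w\<in>strip \<rho>. norm (\<Psi> w - w - h *\<^sub>R cham (F t) w) \<le> \<delta> * \<bar>h\<bar>))"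
proof -
  obtain n where n: "\<And>t. t \<in> {0..1::real} \<Longrightarrow> H t \<in> ext_ball n"
    using analytic_path_uniform_strip[OF H] by blast
  define R where "R = 1 / real (Suc n)"
  \<comment> \<open>The \<open>+ 1\<close> makes M positive, since tolerances are divided by
    it.\<close>
  define M where "M = real n + 1"
  have R: "R > 0" by (simp add: R_def)
  have M: "M > 0" by (simp add: M_def)
  have "\<forall>t\<in>{0..1}. \<exists>F. strip_ext R F (H t) \<and> (\<forall>z\<in>strip R. norm (F z) \<le> M)"
  proof
    fix t :: real assume "t \<in> {0..1}"
    then obtain F where F: "strip_ext R F (H t)" "\<forall>z\<in>strip R. norm (F z) \<le> real n"
      using n unfolding ext_ball_def R_def by blast
    have "norm (F z) \<le> M" if "z \<in> strip R" for z using F(2) that by (auto simp: M_def intro: order_trans)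
    then show "\<exists>F. strip_ext R F (H t) \<and> (\<forall>z\<in>strip R. norm (F z) \<le> M)" using F(1) by blast
  qed
  from bchoice[OF this] obtain F where
    F0: "\<forall>t\<in>{0..1}. strip_ext R (F t) (H t) \<and> (\<forall>z\<in>strip R. norm (F t z) \<le> M)" ..
  have ext: "strip_ext R (F t) (H t)" and bd: "z \<in> strip R \<Longrightarrow> norm (F t z) \<le> M" if "t \<in> {0..1}" for t z
    using F0 that by blast+
  have holo: "holo_on (F t) (strip R)" if "t \<in> {0..1}" for t by (rule strip_extD(1)[OF ext[OF that]])
  let ?c = "real CARD('n + 'n)"
  have c: "?c > 0" by (simp only: of_nat_0_less_iff zero_less_card_finite)
  \<comment> \<open>Sampling halves the width, and a Cauchy estimate of width R / 4 then leads from
    R / 2 to R / 4; the Lipschitz estimate loses R / 2 from the full strip.\<close>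
  define \<rho> where "\<rho> = R / 4"
  have \<rho>: "\<rho> > 0" using R by (simp add: \<rho>_def)
  have sub2: "z \<in> strip (R - 2 * \<rho>)" if "z \<in> strip \<rho>" for z :: "complex ^ ('n + 'n)"
    using that by (rule strip_mono') (use R in \<open>simp add: \<rho>_def\<close>)
  have sub1: "z \<in> strip (R - \<rho>)" if "z \<in> strip \<rho>" for z :: "complex ^ ('n + 'n)"
    using that by (rule strip_mono') (use R in \<open>simp add: \<rho>_def\<close>)
  have sub: "z \<in> strip R" if "z \<in> strip (R / 2)" for z :: "complex ^ ('n + 'n)"
    using that by (rule strip_mono') (use R in simp)
  \<comment> \<open>The same list serves all t, because the extensions share the strip and the bound
    M.\<close>
  have sample: "\<exists>L. (\<forall>p\<in>set L. trigpoly (snd p)) \<and> (\<forall>t\<in>{0..1}. \<forall>z\<in>strip (R / 2).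
      norm (F t z - (\<Sum>p\<leftarrow>L. of_real (H t (to_torus (fst p))) * snd p z)) \<le> \<eta>)" if "\<eta> > 0" for \<eta> :: real
  proof -
    have 1: "0 < R / 2" "R / 2 < R" "0 < \<eta> / M" using R M that by auto
    obtain L :: "((real ^ ('n + 'n)) \<times> (complex ^ ('n + 'n) \<Rightarrow> complex)) list" where L: "\<And>p. p \<in> set L \<Longrightarrow> trigpoly (snd p)"
      "\<And>F f M' z. strip_ext R F f \<Longrightarrow> (\<And>z. z \<in> strip R \<Longrightarrow> norm (F z) \<le> M') \<Longrightarrow> z \<in> strip (R / 2) \<Longrightarrow>
       norm (F z - (\<Sum>p\<leftarrow>L. of_real (f (to_torus (fst p))) * snd p z)) \<le> M' * (\<eta> / M)"
      by (rule sampling[OF 1]) blast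
    show ?thesis
    proof (intro exI[of _ L] conjI ballI L(1))
      fix t :: real and z :: "complex ^ ('n + 'n)"
      assume t: "t \<in> {0..1}" and z: "z \<in> strip (R / 2)"
      have "norm (F t z - (\<Sum>p\<leftarrow>L. of_real (H t (to_torus (fst p))) * snd p z)) \<le> M * (\<eta> / M)"
        by (rule L(2)[OF ext[OF t] bd[OF t] z])
      then show "norm (F t z - (\<Sum>p\<leftarrow>L. of_real (H t (to_torus (fst p))) * snd p z)) \<le> \<eta>" using M by simp
    qed
  qed
  have close: "norm (cham G z - cham G' z) \<le> \<eta>"
    if "holo_on G (strip (R / 2))" "holo_on G' (strip (R / 2))"
      "\<And>z. z \<in> strip (R / 2) \<Longrightarrow> norm (G z - G' z) \<le> \<eta> * \<rho> / ?c" "z \<in> strip \<rho>" for G G' \<eta> and z :: "complex ^ ('n + 'n)"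
  proof -
    have "R / 2 - \<rho> = \<rho>" by (simp add: \<rho>_def)
    then have "norm (cham G z - cham G' z) \<le> ?c * (\<eta> * \<rho> / ?c / \<rho>)"
      using that \<rho> by (intro cham_diff_bound[where r = "R / 2"]) auto
    then show ?thesis using c \<rho> by simp
  qed
  show ?thesis
  proof (rule that[of \<rho> "?c * (M / \<rho>\<^sup>2)" F "?c * (M / \<rho>)"])
    show "\<rho> > 0" by (rule \<rho>)
    show "0 \<le> ?c * (M / \<rho>\<^sup>2)" using M \<rho> by simp
    show "cvec (ham_vf (H t) (to_torus x)) = cham (F t) (cvec x)" if "t \<in> {0..1}" for t x
      by (rule cvec_ham_vf[OF ext[OF that] R])
    show "norm (cham (F t) z - cham (F t) w) \<le> ?c * (M / \<rho>\<^sup>2) * norm (z - w)"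
      if "t \<in> {0..1}" "z \<in> strip \<rho>" "w \<in> strip \<rho>" for t z w
      by (rule cham_lipschitz[OF holo bd \<rho> sub2 sub2]) (use that in auto)
    show "norm (cham (F t) z) \<le> ?c * (M / \<rho>)" if "t \<in> {0..1}" "z \<in> strip \<rho>" for t z
      by (rule cham_bound[OF holo bd \<rho> sub1]) (use that in auto)
    show "\<exists>r>0. \<forall>s\<in>{0..1}. \<forall>t\<in>{0..1}. \<bar>s - t\<bar> < r \<longrightarrow>
       (\<forall>z\<in>strip \<rho>. norm (cham (F s) z - cham (F t) z) \<le> \<eta>)" if "\<eta> > 0" for \<eta>
    proof -
      \<comment> \<open>A third each for sampling at time s, for the change of the sample values,
        and for sampling at time t, rescaled so that Cauchy's estimate returns \<eta>.\<close>
      define \<eta>' where "\<eta>' = \<eta> * \<rho> / ?c / 3"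
      have \<eta>': "\<eta>' > 0" using that \<rho> c by (simp add: \<eta>'_def)
      obtain L where L: "\<forall>p\<in>set L. trigpoly (snd p)"
        "\<forall>t\<in>{0..1}. \<forall>z\<in>strip (R / 2). norm (F t z - (\<Sum>p\<leftarrow>L. of_real (H t (to_torus (fst p))) * snd p z)) \<le> \<eta>'"
        using sample[OF \<eta>'] by (elim exE conjE)
      have "\<forall>p\<in>set L. \<exists>B\<ge>0. \<forall>z\<in>strip (R / 2). norm (snd p z) \<le> B" using L(1) trigpoly_bounded by blast
      from bchoice[OF this] obtain B where B: "\<And>p. p \<in> set L \<Longrightarrow> 0 \<le> B p"
        "\<And>p z. p \<in> set L \<Longrightarrow> z \<in> strip (R / 2) \<Longrightarrow> norm (snd p z) \<le> B p" by blast
      define D where "D s t = (\<Sum>p\<leftarrow>L. \<bar>H s (to_torus (fst p)) - H t (to_torus (fst p))\<bar> * B p)" for s t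
      have uD: "\<exists>r>0. \<forall>s\<in>{0..1}. \<forall>t\<in>{0..1}. \<bar>s - t\<bar> < r \<longrightarrow> D s t < \<eta>'"
      proof -
        define a where "a = (\<Sum>p\<leftarrow>L. B p) + 1"
        have a: "a > 0" unfolding a_def using B(1) by (intro add_nonneg_pos sum_list_nonneg) auto
        have "\<forall>p\<in>set L. \<exists>r>0. \<forall>s\<in>{0..1}. \<forall>t\<in>{0..1}. \<bar>s - t\<bar> < r \<longrightarrow> \<bar>H s (to_torus (fst p)) - H t (to_torus (fst p))\<bar> \<le> \<eta>' / (2 * a)"
        proof
          fix p
          have "continuous_on {0..1} (\<lambda>t. H t (to_torus (fst p)))"
            by (rule continuous_on_subset[OF analytic_path_eval_continuous[OF H]]) auto
          then have "uniformly_continuous_on {0..1} (\<lambda>t. H t (to_torus (fst p)))"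
            by (rule compact_uniformly_continuous) simp
          moreover have "\<eta>' / (2 * a) > 0" using \<eta>' a by simp
          ultimately obtain r where "r > 0" "\<forall>s\<in>{0..1}. \<forall>t\<in>{0..1}. dist t s < r \<longrightarrow> dist (H t (to_torus (fst p))) (H s (to_torus (fst p))) < \<eta>' / (2 * a)"
            unfolding uniformly_continuous_on_def by blast
          then show "\<exists>r>0. \<forall>s\<in>{0..1}. \<forall>t\<in>{0..1}. \<bar>s - t\<bar> < r \<longrightarrow> \<bar>H s (to_torus (fst p)) - H t (to_torus (fst p))\<bar> \<le> \<eta>' / (2 * a)"
            by (intro exI[of _ r]) (auto simp: dist_real_def less_imp_le)
        qed
        from bchoice[OF this] obtain r where r: "\<And>p. p \<in> set L \<Longrightarrow> r p > 0"
          "\<And>p s t. p \<in> set L \<Longrightarrow> s \<in> {0..1} \<Longrightarrow> t \<in> {0..1} \<Longrightarrow> \<bar>s - t\<bar> < r p \<Longrightarrow> \<bar>H s (to_torus (fst p)) - H t (to_torus (fst p))\<bar> \<le> \<eta>' / (2 * a)"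
          by blast
        define r0 where "r0 = Min (insert 1 (r ` set L))"
        have r0: "r0 > 0" unfolding r0_def using r(1) by (subst Min_gr_iff) auto
        have r0p: "r0 \<le> r p" if "p \<in> set L" for p unfolding r0_def using that by (intro Min_le) auto
        have "D s t < \<eta>'" if st: "s \<in> {0..1}" "t \<in> {0..1}" "\<bar>s - t\<bar> < r0" for s t
        proof -
          have "D s t \<le> (\<Sum>p\<leftarrow>L. \<eta>' / (2 * a) * B p)"
            unfolding D_def
            by (intro sum_list_mono mult_right_mono r(2) B(1) st) (use st r0p in \<open>auto intro: order.strict_trans2\<close>)
          also have "\<dots> = \<eta>' / (2 * a) * (\<Sum>p\<leftarrow>L. B p)" by (rule sum_list_const_mult)
          also have "(\<Sum>p\<leftarrow>L. B p) = a - 1" by (simp add: a_def)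
          also have "\<eta>' / (2 * a) * (a - 1) \<le> \<eta>' / (2 * a) * a" using \<eta>' a by (intro mult_left_mono) auto
          also have "\<dots> < \<eta>'" using a \<eta>' by simp
          finally show ?thesis .
        qed
        then show ?thesis using r0 by blast
      qed
      then obtain r where r: "r > 0" "\<And>s t. s \<in> {0..1} \<Longrightarrow> t \<in> {0..1} \<Longrightarrow> \<bar>s - t\<bar> < r \<Longrightarrow> D s t < \<eta>'" by blast
      show ?thesis
      proof (intro exI[of _ r] conjI r(1) ballI impI)
        fix s t :: real and z :: "complex ^ ('n + 'n)"
        assume st: "s \<in> {0..1}" "t \<in> {0..1}" "\<bar>s - t\<bar> < r" and z: "z \<in> strip \<rho>"
        show "norm (cham (F s) z - cham (F t) z) \<le> \<eta>"
        proof (rule close[OF _ _ _ z])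
          show "holo_on (F s) (strip (R / 2))" "holo_on (F t) (strip (R / 2))"
            using holo st(1,2) sub by (blast intro: holo_on_subset)+
          fix z :: "complex ^ ('n + 'n)" assume z: "z \<in> strip (R / 2)"
          let ?S = "\<lambda>t. \<Sum>p\<leftarrow>L. of_real (H t (to_torus (fst p))) * snd p z"
          have "?S s - ?S t = (\<Sum>p\<leftarrow>L. of_real (H s (to_torus (fst p)) - H t (to_torus (fst p))) * snd p z)"
            by (simp add: sum_list_subtractf left_diff_distrib)
          then have "norm (?S s - ?S t) \<le> (\<Sum>p\<leftarrow>L. norm (of_real (H s (to_torus (fst p)) - H t (to_torus (fst p))) * snd p z))"
            using norm_sum_list_le[of "map (\<lambda>p. of_real (H s (to_torus (fst p)) - H t (to_torus (fst p))) * snd p z) L"]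
            by (simp add: o_def del: of_real_diff)
          also have "\<dots> \<le> D s t"
            unfolding D_def by (intro sum_list_mono) (use B(2)[OF _ z] in \<open>auto simp: norm_mult simp del: of_real_diff intro!: mult_left_mono\<close>)
          also have "\<dots> \<le> \<eta>'" using r(2)[OF st] by simp
          finally have S: "norm (?S s - ?S t) \<le> \<eta>'" .
          have e: "norm (F s z - ?S s) \<le> \<eta>'" "norm (?S t - F t z) \<le> \<eta>'"
            using L(2) st(1,2) z by (auto simp: norm_minus_commute)
          have "F s z - F t z = (F s z - ?S s) + ((?S s - ?S t) + (?S t - F t z))" by simp
          then have "norm (F s z - F t z) \<le> \<eta>' + (\<eta>' + \<eta>')"
            using e S by (simp only:) (intro norm_triangle_le add_mono)
          then show "norm (F s z - F t z) \<le> \<eta> * \<rho> / ?c" by (simp add: \<eta>'_def)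
        qed
      qed
    qed
    show "\<exists>h0>0. \<forall>h. \<bar>h\<bar> \<le> h0 \<longrightarrow> (\<exists>\<Psi>. shear_lift \<Psi> \<and>
        (\<forall>w\<in>strip \<rho>. norm (\<Psi> w - w - h *\<^sub>R cham (F t) w) \<le> \<delta> * \<bar>h\<bar>))" if \<delta>: "\<delta> > 0" and t: "t \<in> {0..1}" for \<delta> t
    proof -
      have \<delta>2: "\<delta> / 2 > 0" and \<eta>': "\<delta> / 2 * \<rho> / ?c > 0" using \<delta> \<rho> c by auto
      obtain L where L: "\<forall>p\<in>set L. trigpoly (snd p)"
        "\<forall>t\<in>{0..1}. \<forall>z\<in>strip (R / 2). norm (F t z - (\<Sum>p\<leftarrow>L. of_real (H t (to_torus (fst p))) * snd p z)) \<le> \<delta> / 2 * \<rho> / ?c"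
        using sample[OF \<eta>'] by (elim exE conjE)
      define K where "K = (\<lambda>z. \<Sum>p\<leftarrow>L. of_real (H t (to_torus (fst p))) * snd p z)"
      have K: "shear_ham K"
        unfolding K_def using L(1) by (intro shear_ham_sum_list shear_ham_trigpoly) blast
      then have fK: "flowable (cham K)" and tK: "tame K" by (auto simp: shear_ham_def)
      have cl: "norm (cham K w - cham (F t) w) \<le> \<delta> / 2" if "w \<in> strip \<rho>" for w
      proof (rule close[OF _ _ _ that])
        show "holo_on K (strip (R / 2))" by (rule tameD(1)[OF tK])
        show "holo_on (F t) (strip (R / 2))" using holo[OF t] sub by (blast intro: holo_on_subset)
        show "norm (K z - F t z) \<le> \<delta> / 2 * \<rho> / ?c" if "z \<in> strip (R / 2)" for z
          using L(2) t that unfolding K_def by (subst norm_minus_commute) blast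
      qed
      obtain h0 where h0: "h0 > 0" "\<And>h. \<bar>h\<bar> \<le> h0 \<Longrightarrow>
          \<exists>\<Psi>. shear_lift \<Psi> \<and> (\<forall>w\<in>strip \<rho>. norm (\<Psi> w - w - h *\<^sub>R cham K w) \<le> \<delta> / 2 * \<bar>h\<bar>)"
        by (rule flowableD[OF fK \<rho> \<delta>2]) blast
      show ?thesis
      proof (intro exI[of _ h0] conjI h0(1) allI impI)
        fix h assume "\<bar>h\<bar> \<le> h0"
        then obtain \<Psi> where \<Psi>: "shear_lift \<Psi>" "\<forall>w\<in>strip \<rho>. norm (\<Psi> w - w - h *\<^sub>R cham K w) \<le> \<delta> / 2 * \<bar>h\<bar>"
          using h0(2) by blast
        have "norm (\<Psi> w - w - h *\<^sub>R cham (F t) w) \<le> \<delta> * \<bar>h\<bar>" if w: "w \<in> strip \<rho>" for w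
        proof -
          have 1: "norm (h *\<^sub>R (cham K w - cham (F t) w)) \<le> \<bar>h\<bar> * (\<delta> / 2)"
            unfolding norm_scaleR by (intro mult_left_mono cl w) simp
          have 2: "norm (\<Psi> w - w - h *\<^sub>R cham K w) \<le> \<delta> / 2 * \<bar>h\<bar>" using \<Psi>(2) w by blast
          have "\<Psi> w - w - h *\<^sub>R cham (F t) w = (\<Psi> w - w - h *\<^sub>R cham K w) + h *\<^sub>R (cham K w - cham (F t) w)"
            by (simp add: algebra_simps)
          also have "norm \<dots> \<le> \<delta> / 2 * \<bar>h\<bar> + \<bar>h\<bar> * (\<delta> / 2)"
            by (rule norm_triangle_le[OF add_mono[OF 2 1]])
          finally show ?thesis by simp
        qed
        then show "\<exists>\<Psi>. shear_lift \<Psi> \<and> (\<forall>w\<in>strip \<rho>. norm (\<Psi> w - w - h *\<^sub>R cham (F t) w) \<le> \<delta> * \<bar>h\<bar>)"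
          using \<Psi>(1) by blast
      qed
    qed
  qed
qed

text \<open>Retraction onto a closed strip that does not increase distances. It extends a vector
  field known on a strip to a globally Lipschitz one, so that solutions exist on the whole time
  interval. The extended field is not holomorphic in general; holomorphy of its time-one map near
  the real points comes later from approximation.\<close>

definition im_clamp :: "real \<Rightarrow> complex ^ 'k \<Rightarrow> complex ^ 'k" where
  "im_clamp r z = (\<chi> k. Complex (Re (z $ k)) (max (- r) (min r (Im (z $ k)))))"

lemma norm_im_clamp_diff: "norm (im_clamp r z - im_clamp r w) \<le> norm (z - w :: complex ^ 'k::finite)"
proof (rule norm_le_componentwise_cart)
  fix i
  let ?c = "\<lambda>x. max (- r) (min r x)"
  have "\<bar>?c (Im (z $ i)) - ?c (Im (w $ i))\<bar> \<le> \<bar>Im (z $ i) - Im (w $ i)\<bar>" by (auto simp: max_def min_def abs_if)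
  then have "(?c (Im (z $ i)) - ?c (Im (w $ i)))\<^sup>2 \<le> (Im (z $ i) - Im (w $ i))\<^sup>2" by (simp only: abs_le_square_iff)
  then show "norm ((im_clamp r z - im_clamp r w) $ i) \<le> norm ((z - w) $ i)"
    unfolding norm_complex_def by (intro real_sqrt_le_mono add_mono) (simp_all add: im_clamp_def)
qed

lemma im_clamp_in_strip: "0 < r \<Longrightarrow> r < s \<Longrightarrow> im_clamp r z \<in> strip s"
  by (auto simp: strip_def im_clamp_def abs_less_iff)

lemma im_clamp_strip: "z \<in> strip r \<Longrightarrow> im_clamp r z = z"
proof -
  assume "z \<in> strip r"
  then have "max (- r) (min r (Im (z $ k))) = Im (z $ k)" for k
    unfolding strip_def by (auto simp: abs_less_iff max_def min_def dest!: spec[of _ k])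
  then show ?thesis by (simp add: im_clamp_def vec_eq_iff)
qed

text \<open>The admissible step size may depend on t. Finitely many grid times have a common one,
  and every other time borrows the map of the grid time just below it, half of \<delta> covering the
  difference of the fields.\<close>

lemma uniform_consistency:
  fixes X :: "real \<Rightarrow> complex ^ ('n::finite + 'n) \<Rightarrow> complex ^ ('n + 'n)"
  assumes uc: "\<And>\<eta>. \<eta> > 0 \<Longrightarrow> \<exists>r>0. \<forall>s\<in>{0..1}. \<forall>t\<in>{0..1}. \<bar>s - t\<bar> < r \<longrightarrow> (\<forall>z\<in>V. norm (X s z - X t z) \<le> \<eta>)"
    and fl: "\<And>\<delta> t. \<delta> > 0 \<Longrightarrow> t \<in> {0..1} \<Longrightarrow> \<exists>h0>0. \<forall>h. \<bar>h\<bar> \<le> h0 \<longrightarrow>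
       (\<exists>\<Psi>. shear_lift \<Psi> \<and> (\<forall>w\<in>V. norm (\<Psi> w - w - h *\<^sub>R X t w) \<le> \<delta> * \<bar>h\<bar>))"
    and \<delta>: "\<delta> > 0"
  shows "\<exists>h0>0. \<forall>t\<in>{0..1}. \<forall>h. 0 < h \<longrightarrow> h \<le> h0 \<longrightarrow>
       (\<exists>\<Psi>. shear_lift \<Psi> \<and> (\<forall>w\<in>V. norm (\<Psi> w - w - h *\<^sub>R X t w) \<le> \<delta> * h))"
proof -
  have \<delta>2: "\<delta> / 2 > 0" using \<delta> by simp
  obtain r where r: "r > 0" "\<And>s t z. s \<in> {0..1} \<Longrightarrow> t \<in> {0..1} \<Longrightarrow> \<bar>s - t\<bar> < r \<Longrightarrow> z \<in> V \<Longrightarrow> norm (X s z - X t z) \<le> \<delta> / 2"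
    using uc[OF \<delta>2] by blast
  obtain N0 :: nat where N0: "1 / r < N0" using reals_Archimedean2 by blast
  define N where "N = Suc N0"
  have N: "real N > 0" by (simp add: N_def)
  have "1 / r < real N" using N0 by (simp add: N_def)
  then have Nr: "1 / real N < r" using r(1) N by (simp add: field_simps)
  have "\<forall>k\<in>{..N}. \<exists>h0>0. \<forall>h. \<bar>h\<bar> \<le> h0 \<longrightarrow>
       (\<exists>\<Psi>. shear_lift \<Psi> \<and> (\<forall>w\<in>V. norm (\<Psi> w - w - h *\<^sub>R X (real k / real N) w) \<le> \<delta> / 2 * \<bar>h\<bar>))"
  proof
    fix k assume "k \<in> {..N}"
    then have "real k / real N \<in> {0..1}" using N by simp
    then show "\<exists>h0>0. \<forall>h. \<bar>h\<bar> \<le> h0 \<longrightarrow>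
       (\<exists>\<Psi>. shear_lift \<Psi> \<and> (\<forall>w\<in>V. norm (\<Psi> w - w - h *\<^sub>R X (real k / real N) w) \<le> \<delta> / 2 * \<bar>h\<bar>))"
      by (rule fl[OF \<delta>2])
  qed
  from bchoice[OF this] obtain g where g: "\<And>k. k \<le> N \<Longrightarrow> g k > 0"
    "\<And>k h. k \<le> N \<Longrightarrow> \<bar>h\<bar> \<le> g k \<Longrightarrow> \<exists>\<Psi>. shear_lift \<Psi> \<and> (\<forall>w\<in>V. norm (\<Psi> w - w - h *\<^sub>R X (real k / real N) w) \<le> \<delta> / 2 * \<bar>h\<bar>)"
    by blast
  define h0 where "h0 = Min (g ` {..N})"
  have h0: "h0 > 0" unfolding h0_def using g(1) by (subst Min_gr_iff) auto
  have h0g: "h0 \<le> g k" if "k \<le> N" for k unfolding h0_def using that by (intro Min_le) auto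
  show ?thesis
  proof (intro exI[of _ h0] conjI h0 ballI allI impI)
    fix t h :: real assume t: "t \<in> {0..1}" and h: "0 < h" "h \<le> h0"
    define k where "k = nat \<lfloor>t * real N\<rfloor>"
    have f0: "0 \<le> \<lfloor>t * real N\<rfloor>" using t N by simp
    have k: "real k \<le> t * real N" "t * real N < real k + 1"
      using f0 by (simp_all add: k_def of_nat_nat)
    have "t * real N \<le> 1 * real N" using t N by (intro mult_right_mono) auto
    then have kN: "k \<le> N" using k(1) by simp
    have kt: "real k / real N \<in> {0..1}" using kN N by simp
    have "real k / real N \<le> t" "t < real k / real N + 1 / real N"
      using k N by (auto simp: field_simps)
    then have near: "\<bar>real k / real N - t\<bar> < r" using Nr by linarith
    have "\<bar>h\<bar> \<le> g k" using h h0g[OF kN] by simp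
    then obtain \<Psi> where \<Psi>: "shear_lift \<Psi>" "\<forall>w\<in>V. norm (\<Psi> w - w - h *\<^sub>R X (real k / real N) w) \<le> \<delta> / 2 * \<bar>h\<bar>"
      using g(2)[OF kN] by blast
    have "norm (\<Psi> w - w - h *\<^sub>R X t w) \<le> \<delta> * h" if w: "w \<in> V" for w
    proof -
      have 1: "norm (h *\<^sub>R (X (real k / real N) w - X t w)) \<le> \<bar>h\<bar> * (\<delta> / 2)"
        unfolding norm_scaleR by (intro mult_left_mono r(2) kt t near w) simp
      have 2: "norm (\<Psi> w - w - h *\<^sub>R X (real k / real N) w) \<le> \<delta> / 2 * \<bar>h\<bar>" using \<Psi>(2) w by blast
      have "\<Psi> w - w - h *\<^sub>R X t w = (\<Psi> w - w - h *\<^sub>R X (real k / real N) w) + h *\<^sub>R (X (real k / real N) w - X t w)"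
        by (simp add: algebra_simps)
      also have "norm \<dots> \<le> \<delta> / 2 * \<bar>h\<bar> + \<bar>h\<bar> * (\<delta> / 2)"
        by (rule norm_triangle_le[OF add_mono[OF 2 1]])
      finally show ?thesis using h(1) by simp
    qed
    then show "\<exists>\<Psi>. shear_lift \<Psi> \<and> (\<forall>w\<in>V. norm (\<Psi> w - w - h *\<^sub>R X t w) \<le> \<delta> * h)" using \<Psi>(1) by blast
  qed
qed

text \<open>Z is the time-one map of the clamped field. The last conclusion is uniqueness on the
  real cover, which makes the flow on the torus well defined.\<close>

lemma ham_path_approx:
  fixes H :: "real \<Rightarrow> 'n::finite phase_space \<Rightarrow> real"
  assumes H: "continuous_map (top_of_set {0..}) analytic_fun_topology H"
  obtains \<rho> Z where "\<rho> > 0"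
    "\<And>\<epsilon>. \<epsilon> > 0 \<Longrightarrow> \<exists>\<Psi>. shear_lift \<Psi> \<and> (\<forall>z\<in>strip \<rho>. norm (\<Psi> z - Z z) \<le> \<epsilon>)"
    "\<And>x. \<exists>y. ham_solution H 0 1 y \<and> y 0 = x \<and> Z (cvec x) = cvec (y 1)"
    "\<And>x y. ham_solution H 0 1 x \<Longrightarrow> ham_solution H 0 1 y \<Longrightarrow> x 0 = y 0 \<Longrightarrow> x 1 = y 1"
proof -
  obtain \<rho> L M and F :: "real \<Rightarrow> complex ^ ('n + 'n) \<Rightarrow> complex" where \<rho>: "\<rho> > 0" and L: "L \<ge> 0"
    and vf: "\<And>t x. t \<in> {0..1} \<Longrightarrow> cvec (ham_vf (H t) (to_torus x)) = cham (F t) (cvec x)"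
    and lip: "\<And>t z w. t \<in> {0..1} \<Longrightarrow> z \<in> strip \<rho> \<Longrightarrow> w \<in> strip \<rho> \<Longrightarrow> norm (cham (F t) z - cham (F t) w) \<le> L * norm (z - w)"
    and bd: "\<And>t z. t \<in> {0..1} \<Longrightarrow> z \<in> strip \<rho> \<Longrightarrow> norm (cham (F t) z) \<le> M"
    and uc: "\<And>\<eta>. \<eta> > 0 \<Longrightarrow> \<exists>r>0. \<forall>s\<in>{0..1}. \<forall>t\<in>{0..1}. \<bar>s - t\<bar> < r \<longrightarrow>
       (\<forall>z\<in>strip \<rho>. norm (cham (F s) z - cham (F t) z) \<le> \<eta>)"
    and fl: "\<And>\<delta> t. \<delta> > 0 \<Longrightarrow> t \<in> {0..1} \<Longrightarrow> \<exists>h0>0. \<forall>h. \<bar>h\<bar> \<le> h0 \<longrightarrow>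
       (\<exists>\<Psi>. shear_lift \<Psi> \<and> (\<forall>w\<in>strip \<rho>. norm (\<Psi> w - w - h *\<^sub>R cham (F t) w) \<le> \<delta> * \<bar>h\<bar>))"
    by (rule ham_path_fields[OF H]) blast
  define f where "f t z = cham (F t) (im_clamp (\<rho> / 2) z)" for t z
  define g where "g t x = ham_vf (H t) (to_torus x)" for t x
  have cs: "im_clamp (\<rho> / 2) z \<in> strip \<rho>" for z :: "complex ^ ('n + 'n)" using \<rho> by (intro im_clamp_in_strip) auto
  have f_strip: "f t z = cham (F t) z" if "z \<in> strip (\<rho> / 2)" for t z
    using im_clamp_strip[OF that] by (simp add: f_def)
  have f_real: "f t (cvec x) = cvec (g t x)" if "t \<in> {0..1}" for t x
    using vf[OF that] \<rho> by (simp add: f_strip g_def)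
  have f_lip: "norm (f t x - f t y) \<le> L * norm (x - y)" if "t \<in> {0..1}" for t x y
    unfolding f_def using lip[OF that cs cs, of x y] mult_left_mono[OF norm_im_clamp_diff L] order_trans by blast
  have f_bd: "norm (f t x) \<le> M" if "t \<in> {0..1}" for t x
    unfolding f_def by (rule bd[OF that cs])
  have f_uc: "\<exists>r>0. \<forall>s\<in>{0..1}. \<forall>t\<in>{0..1}. \<bar>s - t\<bar> < r \<longrightarrow> (\<forall>x. norm (f s x - f t x) \<le> \<eta>)" if "\<eta> > 0" for \<eta>
    using uc[OF that] cs unfolding f_def by meson
  have f_cont: "continuous_on {0..1} (\<lambda>t. f t x)" for x
    unfolding continuous_on_iff
  proof (intro ballI allI impI)
    fix t e :: real assume t: "t \<in> {0..1}" and e: "e > 0"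
    obtain r where r: "r > 0" "\<And>s t x. s \<in> {0..1} \<Longrightarrow> t \<in> {0..1} \<Longrightarrow> \<bar>s - t\<bar> < r \<Longrightarrow> norm (f s x - f t x) \<le> e / 2"
      using f_uc[of "e / 2"] e by auto
    show "\<exists>d>0. \<forall>s\<in>{0..1}. dist s t < d \<longrightarrow> dist (f s x) (f t x) < e"
    proof (intro exI[of _ r] conjI r(1) ballI impI)
      fix s :: real assume "s \<in> {0..1}" "dist s t < r"
      then have "norm (f s x - f t x) \<le> e / 2" using r(2) t by (simp add: dist_real_def)
      then show "dist (f s x) (f t x) < e" using e by (simp add: dist_norm)
    qed
  qed
  have g_lip: "norm (g t x - g t y) \<le> L * norm (x - y)" if "t \<in> {0..1}" for t x y
    using f_lip[OF that, of "cvec x" "cvec y"] unfolding f_real[OF that] cvec_diff[symmetric] norm_cvec .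
  have g_cont: "continuous_on {0..1} (\<lambda>t. g t x)" for x
  proof -
    have "continuous_on {0..1} (\<lambda>t. cRe (f t (cvec x)))"
      unfolding cRe_def by (intro continuous_intros f_cont)
    moreover have "cRe (f t (cvec x)) = g t x" if "t \<in> {0..1}" for t
      unfolding f_real[OF that] by (simp add: cRe_def vec_eq_iff)
    ultimately show ?thesis by (rule continuous_on_eq)
  qed
  have "\<forall>z. \<exists>x. x 0 = z \<and> (\<forall>t\<in>{0..1}. (x has_vector_derivative f t (x t)) (at t within {0..1}))"
  proof
    fix z :: "complex ^ ('n + 'n)"
    obtain x where "x 0 = z" "\<And>t. t \<in> {0..1} \<Longrightarrow> (x has_vector_derivative f t (x t)) (at t within {0..1})"
      using picard_lindeloef[OF f_lip L f_cont] by blast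
    then show "\<exists>x. x 0 = z \<and> (\<forall>t\<in>{0..1}. (x has_vector_derivative f t (x t)) (at t within {0..1}))" by blast
  qed
  from choice[OF this] obtain X where X0: "\<And>z. X z 0 = z"
    and X: "\<And>z t. t \<in> {0..1} \<Longrightarrow> (X z has_vector_derivative f t (X z t)) (at t within {0..1})" by blast
  have real_sol: "\<exists>y. ham_solution H 0 1 y \<and> y 0 = x" for x
  proof -
    obtain y where "y 0 = x" "\<And>t. t \<in> {0..1} \<Longrightarrow> (y has_vector_derivative g t (y t)) (at t within {0..1})"
      using picard_lindeloef[OF g_lip L g_cont] by blast
    then show ?thesis unfolding ham_solution_def g_def by blast
  qed
  \<comment> \<open>Serves two ends: for real z it identifies complex and real orbits, and for z in
    a thin strip it keeps the complex orbit near a real one.\<close>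
  have compare: "norm (X z t - cvec (y t)) \<le> exp L * norm (z - cvec (y 0))"
    if y: "ham_solution H 0 1 y" and t: "t \<in> {0..1}" for y z t
  proof -
    have "norm (X z t - cvec (y t)) \<le> exp (L * t) * norm (X z 0 - cvec (y 0))"
    proof (rule gronwall_difference[OF X _ _ t])
      fix s :: real assume s: "s \<in> {0..1}"
      have "(y has_vector_derivative g s (y s)) (at s within {0..1})"
        using y s unfolding ham_solution_def g_def by blast
      from bounded_linear.has_vector_derivative[OF bounded_linear_cvec this]
      show "((\<lambda>t. cvec (y t)) has_vector_derivative f s (cvec (y s))) (at s within {0..1})"
        unfolding f_real[OF s] .
      show "norm (f s (X z s) - f s (cvec (y s))) \<le> L * norm (X z s - cvec (y s))" by (rule f_lip[OF s])
    qed
    also have "\<dots> \<le> exp L * norm (z - cvec (y 0))"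
    proof -
      have "L * t \<le> L * 1" using t L by (intro mult_left_mono) auto
      then show ?thesis unfolding X0 by (intro mult_right_mono) auto
    qed
    finally show ?thesis .
  qed
  let ?c = "real CARD('n + 'n)"
  have c: "?c > 0" by (simp only: of_nat_0_less_iff zero_less_card_finite)
  \<comment> \<open>A point of this strip is within \<open>?c * \<rho>0\<close> of its real part;
    after growth by exp L this is \<rho> / 8.\<close>
  define \<rho>0 where "\<rho>0 = \<rho> / (8 * ?c * exp L)"
  have \<rho>0: "\<rho>0 > 0" "exp L * (?c * \<rho>0) = \<rho> / 8" using \<rho> c by (auto simp: \<rho>0_def)
  show ?thesis
  proof (rule that[of \<rho>0 "\<lambda>z. X z 1"])
    show "\<rho>0 > 0" by (rule \<rho>0)
    show "\<exists>y. ham_solution H 0 1 y \<and> y 0 = x \<and> X (cvec x) 1 = cvec (y 1)" for x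
    proof -
      obtain y where y: "ham_solution H 0 1 y" "y 0 = x" using real_sol by blast
      have "norm (X (cvec x) 1 - cvec (y 1)) \<le> 0" using compare[OF y(1), of 1 "cvec x"] y(2) by simp
      then show ?thesis using y by auto
    qed
    show "x 1 = y 1" if "ham_solution H 0 1 x" "ham_solution H 0 1 y" "x 0 = y 0" for x y
    proof -
      have "norm (x 1 - y 1) \<le> exp (L * 1) * norm (x 0 - y 0)"
      proof (rule gronwall_difference[where x' = "\<lambda>t. g t (x t)" and y' = "\<lambda>t. g t (y t)"])
        show "(x has_vector_derivative g t (x t)) (at t within {0..1})" if "t \<in> {0..1}" for t
          using \<open>ham_solution H 0 1 x\<close> that unfolding ham_solution_def g_def by blast
        show "(y has_vector_derivative g t (y t)) (at t within {0..1})" if "t \<in> {0..1}" for t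
          using \<open>ham_solution H 0 1 y\<close> that unfolding ham_solution_def g_def by blast
      qed (auto intro: g_lip)
      then show ?thesis using that(3) by simp
    qed
    show "\<exists>\<Psi>. shear_lift \<Psi> \<and> (\<forall>z\<in>strip \<rho>0. norm (\<Psi> z - X z 1) \<le> \<epsilon>)" if "\<epsilon> > 0" for \<epsilon>
    proof (rule one_step_method_converges[where P = shear_lift and f = f and x = "\<lambda>t z. X z t" and V = "strip (\<rho> / 2)"
        and R = "\<rho> / 8" and Z = "strip \<rho>0" and L = L and M = M and \<epsilon> = \<epsilon>])
      show "shear_lift (\<lambda>z :: complex ^ ('n + 'n). z)" by (rule shear_lift_id)
      show "shear_lift (\<lambda>z. \<Phi> (\<Psi> z))" if "shear_lift \<Phi>" "shear_lift \<Psi>"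
        for \<Phi> \<Psi> :: "complex ^ ('n + 'n) \<Rightarrow> complex ^ ('n + 'n)"
        using that by (rule shear_lift_comp)
      show "norm (f t x - f t y) \<le> L * norm (x - y)" if "t \<in> {0..1}" for t x y by (rule f_lip[OF that])
      show "norm (f t x) \<le> M" if "t \<in> {0..1}" for t x by (rule f_bd[OF that])
      show "\<exists>r>0. \<forall>s\<in>{0..1}. \<forall>t\<in>{0..1}. \<bar>s - t\<bar> < r \<longrightarrow> (\<forall>x. norm (f s x - f t x) \<le> \<eta>)" if "\<eta> > 0" for \<eta>
        by (rule f_uc[OF that])
      show "(X z has_vector_derivative f t (X z t)) (at t within {0..1})" if "t \<in> {0..1}" for z t by (rule X[OF that])
      show "X z 0 = z" for z by (rule X0)
      show "0 \<le> L" by (rule L)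
      show "\<epsilon> > 0" by (rule that)
      show "\<rho> / 8 > 0" using \<rho> by simp
      show "w \<in> strip (\<rho> / 2)" if z: "z \<in> strip \<rho>0" and t: "t \<in> {0..1}" and w: "norm (w - X z t) \<le> \<rho> / 8" for z t w
      proof -
        \<comment> \<open>The real orbit starting at the real part of z is \<rho> / 8 away from the
          complex orbit, and w is another \<rho> / 8 away; so w stays inside the region where the
          clamp acts as the identity.\<close>
        obtain y where y: "ham_solution H 0 1 y" "y 0 = cRe z" using real_sol by blast
        have "norm (X z t - cvec (y t)) \<le> exp L * norm (z - cvec (cRe z))" using compare[OF y(1) t, of z] y(2) by simp
        also have "\<dots> \<le> exp L * (?c * \<rho>0)" by (intro mult_left_mono norm_diff_cRe_strip z) simp
        finally have "norm (X z t - cvec (y t)) \<le> \<rho> / 8" unfolding \<rho>0(2) .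
        then have "norm (w - cvec (y t)) \<le> \<rho> / 4"
          using norm_triangle_ineq[of "w - X z t" "X z t - cvec (y t)"] w by simp
        then show ?thesis by (rule strip_near[of _ "\<rho> / 8", rotated]) (use \<rho> in auto)
      qed
      show "\<exists>h0>0. \<forall>t\<in>{0..1}. \<forall>h. 0 < h \<longrightarrow> h \<le> h0 \<longrightarrow>
          (\<exists>\<Psi>. shear_lift \<Psi> \<and> (\<forall>w\<in>strip (\<rho> / 2). norm (\<Psi> w - w - h *\<^sub>R f t w) \<le> \<delta> * h))" if \<delta>: "\<delta> > 0" for \<delta>
      proof -
        have sub: "w \<in> strip \<rho>" if "w \<in> strip (\<rho> / 2)" for w :: "complex ^ ('n + 'n)"
          using that by (rule strip_mono') (use \<rho> in simp)
        obtain h0 where h0: "h0 > 0" "\<And>t h. t \<in> {0..1} \<Longrightarrow> 0 < h \<Longrightarrow> h \<le> h0 \<Longrightarrow>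
          \<exists>\<Psi>. shear_lift \<Psi> \<and> (\<forall>w\<in>strip \<rho>. norm (\<Psi> w - w - h *\<^sub>R cham (F t) w) \<le> \<delta> * h)"
          using uniform_consistency[where X = "\<lambda>t. cham (F t)" and V = "strip \<rho>", OF uc fl \<delta>] by blast
        show ?thesis
        proof (intro exI[of _ h0] conjI h0(1) ballI allI impI)
          fix t h :: real assume "t \<in> {0..1}" "0 < h" "h \<le> h0"
          then obtain \<Psi> where "shear_lift \<Psi>" "\<forall>w\<in>strip \<rho>. norm (\<Psi> w - w - h *\<^sub>R cham (F t) w) \<le> \<delta> * h"
            using h0(2) by blast
          then show "\<exists>\<Psi>. shear_lift \<Psi> \<and> (\<forall>w\<in>strip (\<rho> / 2). norm (\<Psi> w - w - h *\<^sub>R f t w) \<le> \<delta> * h)"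
            using sub f_strip by (intro exI[of _ \<Psi>]) auto
        qed
      qed
    qed
  qed
qed

section \<open>Compositions of shears are Hamiltonian\<close>

text \<open>Solutions are considered through lifts, and two lifts of the same initial point differ
  by a lattice vector. Translating one of them gives again a solution, so uniqueness on the cover
  yields uniqueness of the end point on the torus.\<close>

lemma ham_flow_eq:
  assumes H: "continuous_map (top_of_set {0..}) analytic_fun_topology H"
    and x: "ham_solution H 0 1 x"
  shows "ham_flow H 0 1 (to_torus (x 0)) = to_torus (x 1)"
proof -
  have uniq: "x 1 = y 1" if "ham_solution H 0 1 x" "ham_solution H 0 1 y" "x 0 = y 0" for x y
    by (rule ham_path_approx[OF H]) (use that in blast)
  show ?thesis
    unfolding ham_flow_def
  proof (rule the_equality)
    show "\<exists>y. ham_solution H 0 1 y \<and> to_torus (y 0) = to_torus (x 0) \<and> to_torus (y 1) = to_torus (x 1)"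
      using x by blast
    fix z' assume "\<exists>y. ham_solution H 0 1 y \<and> to_torus (y 0) = to_torus (x 0) \<and> to_torus (y 1) = z'"
    then obtain y where y: "ham_solution H 0 1 y" "to_torus (y 0) = to_torus (x 0)" "to_torus (y 1) = z'" by blast
    define m where "m = y 0 - x 0"
    have m: "m \<in> integer_lattice" using y(2) by (simp add: m_def to_torus_eq_iff)
    have tm: "to_torus (w - m) = to_torus w" for w
      using integer_lattice_uminus[OF m] by (simp add: to_torus_eq_iff)
    have "ham_solution H 0 1 (\<lambda>t. y t - m)"
      unfolding ham_solution_def tm
    proof
      fix r :: real assume "r \<in> {0..1}"
      then have "(y has_vector_derivative ham_vf (H r) (to_torus (y r))) (at r within {0..1})"
        using y(1) unfolding ham_solution_def by blast
      then have "((\<lambda>t. y t - m) has_vector_derivative ham_vf (H r) (to_torus (y r)) - 0) (at r within {0..1})"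
        by (intro has_vector_derivative_diff has_vector_derivative_const)
      then show "((\<lambda>t. y t - m) has_vector_derivative ham_vf (H r) (to_torus (y r))) (at r within {0..1})" by simp
    qed
    then have "x 1 = y 1 - m" using uniq[OF x] by (simp add: m_def)
    then show "z' = to_torus (x 1)" using y(3) tm by simp
  qed
qed

text \<open>A C1 switch from 0 to 1 on the unit interval, whose derivative is the tent function.
  Positive parts give one formula for all arguments. Hamiltonians must depend continuously on time,
  which rules out switching them on abruptly.\<close>

definition smoothstep :: "real \<Rightarrow> real" where
  "smoothstep u = 2 * ((max 0 u)\<^sup>2 - 2 * (max 0 (u - 1/2))\<^sup>2 + (max 0 (u - 1))\<^sup>2)"

definition tent :: "real \<Rightarrow> real" where
  "tent u = 4 * (max 0 u - 2 * max 0 (u - 1/2) + max 0 (u - 1))"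

lemma smoothstep_le_0: "u \<le> 0 \<Longrightarrow> smoothstep u = 0"
  by (simp add: smoothstep_def max_def)

lemma smoothstep_ge_1: "1 \<le> u \<Longrightarrow> smoothstep u = 1"
  by (simp add: smoothstep_def max_def power2_eq_square algebra_simps)

lemma tent_outside: "u \<le> 0 \<or> 1 \<le> u \<Longrightarrow> tent u = 0"
  by (auto simp: tent_def max_def)

lemma DERIV_pos_part_square: "((\<lambda>u::real. (max 0 u)\<^sup>2) has_real_derivative 2 * max 0 u) (at u)"
proof -
  consider "u > 0" | "u < 0" | "u = 0" by linarith
  then show ?thesis
  proof cases
    case 1
    have "((\<lambda>u::real. u\<^sup>2) has_real_derivative 2 * max 0 u) (at u)"
      using 1 by (auto intro!: derivative_eq_intros)
    then show ?thesis
      by (rule has_field_derivative_transform_within_open[where S = "{0<..}"]) (use 1 in auto)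
  next
    case 2
    have "((\<lambda>u::real. 0) has_real_derivative 2 * max 0 u) (at u)" using 2 by simp
    then show ?thesis
      by (rule has_field_derivative_transform_within_open[where S = "{..<0}"]) (use 2 in auto)
  next
    case 3
    have "((\<lambda>h::real. (max 0 h)\<^sup>2 / h) \<longlongrightarrow> 0) (at 0)"
    proof (rule Lim_null_comparison)
      show "\<forall>\<^sub>F h in at (0::real). norm ((max 0 h)\<^sup>2 / h) \<le> \<bar>h\<bar>"
        by (rule always_eventually) (auto simp: max_def power2_eq_square)
      show "((\<lambda>h::real. \<bar>h\<bar>) \<longlongrightarrow> 0) (at 0)" by (intro tendsto_rabs_zero tendsto_ident_at)
    qed
    then show ?thesis using 3 by (simp add: DERIV_def)
  qed
qed

lemma DERIV_smoothstep: "(smoothstep has_real_derivative tent u) (at u)"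
proof -
  have "((\<lambda>u. (max 0 (u - c))\<^sup>2) has_real_derivative 2 * max 0 (u - c) * 1) (at u)" for c :: real
    by (rule DERIV_chain2[OF DERIV_pos_part_square]) (auto intro!: derivative_eq_intros)
  then have d: "((\<lambda>u. (max 0 (u - c))\<^sup>2) has_real_derivative 2 * max 0 (u - c)) (at u)" for c :: real
    by simp
  have "((\<lambda>u. 2 * ((max 0 u)\<^sup>2 - 2 * (max 0 (u - 1/2))\<^sup>2 + (max 0 (u - 1))\<^sup>2)) has_real_derivative
      2 * (2 * max 0 u - 2 * (2 * max 0 (u - 1/2)) + 2 * max 0 (u - 1))) (at u)"
    by (intro DERIV_cmult DERIV_add DERIV_diff DERIV_pos_part_square d)
  then show ?thesis unfolding smoothstep_def[abs_def] tent_def by (simp add: algebra_simps)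
qed

lemma continuous_on_tent: "continuous_on S tent"
  unfolding tent_def by (intro continuous_intros)

section \<open>Time-dependent combinations of finitely many Hamiltonians\<close>

lemma strip_ext_sum:
  assumes "\<And>j. j \<in> J \<Longrightarrow> strip_ext r (F j) (K j)"
  shows "strip_ext r (\<lambda>z. \<Sum>j\<in>J. of_real (c j) * F j z) (\<lambda>x. \<Sum>j\<in>J. c j * K j x)"
  unfolding strip_ext_def
  using strip_extD[OF assms]
  by (auto intro!: holo_on_sum holo_on_cmult sum.cong)

lemma analytic_family_uniform:
  fixes K :: "'j \<Rightarrow> (real, 'k::finite) torus \<Rightarrow> real"
  assumes "finite J" "\<And>j. j \<in> J \<Longrightarrow> analytic_fun (K j)"
  obtains r F where "r > 0" "\<And>j. j \<in> J \<Longrightarrow> strip_ext r (F j) (K j)"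
proof -
  have "\<forall>j\<in>J. \<exists>r F. r > 0 \<and> strip_ext r F (K j)"
  proof
    fix j assume "j \<in> J"
    then have "analytic_fun (K j)" by (rule assms(2))
    then show "\<exists>r F. r > 0 \<and> strip_ext r F (K j)" by (rule analytic_funE) blast
  qed
  from bchoice[OF this] obtain r where "\<forall>j\<in>J. \<exists>F. r j > 0 \<and> strip_ext (r j) F (K j)" ..
  from bchoice[OF this] obtain F where F: "\<forall>j\<in>J. r j > 0 \<and> strip_ext (r j) (F j) (K j)" ..
  \<comment> \<open>The inserted 1 provides a positive minimum also for an empty family.\<close>
  define r0 where "r0 = Min (insert 1 (r ` J))"
  have "r0 > 0" unfolding r0_def using F assms(1) by (subst Min_gr_iff) auto
  moreover have "strip_ext r0 (F j) (K j)" if "j \<in> J" for j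
  proof (rule strip_ext_mono)
    show "strip_ext (r j) (F j) (K j)" using F that by blast
    show "r0 \<le> r j" unfolding r0_def using that assms(1) by (intro Min_le) auto
  qed
  ultimately show ?thesis by (rule that)
qed

text \<open>All combinations extend to one strip, so openness of a set has to be tested only on that
  neighbourhood. There the distance of two combinations is at most the sum of the coefficient
  differences times fixed bounds.\<close>

lemma continuous_map_analytic_sum:
  fixes K :: "'j \<Rightarrow> (real, 'k::finite) torus \<Rightarrow> real"
  assumes J: "finite J" "\<And>j. j \<in> J \<Longrightarrow> analytic_fun (K j)"
    and \<beta>: "\<And>j. j \<in> J \<Longrightarrow> continuous_on {0..} (\<beta> j)"
  shows "continuous_map (top_of_set {0::real..}) analytic_fun_topology (\<lambda>t x. \<Sum>j\<in>J. \<beta> j t * K j x)"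
proof -
  obtain r F where r: "r > 0" and F: "\<And>j. j \<in> J \<Longrightarrow> strip_ext r (F j) (K j)"
    using analytic_family_uniform[of J K] J by blast
  define S where "S t z = (\<Sum>j\<in>J. of_real (\<beta> j t) * F j z)" for t z
  have ext: "strip_ext r (S t) (\<lambda>x. \<Sum>j\<in>J. \<beta> j t * K j x)" for t
    unfolding S_def by (rule strip_ext_sum[OF F])
  have an: "analytic_fun (\<lambda>x. \<Sum>j\<in>J. \<beta> j t * K j x)" for t
    by (rule analytic_fun_strip_ext[OF ext r])
  have r2: "r / 2 > 0" "r / 2 < r" "r / 2 \<le> r" using r by auto
  have "\<forall>j\<in>J. \<exists>M. \<forall>z\<in>strip (r / 2). norm (F j z) \<le> M"
    using strip_ext_bounded[OF F r2(1,2)] by metis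
  from bchoice[OF this] obtain M where M: "\<And>j z. j \<in> J \<Longrightarrow> z \<in> strip (r / 2) \<Longrightarrow> norm (F j z) \<le> M j" by blast
  let ?W = "to_torus ` (strip (r / 2) :: (complex ^ 'k) set)"
  show ?thesis
    unfolding continuous_map_def
  proof (intro conjI allI impI)
    show "(\<lambda>t x. \<Sum>j\<in>J. \<beta> j t * K j x) \<in> topspace (top_of_set {0..}) \<rightarrow> topspace analytic_fun_topology"
      using an by (auto simp: analytic_fun_topology_def)
    fix U :: "((real, 'k) torus \<Rightarrow> real) set" assume U: "openin analytic_fun_topology U"
    let ?A = "{t \<in> topspace (top_of_set {0..}). (\<lambda>x. \<Sum>j\<in>J. \<beta> j t * K j x) \<in> U}"
    show "openin (top_of_set {0..}) ?A"
      unfolding openin_euclidean_subtopology_iff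
    proof (intro conjI ballI)
      show "?A \<subseteq> {0..}" by auto
      fix t assume "t \<in> ?A"
      then have t: "t \<ge> 0" "(\<lambda>x. \<Sum>j\<in>J. \<beta> j t * K j x) \<in> U" by auto
      have ext2: "strip_ext (r / 2) (S t) (\<lambda>x. \<Sum>j\<in>J. \<beta> j t * K j x)" for t
        by (rule strip_ext_mono[OF ext r2(3)])
      note hol = torus_of_strip_ext[OF ext2]
      have "complex_nbhd ?W \<and> torus_holo_fun ?W (\<lambda>x. S t (rep_torus x)) \<and> (\<lambda>x. \<Sum>j\<in>J. \<beta> j t * K j x) \<in> U \<and>
          (\<forall>x. S t (rep_torus (torus_complexify x)) = complex_of_real (\<Sum>j\<in>J. \<beta> j t * K j x))"
        by (intro conjI allI complex_nbhd_strip[OF r2(1)] hol t(2))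
      from U[unfolded analytic_fun_topology_def openin_inductive_limit_topology, THEN conjunct2,
          THEN spec, THEN spec, THEN spec, THEN mp, OF this]
      have "\<exists>\<epsilon>>0. \<forall>G g. torus_holo_fun ?W G \<and> g \<in> {f. analytic_fun f} \<and>
          (\<forall>x. G (torus_complexify x) = complex_of_real (g x)) \<and> (\<forall>z\<in>?W. dist (G z) (S t (rep_torus z)) < \<epsilon>) \<longrightarrow> g \<in> U" .
      then obtain e where e: "e > 0" "\<forall>G g. torus_holo_fun ?W G \<and> g \<in> {f. analytic_fun f} \<and>
          (\<forall>x. G (torus_complexify x) = complex_of_real (g x)) \<and> (\<forall>z\<in>?W. dist (G z) (S t (rep_torus z)) < e) \<longrightarrow> g \<in> U"
        by (elim exE conjE)
      have cont: "continuous_on {0..} (\<lambda>s. \<Sum>j\<in>J. \<bar>\<beta> j s - \<beta> j t\<bar> * M j)"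
        by (intro continuous_intros \<beta>)
      have t0: "t \<in> {0..}" using t(1) by simp
      have "\<exists>d>0. \<forall>s\<in>{0..}. dist s t < d \<longrightarrow>
          dist (\<Sum>j\<in>J. \<bar>\<beta> j s - \<beta> j t\<bar> * M j) (\<Sum>j\<in>J. \<bar>\<beta> j t - \<beta> j t\<bar> * M j) < e"
        by (rule cont[unfolded continuous_on_iff, THEN bspec, OF t0, THEN spec, THEN mp, OF e(1)])
      then obtain d where d: "d > 0" "\<forall>s\<in>{0..}. dist s t < d \<longrightarrow>
          dist (\<Sum>j\<in>J. \<bar>\<beta> j s - \<beta> j t\<bar> * M j) (\<Sum>j\<in>J. \<bar>\<beta> j t - \<beta> j t\<bar> * M j) < e"
        by (elim exE conjE)
      show "\<exists>d>0. \<forall>s\<in>{0..}. dist s t < d \<longrightarrow> s \<in> ?A"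
      proof (intro exI[of _ d] conjI d(1) ballI impI)
        fix s :: real assume s: "s \<in> {0..}" "dist s t < d"
        have "\<forall>x\<in>?W. dist (S s (rep_torus x)) (S t (rep_torus x)) < e"
        proof
          fix x assume "x \<in> ?W"
          then obtain z where z: "z \<in> strip (r / 2)" "x = to_torus z" by blast
          have "S s z - S t z = (\<Sum>j\<in>J. of_real (\<beta> j s - \<beta> j t) * F j z)"
            by (simp add: S_def sum_subtractf left_diff_distrib)
          also have "norm \<dots> \<le> (\<Sum>j\<in>J. \<bar>\<beta> j s - \<beta> j t\<bar> * M j)"
            by (intro order_trans[OF norm_sum sum_mono])
              (auto simp: norm_mult simp del: of_real_diff intro!: mult_left_mono M z(1))
          also have "\<dots> < e" using d(2)[THEN bspec, OF s(1), THEN mp, OF s(2)] by (simp add: dist_real_def)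
          finally have "dist (S s z) (S t z) < e" by (simp add: dist_norm)
          then show "dist (S s (rep_torus x)) (S t (rep_torus x)) < e"
            unfolding z(2) strip_ext_rep_torus[OF ext] .
        qed
        then have "torus_holo_fun ?W (\<lambda>x. S s (rep_torus x)) \<and> (\<lambda>x. \<Sum>j\<in>J. \<beta> j s * K j x) \<in> {f. analytic_fun f} \<and>
            (\<forall>x. S s (rep_torus (torus_complexify x)) = complex_of_real (\<Sum>j\<in>J. \<beta> j s * K j x)) \<and>
            (\<forall>x\<in>?W. dist (S s (rep_torus x)) (S t (rep_torus x)) < e)"
          using an by (intro conjI allI hol CollectI)
        from e(2)[THEN spec, THEN spec, THEN mp, OF this] have "(\<lambda>x. \<Sum>j\<in>J. \<beta> j s * K j x) \<in> U" .
        then show "s \<in> ?A" using s(1) by simp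
      qed
    qed
  qed
qed

lemma analytic_torus_partial:
  assumes "analytic_fun K"
  shows "((\<lambda>h. K (x + to_torus (axis k h))) has_real_derivative torus_partial k K x) (at 0)"
proof -
  obtain r F M where "r > 0" "strip_ext r F K" using assms by (rule analytic_funE)
  then show ?thesis using torus_partial_eq_cpart(2)[of r F K, where k = k and x = "rep_torus x"] by simp
qed

lemma torus_partial_sum:
  assumes "finite J" "\<And>j. j \<in> J \<Longrightarrow> analytic_fun (K j)"
  shows "torus_partial k (\<lambda>x. \<Sum>j\<in>J. c j * K j x) x = (\<Sum>j\<in>J. c j * torus_partial k (K j) x)"
  unfolding torus_partial_def[of k "\<lambda>x. \<Sum>j\<in>J. c j * K j x"]
  by (intro DERIV_imp_deriv DERIV_sum DERIV_cmult analytic_torus_partial assms)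

lemma ham_vf_sum:
  assumes "finite J" "\<And>j. j \<in> J \<Longrightarrow> analytic_fun (K j)"
  shows "ham_vf (\<lambda>x. \<Sum>j\<in>J. c j * K j x) x = (\<Sum>j\<in>J. c j *\<^sub>R ham_vf (K j) x)"
  by (auto simp: vec_eq_iff ham_vf_def torus_partial_sum[OF assms] sum_negf split: sum.split)

text \<open>\<open>S\<close> is the time-one map of \<open>K\<close>, and the Hamiltonian vector field of \<open>K\<close> is constant along its orbits.\<close>

definition shear_of :: "('n::finite phase_space \<Rightarrow> real) \<Rightarrow> ('n phase_space \<Rightarrow> 'n phase_space) \<Rightarrow> bool" where
  "shear_of K S \<longleftrightarrow> analytic_fun K \<and> (\<forall>y. S (to_torus y) = to_torus (y + ham_vf K (to_torus y))) \<and>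
     (\<forall>y s. ham_vf K (to_torus (y + s *\<^sub>R ham_vf K (to_torus y))) = ham_vf K (to_torus y))"

section \<open>Shears as time-one maps\<close>

lemma q_part_to_torus: "q_part (to_torus y) = to_torus (\<chi> i. y $ Inl i)"
  by (simp add: q_part.abs_eq)

lemma p_part_to_torus: "p_part (to_torus y) = to_torus (\<chi> i. y $ Inr i)"
  by (simp add: p_part.abs_eq)

lemma phase_pt_to_torus: "phase_pt (to_torus q) (to_torus p) = to_torus (\<chi> k. case k of Inl i \<Rightarrow> q $ i | Inr i \<Rightarrow> p $ i)"
  by (simp add: phase_pt.abs_eq)

lemma holo_on_proj:
  fixes F :: "complex ^ 'n::finite \<Rightarrow> complex" and \<iota> :: "'n \<Rightarrow> 'm::finite"
  assumes "holo_on F U" "\<And>z. z \<in> V \<Longrightarrow> (\<chi> i. z $ \<iota> i) \<in> U"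
  shows "holo_on (\<lambda>z. F (\<chi> i. z $ \<iota> i)) V"
  unfolding holo_on_def
proof
  fix z assume z: "z \<in> V"
  obtain D where D: "(F has_derivative D) (at (\<chi> i. z $ \<iota> i))" "\<forall>c v. D (c *s v) = c * D v"
    using holo_onE[OF assms(1) assms(2)[OF z]] by blast
  have "((\<lambda>z :: complex ^ 'm. \<chi> i. z $ \<iota> i) has_derivative (\<lambda>z. \<chi> i. z $ \<iota> i)) (at z)"
    by (intro bounded_linear_imp_has_derivative linear_conv_bounded_linear[THEN iffD1] linearI)
      (simp_all add: vec_eq_iff)
  from has_derivative_compose[OF this, of F D] D(1)
  have "((\<lambda>z. F (\<chi> i. z $ \<iota> i)) has_derivative (\<lambda>v. D (\<chi> i. v $ \<iota> i))) (at z)" by simp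
  moreover have "D (\<chi> i. (c *s v) $ \<iota> i) = c * D (\<chi> i. v $ \<iota> i)" for c v
  proof -
    have "(\<chi> i. (c *s v) $ \<iota> i) = c *s (\<chi> i. v $ \<iota> i)" by (simp add: vec_eq_iff)
    then show ?thesis using D(2) by simp
  qed
  ultimately show "\<exists>D. ((\<lambda>z. F (\<chi> i. z $ \<iota> i)) has_derivative D) (at z) \<and> (\<forall>c v. D (c *s v) = c * D v)"
    by blast
qed

text \<open>Turns functions of q or of p alone into analytic Hamiltonians on phase space, \<iota>
  being \<open>Inl\<close> or \<open>Inr\<close>.\<close>

lemma analytic_fun_proj:
  fixes f :: "(real, 'n::finite) torus \<Rightarrow> real" and \<iota> :: "'n \<Rightarrow> 'm::finite"
  assumes f: "analytic_fun f" and P: "\<And>y. P (to_torus y) = to_torus (\<chi> i. y $ \<iota> i)"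
  shows "analytic_fun (\<lambda>x. f (P x))"
proof -
  obtain r F M where r: "r > 0" and F: "strip_ext r F f" using f by (rule analytic_funE)
  have "strip_ext r (\<lambda>z. F (\<chi> i. z $ \<iota> i)) (\<lambda>x. f (P x))"
    unfolding strip_ext_def
  proof (intro conjI allI impI)
    show "holo_on (\<lambda>z. F (\<chi> i. z $ \<iota> i)) (strip r)"
      by (rule holo_on_proj[OF strip_extD(1)[OF F]]) (simp add: strip_def)
    show "F (\<chi> i. (z + m) $ \<iota> i) = F (\<chi> i. z $ \<iota> i)" if "m \<in> integer_lattice" for z m :: "complex ^ 'm"
    proof -
      have "(\<chi> i. (z + m) $ \<iota> i) = (\<chi> i. z $ \<iota> i) + (\<chi> i. m $ \<iota> i)" by (simp add: vec_eq_iff)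
      moreover have "(\<chi> i. m $ \<iota> i) \<in> integer_lattice" using that by (simp add: integer_lattice_def)
      ultimately show ?thesis using strip_extD(2)[OF F] by simp
    qed
    show "F (\<chi> i. cvec x $ \<iota> i) = complex_of_real (f (P (to_torus x)))" for x
    proof -
      have "(\<chi> i. cvec x $ \<iota> i) = cvec (\<chi> i. x $ \<iota> i)" by (simp add: vec_eq_iff)
      then show ?thesis using strip_extD(3)[OF F] by (simp add: P)
    qed
  qed
  then show ?thesis using r by (rule analytic_fun_strip_ext)
qed

lemma ham_vf_p_part: "ham_vf (\<lambda>z. \<tau> (p_part z)) (to_torus y) =
  (\<chi> k. case k of Inl i \<Rightarrow> torus_partial i \<tau> (to_torus (\<chi> i. y $ Inr i)) | Inr i \<Rightarrow> 0)"
proof -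
  have 1: "p_part (to_torus y + to_torus (axis (Inr i) h)) = to_torus (\<chi> i. y $ Inr i) + to_torus (axis i h)" for i h
    unfolding to_torus_add[symmetric] p_part_to_torus
    by (rule arg_cong[where f = to_torus]) (simp add: vec_eq_iff axis_def)
  have 2: "p_part (to_torus y + to_torus (axis (Inl i) h)) = to_torus (\<chi> i. y $ Inr i)" for i h
    unfolding to_torus_add[symmetric] p_part_to_torus
    by (rule arg_cong[where f = to_torus]) (simp add: vec_eq_iff axis_def)
  show ?thesis
    by (auto simp: vec_eq_iff ham_vf_def torus_partial_def 1 2 split: sum.split)
qed

lemma ham_vf_q_part: "ham_vf (\<lambda>z. v (q_part z)) (to_torus y) =
  (\<chi> k. case k of Inl i \<Rightarrow> 0 | Inr i \<Rightarrow> - torus_partial i v (to_torus (\<chi> i. y $ Inl i)))"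
proof -
  have 1: "q_part (to_torus y + to_torus (axis (Inl i) h)) = to_torus (\<chi> i. y $ Inl i) + to_torus (axis i h)" for i h
    unfolding to_torus_add[symmetric] q_part_to_torus
    by (rule arg_cong[where f = to_torus]) (simp add: vec_eq_iff axis_def)
  have 2: "q_part (to_torus y + to_torus (axis (Inr i) h)) = to_torus (\<chi> i. y $ Inl i)" for i h
    unfolding to_torus_add[symmetric] q_part_to_torus
    by (rule arg_cong[where f = to_torus]) (simp add: vec_eq_iff axis_def)
  show ?thesis
    by (auto simp: vec_eq_iff ham_vf_def torus_partial_def 1 2 split: sum.split)
qed

definition hshear :: "((real, 'n::finite) torus \<Rightarrow> real) \<Rightarrow> 'n phase_space \<Rightarrow> 'n phase_space" where
  "hshear \<tau> z = phase_pt (q_part z + to_torus (torus_grad \<tau> (p_part z))) (p_part z)"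

definition vshear :: "((real, 'n::finite) torus \<Rightarrow> real) \<Rightarrow> 'n phase_space \<Rightarrow> 'n phase_space" where
  "vshear v z = phase_pt (q_part z) (p_part z - to_torus (torus_grad v (q_part z)))"

lemma shears_eq: "horizontal_shears = {hshear \<tau> | \<tau>. analytic_fun \<tau>}" "vertical_shears = {vshear v | v. analytic_fun v}"
  unfolding horizontal_shears_def vertical_shears_def hshear_def[abs_def] vshear_def[abs_def] by (rule refl)+

lemma hshear_to_torus: "hshear \<tau> (to_torus y) = to_torus (y + ham_vf (\<lambda>z. \<tau> (p_part z)) (to_torus y))"
  unfolding hshear_def q_part_to_torus p_part_to_torus to_torus_add[symmetric] phase_pt_to_torus ham_vf_p_part
  by (rule arg_cong[where f = to_torus]) (simp add: vec_eq_iff torus_grad_def split: sum.split)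

lemma vshear_to_torus: "vshear v (to_torus y) = to_torus (y + ham_vf (\<lambda>z. v (q_part z)) (to_torus y))"
  unfolding vshear_def q_part_to_torus p_part_to_torus to_torus_diff[symmetric] phase_pt_to_torus ham_vf_q_part
  by (rule arg_cong[where f = to_torus]) (simp add: vec_eq_iff torus_grad_def split: sum.split)

lemma shear_of_hshear: "analytic_fun \<tau> \<Longrightarrow> shear_of (\<lambda>z. \<tau> (p_part z)) (hshear \<tau>)"
  unfolding shear_of_def hshear_to_torus
  by (auto intro!: analytic_fun_proj[where \<iota> = Inr] p_part_to_torus simp: ham_vf_p_part)

lemma shear_of_vshear: "analytic_fun v \<Longrightarrow> shear_of (\<lambda>z. v (q_part z)) (vshear v)"
  unfolding shear_of_def vshear_to_torus
  by (auto intro!: analytic_fun_proj[where \<iota> = Inl] q_part_to_torus simp: ham_vf_q_part)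

lemma shears_shear_of: "S \<in> horizontal_shears \<union> vertical_shears \<Longrightarrow> \<exists>K. shear_of K S"
  unfolding shears_eq using shear_of_hshear shear_of_vshear by blast

text \<open>The Hamiltonians of the shears are switched on one after the other, the \<open>j\<close>-th one during the
  time interval \<open>[j / N, (j + 1) / N]\<close> with a tent-shaped intensity of integral one.\<close>

lemma shear_composition_Ham:
  assumes S: "\<And>j. j < N \<Longrightarrow> shear_of (K j) (S j)"
  shows "\<exists>H. continuous_map (top_of_set {0..}) analytic_fun_topology H \<and>
    (\<forall>y. (\<forall>j<N. y (Suc j) = S j (y j)) \<longrightarrow> ham_flow H 0 1 (y 0) = y N)"
proof -
  define \<beta> where "\<beta> j t = real N * tent (real N * t - real j)" for j t
  define H where "H t x = (\<Sum>j<N. \<beta> j t * K j x)" for t x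
  have an: "analytic_fun (K j)" if "j < N" for j using S[OF that] by (simp add: shear_of_def)
  have "continuous_map (top_of_set {0..}) analytic_fun_topology (\<lambda>t x. \<Sum>j<N. \<beta> j t * K j x)"
  proof (rule continuous_map_analytic_sum)
    show "continuous_on {0..} (\<beta> j)" for j
      unfolding \<beta>_def by (intro continuous_intros continuous_on_compose2[OF continuous_on_tent[of UNIV]]) auto
  qed (use an in auto)
  then have H: "continuous_map (top_of_set {0..}) analytic_fun_topology H" unfolding H_def[abs_def] .
  have vf: "ham_vf (H t) x = (\<Sum>j<N. \<beta> j t *\<^sub>R ham_vf (K j) x)" for t x
    unfolding H_def[abs_def] by (rule ham_vf_sum) (use an in auto)
  have "ham_flow H 0 1 (y 0) = y N" if y: "\<forall>j<N. y (Suc j) = S j (y j)" for y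
  proof -
    \<comment> \<open>Lifts the prescribed orbit of the shears to the real cover, adding one
      displacement per shear.\<close>
    define w where "w = rec_nat (rep_torus (y 0)) (\<lambda>j u. u + ham_vf (K j) (to_torus u))"
    have w0: "w 0 = rep_torus (y 0)" and wS: "w (Suc j) = w j + ham_vf (K j) (to_torus (w j))" for j
      by (simp_all add: w_def)
    have wy: "to_torus (w j) = y j" if "j \<le> N" for j
      using that
    proof (induction j)
      case (Suc j)
      have "S j (to_torus (w j)) = to_torus (w (Suc j))"
        using S[of j] Suc.prems by (simp add: shear_of_def wS)
      then show ?case using Suc y by simp
    qed (simp add: w0)
    define V where "V j = ham_vf (K j) (to_torus (w j))" for j
    have wsum: "w j = w 0 + (\<Sum>i<j. V i)" for j by (induction j) (simp_all add: wS V_def)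
    \<comment> \<open>The solution is explicit: each displacement is carried out during its own time
      window, with speed given by the tent function.\<close>
    define x where "x t = w 0 + (\<Sum>j<N. smoothstep (real N * t - real j) *\<^sub>R V j)" for t
    have "((\<lambda>t. smoothstep (real N * t - real j)) has_real_derivative tent (real N * t - real j) * real N) (at t within {0..1})" for t j
      by (rule DERIV_chain2[OF DERIV_smoothstep]) (auto intro!: derivative_eq_intros)
    then have sd: "((\<lambda>t. smoothstep (real N * t - real j)) has_real_derivative \<beta> j t) (at t within {0..1})" for t j
      by (simp add: \<beta>_def mult.commute)
    have "((\<lambda>t. smoothstep (real N * t - real j) *\<^sub>R V j) has_vector_derivative \<beta> j t *\<^sub>R V j) (at t within {0..1})" for t j
      using has_vector_derivative_scaleR[OF sd has_vector_derivative_const[of "V j"]] by simp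
    then have "(x has_vector_derivative 0 + (\<Sum>j<N. \<beta> j t *\<^sub>R V j)) (at t within {0..1})" for t
      unfolding x_def by (intro has_vector_derivative_add has_vector_derivative_const has_vector_derivative_sum) auto
    \<comment> \<open>Within the j-th window the earlier switches are at 1 and the later ones at 0,
      so the orbit is on the segment from \<open>w j\<close> in direction \<open>V j\<close>, where
      the field of \<open>K j\<close> is constant. Outside the window the intensity is 0.\<close>
    moreover have "\<beta> j t *\<^sub>R V j = \<beta> j t *\<^sub>R ham_vf (K j) (to_torus (x t))" if j: "j < N" for j t
    proof (cases "0 < real N * t - real j \<and> real N * t - real j < 1")
      case False
      then show ?thesis using tent_outside[of "real N * t - real j"] by (simp add: \<beta>_def not_less)
    next
      case True
      have "smoothstep (real N * t - real i) *\<^sub>R V i =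
          (if i < j then V i else if i = j then smoothstep (real N * t - real j) *\<^sub>R V j else 0)" for i
      proof -
        consider "i < j" | "i = j" | "i > j" by linarith
        then show ?thesis
        proof cases
          case 1
          then have "real i + 1 \<le> real j" by (metis Suc_leI of_nat_Suc of_nat_le_iff add.commute)
          then show ?thesis using 1 True smoothstep_ge_1[of "real N * t - real i"] by simp
        next
          case 3
          then have "real j + 1 \<le> real i" by (metis Suc_leI of_nat_Suc of_nat_le_iff add.commute)
          then show ?thesis using 3 True smoothstep_le_0[of "real N * t - real i"] by simp
        qed simp
      qed
      then have "x t = w 0 + (\<Sum>i<N. if i < j then V i else if i = j then smoothstep (real N * t - real j) *\<^sub>R V j else 0)"
        by (simp add: x_def)
      also have "(\<Sum>i<N. if i < j then V i else if i = j then smoothstep (real N * t - real j) *\<^sub>R V j else 0)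
          = (\<Sum>i<N. if i < j then V i else 0) + (\<Sum>i<N. if i = j then smoothstep (real N * t - real j) *\<^sub>R V j else 0)"
        unfolding sum.distrib[symmetric] by (intro sum.cong) auto
      also have "(\<Sum>i<N. if i < j then V i else 0) = (\<Sum>i<j. V i)"
        using j by (intro sum.mono_neutral_cong_right) auto
      also have "(\<Sum>i<N. if i = j then smoothstep (real N * t - real j) *\<^sub>R V j else 0) = smoothstep (real N * t - real j) *\<^sub>R V j"
        using j by simp
      finally have "x t = w j + smoothstep (real N * t - real j) *\<^sub>R V j" using wsum[of j] by simp
      then show ?thesis using S[OF j] unfolding shear_of_def V_def by simp
    qed
    then have "(\<Sum>j<N. \<beta> j t *\<^sub>R V j) = ham_vf (H t) (to_torus (x t))" for t
      unfolding vf by (intro sum.cong) auto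
    ultimately have "ham_solution H 0 1 x" unfolding ham_solution_def by simp
    then have fl: "ham_flow H 0 1 (to_torus (x 0)) = to_torus (x 1)" by (rule ham_flow_eq[OF H])
    have "x 0 = w 0" by (simp add: x_def smoothstep_le_0)
    moreover have "x 1 = w N"
    proof -
      have "smoothstep (real N - real j) = 1" if "j < N" for j
        by (rule smoothstep_ge_1) (use that in \<open>simp add: Suc_leI le_diff_eq flip: of_nat_Suc\<close>)
      then show ?thesis unfolding x_def wsum[of N] by simp
    qed
    ultimately show ?thesis using fl wy[of 0] wy[of N] by simp
  qed
  then show ?thesis using H by blast
qed

lemma foldr_shears_Ham:
  assumes "set Ss \<subseteq> horizontal_shears \<union> vertical_shears"
  shows "foldr (\<circ>) Ss id \<in> analytic_Ham"
proof -
  \<comment> \<open>A composition applies the last entry of the list first, so the reversed list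
    gives the order in time.\<close>
  let ?R = "rev Ss"
  have "\<forall>j<length ?R. \<exists>K. shear_of K (?R ! j)"
    using assms shears_shear_of nth_mem[of _ ?R] by auto
  then obtain K where "\<And>j. j < length ?R \<Longrightarrow> shear_of (K j) (?R ! j)" by metis
  from shear_composition_Ham[where K = K and S = "\<lambda>j. ?R ! j" and N = "length ?R", OF this] obtain H where
    H: "continuous_map (top_of_set {0..}) analytic_fun_topology H"
      "\<And>y. \<forall>j<length ?R. y (Suc j) = (?R ! j) (y j) \<Longrightarrow> ham_flow H 0 1 (y 0) = y (length ?R)" by blast
  have "ham_flow H 0 1 z = foldr (\<circ>) Ss id z" for z
  proof -
    have foldr_app: "foldr (\<circ>) Ts id z = fold (\<lambda>f x. f x) (rev Ts) z" for Ts :: "('a phase_space \<Rightarrow> 'a phase_space) list"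
      by (induction Ts) simp_all
    define y where "y j = fold (\<lambda>f x. f x) (take j ?R) z" for j
    have "y (Suc j) = (?R ! j) (y j)" if "j < length ?R" for j
      using that by (simp add: y_def take_Suc_conv_app_nth)
    then have "ham_flow H 0 1 (y 0) = y (length ?R)" using H(2) by blast
    then show ?thesis by (simp add: y_def foldr_app)
  qed
  then have "foldr (\<circ>) Ss id = ham_flow H 0 1" by auto
  then show ?thesis unfolding analytic_Ham_def using H(1) by blast
qed

section \<open>The group generated by the shears\<close>

lemma torus_grad_uminus: "analytic_fun \<tau> \<Longrightarrow> torus_grad (\<lambda>x. - \<tau> x) x = - torus_grad \<tau> x"
proof -
  assume t: "analytic_fun \<tau>"
  have "torus_partial k (\<lambda>x. - \<tau> x) x = - torus_partial k \<tau> x" for k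
    unfolding torus_partial_def[of k "\<lambda>x. - \<tau> x"]
    by (intro DERIV_imp_deriv DERIV_minus analytic_torus_partial t)
  then show ?thesis by (simp add: torus_grad_def vec_eq_iff)
qed

lemma analytic_fun_uminus: "analytic_fun \<tau> \<Longrightarrow> analytic_fun (\<lambda>x. - \<tau> x)"
proof -
  assume "analytic_fun \<tau>"
  then obtain r F M where "r > 0" "strip_ext r F \<tau>" by (rule analytic_funE)
  then show ?thesis
    using analytic_fun_strip_ext[OF strip_ext_sum[of "{()}" r "\<lambda>_. F" "\<lambda>_. \<tau>" "\<lambda>_. -1"]] by simp
qed

lemma hshear_inverse: "analytic_fun \<tau> \<Longrightarrow> hshear (\<lambda>x. - \<tau> x) (hshear \<tau> z) = z"
  by (simp add: hshear_def torus_grad_uminus to_torus_minus)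

lemma vshear_inverse: "analytic_fun v \<Longrightarrow> vshear (\<lambda>x. - v x) (vshear v z) = z"
  by (simp add: vshear_def torus_grad_uminus to_torus_minus)

lemma shear_inverse:
  assumes "S \<in> horizontal_shears \<union> vertical_shears"
  obtains S' where "S' \<in> horizontal_shears \<union> vertical_shears" "S' \<circ> S = id" "S \<circ> S' = id"
proof -
  from assms consider \<tau> where "analytic_fun \<tau>" "S = hshear \<tau>" | v where "analytic_fun v" "S = vshear v"
    unfolding shears_eq by blast
  then show ?thesis
  proof cases
    case 1
    show ?thesis
    proof (rule that[of "hshear (\<lambda>x. - \<tau> x)"])
      show "hshear (\<lambda>x. - \<tau> x) \<in> horizontal_shears \<union> vertical_shears"
        unfolding shears_eq using analytic_fun_uminus[OF 1(1)] by blast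
      show "hshear (\<lambda>x. - \<tau> x) \<circ> S = id" unfolding 1(2) using hshear_inverse[OF 1(1)] by (simp add: fun_eq_iff)
      show "S \<circ> hshear (\<lambda>x. - \<tau> x) = id"
        unfolding 1(2) using hshear_inverse[OF analytic_fun_uminus[OF 1(1)]] by (simp add: fun_eq_iff)
    qed
  next
    case 2
    show ?thesis
    proof (rule that[of "vshear (\<lambda>x. - v x)"])
      show "vshear (\<lambda>x. - v x) \<in> horizontal_shears \<union> vertical_shears"
        unfolding shears_eq using analytic_fun_uminus[OF 2(1)] by blast
      show "vshear (\<lambda>x. - v x) \<circ> S = id" unfolding 2(2) using vshear_inverse[OF 2(1)] by (simp add: fun_eq_iff)
      show "S \<circ> vshear (\<lambda>x. - v x) = id"
        unfolding 2(2) using vshear_inverse[OF analytic_fun_uminus[OF 2(1)]] by (simp add: fun_eq_iff)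
    qed
  qed
qed

lemma shear_bij: "S \<in> horizontal_shears \<union> vertical_shears \<Longrightarrow> bij S"
  by (erule shear_inverse) (metis o_bij)

lemma Bij_UNIV: "Bij UNIV = {f. bij f}"
  by (auto simp: Bij_def)

lemma mult_BijGroup_UNIV: "bij f \<Longrightarrow> bij g \<Longrightarrow> f \<otimes>\<^bsub>BijGroup UNIV\<^esub> g = f \<circ> g"
  by (auto simp: BijGroup_def Bij_UNIV compose_def)

lemma one_BijGroup_UNIV: "\<one>\<^bsub>BijGroup UNIV\<^esub> = id"
  by (auto simp: BijGroup_def)

lemma foldr_comp_Cons: "foldr (\<circ>) (S # Ss) id = S \<circ> foldr (\<circ>) Ss id"
  by simp

lemma bij_foldr_shears: "set Ss \<subseteq> horizontal_shears \<union> vertical_shears \<Longrightarrow> bij (foldr (\<circ>) Ss id)"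
proof (induction Ss)
  case (Cons S Ss)
  then have "bij S" by (intro shear_bij) simp
  moreover have "bij (foldr (\<circ>) Ss id)" by (rule Cons.IH) (use Cons.prems in auto)
  ultimately show ?case unfolding foldr_comp_Cons by (intro bij_comp)
qed (simp add: bij_id)

text \<open>The inverse of a shear is the shear with the negated function, so words without inverses
  already form the group.\<close>

lemma shear_group_eq:
  "shear_group = {foldr (\<circ>) Ss id | Ss. set Ss \<subseteq> horizontal_shears \<union> vertical_shears}"
proof (intro equalityI subsetI)
  let ?A = "horizontal_shears \<union> vertical_shears :: ('a phase_space \<Rightarrow> 'a phase_space) set"
  fix f :: "'a phase_space \<Rightarrow> 'a phase_space"
  assume "f \<in> shear_group"
  then have "f \<in> generate (BijGroup UNIV) ?A" by (simp add: shear_group_def Un_commute)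
  then have "\<exists>Ss. set Ss \<subseteq> ?A \<and> f = foldr (\<circ>) Ss id"
  proof (induction rule: generate.induct)
    case one
    show ?case by (rule exI[of _ "[]"]) (simp add: one_BijGroup_UNIV)
  next
    case (incl h)
    then show ?case by (intro exI[of _ "[h]"]) simp
  next
    case (inv h)
    then obtain h' where h': "h' \<in> ?A" "h' \<circ> h = id" by (rule shear_inverse)
    have "inv\<^bsub>BijGroup UNIV\<^esub> h = h'"
    proof (rule group.inv_equality[OF group_BijGroup])
      show "h' \<otimes>\<^bsub>BijGroup UNIV\<^esub> h = \<one>\<^bsub>BijGroup UNIV\<^esub>"
        unfolding mult_BijGroup_UNIV[OF shear_bij[OF h'(1)] shear_bij[OF inv]] one_BijGroup_UNIV by (rule h'(2))
      show "h \<in> carrier (BijGroup UNIV)" "h' \<in> carrier (BijGroup UNIV)"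
        using shear_bij[OF inv] shear_bij[OF h'(1)] by (simp_all add: BijGroup_def Bij_UNIV)
    qed
    then show ?case using h'(1) by (intro exI[of _ "[h']"]) simp
  next
    case (eng h1 h2)
    then obtain Ss Ts where st: "set Ss \<subseteq> ?A" "h1 = foldr (\<circ>) Ss id" "set Ts \<subseteq> ?A" "h2 = foldr (\<circ>) Ts id" by blast
    have app: "foldr (\<circ>) (Ss @ Ts) id = foldr (\<circ>) Ss id \<circ> foldr (\<circ>) Ts id"
      by (induction Ss) (simp_all add: o_assoc)
    have "h1 \<otimes>\<^bsub>BijGroup UNIV\<^esub> h2 = foldr (\<circ>) (Ss @ Ts) id"
      unfolding app st(2,4) by (rule mult_BijGroup_UNIV) (intro bij_foldr_shears st)+
    moreover have "set (Ss @ Ts) \<subseteq> ?A" using st(1,3) by simp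
    ultimately show ?case by blast
  qed
  then show "f \<in> {foldr (\<circ>) Ss id | Ss. set Ss \<subseteq> ?A}" by blast
next
  let ?A = "horizontal_shears \<union> vertical_shears :: ('a phase_space \<Rightarrow> 'a phase_space) set"
  fix f :: "'a phase_space \<Rightarrow> 'a phase_space"
  assume "f \<in> {foldr (\<circ>) Ss id | Ss. set Ss \<subseteq> ?A}"
  then obtain Ss where "f = foldr (\<circ>) Ss id" "set Ss \<subseteq> ?A" by blast
  moreover have "set Ss \<subseteq> ?A \<Longrightarrow> foldr (\<circ>) Ss id \<in> generate (BijGroup UNIV) ?A"
  proof (induction Ss)
    case Nil
    show ?case using generate.one[of "BijGroup UNIV" ?A] unfolding one_BijGroup_UNIV foldr_Nil id_apply .
  next
    case (Cons S Ss)
    have "S \<in> ?A" "set Ss \<subseteq> ?A" using Cons.prems by auto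
    then have "S \<otimes>\<^bsub>BijGroup UNIV\<^esub> foldr (\<circ>) Ss id \<in> generate (BijGroup UNIV) ?A"
      by (rule generate.eng[OF generate.incl Cons.IH])
    moreover have "S \<otimes>\<^bsub>BijGroup UNIV\<^esub> foldr (\<circ>) Ss id = S \<circ> foldr (\<circ>) Ss id"
      by (rule mult_BijGroup_UNIV[OF shear_bij bij_foldr_shears]) (use Cons.prems in auto)
    ultimately show ?case unfolding foldr_comp_Cons by (simp only:)
  qed
  ultimately show "f \<in> shear_group" by (simp add: shear_group_def Un_commute)
qed

lemma shear_group_subset_Ham: "shear_group \<subseteq> analytic_Ham"
  unfolding shear_group_eq using foldr_shears_Ham by blast

section \<open>Density\<close>

lemma shear_lift_lattice: "shear_lift \<Psi> \<Longrightarrow> m \<in> integer_lattice \<Longrightarrow> \<Psi> (z + m) = \<Psi> z + m"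
proof (induction \<Psi> rule: shear_lift.induct)
  case (shear_lift_step \<Psi> a c \<theta>)
  then show ?case by (simp add: tshear_def ctrig_periodic)
qed simp

lemma shear_lift_holo: "shear_lift \<Psi> \<Longrightarrow> holo_on (\<lambda>z. \<Psi> z $ k) UNIV"
proof (induction \<Psi> arbitrary: k rule: shear_lift.induct)
  case shear_lift_id
  show ?case by (rule holo_on_nth)
next
  case (shear_lift_step \<Psi> a c \<theta>)
  have "holo_on (\<lambda>z. phase a (\<Psi> z)) UNIV"
    unfolding phase_def by (intro holo_on_sum holo_on_cmult shear_lift_step.IH)
  then have "holo_on (\<lambda>z. ctrig a \<theta> (\<Psi> z)) UNIV"
    unfolding ctrig_def
    by (rule holo_on_comp[where g = "\<lambda>u. cos (of_real (2 * pi) * u + of_real \<theta>)"])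
      (auto intro!: derivative_eq_intros)
  then have "holo_on (\<lambda>z. \<Psi> z $ k + of_real c * ctrig a \<theta> (\<Psi> z) * symp a $ k) UNIV"
    by (intro holo_on_add shear_lift_step.IH holo_on_mult[OF _ holo_on_const] holo_on_cmult)
  then show ?case by (simp add: tshear_def)
qed

section \<open>The real shears below the trigonometric lifts\<close>

definition rtrig :: "('k \<Rightarrow> int) \<Rightarrow> real \<Rightarrow> (real, 'k::finite) torus \<Rightarrow> real" where
  "rtrig a \<theta> x = cos (2 * pi * (\<Sum>i\<in>UNIV. of_int (a i) * rep_torus x $ i) + \<theta>)"

lemma strip_ext_rtrig: "strip_ext r (ctrig a \<theta>) (rtrig a \<theta>)"
proof -
  have "ctrig a \<theta> (cvec x) = complex_of_real (rtrig a \<theta> (to_torus x))" for x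
  proof -
    obtain m where m: "m \<in> integer_lattice" "rep_torus (to_torus x) = x + m" by (rule rep_torus_to_torusE)
    have "complex_of_real (rtrig a \<theta> (to_torus x)) = ctrig a \<theta> (cvec x + cvec m)"
      unfolding rtrig_def m(2) ctrig_cvec[symmetric] cvec_add ..
    also have "\<dots> = ctrig a \<theta> (cvec x)" using m(1) by (intro ctrig_periodic) simp
    finally show ?thesis by simp
  qed
  then show ?thesis unfolding strip_ext_def using holo_on_ctrig ctrig_periodic by blast
qed

lemma rtrig_to_torus: "rtrig a \<theta> (to_torus x) = cos (2 * pi * (\<Sum>i\<in>UNIV. of_int (a i) * x $ i) + \<theta>)"
proof -
  have "complex_of_real (rtrig a \<theta> (to_torus x)) = ctrig a \<theta> (cvec x)"
    using strip_extD(3)[OF strip_ext_rtrig[of 1]] by metis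
  then show ?thesis unfolding ctrig_cvec by (simp only: of_real_eq_iff)
qed

text \<open>Antiderivative whose gradient is \<open>c\<close> times the cosine times a; the shift by
  pi / 2 turns the sine into a cosine.\<close>

definition trig_ham :: "('k \<Rightarrow> int) \<Rightarrow> real \<Rightarrow> real \<Rightarrow> (real, 'k::finite) torus \<Rightarrow> real" where
  "trig_ham a c \<theta> x = - c / (2 * pi) * rtrig a (\<theta> + pi / 2) x"

lemma strip_ext_trig_ham:
  "strip_ext r (\<lambda>z. of_real (- c / (2 * pi)) * ctrig a (\<theta> + pi / 2) z) (trig_ham a c \<theta>)"
  using strip_ext_sum[of "{()}" r "\<lambda>_. ctrig a (\<theta> + pi / 2)" "\<lambda>_. rtrig a (\<theta> + pi / 2)" "\<lambda>_. - c / (2 * pi)", OF strip_ext_rtrig]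
  unfolding trig_ham_def[abs_def] by simp

lemma analytic_trig_ham: "analytic_fun (trig_ham a c \<theta>)"
  by (rule analytic_fun_strip_ext[OF strip_ext_trig_ham zero_less_one])

lemma torus_partial_trig_ham:
  "torus_partial k (trig_ham a c \<theta>) (to_torus x) = c * rtrig a \<theta> (to_torus x) * of_int (a k)"
proof -
  have "complex_of_real (torus_partial k (trig_ham a c \<theta>) (to_torus x)) =
      cpart k (\<lambda>z. of_real (- c / (2 * pi)) * ctrig a (\<theta> + pi / 2) z) (cvec x)"
    by (rule torus_partial_eq_cpart(1)[OF strip_ext_trig_ham zero_less_one])
  also have "\<dots> = of_real (- c / (2 * pi)) * (- (of_real (2 * pi) * ctrig a (\<theta> + pi / 2 - pi / 2) (cvec x)) * of_int (a k))"
    by (simp only: cpart_cmult[OF holo_on_ctrig UNIV_I] cpart_ctrig)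
  also have "\<dots> = of_real c * ctrig a \<theta> (cvec x) * of_int (a k)"
    by (simp add: field_simps)
  also have "\<dots> = complex_of_real (c * rtrig a \<theta> (to_torus x) * of_int (a k))"
    by (simp add: strip_extD(3)[OF strip_ext_rtrig[of 1]])
  finally show ?thesis by (simp only: of_real_eq_iff)
qed

text \<open>The same generating function serves for both kinds of shears: a vertical shear subtracts
  the gradient and a horizontal one adds it, which are the signs built into
  \<open>symp\<close>.\<close>

lemma tshear_real:
  assumes "q_only a \<or> p_only a"
  obtains S where "S \<in> horizontal_shears \<union> vertical_shears"
    "\<And>y. \<exists>y'. tshear a c \<theta> (cvec y) = cvec y' \<and> S (to_torus y) = to_torus y'"
proof -
  define R where "R y = c * cos (2 * pi * (\<Sum>i\<in>UNIV. of_int (a i) * y $ i) + \<theta>)" for y :: "real ^ ('a + 'a)"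
  define y' where "y' y = y + (\<chi> k. R y * (case k of Inl i \<Rightarrow> of_int (a (Inr i)) | Inr i \<Rightarrow> - of_int (a (Inl i))))" for y
  have lift: "tshear a c \<theta> (cvec y) = cvec (y' y)" for y
    unfolding tshear_def ctrig_cvec
    by (simp add: vec_eq_iff symp_def y'_def R_def split: sum.split)
  from assms show ?thesis
  proof
    assume q: "q_only a"
    let ?v = "trig_ham (\<lambda>i. a (Inl i)) c \<theta>"
    have R: "R y = c * rtrig (\<lambda>i. a (Inl i)) \<theta> (to_torus (\<chi> i. y $ Inl i))" for y
      using q by (simp add: R_def rtrig_to_torus sum_UNIV_sum q_only_def)
    have "vshear ?v (to_torus y) = to_torus (y' y)" for y
      unfolding vshear_to_torus ham_vf_q_part torus_partial_trig_ham R[symmetric]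
      by (rule arg_cong[where f = to_torus]) (use q in \<open>simp add: y'_def vec_eq_iff q_only_def split: sum.split\<close>)
    moreover have "vshear ?v \<in> horizontal_shears \<union> vertical_shears"
      unfolding shears_eq using analytic_trig_ham by blast
    ultimately show ?thesis using lift that by blast
  next
    assume p: "p_only a"
    let ?v = "trig_ham (\<lambda>i. a (Inr i)) c \<theta>"
    have R: "R y = c * rtrig (\<lambda>i. a (Inr i)) \<theta> (to_torus (\<chi> i. y $ Inr i))" for y
      using p by (simp add: R_def rtrig_to_torus sum_UNIV_sum p_only_def)
    have "hshear ?v (to_torus y) = to_torus (y' y)" for y
      unfolding hshear_to_torus ham_vf_p_part torus_partial_trig_ham R[symmetric]
      by (rule arg_cong[where f = to_torus]) (use p in \<open>simp add: y'_def vec_eq_iff p_only_def split: sum.split\<close>)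
    moreover have "hshear ?v \<in> horizontal_shears \<union> vertical_shears"
      unfolding shears_eq using analytic_trig_ham by blast
    ultimately show ?thesis using lift that by blast
  qed
qed

text \<open>The lift and the map on the torus are followed in parallel, one shear at a time; real
  points stay real.\<close>

lemma shear_lift_real:
  "shear_lift \<Psi> \<Longrightarrow> \<exists>Ss. set Ss \<subseteq> horizontal_shears \<union> vertical_shears \<and>
     (\<forall>x. \<exists>y. \<Psi> (cvec x) = cvec y \<and> foldr (\<circ>) Ss id (to_torus x) = to_torus y)"
proof (induction \<Psi> rule: shear_lift.induct)
  case shear_lift_id
  show ?case by (intro exI[of _ "[]"]) auto
next
  case (shear_lift_step \<Psi> a c \<theta>)
  then obtain Ss where Ss: "set Ss \<subseteq> horizontal_shears \<union> vertical_shears"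
    "\<And>x. \<exists>y. \<Psi> (cvec x) = cvec y \<and> foldr (\<circ>) Ss id (to_torus x) = to_torus y" by blast
  obtain S where S: "S \<in> horizontal_shears \<union> vertical_shears"
    "\<And>y. \<exists>y'. tshear a c \<theta> (cvec y) = cvec y' \<and> S (to_torus y) = to_torus y'"
    using tshear_real[OF shear_lift_step.hyps(2)] by metis
  have "\<exists>y. tshear a c \<theta> (\<Psi> (cvec x)) = cvec y \<and> foldr (\<circ>) (S # Ss) id (to_torus x) = to_torus y" for x
  proof -
    obtain y where y: "\<Psi> (cvec x) = cvec y" "foldr (\<circ>) Ss id (to_torus x) = to_torus y" using Ss(2) by blast
    have "foldr (\<circ>) (S # Ss) id (to_torus x) = S (to_torus y)"
      unfolding foldr_comp_Cons comp_apply y(2) ..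
    then show ?thesis unfolding y(1) using S(2)[of y] by simp
  qed
  moreover have "set (S # Ss) \<subseteq> horizontal_shears \<union> vertical_shears" using S(1) Ss(1) by simp
  ultimately show ?case by blast
qed

text \<open>Cauchy's estimate turns uniform convergence into uniform convergence of the derivatives.\<close>

lemma holo_uniform_limit:
  fixes F :: "complex ^ 'k::finite \<Rightarrow> complex"
  assumes lim: "\<And>\<epsilon>. \<epsilon> > 0 \<Longrightarrow> \<exists>g. holo_on g (strip r) \<and> (\<forall>z\<in>strip r. norm (g z - F z) \<le> \<epsilon>)"
    and s: "0 < s" "s < r"
  shows "holo_on F (strip (r - s))"
proof -
  let ?S = "strip (r - s) :: (complex ^ 'k) set"
  have sub: "?S \<subseteq> strip r" using s by (intro strip_mono) simp
  have "\<forall>n. \<exists>g. holo_on g (strip r) \<and> (\<forall>z\<in>strip r. norm (g z - F z) \<le> 1 / real (Suc n))"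
    using lim by simp
  from choice[OF this] obtain g where g: "\<And>n. holo_on (g n) (strip r)"
    "\<And>n z. z \<in> strip r \<Longrightarrow> norm (g n z - F z) \<le> 1 / real (Suc n)" by blast
  have "\<forall>n. \<forall>z\<in>?S. \<exists>D. (g n has_derivative D) (at z) \<and> (\<forall>c v. D (c *s v) = c * D v)"
    using g(1) sub unfolding holo_on_def by blast
  then have "\<forall>n. \<exists>D. \<forall>z\<in>?S. (g n has_derivative D z) (at z) \<and> (\<forall>c v. D z (c *s v) = c * D z v)"
    by (intro allI bchoice) blast
  from choice[OF this] obtain D where
    D: "\<And>n z. z \<in> ?S \<Longrightarrow> (g n has_derivative D n z) (at z)"
      "\<And>n z. z \<in> ?S \<Longrightarrow> \<forall>c v. D n z (c *s v) = c * D n z v" by blast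
  have diff: "norm (D n z v - D m z v) \<le> (1 / real (Suc n) + 1 / real (Suc m)) / s * norm v"
    if z: "z \<in> ?S" for n m z v
  proof (rule Cauchy_derivative[where F = "\<lambda>z. g n z - g m z" and D = "\<lambda>v. D n z v - D m z v" and r = r])
    show "holo_on (\<lambda>z. g n z - g m z) (strip r)" by (intro holo_on_diff g)
    show "norm (g n z - g m z) \<le> 1 / real (Suc n) + 1 / real (Suc m)" if "z \<in> strip r" for z
      using norm_triangle_ineq4[of "g n z - F z" "g m z - F z"] g(2)[OF that, of n] g(2)[OF that, of m] by simp
    show "((\<lambda>z. g n z - g m z) has_derivative (\<lambda>v. D n z v - D m z v)) (at z)"
      by (intro has_derivative_diff D z)
    show "\<forall>c v. D n z (c *s v) - D m z (c *s v) = c * (D n z v - D m z v)"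
      using D(2)[OF z] by (simp add: right_diff_distrib)
  qed (use s z in auto)
  have inv0: "(\<lambda>n. 1 / real (Suc n)) \<longlonglongrightarrow> 0"
    using LIMSEQ_inverse_real_of_nat by (simp add: inverse_eq_divide)
  have conv: "convergent (\<lambda>n. D n z v)" if z: "z \<in> ?S" for z v
  proof (rule Cauchy_convergent, rule metric_CauchyI)
    fix e :: real assume e: "e > 0"
    have "(\<lambda>n. 2 * (1 / real (Suc n)) / s * norm v) \<longlonglongrightarrow> 2 * 0 / s * norm v"
      using s by (intro tendsto_intros inv0) auto
    then have "\<forall>\<^sub>F n in sequentially. 2 * (1 / real (Suc n)) / s * norm v < e"
      by (rule order_tendstoD) (use e in simp)
    then obtain N where N: "2 * (1 / real (Suc N)) / s * norm v < e"
      unfolding eventually_sequentially by blast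
    show "\<exists>M. \<forall>m\<ge>M. \<forall>n\<ge>M. dist (D m z v) (D n z v) < e"
    proof (intro exI[of _ N] allI impI)
      fix m n assume mn: "m \<ge> N" "n \<ge> N"
      have "1 / real (Suc m) + 1 / real (Suc n) \<le> 2 * (1 / real (Suc N))"
        using mn frac_le[of 1 1 "real (Suc N)" "real (Suc m)"] frac_le[of 1 1 "real (Suc N)" "real (Suc n)"] by simp
      then have "(1 / real (Suc m) + 1 / real (Suc n)) / s * norm v \<le> 2 * (1 / real (Suc N)) / s * norm v"
        using s by (intro mult_right_mono divide_right_mono) auto
      then show "dist (D m z v) (D n z v) < e"
        using diff[OF z, of m v n] N by (simp add: dist_norm)
    qed
  qed
  \<comment> \<open>The derivatives form a Cauchy sequence for each direction, at a rate uniform in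
    the point; the limit is the candidate for the derivative.\<close>
  define E where "E z v = lim (\<lambda>n. D n z v)" for z v
  have E: "(\<lambda>n. D n z v) \<longlonglongrightarrow> E z v" if "z \<in> ?S" for z v
    using conv[OF that] unfolding E_def convergent_LIMSEQ_iff .
  have DE: "norm (D n z v - E z v) \<le> 1 / real (Suc n) / s * norm v" if z: "z \<in> ?S" for n z v
  proof (rule tendsto_le[OF sequentially_bot])
    show "(\<lambda>m. norm (D n z v - D m z v)) \<longlonglongrightarrow> norm (D n z v - E z v)"
      by (intro tendsto_intros E z)
    have "(\<lambda>m. (1 / real (Suc n) + 1 / real (Suc m)) / s * norm v) \<longlonglongrightarrow> (1 / real (Suc n) + 0) / s * norm v"
      using s by (intro tendsto_intros inv0) auto
    then show "(\<lambda>m. (1 / real (Suc n) + 1 / real (Suc m)) / s * norm v) \<longlonglongrightarrow> 1 / real (Suc n) / s * norm v" by simp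
    show "\<forall>\<^sub>F m in sequentially. norm (D n z v - D m z v) \<le> (1 / real (Suc n) + 1 / real (Suc m)) / s * norm v"
      by (intro always_eventually allI diff z)
  qed
  have gF: "(\<lambda>n. g n z) \<longlonglongrightarrow> F z" if z: "z \<in> ?S" for z
  proof (rule LIM_zero_cancel, rule Lim_null_comparison)
    show "\<forall>\<^sub>F n in sequentially. norm (g n z - F z) \<le> 1 / real (Suc n)"
      using g(2) z sub by (intro always_eventually allI) blast
  qed (rule inv0)
  have S0: "0 \<in> ?S" using s by (simp add: strip_def)
  have "\<exists>G. \<forall>x\<in>?S. (\<lambda>n. g n x) \<longlonglongrightarrow> G x \<and> (G has_derivative E x) (at x within ?S)"
  proof (rule has_derivative_sequence[where f = g and f' = D and g' = E, OF convex_strip _ _ S0 gF[OF S0]])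
    show "(g n has_derivative D n x) (at x within ?S)" if "x \<in> ?S" for n x
      using D(1)[OF that] by (rule has_derivative_at_withinI)
    fix e :: real assume e: "e > 0"
    have "(\<lambda>n. 1 / real (Suc n) / s) \<longlonglongrightarrow> 0 / s" using s by (intro tendsto_intros inv0) auto
    then have "\<forall>\<^sub>F n in sequentially. 1 / real (Suc n) / s < e" by (rule order_tendstoD) (use e in simp)
    then show "\<forall>\<^sub>F n in sequentially. \<forall>x\<in>?S. \<forall>h. norm (D n x h - E x h) \<le> e * norm h"
    proof eventually_elim
      case (elim n)
      show ?case
      proof (intro ballI allI)
        fix x h assume "x \<in> ?S"
        then have "norm (D n x h - E x h) \<le> 1 / real (Suc n) / s * norm h" by (rule DE)
        also have "\<dots> \<le> e * norm h" using elim by (intro mult_right_mono) auto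
        finally show "norm (D n x h - E x h) \<le> e * norm h" .
      qed
    qed
  qed
  then obtain G where G: "\<And>x. x \<in> ?S \<Longrightarrow> (\<lambda>n. g n x) \<longlonglongrightarrow> G x"
    "\<And>x. x \<in> ?S \<Longrightarrow> (G has_derivative E x) (at x within ?S)" by blast
  \<comment> \<open>The theorem on derivative sequences provides some limit function; uniqueness of
    pointwise limits identifies it with F.\<close>
  have GF: "G x = F x" if "x \<in> ?S" for x using LIMSEQ_unique[OF G(1)[OF that] gF[OF that]] .
  show ?thesis
  proof (rule holo_onI)
    fix z assume z: "z \<in> ?S"
    have "(G has_derivative E z) (at z)" using G(2)[OF z] at_within_open[OF z open_strip] by simp
    then show "(F has_derivative E z) (at z)"
      by (rule has_derivative_transform_within_open[OF _ open_strip z]) (rule GF)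
    fix c v
    have "(\<lambda>n. D n z (c *s v)) \<longlonglongrightarrow> c * E z v"
      using D(2)[OF z] by (simp add: tendsto_mult[OF tendsto_const E[OF z]])
    then show "E z (c *s v) = c * E z v" using LIMSEQ_unique E[OF z] by blast
  qed
qed

lemma torus_holo_map_of_lift:
  fixes Z :: "complex ^ 'k::finite \<Rightarrow> complex ^ 'l::finite"
  assumes holo: "\<And>k. holo_on (\<lambda>z. Z z $ k) (strip r)"
    and eq: "\<And>z. z \<in> strip r \<Longrightarrow> F (to_torus z) = to_torus (Z z)"
  shows "torus_holo_map (to_torus ` strip r) F"
  unfolding torus_holo_map_def
proof
  fix z :: "complex ^ 'k" assume "z \<in> to_torus -` (to_torus ` strip r)"
  then have z: "z \<in> strip r" by (simp add: to_torus_in_strip_image)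
  show "\<exists>U g. open U \<and> z \<in> U \<and> U \<subseteq> to_torus -` (to_torus ` strip r) \<and>
      (\<forall>j. holo_on (\<lambda>w. g w $ j) U) \<and> (\<forall>w\<in>U. F (to_torus w) = to_torus (g w))"
    by (rule exI[of _ "strip r"], rule exI[of _ Z]) (use z holo eq open_strip in auto)
qed

text \<open>A map on the torus has to choose a representative, and this one may be a lattice
  translate of z; equivariance makes the choice irrelevant.\<close>

lemma lift_rep_torus:
  assumes "\<And>z m. m \<in> integer_lattice \<Longrightarrow> z \<in> strip r \<Longrightarrow> Z (z + m) = Z z + m" "z \<in> strip r"
  shows "to_torus (Z (rep_torus (to_torus z))) = to_torus (Z z)"
proof -
  obtain m where m: "m \<in> integer_lattice" "rep_torus (to_torus z) = z + m" by (rule rep_torus_to_torusE)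
  show ?thesis unfolding m(2) assms(1)[OF m(1) assms(2)] to_torus_eq_iff using m(1) by simp
qed

text \<open>Openness of U is used for a single neighbourhood and a single extension, the one induced
  by Z on half the strip. The approximation of Z by lifts is uniform there and bounds the quotient
  distance.\<close>

lemma Ham_approximation:
  assumes \<phi>: "\<phi> \<in> analytic_Ham" and U: "openin analytic_Ham_topology U" "\<phi> \<in> U"
  shows "\<exists>Ss. set Ss \<subseteq> horizontal_shears \<union> vertical_shears \<and> foldr (\<circ>) Ss id \<in> U"
proof -
  obtain H where H: "continuous_map (top_of_set {0..}) analytic_fun_topology H" "\<phi> = ham_flow H 0 1"
    using \<phi> unfolding analytic_Ham_def by blast
  obtain \<rho> Z where \<rho>: "\<rho> > 0"
    and approx: "\<And>\<epsilon>. \<epsilon> > 0 \<Longrightarrow> \<exists>\<Psi>. shear_lift \<Psi> \<and> (\<forall>z\<in>strip \<rho>. norm (\<Psi> z - Z z) \<le> \<epsilon>)"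
    and sol: "\<And>x. \<exists>y. ham_solution H 0 1 y \<and> y 0 = x \<and> Z (cvec x) = cvec (y 1)"
    by (rule ham_path_approx[OF H(1)]) blast
  have holo: "holo_on (\<lambda>z. Z z $ k) (strip (\<rho> / 2))" for k
  proof -
    have "\<exists>g. holo_on g (strip \<rho>) \<and> (\<forall>z\<in>strip \<rho>. norm (g z - Z z $ k) \<le> \<epsilon>)" if e: "\<epsilon> > 0" for \<epsilon>
    proof -
      obtain \<Psi> where \<Psi>: "shear_lift \<Psi>" "\<forall>z\<in>strip \<rho>. norm (\<Psi> z - Z z) \<le> \<epsilon>" using approx[OF e] by blast
      have "norm (\<Psi> z $ k - Z z $ k) \<le> \<epsilon>" if "z \<in> strip \<rho>" for z
        using \<Psi>(2) that Finite_Cartesian_Product.norm_nth_le[of "\<Psi> z - Z z" k] by fastforce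
      then show ?thesis
        using holo_on_subset[OF shear_lift_holo[OF \<Psi>(1), of k]] by (intro exI[of _ "\<lambda>z. \<Psi> z $ k"]) auto
    qed
    from holo_uniform_limit[OF this, of "\<rho> / 2"] \<rho> show ?thesis by simp
  qed
  \<comment> \<open>Equivariance is inherited from the approximating lifts by letting the error tend
    to 0.\<close>
  have Zper: "Z (z + m) = Z z + m" if m: "m \<in> integer_lattice" and z: "z \<in> strip \<rho>" for z m
  proof -
    have zm: "z + m \<in> strip \<rho>" using z strip_lattice[OF m] by blast
    have "norm (Z (z + m) - (Z z + m)) \<le> 0 + e" if e: "e > 0" for e
    proof -
      obtain \<Psi> where \<Psi>: "shear_lift \<Psi>" "\<forall>z\<in>strip \<rho>. norm (\<Psi> z - Z z) \<le> e / 2"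
        using approx[of "e / 2"] e by auto
      have "Z (z + m) - (Z z + m) = (\<Psi> z - Z z) - (\<Psi> (z + m) - Z (z + m))"
        by (simp add: shear_lift_lattice[OF \<Psi>(1) m])
      also have "norm \<dots> \<le> e / 2 + e / 2"
        by (rule order_trans[OF norm_triangle_ineq4 add_mono]) (use \<Psi>(2) z zm in auto)
      finally show ?thesis by simp
    qed
    then have "norm (Z (z + m) - (Z z + m)) \<le> 0" by (rule field_le_epsilon)
    then show ?thesis by simp
  qed
  have sub: "z \<in> strip \<rho>" if "z \<in> strip (\<rho> / 2)" for z :: "complex ^ ('a + 'a)"
    using that by (rule strip_mono') (use \<rho> in simp)
  let ?W = "to_torus ` (strip (\<rho> / 2) :: (complex ^ ('a + 'a)) set)"
  define F where "F x = to_torus (Z (rep_torus x))" for x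
  have F: "F (to_torus z) = to_torus (Z z)" if "z \<in> strip (\<rho> / 2)" for z
    unfolding F_def by (rule lift_rep_torus[OF Zper sub[OF that]])
  have F_holo: "torus_holo_map ?W F" by (rule torus_holo_map_of_lift[OF holo F])
  have F_real: "F (torus_complexify x) = torus_complexify (\<phi> x)" for x
  proof -
    obtain y where y: "ham_solution H 0 1 y" "y 0 = rep_torus x" "Z (cvec (rep_torus x)) = cvec (y 1)"
      using sol by blast
    have "\<phi> x = to_torus (y 1)" using ham_flow_eq[OF H(1) y(1)] H(2) y(2) by simp
    moreover have "torus_complexify x = to_torus (cvec (rep_torus x))"
      using torus_complexify_to_torus[of "rep_torus x"] by simp
    ultimately show ?thesis using F[of "cvec (rep_torus x)"] \<rho> y(3) by simp
  qed
  have W: "complex_nbhd ?W" using \<rho> by (intro complex_nbhd_strip) simp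
  have "complex_nbhd ?W \<and> torus_holo_map ?W F \<and> \<phi> \<in> U \<and> (\<forall>x. F (torus_complexify x) = torus_complexify (\<phi> x))"
    by (intro conjI allI W F_holo U(2) F_real)
  from U(1)[unfolded analytic_Ham_topology_def openin_inductive_limit_topology, THEN conjunct2,
      THEN spec, THEN spec, THEN spec, THEN mp, OF this]
  obtain e where e: "e > 0" "\<forall>G g. torus_holo_map ?W G \<and> g \<in> analytic_Ham \<and>
      (\<forall>x. G (torus_complexify x) = torus_complexify (g x)) \<and> (\<forall>z\<in>?W. dist (G z) (F z) < e) \<longrightarrow> g \<in> U"
    by (elim exE conjE)
  \<comment> \<open>Half of e, because the neighbourhood asks for a strict inequality.\<close>
  obtain \<Psi> where \<Psi>: "shear_lift \<Psi>" "\<forall>z\<in>strip \<rho>. norm (\<Psi> z - Z z) \<le> e / 2"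
    using approx[of "e / 2"] e(1) by auto
  obtain Ss where Ss: "set Ss \<subseteq> horizontal_shears \<union> vertical_shears"
    "\<And>x. \<exists>y. \<Psi> (cvec x) = cvec y \<and> foldr (\<circ>) Ss id (to_torus x) = to_torus y"
    using shear_lift_real[OF \<Psi>(1)] by blast
  define G where "G x = to_torus (\<Psi> (rep_torus x))" for x
  have G: "G (to_torus z) = to_torus (\<Psi> z)" if "z \<in> strip (\<rho> / 2)" for z
    unfolding G_def by (rule lift_rep_torus[OF shear_lift_lattice[OF \<Psi>(1)] that])
  have G_holo: "torus_holo_map ?W G"
    by (rule torus_holo_map_of_lift[OF holo_on_subset[OF shear_lift_holo[OF \<Psi>(1)] subset_UNIV] G])
  have G_real: "G (torus_complexify x) = torus_complexify (foldr (\<circ>) Ss id x)" for x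
  proof -
    obtain y where y: "\<Psi> (cvec (rep_torus x)) = cvec y" "foldr (\<circ>) Ss id (to_torus (rep_torus x)) = to_torus y"
      using Ss(2) by blast
    have "torus_complexify x = to_torus (cvec (rep_torus x))"
      using torus_complexify_to_torus[of "rep_torus x"] by simp
    then have "G (torus_complexify x) = to_torus (cvec y)" using G[of "cvec (rep_torus x)"] \<rho> y(1) by simp
    moreover have "foldr (\<circ>) Ss id x = to_torus y" using y(2) unfolding to_torus_rep_torus .
    ultimately show ?thesis by (simp only: torus_complexify_to_torus)
  qed
  have "dist (G x) (F x) < e" if "x \<in> ?W" for x
  proof -
    obtain z where z: "z \<in> strip (\<rho> / 2)" "x = to_torus z" using \<open>x \<in> ?W\<close> by blast
    have "dist (G x) (F x) \<le> norm (\<Psi> z - Z z)" unfolding z(2) G[OF z(1)] F[OF z(1)] by (rule dist_to_torus_le)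
    also have "\<dots> \<le> e / 2" using \<Psi>(2) sub[OF z(1)] by blast
    finally show ?thesis using e(1) by simp
  qed
  then have "torus_holo_map ?W G \<and> foldr (\<circ>) Ss id \<in> analytic_Ham \<and>
      (\<forall>x. G (torus_complexify x) = torus_complexify (foldr (\<circ>) Ss id x)) \<and> (\<forall>z\<in>?W. dist (G z) (F z) < e)"
    by (intro conjI allI ballI G_holo G_real foldr_shears_Ham Ss(1))
  from e(2)[THEN spec, THEN spec, THEN mp, OF this] have "foldr (\<circ>) Ss id \<in> U" .
  then show ?thesis using Ss(1) by blast
qed

theorem mainTheorem1:
  shows "(shear_group :: ('n::finite phase_space \<Rightarrow> 'n phase_space) set) \<subseteq> analytic_Ham \<and>
    analytic_Ham_topology closure_of shear_group
      = (analytic_Ham :: ('n phase_space \<Rightarrow> 'n phase_space) set) \<and>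
    (\<forall>\<phi> \<in> (analytic_Ham :: ('n phase_space \<Rightarrow> 'n phase_space) set).
      \<forall>U. openin analytic_Ham_topology U \<and> \<phi> \<in> U \<longrightarrow>
        (\<exists>Ss. set Ss \<subseteq> horizontal_shears \<union> vertical_shears \<and> foldr (\<circ>) Ss id \<in> U))"
proof (intro conjI ballI allI impI)
  show "shear_group \<subseteq> (analytic_Ham :: ('n phase_space \<Rightarrow> 'n phase_space) set)"
    by (rule shear_group_subset_Ham)
  show "analytic_Ham_topology closure_of shear_group = (analytic_Ham :: ('n phase_space \<Rightarrow> 'n phase_space) set)"
  proof (intro equalityI subsetI)
    fix \<phi> :: "'n phase_space \<Rightarrow> 'n phase_space"
    assume "\<phi> \<in> analytic_Ham_topology closure_of shear_group"
    then show "\<phi> \<in> analytic_Ham"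
      using closure_of_subset_topspace[of analytic_Ham_topology shear_group]
      by (auto simp: analytic_Ham_topology_def)
  next
    fix \<phi> :: "'n phase_space \<Rightarrow> 'n phase_space"
    assume \<phi>: "\<phi> \<in> analytic_Ham"
    show "\<phi> \<in> analytic_Ham_topology closure_of shear_group"
      unfolding in_closure_of
    proof (intro conjI allI impI)
      show "\<phi> \<in> topspace analytic_Ham_topology" using \<phi> by (simp add: analytic_Ham_topology_def)
      fix U assume "\<phi> \<in> U \<and> openin analytic_Ham_topology U"
      then show "\<exists>\<psi>. \<psi> \<in> shear_group \<and> \<psi> \<in> U"
        using Ham_approximation[OF \<phi>, of U] unfolding shear_group_eq by blast
    qed
  qed
  fix \<phi> :: "'n phase_space \<Rightarrow> 'n phase_space" and U
  assume "\<phi> \<in> analytic_Ham" "openin analytic_Ham_topology U \<and> \<phi> \<in> U"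
  then show "\<exists>Ss. set Ss \<subseteq> horizontal_shears \<union> vertical_shears \<and> foldr (\<circ>) Ss id \<in> U"
    using Ham_approximation by blast
qed

end
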